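(* Let $v>0$ and $A_0\in\mathbb{R}$ be fixed, and consider the system with moving left boundary, whose location at time $t$ is $A=A_0+vt$. Let $\{f^n(0)\}$ be a deterministic sequence with $f^n(0)\in\mathcal{M}^{(n)}$, let $f(0)\in\mathcal{M}$, and suppose $f^n(0)\to f(0)$ weakly as $n\to\infty$. Let $f^n(\cdot)$ be the corresponding empirical-distribution process. Then $f^n(\cdot)\Rightarrow f(\cdot)$ (convergence in distribution) in $D([0,\infty),\mathcal{M})$, where $f(\cdot)\in D([0,\infty),\mathcal{M})$ is deterministic and uniquely determined by $f(0)$. Moreover, $f(\cdot)$ is a continuous element of $D([0,\infty),\mathcal{M})$ which satisfies $$f(t)h-f(0)h-\int_0^tL^{\{l\}}[f(s)h]\,ds=0,\qquad\forall h\in\mathcal{C}_b,\ \forall t\ge0.$$ (This trajectory is called the mean-field limit (MFL) with initial state $f(0)$.) Furthermore, $f(\cdot)$ is the unique mean-field model (for the moving left boundary system) with initial state $f(0)$.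
   Context: Model with moving left boundary. Fix $\lambda\ge0$ and a random variable $Z>0$ with CDF $J$ and $\mathbb{E}Z=1$. The boundary at time $t$ is at $A=A_0+vt$. There are $n$ particles on $\mathbb{R}$ (particles are allowed to be to the left of $A$). At the points of its own independent Poisson process of rate $\lambda$ each particle makes an independent jump: a particle located at $y$ first instantly moves to $y\vee A=\max\{y,A\}$ ($A$ being the current boundary location) and then jumps forward by an i.i.d. amount distributed as $Z$. Each particle also has another independent Poisson process, of rate $1$, at whose points it chooses another particle uniformly at random and moves to the location of the chosen particle if that is to the right of its own location. $f^n_x(t)$ is the fraction of particles located in $(-\infty,x]$ at time $t$; $f^n(t)=(f^n_x(t),x\in\mathbb{R})$. Notation. $\mathcal{M}$ is the set of (proper) cumulative distribution functions on $\mathbb{R}$ with the topology of weak convergence; $\mathcal{M}^{(n)}\subset\mathcal{M}$ is the set of empirical distributions of $n$ points. $D([0,\infty),\mathcal{M})$ is the Skorohod space with the $J_1$ topology. $\mathcal{C}_b$ is the set of continuous bounded functions on $\mathbb{R}$ that are constant to the left of some closed bounded interval and constant (possibly with another value) to the right of it. $fh=\int_{\mathbb{R}}h(x)\,df_x$. Operator $L^{\{l\}}$: for a pair $(f,A)$ with $f\in\mathcal{M}$ and $h\in\mathcal{C}_b$, $$L^{\{l\}}[fh]=\lambda\,\mathbb{E}\int_{-\infty}^{\infty}d_yf_y\,(h((y\vee A)+Z)-h(y))+\int_{-\infty}^{\infty}d_yf_y\int_y^{\infty}d_\xi f_\xi\,(h(\xi)-h(y)),$$ the expectation being over $Z$;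 in $L^{\{l\}}[f(s)h]$ the boundary is $A=A_0+vs$. Mean-field model for this system: a function $f_x(t)$, $x\in\mathbb{R}$, $t\ge0$, such that (a) for every $t$, $f(t)=(f_x(t),x\in\mathbb{R})\in\mathcal{M}$; (b) for every $x$, $f_x(t)$ is non-increasing and $(\lambda+1)$-Lipschitz in $t$; (c) for every $x$ and every $t$ at which $\frac{\partial}{\partial t}f_x(t)$ exists, with $A=A_0+vt$, $$\frac{\partial}{\partial t}f_x(t)=-\lambda f_x(t)-f_x(t)(1-f_x(t)),\quad x\le A,$$ $$\frac{\partial}{\partial t}f_x(t)=-\lambda f_A(t)(1-J(x-A))-\lambda\int_{(A,x]}(1-J(x-y))\,d_yf_y(t)-f_x(t)(1-f_x(t)),\quad x>A.$$ *)

theory Defs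
  imports "HOL-Probability.Probability"
begin

section \<open>Convergence of random elements of a topological space\<close>

text \<open>The topology of \<open>Metric_space.mtopology\<close>, but usable without first proving the metric axioms.\<close>

definition metric_topology :: "'a set \<Rightarrow> ('a \<Rightarrow> 'a \<Rightarrow> real) \<Rightarrow> 'a topology" where
  "metric_topology S d =
     topology (\<lambda>U. U \<subseteq> S \<and> (\<forall>x\<in>U. \<exists>e>0. \<forall>y\<in>S. d x y < e \<longrightarrow> y \<in> U))"

lemma openin_metric_topology:
  "openin (metric_topology S d) U \<longleftrightarrow>
     U \<subseteq> S \<and> (\<forall>x\<in>U. \<exists>e>0. \<forall>y\<in>S. d x y < e \<longrightarrow> y \<in> U)"
proof -
  let ?L = "\<lambda>U. U \<subseteq> S \<and> (\<forall>x\<in>U. \<exists>e>0. \<forall>y\<in>S. d x y < e \<longrightarrow> y \<in> U)"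
  have "?L (U \<inter> V)" if U: "?L U" and V: "?L V" for U V
  proof (intro conjI ballI)
    show "U \<inter> V \<subseteq> S" using U by blast
    fix x assume x: "x \<in> U \<inter> V"
    obtain a where a: "a > 0" "\<forall>y\<in>S. d x y < a \<longrightarrow> y \<in> U" using U x by blast
    obtain b where b: "b > 0" "\<forall>y\<in>S. d x y < b \<longrightarrow> y \<in> V" using V x by blast
    show "\<exists>e>0. \<forall>y\<in>S. d x y < e \<longrightarrow> y \<in> U \<inter> V"
      using a b by (intro exI[of _ "min a b"]) auto
  qed
  moreover have "?L (\<Union>\<K>)" if K: "\<forall>U\<in>\<K>. ?L U" for \<K>
  proof (intro conjI ballI)
    show "\<Union>\<K> \<subseteq> S" using K by blast
    fix x assume "x \<in> \<Union>\<K>"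
    then obtain U where U: "U \<in> \<K>" "x \<in> U" by blast
    then obtain e where "e > 0" "\<forall>y\<in>S. d x y < e \<longrightarrow> y \<in> U" using K by blast
    then show "\<exists>e>0. \<forall>y\<in>S. d x y < e \<longrightarrow> y \<in> \<Union>\<K>" using U by blast
  qed
  ultimately have "istopology ?L" unfolding istopology_def by blast
  then show ?thesis by (simp add: metric_topology_def)
qed

lemma topspace_metric_topology [simp]: "topspace (metric_topology S d) = S"
proof -
  have "openin (metric_topology S d) S"
    by (auto simp: openin_metric_topology intro: exI[of _ 1])
  then show ?thesis
    by (metis openin_metric_topology openin_topspace openin_subset subset_antisym)
qed

lemma metric_topology_eq_mtopology:
  assumes "Metric_space S d"
  shows "metric_topology S d = Metric_space.mtopology S d"
proof -
  interpret Metric_space S d by fact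
  show ?thesis
    unfolding topology_eq openin_metric_topology openin_mtopology by fastforce
qed

definition borel_of :: "'a topology \<Rightarrow> 'a measure" where
  "borel_of T = sigma (topspace T) {U. openin T U}"

definition converges_in_law :: "'a topology \<Rightarrow> (nat \<Rightarrow> 'a measure) \<Rightarrow> 'a measure \<Rightarrow> bool" where
  "converges_in_law T \<mu> \<nu> \<longleftrightarrow>
     (\<forall>F. continuous_map T euclideanreal F \<and> bounded (F ` topspace T) \<longrightarrow>
        (\<lambda>n. \<integral>x. F x \<partial>\<mu> n) \<longlonglongrightarrow> (\<integral>x. F x \<partial>\<nu>))"

definition converges_in_distribution ::
    "'a topology \<Rightarrow> (nat \<Rightarrow> 'w measure) \<Rightarrow> (nat \<Rightarrow> 'w \<Rightarrow> 'a) \<Rightarrow> 'a measure \<Rightarrow> bool" where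
  "converges_in_distribution T P X \<nu> \<longleftrightarrow>
     (\<forall>\<^sub>F n in sequentially. X n \<in> P n \<rightarrow>\<^sub>M borel_of T) \<and>
     converges_in_law T (\<lambda>n. distr (P n) (borel_of T) (X n)) \<nu>"


section \<open>Cumulative distribution functions with the weak topology\<close>

definition cdfs :: "(real \<Rightarrow> real) set" where
  "cdfs = {F. mono F \<and> (\<forall>x. continuous (at_right x) F) \<and>
              (F \<longlongrightarrow> 0) at_bot \<and> (F \<longlongrightarrow> 1) at_top}"

definition empirical_cdf :: "nat \<Rightarrow> (nat \<Rightarrow> real) \<Rightarrow> real \<Rightarrow> real" where
  "empirical_cdf n x y = real (card {i\<in>{..<n}. x i \<le> y}) / real n"

definition empirical_cdfs :: "nat \<Rightarrow> (real \<Rightarrow> real) set" where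
  "empirical_cdfs n = range (empirical_cdf n)"

text \<open>The L\'evy distance, which metrizes weak convergence.\<close>

definition levy_dist :: "(real \<Rightarrow> real) \<Rightarrow> (real \<Rightarrow> real) \<Rightarrow> real" where
  "levy_dist F G = Inf {e. e > 0 \<and> (\<forall>x. F (x - e) - e \<le> G x \<and> G x \<le> F (x + e) + e)}"

definition weak_topology :: "(real \<Rightarrow> real) topology" where
  "weak_topology = metric_topology cdfs levy_dist"


section \<open>The Skorohod space and its J1 topology\<close>

text \<open>Paths are indexed by \<open>{0..}\<close> and hence extensional on it.\<close>

definition cadlag_paths :: "'a topology \<Rightarrow> (real \<Rightarrow> 'a) set" where
  "cadlag_paths T = {x \<in> {0..} \<rightarrow>\<^sub>E topspace T.
     (\<forall>t\<ge>0. limitin T x (x t) (at_right t)) \<and>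
     (\<forall>t>0. \<exists>l. limitin T x l (at_left t))}"

definition log_slopes :: "(real \<Rightarrow> real) \<Rightarrow> real set" where
  "log_slopes \<psi> = {\<bar>ln ((\<psi> s - \<psi> t) / (s - t))\<bar> | s t. 0 \<le> t \<and> t < s}"

definition time_changes :: "(real \<Rightarrow> real) set" where
  "time_changes = {\<psi>. strict_mono_on {0..} \<psi> \<and> \<psi> ` {0..} = {0..} \<and> bdd_above (log_slopes \<psi>)}"

text \<open>
  The J1 metric on paths in a metric space with distance \<open>r\<close>, in the form given by
  Ethier and Kurtz, \<^emph>\<open>Markov Processes\<close>, Section 3.5.
\<close>

definition J1_dist :: "('a \<Rightarrow> 'a \<Rightarrow> real) \<Rightarrow> (real \<Rightarrow> 'a) \<Rightarrow> (real \<Rightarrow> 'a) \<Rightarrow> real" where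
  "J1_dist r x y = (INF \<psi>\<in>time_changes. max (Sup (log_slopes \<psi>))
     (LBINT u:{0..}. exp (- u) * (SUP t\<in>{0..}. min 1 (r (x (min t u)) (y (min (\<psi> t) u))))))"

definition skorohod_space :: "(real \<Rightarrow> real \<Rightarrow> real) set" where
  "skorohod_space = cadlag_paths weak_topology"

definition J1_topology :: "(real \<Rightarrow> real \<Rightarrow> real) topology" where
  "J1_topology = metric_topology skorohod_space (J1_dist levy_dist)"


section \<open>The particle system with moving left boundary\<close>

text \<open>The case \<open>r = 0\<close>, a process without points, is included: \<open>0 ^ 0 = 1\<close> in the Poisson weights.\<close>

definition poisson_process :: "'w measure \<Rightarrow> real \<Rightarrow> (real \<Rightarrow> 'w \<Rightarrow> nat) \<Rightarrow> bool" where
  "poisson_process P r N \<longleftrightarrow>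
     (\<forall>t\<ge>0. N t \<in> P \<rightarrow>\<^sub>M count_space UNIV) \<and>
     (\<forall>\<omega>\<in>space P. N 0 \<omega> = 0 \<and> mono_on {0..} (\<lambda>t. N t \<omega>) \<and>
        (\<forall>t\<ge>0. \<forall>\<^sub>F s in at_right t. N s \<omega> = N t \<omega>)) \<and>
     (\<forall>\<tau>::nat \<Rightarrow> real. 0 \<le> \<tau> 0 \<and> incseq \<tau> \<longrightarrow>
        prob_space.indep_vars P (\<lambda>_. count_space UNIV)
          (\<lambda>k \<omega>. N (\<tau> (Suc k)) \<omega> - N (\<tau> k) \<omega>) UNIV) \<and>
     (\<forall>s t k. 0 \<le> s \<and> s \<le> t \<longrightarrow>
        measure P {\<omega>\<in>space P. N t \<omega> - N s \<omega> = k}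
          = exp (- (r * (t - s))) * (r * (t - s)) ^ k / fact k)"

text \<open>
  \<open>point_at N k t\<close>: the point number \<open>k\<close> (counting from 0) of the counting path \<open>N\<close> occurs
  at time \<open>t\<close>.
\<close>

definition point_at :: "(real \<Rightarrow> nat) \<Rightarrow> nat \<Rightarrow> real \<Rightarrow> bool" where
  "point_at N k t \<longleftrightarrow> 0 < t \<and> N t = Suc k \<and> (\<forall>\<^sub>F s in at_left t. N s = k)"

text \<open>
  The independent sources of randomness. Particles are numbered by \<open>i < n\<close>; \<open>Jump_size i k\<close> and
  \<open>Target i k\<close> are the marks attached to the \<open>k\<close>-th points of the two clocks of particle \<open>i\<close>.
\<close>

datatype source = Jump_clock nat | Sync_clock nat | Jump_size nat nat | Target nat nat

fun owner :: "source \<Rightarrow> nat" where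
  "owner (Jump_clock i) = i"
| "owner (Sync_clock i) = i"
| "owner (Jump_size i k) = i"
| "owner (Target i k) = i"

fun source_events ::
    "'w measure \<Rightarrow> (nat \<Rightarrow> real \<Rightarrow> 'w \<Rightarrow> nat) \<Rightarrow> (nat \<Rightarrow> real \<Rightarrow> 'w \<Rightarrow> nat) \<Rightarrow>
     (nat \<Rightarrow> nat \<Rightarrow> 'w \<Rightarrow> real) \<Rightarrow> (nat \<Rightarrow> nat \<Rightarrow> 'w \<Rightarrow> nat) \<Rightarrow> source \<Rightarrow> 'w set set" where
  "source_events P NJ NS \<xi> K (Jump_clock i) =
     sigma_sets (space P) {{\<omega>\<in>space P. NJ i t \<omega> = m} | t m. 0 \<le> t}"
| "source_events P NJ NS \<xi> K (Sync_clock i) =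
     sigma_sets (space P) {{\<omega>\<in>space P. NS i t \<omega> = m} | t m. 0 \<le> t}"
| "source_events P NJ NS \<xi> K (Jump_size i k) = {\<xi> i k -` B \<inter> space P | B. B \<in> sets borel}"
| "source_events P NJ NS \<xi> K (Target i k) = {K i k -` B \<inter> space P | B. True}"

definition driving_noise ::
    "'w measure \<Rightarrow> real \<Rightarrow> real measure \<Rightarrow> nat \<Rightarrow>
     (nat \<Rightarrow> real \<Rightarrow> 'w \<Rightarrow> nat) \<Rightarrow> (nat \<Rightarrow> real \<Rightarrow> 'w \<Rightarrow> nat) \<Rightarrow>
     (nat \<Rightarrow> nat \<Rightarrow> 'w \<Rightarrow> real) \<Rightarrow> (nat \<Rightarrow> nat \<Rightarrow> 'w \<Rightarrow> nat) \<Rightarrow> bool" where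
  "driving_noise P lam \<zeta> n NJ NS \<xi> K \<longleftrightarrow>
     (\<forall>i<n. poisson_process P lam (NJ i)) \<and>
     (\<forall>i<n. poisson_process P 1 (NS i)) \<and>
     (\<forall>i<n. \<forall>k. \<xi> i k \<in> borel_measurable P \<and> distr P borel (\<xi> i k) = \<zeta>) \<and>
     (\<forall>i<n. \<forall>k. K i k \<in> P \<rightarrow>\<^sub>M count_space UNIV \<and>
        distr P (count_space UNIV) (K i k) = measure_pmf (pmf_of_set ({..<n} - {i}))) \<and>
     prob_space.indep_sets P (source_events P NJ NS \<xi> K) {s. owner s < n}"

text \<open>
  \<open>X i t \<omega>\<close> is the location of particle \<open>i\<close> at time \<open>t\<close>. Locations are constant between the points
  of a particle's clocks; hence ``eventually in \<open>at_left t\<close>'' refers to the state just before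
  \<open>t\<close>. Almost surely no two clocks ring simultaneously and no clock has a multiple point.
\<close>

definition driven_motion ::
    "'w measure \<Rightarrow> real \<Rightarrow> real \<Rightarrow> nat \<Rightarrow>
     (nat \<Rightarrow> real \<Rightarrow> 'w \<Rightarrow> nat) \<Rightarrow> (nat \<Rightarrow> real \<Rightarrow> 'w \<Rightarrow> nat) \<Rightarrow>
     (nat \<Rightarrow> nat \<Rightarrow> 'w \<Rightarrow> real) \<Rightarrow> (nat \<Rightarrow> nat \<Rightarrow> 'w \<Rightarrow> nat) \<Rightarrow>
     (nat \<Rightarrow> real \<Rightarrow> 'w \<Rightarrow> real) \<Rightarrow> bool" where
  "driven_motion P A0 v n NJ NS \<xi> K X \<longleftrightarrow>
     (AE \<omega> in P. \<forall>i<n.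
        (\<forall>s t. 0 \<le> s \<and> s \<le> t \<and> NJ i s \<omega> = NJ i t \<omega> \<and> NS i s \<omega> = NS i t \<omega> \<longrightarrow>
           X i t \<omega> = X i s \<omega>) \<and>
        (\<forall>t k. point_at (\<lambda>s. NJ i s \<omega>) k t \<longrightarrow>
           (\<forall>\<^sub>F s in at_left t. X i t \<omega> = max (X i s \<omega>) (A0 + v * t) + \<xi> i k \<omega>)) \<and>
        (\<forall>t k. point_at (\<lambda>s. NS i s \<omega>) k t \<longrightarrow>
           (\<forall>\<^sub>F s in at_left t. X i t \<omega> = max (X i s \<omega>) (X (K i k \<omega>) s \<omega>))))"

text \<open>
  \<open>\<zeta>\<close> is the law of the jump sizes, and \<open>F0\<close> the deterministic initial empirical distribution
  function.
\<close>

definition particle_system ::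
    "'w measure \<Rightarrow> real \<Rightarrow> real measure \<Rightarrow> real \<Rightarrow> real \<Rightarrow> nat \<Rightarrow> (real \<Rightarrow> real) \<Rightarrow>
     (nat \<Rightarrow> real \<Rightarrow> 'w \<Rightarrow> real) \<Rightarrow> bool" where
  "particle_system P lam \<zeta> A0 v n F0 X \<longleftrightarrow>
     prob_space P \<and>
     (\<forall>i<n. \<forall>t\<ge>0. X i t \<in> borel_measurable P) \<and>
     (\<forall>i<n. \<forall>\<omega>\<in>space P. (\<lambda>t\<in>{0..}. X i t \<omega>) \<in> cadlag_paths euclideanreal) \<and>
     (\<exists>x0. empirical_cdf n x0 = F0 \<and> (\<forall>i<n. \<forall>\<omega>\<in>space P. X i 0 \<omega> = x0 i)) \<and>
     (\<exists>NJ NS \<xi> K. driving_noise P lam \<zeta> n NJ NS \<xi> K \<and> driven_motion P A0 v n NJ NS \<xi> K X)"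

definition empirical_process ::
    "nat \<Rightarrow> (nat \<Rightarrow> real \<Rightarrow> 'w \<Rightarrow> real) \<Rightarrow> 'w \<Rightarrow> real \<Rightarrow> real \<Rightarrow> real" where
  "empirical_process n X \<omega> = (\<lambda>t\<in>{0..}. empirical_cdf n (\<lambda>i. X i t \<omega>))"


section \<open>The limiting dynamics\<close>

definition test_functions :: "(real \<Rightarrow> real) set" where
  "test_functions = {h. continuous_on UNIV h \<and> bounded (range h) \<and>
     (\<exists>a b. a \<le> b \<and> (\<forall>x\<le>a. h x = h a) \<and> (\<forall>x\<ge>b. h x = h b))}"

definition cdf_integral :: "(real \<Rightarrow> real) \<Rightarrow> (real \<Rightarrow> real) \<Rightarrow> real" where
  "cdf_integral F h = (\<integral>x. h x \<partial>interval_measure F)"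

definition L_op :: "real \<Rightarrow> real measure \<Rightarrow> real \<Rightarrow> (real \<Rightarrow> real) \<Rightarrow> (real \<Rightarrow> real) \<Rightarrow> real" where
  "L_op lam \<zeta> A F h =
     lam * (\<integral>z. (\<integral>y. h (max y A + z) - h y \<partial>interval_measure F) \<partial>\<zeta>) +
     (\<integral>y. (LINT \<xi>:{y<..}|interval_measure F. h \<xi> - h y) \<partial>interval_measure F)"

text \<open>
  Here \<open>f t x\<close> stands for $f_x(t)$, and \<open>J\<close> is the distribution function of the jump sizes. The
  derivative is the two-sided one, so \<open>t > 0\<close>. A one-sided version at \<open>t = 0\<close> would be wrong:
  if \<open>J\<close> has an atom at \<open>x - A0\<close>, then the right derivative differs from the right-hand side.
\<close>

definition mean_field_model ::
    "real \<Rightarrow> (real \<Rightarrow> real) \<Rightarrow> real \<Rightarrow> real \<Rightarrow> (real \<Rightarrow> real \<Rightarrow> real) \<Rightarrow> bool" where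
  "mean_field_model lam J A0 v f \<longleftrightarrow>
     (\<forall>t\<ge>0. f t \<in> cdfs) \<and>
     (\<forall>x. antimono_on {0..} (\<lambda>t. f t x) \<and> (lam + 1)-lipschitz_on {0..} (\<lambda>t. f t x)) \<and>
     (\<forall>x. \<forall>t>0. \<forall>D. ((\<lambda>s. f s x) has_real_derivative D) (at t) \<longrightarrow>
        (let A = A0 + v * t in
         (x \<le> A \<longrightarrow> D = - lam * f t x - f t x * (1 - f t x)) \<and>
         (x > A \<longrightarrow> D = - lam * f t A * (1 - J (x - A))
            - lam * (LINT y:{A<..x}|interval_measure (f t). 1 - J (x - y))
            - f t x * (1 - f t x))))"

end

theory Submission
  imports Defs
begin

text \<open>
  A mean-field model is Lipschitz in time, hence the integral of its derivative, and thus a mild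
  (variation of constants) solution of the equation. Mild solutions are constructed by Picard
  iteration; a Gronwall estimate comparing one solution with a spatial shift of another gives
  uniqueness and stability in the Levy distance.

  For the particles, cut time into cells of length \<open>\<delta>\<close>. A particle moves in a cell by an explicit
  rule if it has no clock point there, or a single jump, or a single synchronization with a particle
  without clock points. All others, a fraction of order \<open>\<delta>\<^sup>2\<close>, are sent to \<open>-\<infinity>\<close> or to \<open>\<infinity>\<close>; the two
  resulting chains bound the particle system from below and above. In mean, one step of a chain is
  an Euler step of the equation up to \<open>1 / sqrt n + O(\<delta>\<^sup>2 + \<delta> / n)\<close>. So at finitely many times and
  points the empirical distribution function converges in \<open>L\<^sup>1\<close>. Monotonicity in space and the small
  fraction of particles that move in a short time make this uniform, which suffices for J1.
\<close>

section \<open>The Levy distance\<close>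

text \<open>The delicate point is an atom of \<open>\<zeta>\<close> at \<open>x - bdry t\<close>:
  there the right-hand side of the equation jumps in time, and only its left limits are under
  control. In the Euler comparison the same effect costs, in each cell,
  \<open>lam * \<delta>\<close> times the \<open>\<zeta>\<close>-mass of those z for which the
  boundary crosses \<open>y - z\<close> during the cell. A single such mass need not be small, but
  the boundary moves to the right, so for fixed y these sets are disjoint and the costs add up to at
  most \<open>lam * \<delta>\<close>.

  Weak convergence of the initial states gives no smallness in the supremum norm; hence the spatial
  shift. A shift to the right is compatible with the boundary cutoff, so one-sided estimates close.

  Two dependences must be cut. Marks are consumed in the order of the points, so a cell reads marks
  at random indices; the expectation is split over all values of the point counts. Synchronization
  couples the particles, but the idealized move of a particle reads only its own noise and the old
  configuration. The cell length is fixed before n grows.\<close>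

lemma cdfsD:
  assumes "F \<in> cdfs"
  shows "mono F" "\<And>x. continuous (at_right x) F" "(F \<longlongrightarrow> 0) at_bot" "(F \<longlongrightarrow> 1) at_top"
  using assms by (auto simp: cdfs_def)

lemma cdfs_mono: "F \<in> cdfs \<Longrightarrow> x \<le> y \<Longrightarrow> F x \<le> F y"
  by (auto simp: cdfs_def mono_def)

lemma cdfs_nonneg: assumes "F \<in> cdfs" shows "0 \<le> F x"
proof (rule tendsto_upperbound[OF cdfsD(3)[OF assms]])
  show "\<forall>\<^sub>F y in at_bot. F y \<le> F x"
    using eventually_le_at_bot[of x] by eventually_elim (rule cdfs_mono[OF assms])
qed simp

lemma cdfs_le_1: assumes "F \<in> cdfs" shows "F x \<le> 1"
proof (rule tendsto_lowerbound[OF cdfsD(4)[OF assms]])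
  show "\<forall>\<^sub>F y in at_top. F x \<le> F y"
    using eventually_ge_at_top[of x] by eventually_elim (rule cdfs_mono[OF assms])
qed simp

definition levy_within :: "(real \<Rightarrow> real) \<Rightarrow> (real \<Rightarrow> real) \<Rightarrow> real \<Rightarrow> bool" where
  "levy_within F G e \<longleftrightarrow> (\<forall>x. F (x - e) - e \<le> G x \<and> G x \<le> F (x + e) + e)"

lemma levy_dist_alt: "levy_dist F G = Inf {e. e > 0 \<and> levy_within F G e}"
  by (simp add: levy_dist_def levy_within_def)

lemma levy_within_1: "F \<in> cdfs \<Longrightarrow> G \<in> cdfs \<Longrightarrow> levy_within F G 1"
  unfolding levy_within_def
proof (intro allI conjI)
  fix x assume F: "F \<in> cdfs" and G: "G \<in> cdfs"
  show "F (x - 1) - 1 \<le> G x" using cdfs_nonneg[OF G, of x] cdfs_le_1[OF F, of "x - 1"] by linarith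
  show "G x \<le> F (x + 1) + 1" using cdfs_nonneg[OF F, of "x + 1"] cdfs_le_1[OF G, of x] by linarith
qed

lemma levy_within_mono:
  assumes "F \<in> cdfs" "levy_within F G d" "d \<le> e" shows "levy_within F G e"
  unfolding levy_within_def
proof (intro allI conjI)
  fix x
  have "F (x - e) \<le> F (x - d)" "F (x + d) \<le> F (x + e)"
    using assms(1,3) by (auto intro!: cdfs_mono[OF assms(1)])
  moreover have "F (x - d) - d \<le> G x" "G x \<le> F (x + d) + d"
    using assms(2) by (auto simp: levy_within_def)
  ultimately show "F (x - e) - e \<le> G x" "G x \<le> F (x + e) + e"
    using assms(3) by linarith+
qed

lemma levy_dist_le: "0 < e \<Longrightarrow> levy_within F G e \<Longrightarrow> levy_dist F G \<le> e"
  unfolding levy_dist_alt by (intro cInf_lower bdd_belowI[of _ 0]) auto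

text \<open>The admissible e form an up-set by \<open>levy_within_mono\<close>, so everything
  strictly above the infimum is admissible.\<close>

lemma levy_within_of_less:
  assumes "F \<in> cdfs" "G \<in> cdfs" "levy_dist F G < e"
  shows "levy_within F G e"
proof -
  have "1 \<in> {e. e > 0 \<and> levy_within F G e}"
    using levy_within_1[OF assms(1,2)] by simp
  then have ne: "{e. e > 0 \<and> levy_within F G e} \<noteq> {}" by blast
  have "\<exists>d\<in>{e. e > 0 \<and> levy_within F G e}. d < e"
    using cInf_lessD[OF ne] assms(3) unfolding levy_dist_alt by blast
  then obtain d where "levy_within F G d" "d < e" by blast
  then show ?thesis using levy_within_mono[OF assms(1)] by simp
qed

lemma levy_dist_nonneg:
  assumes "F \<in> cdfs" "G \<in> cdfs" shows "0 \<le> levy_dist F G"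
  unfolding levy_dist_alt
proof (rule cInf_greatest)
  have "1 \<in> {e. e > 0 \<and> levy_within F G e}"
    using levy_within_1[OF assms] by simp
  then show "{e. e > 0 \<and> levy_within F G e} \<noteq> {}" by blast
qed simp

lemma levy_within_sym: "levy_within F G e \<Longrightarrow> levy_within G F e"
  unfolding levy_within_def
proof (intro allI conjI)
  fix x assume *: "\<forall>x. F (x - e) - e \<le> G x \<and> G x \<le> F (x + e) + e"
  show "G (x - e) - e \<le> F x" using *[rule_format, of "x - e"] by simp
  show "F x \<le> G (x + e) + e" using *[rule_format, of "x + e"] by simp
qed

lemma levy_dist_sym: "levy_dist F G = levy_dist G F"
proof -
  have "levy_within F G e = levy_within G F e" for e using levy_within_sym by blast
  then show ?thesis by (simp add: levy_dist_alt)
qed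

lemma levy_dist_self: assumes "F \<in> cdfs" shows "levy_dist F F = 0"
proof (rule antisym)
  show "levy_dist F F \<le> 0"
  proof (rule field_le_epsilon)
    fix e :: real assume e: "0 < e"
    have "F (x - e) \<le> F x" "F x \<le> F (x + e)" for x using e assms by (auto intro!: cdfs_mono[OF assms])
    note * = this
    have "levy_within F F e" unfolding levy_within_def
    proof (intro allI conjI)
      fix x
      show "F (x - e) - e \<le> F x" "F x \<le> F (x + e) + e" using *[of x] e by linarith+
    qed
    then show "levy_dist F F \<le> 0 + e" using levy_dist_le e by simp
  qed
qed (use assms in \<open>auto intro: levy_dist_nonneg\<close>)

lemma levy_within_trans:
  assumes "levy_within F G d" "levy_within G H e" shows "levy_within F H (d + e)"
  unfolding levy_within_def
proof (intro allI conjI)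
  fix x
  have "G (x - e) - e \<le> H x" "H x \<le> G (x + e) + e" using assms(2) by (auto simp: levy_within_def)
  moreover have "F (x - e - d) - d \<le> G (x - e)" "G (x + e) \<le> F (x + e + d) + d"
    using assms(1) by (auto simp: levy_within_def)
  ultimately show "F (x - (d + e)) - (d + e) \<le> H x" "H x \<le> F (x + (d + e)) + (d + e)"
    by (auto simp: algebra_simps)
qed

lemma levy_dist_triangle:
  assumes "F \<in> cdfs" "G \<in> cdfs" "H \<in> cdfs"
  shows "levy_dist F H \<le> levy_dist F G + levy_dist G H"
proof (rule field_le_epsilon)
  fix e :: real assume e: "0 < e"
  let ?d1 = "levy_dist F G + e/2" and ?d2 = "levy_dist G H + e/2"
  have "levy_within F G ?d1" "levy_within G H ?d2"
    using assms e by (auto intro!: levy_within_of_less)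
  then have "levy_within F H (?d1 + ?d2)" by (rule levy_within_trans)
  moreover have "?d1 + ?d2 > 0" using assms e levy_dist_nonneg[of F G] levy_dist_nonneg[of G H] by simp
  ultimately have "levy_dist F H \<le> ?d1 + ?d2" by (rule levy_dist_le[rotated])
  then show "levy_dist F H \<le> levy_dist F G + levy_dist G H + e" by simp
qed

lemma levy_within_of_sup:
  assumes "F \<in> cdfs" "\<And>x. \<bar>F x - G x\<bar> \<le> e" shows "levy_within F G e"
  unfolding levy_within_def
proof (intro allI conjI)
  fix x
  have e: "e \<ge> 0" using assms(2)[of 0] by simp
  have "F (x - e) \<le> F x" "F x \<le> F (x + e)" using assms(1) e by (auto intro!: cdfs_mono[OF assms(1)])
  then show "F (x - e) - e \<le> G x" "G x \<le> F (x + e) + e" using assms(2)[of x] by linarith+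
qed

lemma levy_dist_le_sup:
  assumes "F \<in> cdfs" "\<And>x. \<bar>F x - G x\<bar> \<le> e" shows "levy_dist F G \<le> e"
proof (rule field_le_epsilon)
  fix d :: real assume d: "0 < d"
  have "0 \<le> e" using assms(2)[of 0] by simp
  then show "levy_dist F G \<le> e + d"
    using levy_within_mono[OF assms(1) levy_within_of_sup[OF assms], of "e + d"] d levy_dist_le[of "e+d"] by simp
qed

lemma levy_dist_diff_le:
  assumes "F \<in> cdfs" "G \<in> cdfs" "F' \<in> cdfs" "G' \<in> cdfs"
  shows "\<bar>levy_dist F G - levy_dist F' G'\<bar> \<le> levy_dist F F' + levy_dist G G'"
  using levy_dist_triangle[of F F' G] levy_dist_triangle[of F' G' G]
    levy_dist_triangle[of F' F G'] levy_dist_triangle[of F G G'] assms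
    levy_dist_sym[of F F'] levy_dist_sym[of G G'] by linarith

text \<open>\<open>metric_topology\<close> is defined through neighbourhoods without any metric
  axiom, so openness of balls is where the triangle inequality enters.\<close>

lemma openin_levy_ball:
  assumes "l \<in> cdfs" shows "openin weak_topology {y \<in> cdfs. levy_dist l y < e}"
  unfolding weak_topology_def openin_metric_topology
proof (intro conjI ballI)
  fix x assume x: "x \<in> {y \<in> cdfs. levy_dist l y < e}"
  show "\<exists>d>0. \<forall>y\<in>cdfs. levy_dist x y < d \<longrightarrow> y \<in> {y \<in> cdfs. levy_dist l y < e}"
  proof (rule exI[of _ "e - levy_dist l x"], intro conjI ballI impI)
    fix y assume y: "y \<in> cdfs" "levy_dist x y < e - levy_dist l x"
    then show "y \<in> {y \<in> cdfs. levy_dist l y < e}"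
      using x levy_dist_triangle[OF assms, of x y] by auto
  qed (use x in auto)
qed auto

lemma topspace_weak_topology [simp]: "topspace weak_topology = cdfs"
  by (simp add: weak_topology_def)

lemma limitin_weak_topology:
  assumes "\<And>t. x t \<in> cdfs"
  shows "limitin weak_topology x l F \<longleftrightarrow> l \<in> cdfs \<and> ((\<lambda>t. levy_dist l (x t)) \<longlongrightarrow> 0) F"
proof
  assume L: "limitin weak_topology x l F"
  then have l: "l \<in> cdfs" using limitin_topspace topspace_weak_topology by metis
  moreover have "((\<lambda>t. levy_dist l (x t)) \<longlongrightarrow> 0) F"
  proof (rule tendstoI)
    fix e :: real assume "0 < e"
    then have "l \<in> {y \<in> cdfs. levy_dist l y < e}" using l levy_dist_self by simp
    then have "\<forall>\<^sub>F t in F. x t \<in> {y \<in> cdfs. levy_dist l y < e}"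
      using L openin_levy_ball[OF l] unfolding limitin_def by blast
    then show "\<forall>\<^sub>F t in F. dist (levy_dist l (x t)) 0 < e"
      by eventually_elim (use levy_dist_nonneg[OF l] in \<open>auto simp: dist_real_def\<close>)
  qed
  ultimately show "l \<in> cdfs \<and> ((\<lambda>t. levy_dist l (x t)) \<longlongrightarrow> 0) F" by simp
next
  assume L: "l \<in> cdfs \<and> ((\<lambda>t. levy_dist l (x t)) \<longlongrightarrow> 0) F"
  show "limitin weak_topology x l F"
    unfolding limitin_def
  proof (intro conjI allI impI)
    fix U assume "openin weak_topology U \<and> l \<in> U"
    then obtain e where e: "e > 0" "\<forall>y\<in>cdfs. levy_dist l y < e \<longrightarrow> y \<in> U"
      unfolding weak_topology_def openin_metric_topology by blast
    have "\<forall>\<^sub>F t in F. dist (levy_dist l (x t)) 0 < e" using L e(1) tendstoD by blast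
    then show "\<forall>\<^sub>F t in F. x t \<in> U"
    proof eventually_elim
      case (elim t)
      then have "levy_dist l (x t) < e" by (simp add: dist_real_def)
      then show ?case using e(2) assms by blast
    qed
  qed (use L in simp)
qed

lemma limitin_cong_ev:
  assumes "\<forall>\<^sub>F t in F. x t = y t" "limitin T x l F" shows "limitin T y l F"
  unfolding limitin_def
proof (intro conjI allI impI)
  show "l \<in> topspace T" using assms(2) by (rule limitin_topspace)
  fix U assume "openin T U \<and> l \<in> U"
  then have "\<forall>\<^sub>F t in F. x t \<in> U" using assms(2) by (auto simp: limitin_def)
  with assms(1) show "\<forall>\<^sub>F t in F. y t \<in> U" by eventually_elim simp
qed

text \<open>Paths in the Skorohod space are \<open>undefined\<close> at negative times, so
  membership in \<open>cdfs\<close> holds only eventually along the one-sided filters. Replacing the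
  other values by the limit reduces to the previous lemma.\<close>

lemma limitin_weak_topology_ev:
  assumes "\<forall>\<^sub>F t in F. x t \<in> cdfs"
  shows "limitin weak_topology x l F \<longleftrightarrow> l \<in> cdfs \<and> ((\<lambda>t. levy_dist l (x t)) \<longlongrightarrow> 0) F"
proof (cases "l \<in> cdfs")
  case True
  define y where "y t = (if x t \<in> cdfs then x t else l)" for t
  have ev: "\<forall>\<^sub>F t in F. x t = y t" "\<forall>\<^sub>F t in F. y t = x t" using assms by (eventually_elim, simp add: y_def)+
  have ev2: "\<forall>\<^sub>F t in F. levy_dist l (x t) = levy_dist l (y t)" using ev(1) by eventually_elim simp
  have "limitin weak_topology x l F \<longleftrightarrow> limitin weak_topology y l F"
    using limitin_cong_ev[OF ev(1)] limitin_cong_ev[OF ev(2)] by blast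
  also have "\<dots> \<longleftrightarrow> ((\<lambda>t. levy_dist l (y t)) \<longlongrightarrow> 0) F"
    using True by (subst limitin_weak_topology) (auto simp: y_def)
  also have "\<dots> \<longleftrightarrow> ((\<lambda>t. levy_dist l (x t)) \<longlongrightarrow> 0) F"
    by (rule tendsto_cong) (use ev2 in \<open>simp add: eq_commute\<close>)
  finally show ?thesis using True by simp
next
  case False then show ?thesis using limitin_topspace topspace_weak_topology by metis
qed

section \<open>Lipschitz functions as integrals of their derivatives\<close>

text \<open>The density h comes from Radon-Nikodym, applied to the measure that gives a set A the
  length of its image under G. The lower slope bound makes G a bijection of the line, the upper one
  sends null sets to null sets.\<close>

lemma bilipschitz_image_density:
  fixes G :: "real \<Rightarrow> real"
  assumes low: "\<And>s t. s \<le> t \<Longrightarrow> t - s \<le> G t - G s"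
    and up: "\<And>s t. s \<le> t \<Longrightarrow> G t - G s \<le> K * (t - s)"
  shows "\<exists>h. \<forall>a b. a \<le> b \<longrightarrow> (h has_integral (G b - G a)) {a..b}"
proof -
  have K: "K \<ge> 1" using low[of 0 1] up[of 0 1] by simp
  have mono: "s \<le> t \<Longrightarrow> G s \<le> G t" for s t using low[of s t] by simp
  have smono: "s < t \<Longrightarrow> G s < G t" for s t using low[of s t] by simp
  have lip: "K-lipschitz_on UNIV G"
  proof (rule lipschitz_onI)
    fix x y show "dist (G x) (G y) \<le> K * dist x y"
      using up[of x y] up[of y x] mono[of x y] mono[of y x] by (cases "x \<le> y") (auto simp: dist_real_def abs_if)
  qed (use K in auto)
  have cont: "continuous_on UNIV G" using lip by (rule lipschitz_on_continuous_on)
  have inj: "inj G" by (rule injI) (metis smono linorder_neqE_linordered_idom less_irrefl)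
  have surj: "\<exists>x. G x = y" for y
  proof -
    define r where "r = \<bar>y - G 0\<bar>"
    have "G (-r) \<le> y" using low[of "-r" 0] by (simp add: r_def)
    moreover have "y \<le> G r" using low[of 0 r] by (simp add: r_def)
    ultimately show ?thesis
      using IVT'[of G "-r" y r] continuous_on_subset[OF cont] by (auto simp: r_def)
  qed
  define \<phi> where "\<phi> = inv G"
  have G\<phi>: "G (\<phi> y) = y" for y unfolding \<phi>_def using surj by (metis f_inv_into_f rangeI)
  have \<phi>G: "\<phi> (G x) = x" for x unfolding \<phi>_def using inj by simp
  have \<phi>mono: "mono \<phi>"
    by (rule monoI) (metis G\<phi> smono linorder_not_le)
  have \<phi>m: "\<phi> \<in> borel_measurable borel" using \<phi>mono by (rule borel_measurable_mono)
  \<comment> \<open>Push-forward of Lebesgue measure under the inverse of G; on a Borel set this is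
    the length of the image under G.\<close>
  define \<mu> where "\<mu> = distr lborel lborel \<phi>"
  have vim: "\<phi> -` A = G ` A" for A using G\<phi> \<phi>G by (auto simp: image_iff) metis
  have em: "emeasure \<mu> A = emeasure lborel (G ` A)" if "A \<in> sets borel" for A
    unfolding \<mu>_def using that \<phi>m by (subst emeasure_distr) (auto simp: vim)
  have Gm: "G \<in> borel_measurable borel" by (rule borel_measurable_mono) (simp add: mono monoI)
  have imG: "G ` A \<in> sets borel" if "A \<in> sets borel" for A
    using measurable_sets[OF \<phi>m that] by (simp add: vim)
  have ac: "absolutely_continuous lborel \<mu>"
    unfolding absolutely_continuous_def
  proof
    fix A :: "real set" assume A: "A \<in> null_sets lborel"
    then have Ab: "A \<in> sets borel" by auto
    have "negligible A" using A
      by (simp add: negligible_iff_null_sets null_sets_completionI)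
    then have "negligible (G ` A)"
    proof (rule negligible_locally_Lipschitz_image[rotated])
      fix x assume "x \<in> A"
      show "\<exists>T B. open T \<and> x \<in> T \<and> (\<forall>y\<in>A \<inter> T. norm (G y - G x) \<le> B * norm (y - x))"
        using lipschitz_onD[OF lip] by (intro exI[of _ UNIV] exI[of _ K]) (auto simp: dist_norm)
    qed simp
    then have "emeasure lborel (G ` A) = 0"
      using imG[OF Ab] by (simp add: negligible_iff_null_sets null_sets_def)
    then show "A \<in> null_sets \<mu>" using em[OF Ab] Ab by (auto simp: null_sets_def \<mu>_def)
  qed
  obtain h where h: "h \<in> borel_measurable lborel" "density lborel h = \<mu>"
    using sigma_finite_measure.Radon_Nikodym[OF sigma_finite_lborel ac] by (auto simp: \<mu>_def)
  have Gimg: "G ` {a..b} = {G a..G b}" if "a \<le> b" for a b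
  proof
    show "G ` {a..b} \<subseteq> {G a..G b}" using mono by auto
    show "{G a..G b} \<subseteq> G ` {a..b}"
    proof
      fix y assume y: "y \<in> {G a..G b}"
      then have "\<phi> y \<in> {a..b}" using \<phi>mono \<phi>G by (metis atLeastAtMost_iff monoD)
      then show "y \<in> G ` {a..b}" using G\<phi>[of y] by (metis imageI)
    qed
  qed
  have nn: "(\<integral>\<^sup>+x. h x * indicator {a..b} x \<partial>lborel) = ennreal (G b - G a)" if "a \<le> b" for a b
  proof -
    have "(\<integral>\<^sup>+x. h x * indicator {a..b} x \<partial>lborel) = emeasure \<mu> {a..b}"
      unfolding h(2)[symmetric] using h(1) by (subst emeasure_density) auto
    also have "\<dots> = emeasure lborel {G a..G b}" using em[of "{a..b}"] Gimg[OF that] by simp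
    finally show ?thesis using mono[OF that] by simp
  qed
  have "(enn2real \<circ> h has_integral (G b - G a)) {a..b}" if ab: "a \<le> b" for a b
  proof -
    have m: "(\<lambda>x. h x * indicator {a..b} x) \<in> borel_measurable lborel" using h(1) by simp
    have fin: "AE x in lborel. h x * indicator {a..b} x \<noteq> \<infinity>"
      using nn[OF ab] by (intro nn_integral_PInf_AE[OF m]) auto
    have e: "(\<integral>\<^sup>+x. ennreal (enn2real (h x) * indicator {a..b} x) \<partial>lborel) = ennreal (G b - G a)"
      unfolding nn[OF ab, symmetric]
      using fin by (intro nn_integral_cong_AE, eventually_elim) (auto simp: indicator_def less_top)
    have "((\<lambda>x. enn2real (h x) * indicator {a..b} x) has_integral (G b - G a)) UNIV"
      by (rule nn_integral_has_integral[OF _ _ e]) (use h(1) mono[OF ab] in auto)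
    moreover have "(\<lambda>x. enn2real (h x) * indicator {a..b} x) = (\<lambda>x. if x \<in> {a..b} then (enn2real \<circ> h) x else 0)"
      by (auto simp: fun_eq_iff)
    ultimately have "((\<lambda>x. if x \<in> {a..b} then (enn2real \<circ> h) x else 0) has_integral (G b - G a)) UNIV" by metis
    then show ?thesis by (simp only: has_integral_restrict_UNIV)
  qed
  then show ?thesis by blast
qed

text \<open>Lebesgue differentiation: averages over \<open>[x, x + k]\<close> converge for x outside
  a null set. Applied to h and to its reflection, this controls the difference quotients from both
  sides.\<close>

lemma indefinite_integral_AE_derivative:
  fixes G h :: "real \<Rightarrow> real"
  assumes int: "\<And>a b. a \<le> b \<Longrightarrow> (h has_integral (G b - G a)) {a..b}"
  shows "\<exists>N. negligible N \<and> (\<forall>x. x \<notin> N \<longrightarrow> (G has_real_derivative h x) (at x))"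
proof -
  have i1: "h integrable_on cbox a b" for a b
    using int[of a b] by (cases "a \<le> b") auto
  obtain N1 where N1: "negligible N1"
    "\<And>x e. x \<notin> N1 \<Longrightarrow> 0 < e \<Longrightarrow> \<exists>d>0. \<forall>k. 0 < k \<and> k < d \<longrightarrow>
        norm (integral (cbox x (x + k *\<^sub>R One)) h /\<^sub>R k ^ DIM(real) - h x) < e"
    using integrable_ccontinuous_explicit[OF i1] by metis
  \<comment> \<open>The reflected integrand turns averages to the left of x into averages to the
    right of \<open>-x\<close>.\<close>
  have i2': "((\<lambda>x. h (- x)) has_integral (G (-a) - G (-b))) {a..b}" if "a \<le> b" for a b
    using has_integral_reflect_real[where a="-b" and b="-a" and f=h and i="G (-a) - G (-b)"] int[of "-b" "-a"] that by simp
  have i2: "(\<lambda>x. h (- x)) integrable_on cbox a b" for a b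
    using i2'[of a b] by (cases "a \<le> b") auto
  obtain N2 where N2: "negligible N2"
    "\<And>x e. x \<notin> N2 \<Longrightarrow> 0 < e \<Longrightarrow> \<exists>d>0. \<forall>k. 0 < k \<and> k < d \<longrightarrow>
        norm (integral (cbox x (x + k *\<^sub>R One)) (\<lambda>x. h (- x)) /\<^sub>R k ^ DIM(real) - h (- x)) < e"
    using integrable_ccontinuous_explicit[OF i2] by metis
  define N where "N = N1 \<union> uminus ` N2"
  have "negligible (uminus ` N2)"
  proof (rule negligible_locally_Lipschitz_image[OF _ N2(1)])
    fix x :: real
    show "\<exists>T B. open T \<and> x \<in> T \<and> (\<forall>y\<in>N2 \<inter> T. norm (- y - - x) \<le> B * norm (y - x))"
      by (rule exI[of _ UNIV], rule exI[of _ 1]) auto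
  qed simp
  then have "negligible N" using N1(1) by (simp add: N_def)
  moreover have "(G has_real_derivative h x) (at x)" if x: "x \<notin> N" for x
    unfolding DERIV_def LIM_eq
  proof (intro allI impI)
    fix r :: real assume r: "0 < r"
    have x1: "x \<notin> N1" and x2: "-x \<notin> N2" using x by (auto simp: N_def image_iff) 
    obtain d1 where d1: "d1 > 0" "\<And>k. 0 < k \<Longrightarrow> k < d1 \<Longrightarrow> norm (integral (cbox x (x + k *\<^sub>R One)) h /\<^sub>R k ^ DIM(real) - h x) < r"
      using N1(2)[OF x1 r] by blast
    obtain d2 where d2: "d2 > 0" "\<And>k. 0 < k \<Longrightarrow> k < d2 \<Longrightarrow>
        norm (integral (cbox (-x) (-x + k *\<^sub>R One)) (\<lambda>x. h (- x)) /\<^sub>R k ^ DIM(real) - h (- (-x))) < r"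
      using N2(2)[OF x2 r] by blast
    have "norm ((G (x + k) - G x) / k - h x) < r" if "k \<noteq> 0" "\<bar>k\<bar> < min d1 d2" for k
    proof (cases "k > 0")
      case True
      have "integral (cbox x (x + k *\<^sub>R One)) h = G (x + k) - G x"
        using int[of x "x+k"] True by (simp add: integral_unique)
      then show ?thesis using d1(2)[of k] True that by (simp add: divide_inverse mult.commute)
    next
      case False
      then have k: "-k > 0" using that by simp
      have "integral (cbox (-x) (-x + (-k) *\<^sub>R One)) (\<lambda>x. h (- x)) = G x - G (x + k)"
        using integral_unique[OF i2'[of "-x" "-x + -k"]] k by simp (metis add.commute)
      then have "norm ((G x - G (x+k)) /\<^sub>R (-k) - h x) < r" using d2(2)[of "-k"] k that by simp
      moreover have "(G x - G (x+k)) /\<^sub>R (-k) = (G (x + k) - G x) / k"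
        using that by (simp add: field_simps)
      ultimately show ?thesis by simp
    qed
    then show "\<exists>s>0. \<forall>k. k \<noteq> 0 \<and> norm (k - 0) < s \<longrightarrow> norm ((G (x + k) - G x) / k - h x) < r"
      using d1(1) d2(1) by (intro exI[of _ "min d1 d2"]) auto
  qed
  ultimately show ?thesis by blast
qed

text \<open>D is tied to u only at points where the derivative exists. Such points have full
  measure, as a Lipschitz function is an indefinite integral up to a linear term, so D agrees almost
  everywhere with an integrand already known to have the right integral.\<close>

lemma lipschitz_has_integral_derivative:
  fixes u D :: "real \<Rightarrow> real"
  assumes lip: "C-lipschitz_on {0..T} u" and T: "0 < T"
    and der: "\<And>t d. 0 < t \<Longrightarrow> t < T \<Longrightarrow> (u has_real_derivative d) (at t) \<Longrightarrow> d = D t"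
  shows "(D has_integral (u T - u 0)) {0..T}"
proof -
  have C: "C \<ge> 0" using lip by (rule lipschitz_on_nonneg)
  define c where "c t = max 0 (min T t)" for t :: real
  \<comment> \<open>The slope \<open>C + 1\<close> lifts all difference quotients from
    \<open>[-C, C]\<close> into \<open>[1, 2 * C + 1]\<close>; the clamp \<open>c\<close> extends u
    by constants to the whole line.\<close>
  define G where "G t = (C + 1) * t + u (c t)" for t
  have cc: "c t \<in> {0..T}" for t using T by (auto simp: c_def)
  have b: "\<bar>u (c t) - u (c s)\<bar> \<le> C * (t - s)" if "s \<le> t" for s t
  proof -
    have "\<bar>u (c t) - u (c s)\<bar> \<le> C * \<bar>c t - c s\<bar>"
      using lipschitz_onD[OF lip cc cc, of t s] by (simp add: dist_real_def)
    also have "\<dots> \<le> C * (t - s)" using that C by (intro mult_left_mono) (auto simp: c_def)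
    finally show ?thesis .
  qed
  have "\<exists>h. \<forall>a b. a \<le> b \<longrightarrow> (h has_integral (G b - G a)) {a..b}"
  proof (rule bilipschitz_image_density)
    fix s t :: real assume "s \<le> t"
    then show "t - s \<le> G t - G s" "G t - G s \<le> (2 * C + 1) * (t - s)"
      using b[of s t] by (auto simp: G_def algebra_simps)
  qed
  then obtain h where h: "\<And>a b. a \<le> b \<Longrightarrow> (h has_integral (G b - G a)) {a..b}" by blast
  obtain N where N: "negligible N" "\<And>x. x \<notin> N \<Longrightarrow> (G has_real_derivative h x) (at x)"
    using indefinite_integral_AE_derivative[OF h] by blast
  have eq: "D x = h x - (C + 1)" if x: "0 < x" "x < T" "x \<notin> N" for x
  proof -
    have "((\<lambda>t. G t - (C + 1) * t) has_real_derivative (h x - (C + 1))) (at x)"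
      using N(2)[OF x(3)] by (auto intro!: derivative_eq_intros)
    moreover have "\<forall>\<^sub>F t in nhds x. G t - (C + 1) * t = u t"
      using eventually_nhds_in_open[of "{0<..<T}" x] x
      by (auto simp: G_def c_def elim!: eventually_mono)
    ultimately have "(u has_real_derivative (h x - (C + 1))) (at x)"
      by (subst (asm) DERIV_cong_ev[OF refl _ refl]) 
    then show ?thesis using der x by force
  qed
  have "((\<lambda>x. h x - (C + 1)) has_integral ((G T - G 0) - (C + 1) * (T - 0))) {0..T}"
    using h[of 0 T] T has_integral_const_real[of "C+1" 0 T]
    by (intro has_integral_diff) (auto simp: mult.commute)
  moreover have "(G T - G 0) - (C + 1) * (T - 0) = u T - u 0"
    using T by (simp add: G_def c_def algebra_simps)
  ultimately have "((\<lambda>x. h x - (C + 1)) has_integral (u T - u 0)) {0..T}" by simp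
  then show ?thesis
    by (rule has_integral_spike[of "N \<union> {0, T}", rotated 2]) (use N(1) eq in \<open>auto simp: not_less\<close>)
qed

section \<open>The mean-field equation in mild form\<close>

text \<open>Inserting the inequality into itself m times leaves a partial sum of
  \<open>exp (K * t)\<close> and the remainder \<open>B * (K * t) ^ m / fact m\<close>, which
  vanishes. W need only be integrable and bounded above, which suits functions of time that are
  merely measurable.\<close>

lemma gronwall_integral:
  fixes W :: "real \<Rightarrow> real"
  assumes K: "0 \<le> K"
    and int: "\<And>t. 0 \<le> t \<Longrightarrow> t \<le> T \<Longrightarrow> W integrable_on {0..t}"
    and bd: "\<And>t. 0 \<le> t \<Longrightarrow> t \<le> T \<Longrightarrow> W t \<le> B"
    and le: "\<And>t. 0 \<le> t \<Longrightarrow> t \<le> T \<Longrightarrow> W t \<le> a + K * integral {0..t} W"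
    and t: "0 \<le> t" "t \<le> T"
  shows "W t \<le> a * exp (K * t)"
proof -
  have step: "W t \<le> a * (\<Sum>j<m. (K * t) ^ j / fact j) + B * ((K * t) ^ m / fact m)"
    if "0 \<le> t" "t \<le> T" for m t
    using that
  proof (induction m arbitrary: t)
    case 0 then show ?case using bd by simp
  next
    case (Suc m)
    define P where "P s = a * (\<Sum>j<m. (K * s) ^ j / fact j) + B * ((K * s) ^ m / fact m)" for s
    \<comment> \<open>The antiderivative of \<open>P\<close> that vanishes at 0.\<close>
    define Q where "Q s = a * (\<Sum>j<m. K ^ j * s ^ Suc j / fact (Suc j)) + B * (K ^ m * s ^ Suc m / fact (Suc m))" for s
    have d: "((\<lambda>s. K ^ j * s ^ Suc j / fact (Suc j)) has_real_derivative (K * s) ^ j / fact j) (at s within S)" for j s S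
    proof -
      have "((\<lambda>s. K ^ j * s ^ Suc j / fact (Suc j)) has_real_derivative K ^ j * (real (Suc j) * s ^ j) / fact (Suc j)) (at s within S)"
        using DERIV_cdivide[OF DERIV_cmult[OF DERIV_pow[of "Suc j" s S], of "K ^ j"], of "fact (Suc j)"] by simp
      moreover have "K ^ j * (real (Suc j) * s ^ j) / fact (Suc j) = (K * s) ^ j / fact j"
        by (simp add: power_mult_distrib field_simps del: of_nat_Suc)
      ultimately show ?thesis by simp
    qed
    have "(Q has_real_derivative P s) (at s within S)" for s S
      unfolding Q_def P_def by (intro derivative_intros DERIV_sum DERIV_cmult d)
    then have PI: "(P has_integral (Q t - Q 0)) {0..t}"
      using Suc.prems by (intro fundamental_theorem_of_calculus) (auto simp: has_real_derivative_iff_has_vector_derivative)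
    have Q0: "Q 0 = 0" by (simp add: Q_def)
    have "integral {0..t} W \<le> Q t"
      using integral_le[OF int[OF Suc.prems] has_integral_integrable[OF PI]] Suc.IH Suc.prems PI Q0
      by (auto simp: P_def integral_unique)
    then have "W t \<le> a + K * Q t"
      using le[OF Suc.prems] mult_left_mono[OF _ K] by (meson add_left_mono order_trans)
    also have "a + K * Q t = a * (\<Sum>j<Suc m. (K * t) ^ j / fact j) + B * ((K * t) ^ Suc m / fact (Suc m))"
      unfolding Q_def sum.lessThan_Suc_shift
      by (simp add: algebra_simps sum_distrib_left power_mult_distrib del: fact_Suc)
    finally show ?case .
  qed
  have "(\<lambda>m. a * (\<Sum>j<m. (K * t) ^ j / fact j) + B * ((K * t) ^ m / fact m)) \<longlonglongrightarrow> a * exp (K * t) + B * 0"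
  proof (intro tendsto_intros)
    have "(\<lambda>j. (K * t) ^ j / fact j) sums exp (K * t)"
      using exp_converges[of "K * t"] by (simp add: divide_inverse mult.commute)
    then show "(\<lambda>m. \<Sum>j<m. (K * t) ^ j / fact j) \<longlonglongrightarrow> exp (K * t)" by (simp add: sums_def)
    show "(\<lambda>m. (K * t) ^ m / fact m) \<longlonglongrightarrow> 0"
      using summable_LIMSEQ_zero[OF summable_exp[of "K * t"]] by (simp add: divide_inverse mult.commute)
  qed
  from LIMSEQ_le_const[OF this, of "W t"] step t show ?thesis by auto
qed

lemma dominated_convergence_within:
  fixes g :: "'a::{first_countable_topology,t2_space} \<Rightarrow> 'b \<Rightarrow> real"
  assumes "\<And>t. g t \<in> borel_measurable M" "G \<in> borel_measurable M" "integrable M B"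
    and "\<And>t z. z \<in> space M \<Longrightarrow> \<bar>g t z\<bar> \<le> B z"
    and "\<And>z. z \<in> space M \<Longrightarrow> ((\<lambda>t. g t z) \<longlongrightarrow> G z) (at x within S)"
  shows "((\<lambda>t. \<integral>z. g t z \<partial>M) \<longlongrightarrow> (\<integral>z. G z \<partial>M)) (at x within S)"
  unfolding tendsto_at_iff_sequentially
proof (intro allI impI)
  fix X assume X: "\<forall>i. X i \<in> S - {x}" "X \<longlonglongrightarrow> x"
  have "(\<lambda>i. \<integral>z. g (X i) z \<partial>M) \<longlonglongrightarrow> (\<integral>z. G z \<partial>M)"
  proof (rule integral_dominated_convergence[where w=B])
    show "AE z in M. (\<lambda>i. g (X i) z) \<longlonglongrightarrow> G z"
      using assms(5) X unfolding tendsto_at_iff_sequentially comp_def by (intro AE_I2) blast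
  qed (use assms in auto)
  then show "((\<lambda>t. \<integral>z. g t z \<partial>M) \<circ> X) \<longlonglongrightarrow> (\<integral>z. G z \<partial>M)" by (simp add: comp_def)
qed

section \<open>The jump and gain operators\<close>

locale moving_boundary = zeta: real_distribution \<zeta>
  for \<zeta> :: "real measure" +
  fixes lam v A0 :: real
  assumes lam: "0 \<le> lam" and v: "0 < v"
begin

definition bdry :: "real \<Rightarrow> real" where "bdry s = A0 + v * s"

text \<open>The probability that \<open>max Y A + z \<le> x\<close> when Y has distribution function
  F: this event is \<open>A \<le> x - z\<close> together with \<open>Y \<le> x - z\<close>.\<close>

definition shifted :: "real \<Rightarrow> (real \<Rightarrow> real) \<Rightarrow> real \<Rightarrow> real \<Rightarrow> real" where
  "shifted A F x z = (if A \<le> x - z then F (x - z) else 0)"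

definition jump :: "real \<Rightarrow> (real \<Rightarrow> real) \<Rightarrow> real \<Rightarrow> real" where
  "jump A F x = (\<integral>z. shifted A F x z \<partial>\<zeta>)"

text \<open>The probability flux into \<open>{..x}\<close> when a particle is redrawn at every point
  of its clocks: after a synchronization it is below x iff both it and its target were, whence the
  square. The right-hand side of the equation is the gain minus \<open>(lam + 1) * F x\<close>; the
  gain is monotone in F, which is what the integrating factor exploits.\<close>

definition gain :: "real \<Rightarrow> (real \<Rightarrow> real) \<Rightarrow> real \<Rightarrow> real" where
  "gain A F x = lam * jump A F x + (F x)\<^sup>2"

text \<open>Distribution functions without the conditions at infinity. This class contains the
  constant 1, where the iteration starts, and it is preserved by the limits taken below; properness
  of the solution is recovered afterwards.\<close>

definition regular :: "(real \<Rightarrow> real) \<Rightarrow> bool" where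
  "regular F \<longleftrightarrow> mono F \<and> (\<forall>x. 0 \<le> F x \<and> F x \<le> 1) \<and> (\<forall>x. continuous (at_right x) F)"

lemma regularD:
  assumes "regular F"
  shows "mono F" "0 \<le> F x" "F x \<le> 1" "continuous (at_right x) F"
  using assms by (auto simp: regular_def)

lemma regular_measurable: "regular F \<Longrightarrow> F \<in> borel_measurable borel"
  by (intro borel_measurable_mono) (auto simp: regular_def)

lemma shifted_measurable [measurable]:
  assumes [measurable]: "F \<in> borel_measurable borel"
  shows "shifted A F x \<in> borel_measurable borel"
  unfolding shifted_def by measurable

lemma shifted_bounds:
  assumes "regular F" shows "0 \<le> shifted A F x z" "shifted A F x z \<le> 1" "\<bar>shifted A F x z\<bar> \<le> 1"
  using regularD[OF assms] by (auto simp: shifted_def)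

lemma integrable_shifted:
  assumes "regular F" shows "integrable \<zeta> (shifted A F x)"
proof (rule zeta.integrable_const_bound[where B=1])
  show "shifted A F x \<in> borel_measurable \<zeta>"
    using shifted_measurable[OF regular_measurable[OF assms]] by simp
qed (use shifted_bounds[OF assms] in auto)

lemma jump_bounds:
  assumes "regular F" shows "0 \<le> jump A F x" "jump A F x \<le> 1"
proof -
  show "0 \<le> jump A F x" unfolding jump_def
    using shifted_bounds[OF assms] by (intro integral_nonneg_AE) auto
  have "jump A F x \<le> (\<integral>z. 1 \<partial>\<zeta>)" unfolding jump_def
    using shifted_bounds[OF assms] by (intro integral_mono integrable_shifted assms) auto
  then show "jump A F x \<le> 1" by (simp add: zeta.prob_space[simplified])
qed

lemma shifted_mono_x:
  assumes "regular F" "x \<le> y" shows "shifted A F x z \<le> shifted A F y z"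
  using regularD[OF assms(1)] assms(2) by (auto simp: shifted_def mono_def)

lemma jump_mono_x: assumes "regular F" "x \<le> y" shows "jump A F x \<le> jump A F y"
  unfolding jump_def using assms by (intro integral_mono integrable_shifted shifted_mono_x)

lemma jump_mono:
  assumes "regular F" "regular G" "\<And>x. F x \<le> G x" shows "jump A F x \<le> jump A G x"
  unfolding jump_def using assms by (intro integral_mono integrable_shifted) (auto simp: shifted_def)

text \<open>The cutoff \<open>A \<le> x - z\<close> persists when x increases, and where it fails it
  keeps failing for a while to the right.\<close>

lemma shifted_right_continuous:
  assumes "regular F" shows "continuous (at_right x) (\<lambda>x. shifted A F x z)"
proof (cases "A \<le> x - z")
  case True
  have "((\<lambda>y. F (y - z)) \<longlongrightarrow> F (x - z)) (at_right x)"
  proof -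
    have "filterlim (\<lambda>y. y - z) (at_right (x - z)) (at_right x)"
      unfolding filterlim_at by (auto intro!: tendsto_eq_intros simp: eventually_at_filter)
    moreover have "(F \<longlongrightarrow> F (x - z)) (at_right (x - z))"
      using regularD(4)[OF assms] by (simp add: continuous_within)
    ultimately show ?thesis by (rule filterlim_compose[rotated])
  qed
  moreover have "\<forall>\<^sub>F y in at_right x. F (y - z) = shifted A F y z"
    using eventually_at_right_less[of x] by eventually_elim (use True in \<open>auto simp: shifted_def\<close>)
  ultimately have "((\<lambda>y. shifted A F y z) \<longlongrightarrow> F (x - z)) (at_right x)"
    by (rule Lim_transform_eventually)
  then show ?thesis using True by (simp add: continuous_within shifted_def)
next
  case False
  then have "x < A + z" by simp
  then have "\<forall>\<^sub>F y in at_right x. y < A + z"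
    by (auto simp: eventually_at_right)
  then have "\<forall>\<^sub>F y in at_right x. 0 = shifted A F y z"
    by eventually_elim (auto simp: shifted_def)
  then have "((\<lambda>y. shifted A F y z) \<longlongrightarrow> 0) (at_right x)"
    by (rule Lim_transform_eventually[OF tendsto_const])
  then show ?thesis using False by (simp add: continuous_within shifted_def)
qed

lemma jump_right_continuous:
  assumes "regular F" shows "continuous (at_right x) (jump A F)"
  unfolding continuous_within jump_def
proof (rule dominated_convergence_within[where B="\<lambda>_. 1"])
  show "((\<lambda>t. shifted A F t z) \<longlongrightarrow> shifted A F x z) (at_right x)" for z
    using shifted_right_continuous[OF assms] by (simp add: continuous_within)
qed (use shifted_bounds[OF assms] regular_measurable[OF assms] in auto)

lemma gain_bounds:
  assumes "regular F" shows "0 \<le> gain A F x" "gain A F x \<le> lam + 1" "\<bar>gain A F x\<bar> \<le> lam + 1"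
proof -
  have "(F x)\<^sup>2 \<le> 1" using regularD(2,3)[OF assms] by (simp add: power_le_one)
  moreover have "lam * jump A F x \<le> lam * 1" using jump_bounds[OF assms] lam by (intro mult_left_mono)
  ultimately show "gain A F x \<le> lam + 1" by (simp add: gain_def)
  moreover show "0 \<le> gain A F x" using jump_bounds[OF assms] lam by (simp add: gain_def)
  ultimately show "\<bar>gain A F x\<bar> \<le> lam + 1" by simp
qed

lemma gain_mono_x: assumes "regular F" "x \<le> y" shows "gain A F x \<le> gain A F y"
  unfolding gain_def
proof (rule add_mono)
  show "lam * jump A F x \<le> lam * jump A F y" using jump_mono_x[OF assms] lam by (intro mult_left_mono)
  show "(F x)\<^sup>2 \<le> (F y)\<^sup>2" using regularD(1,2)[OF assms(1)] assms(2) by (intro power_mono) (auto simp: mono_def)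
qed

lemma gain_mono:
  assumes "regular F" "regular G" "\<And>x. F x \<le> G x" shows "gain A F x \<le> gain A G x"
  unfolding gain_def
proof (rule add_mono)
  show "lam * jump A F x \<le> lam * jump A G x" using jump_mono[OF assms] lam by (intro mult_left_mono)
  show "(F x)\<^sup>2 \<le> (G x)\<^sup>2" using regularD(2)[OF assms(1)] assms(3) by (intro power_mono)
qed

lemma gain_right_continuous: "regular F \<Longrightarrow> continuous (at_right x) (gain A F)"
  unfolding gain_def using jump_right_continuous regularD(4) by (intro continuous_intros) auto

section \<open>Picard iteration for the mild equation\<close>

definition rate :: real where "rate = lam + 1"

lemma rate_pos: "0 < rate" using lam by (simp add: rate_def)

text \<open>Joint measurability in time and space is what the integrals over time and over
  \<open>\<zeta>\<close> need; quantifying over all real times saves side conditions.\<close>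

definition regular_family :: "(real \<Rightarrow> real \<Rightarrow> real) \<Rightarrow> bool" where
  "regular_family f \<longleftrightarrow> (\<forall>s. regular (f s)) \<and>
     (\<lambda>(s, x). f s x) \<in> borel_measurable (borel \<Otimes>\<^sub>M borel)"

lemma jump_joint_measurable:
  assumes "regular_family f"
  shows "(\<lambda>(s, x). jump (bdry s) (f s) x) \<in> borel_measurable (borel \<Otimes>\<^sub>M borel)"
proof -
  have f: "(\<lambda>(s, x). f s x) \<in> borel_measurable (borel \<Otimes>\<^sub>M borel)" using assms by (simp add: regular_family_def)
  have "(\<lambda>p. f (fst (fst p)) (snd (fst p) - snd p)) \<in> borel_measurable ((borel \<Otimes>\<^sub>M borel) \<Otimes>\<^sub>M \<zeta>)"
  proof -
    have "(\<lambda>p. (fst (fst p), snd (fst p) - snd p)) \<in> (borel \<Otimes>\<^sub>M borel) \<Otimes>\<^sub>M \<zeta> \<rightarrow>\<^sub>M borel \<Otimes>\<^sub>M borel"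
      by measurable
    from measurable_compose[OF this f] show ?thesis by simp
  qed
  then have "(\<lambda>p. shifted (bdry (fst (fst p))) (f (fst (fst p))) (snd (fst p)) (snd p))
      \<in> borel_measurable ((borel \<Otimes>\<^sub>M borel) \<Otimes>\<^sub>M \<zeta>)"
    unfolding shifted_def bdry_def by measurable
  then have "(\<lambda>p. \<integral>z. shifted (bdry (fst p)) (f (fst p)) (snd p) z \<partial>\<zeta>) \<in> borel_measurable (borel \<Otimes>\<^sub>M borel)"
    by (intro zeta.borel_measurable_lebesgue_integral) (simp add: case_prod_unfold)
  then show ?thesis by (simp add: jump_def case_prod_unfold)
qed

lemma gain_joint_measurable:
  assumes "regular_family f"
  shows "(\<lambda>(s, x). gain (bdry s) (f s) x) \<in> borel_measurable (borel \<Otimes>\<^sub>M borel)"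
proof -
  have "(\<lambda>(s, x). f s x) \<in> borel_measurable (borel \<Otimes>\<^sub>M borel)" using assms by (simp add: regular_family_def)
  with jump_joint_measurable[OF assms] show ?thesis
    unfolding gain_def case_prod_unfold by measurable
qed

lemma gain_measurable:
  assumes "regular_family f"
  shows "(\<lambda>s. gain (bdry s) (f s) x) \<in> borel_measurable borel"
proof -
  have "(\<lambda>s. (s, x)) \<in> borel \<rightarrow>\<^sub>M borel \<Otimes>\<^sub>M borel" by measurable
  from measurable_compose[OF this gain_joint_measurable[OF assms]] show ?thesis by simp
qed

text \<open>Integrating factor and domain of integration in one kernel, so that every time integral
  is a Lebesgue integral over the line.\<close>

definition weight :: "real \<Rightarrow> real \<Rightarrow> real" where
  "weight t s = indicator {0..t} s * exp (rate * s)"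

lemma weight_measurable2 [measurable]:
  assumes [measurable]: "f \<in> borel_measurable M" "g \<in> borel_measurable M"
  shows "(\<lambda>p. weight (f p) (g p)) \<in> borel_measurable M"
proof -
  have "(\<lambda>p. weight (f p) (g p)) = (\<lambda>p. if 0 \<le> g p \<and> g p \<le> f p then exp (rate * g p) else 0)"
    by (auto simp: weight_def fun_eq_iff)
  then show ?thesis by simp
qed

lemma weight_nonneg: "0 \<le> weight t s" by (simp add: weight_def)

lemma weight_measurable [measurable]: "weight t \<in> borel_measurable borel"
  by measurable

lemma integral_weight:
  assumes "0 \<le> t"
  shows "integrable lborel (weight t)" "(\<integral>s. rate * weight t s \<partial>lborel) = exp (rate * t) - 1"
proof -
  have d: "((\<lambda>s. exp (rate * s)) has_real_derivative rate * exp (rate * s)) (at s)" for s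
    by (auto intro!: derivative_eq_intros)
  have "has_bochner_integral lborel (\<lambda>s. (rate * exp (rate * s)) * indicator {0..t} s) (exp (rate * t) - exp (rate * 0))"
    using assms d by (intro has_bochner_integral_FTC_Icc_real) (auto intro!: continuous_intros)
  then have h: "has_bochner_integral lborel (\<lambda>s. rate * weight t s) (exp (rate * t) - 1)"
    by (simp add: weight_def mult_ac)
  then show "(\<integral>s. rate * weight t s \<partial>lborel) = exp (rate * t) - 1"
    by (rule has_bochner_integral_integral_eq)
  show "integrable lborel (weight t)"
    using integrable.intros[OF h] rate_pos by simp
qed

text \<open>The variation of constants formula. Through \<open>max 0 t\<close> negative times repeat
  the value at time 0, as \<open>regular_family\<close> speaks of all times.\<close>

definition picard :: "(real \<Rightarrow> real) \<Rightarrow> (real \<Rightarrow> real \<Rightarrow> real) \<Rightarrow> real \<Rightarrow> real \<Rightarrow> real" where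
  "picard f0 f t x = exp (- rate * max 0 t) *
     (f0 x + (\<integral>s. weight (max 0 t) s * gain (bdry s) (f s) x \<partial>lborel))"

lemma integrable_weight_gain:
  assumes "regular_family f" "0 \<le> t"
  shows "integrable lborel (\<lambda>s. weight t s * gain (bdry s) (f s) x)"
proof (rule Bochner_Integration.integrable_bound)
  show "integrable lborel (\<lambda>s. (lam + 1) * weight t s)" using integral_weight[OF assms(2)] by simp
  show "(\<lambda>s. weight t s * gain (bdry s) (f s) x) \<in> borel_measurable lborel"
    using gain_measurable[OF assms(1)] by simp
  have "\<bar>weight t s * gain (bdry s) (f s) x\<bar> \<le> \<bar>(lam + 1) * weight t s\<bar>" for s
  proof -
    have "\<bar>gain (bdry s) (f s) x\<bar> \<le> lam + 1" using assms(1) by (auto simp: regular_family_def intro: gain_bounds)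
    then have "weight t s * \<bar>gain (bdry s) (f s) x\<bar> \<le> weight t s * (lam + 1)"
      using weight_nonneg by (rule mult_left_mono)
    then show ?thesis using lam weight_nonneg[of t s] by (simp add: abs_mult mult.commute)
  qed
  then show "AE s in lborel. norm (weight t s * gain (bdry s) (f s) x) \<le> norm ((lam + 1) * weight t s)" by simp
qed

lemma regular_family_picard:
  assumes f0: "regular f0" and f: "regular_family f"
  shows "regular_family (picard f0 f)"
proof -
  have fs: "regular (f s)" for s using f by (simp add: regular_family_def)
  have "regular (picard f0 f t)" for t
    unfolding regular_def
  proof (intro conjI allI)
    let ?t = "max 0 t"
    let ?I = "\<lambda>x. \<integral>s. weight ?t s * gain (bdry s) (f s) x \<partial>lborel"
    have mono: "?I x \<le> ?I y" if "x \<le> y" for x y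
      using that by (intro integral_mono integrable_weight_gain f mult_left_mono gain_mono_x fs weight_nonneg) auto
    show "mono (picard f0 f t)"
      using mono regularD(1)[OF f0] unfolding picard_def
      by (intro monoI mult_left_mono add_mono) (auto simp: mono_def)
    fix x
    have "0 \<le> ?I x" by (intro integral_nonneg_AE AE_I2 mult_nonneg_nonneg weight_nonneg gain_bounds fs)
    then show "0 \<le> picard f0 f t x" using regularD(2)[OF f0] by (simp add: picard_def)
    \<comment> \<open>The gain is at most \<open>rate\<close>, so the initial value 1 together with
      the integral stays below \<open>exp (rate * t)\<close>, which the prefactor cancels.\<close>
    have "?I x \<le> (\<integral>s. rate * weight ?t s \<partial>lborel)"
    proof (rule integral_mono)
      show "integrable lborel (\<lambda>s. weight ?t s * gain (bdry s) (f s) x)" by (rule integrable_weight_gain[OF f]) simp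
      show "integrable lborel (\<lambda>s. rate * weight ?t s)" using integral_weight(1)[of ?t] by simp
      show "weight ?t s * gain (bdry s) (f s) x \<le> rate * weight ?t s" for s
        using mult_left_mono[OF gain_bounds(2)[OF fs] weight_nonneg] by (simp add: rate_def mult.commute)
    qed
    also have "\<dots> = exp (rate * ?t) - 1" by (rule integral_weight) simp
    finally have "f0 x + ?I x \<le> exp (rate * ?t)" using regularD(3)[OF f0, of x] by simp
    then have "picard f0 f t x \<le> exp (- rate * ?t) * exp (rate * ?t)"
      unfolding picard_def by (intro mult_left_mono) auto
    then show "picard f0 f t x \<le> 1" by (simp add: exp_minus_inverse mult_exp_exp)
    show "continuous (at_right x) (picard f0 f t)"
    proof -
      have "(?I \<longlongrightarrow> ?I x) (at_right x)"
      proof (rule dominated_convergence_within[where B="\<lambda>s. rate * weight ?t s"])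
        show "integrable lborel (\<lambda>s. rate * weight ?t s)" using integral_weight(1)[of ?t] by simp
        show "((\<lambda>x. weight ?t s * gain (bdry s) (f s) x) \<longlongrightarrow> weight ?t s * gain (bdry s) (f s) x) (at_right x)" for s
          using gain_right_continuous[OF fs] by (intro tendsto_intros) (auto simp: continuous_within)
        show "\<bar>weight ?t s * gain (bdry s) (f s) x\<bar> \<le> rate * weight ?t s" for s x
          using mult_left_mono[OF gain_bounds(3)[OF fs] weight_nonneg] weight_nonneg[of ?t s]
          by (simp add: abs_mult rate_def mult.commute)
      qed (use gain_measurable[OF f] in auto)
      then show ?thesis
        using regularD(4)[OF f0, of x] unfolding picard_def continuous_within by (intro tendsto_intros)
    qed
  qed
  moreover have "(\<lambda>(t, x). picard f0 f t x) \<in> borel_measurable (borel \<Otimes>\<^sub>M borel)"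
  proof -
    have "(\<lambda>p. gain (bdry (snd p)) (f (snd p)) (snd (fst p))) \<in> borel_measurable ((borel \<Otimes>\<^sub>M borel) \<Otimes>\<^sub>M lborel)"
    proof -
      have "(\<lambda>p. (snd p, snd (fst p))) \<in> (borel \<Otimes>\<^sub>M borel) \<Otimes>\<^sub>M lborel \<rightarrow>\<^sub>M borel \<Otimes>\<^sub>M borel" by measurable
      from measurable_compose[OF this gain_joint_measurable[OF f]] show ?thesis by simp
    qed
    then have "(\<lambda>p. weight (max 0 (fst (fst p))) (snd p) * gain (bdry (snd p)) (f (snd p)) (snd (fst p)))
        \<in> borel_measurable ((borel \<Otimes>\<^sub>M borel) \<Otimes>\<^sub>M lborel)"
      by measurable
    then have "(\<lambda>p. \<integral>s. weight (max 0 (fst p)) s * gain (bdry s) (f s) (snd p) \<partial>lborel) \<in> borel_measurable (borel \<Otimes>\<^sub>M borel)"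
      by (intro lborel.borel_measurable_lebesgue_integral) (simp add: case_prod_unfold)
    with regular_measurable[OF f0] show ?thesis unfolding picard_def case_prod_unfold by measurable
  qed
  ultimately show ?thesis by (simp add: regular_family_def)
qed

lemma picard_mono:
  assumes f: "regular_family f" and g: "regular_family g" and le: "\<And>s x. f s x \<le> g s x"
  shows "picard f0 f t x \<le> picard f0 g t x"
  unfolding picard_def
proof (intro mult_left_mono add_left_mono)
  have r: "regular (f s)" "regular (g s)" for s using f g by (auto simp: regular_family_def)
  show "(\<integral>s. weight (max 0 t) s * gain (bdry s) (f s) x \<partial>lborel) \<le> (\<integral>s. weight (max 0 t) s * gain (bdry s) (g s) x \<partial>lborel)"
    by (intro integral_mono integrable_weight_gain f g mult_left_mono gain_mono r le weight_nonneg) auto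
qed auto

text \<open>The iteration starts at the largest regular function. As \<open>picard\<close> is
  monotone, the iterates decrease, so that they converge pointwise without any contraction
  estimate.\<close>

primrec iter :: "(real \<Rightarrow> real) \<Rightarrow> nat \<Rightarrow> real \<Rightarrow> real \<Rightarrow> real" where
  "iter f0 0 = (\<lambda>t x. 1)"
| "iter f0 (Suc m) = picard f0 (iter f0 m)"

context
  fixes f0 :: "real \<Rightarrow> real"
  assumes f0: "regular f0"
begin

lemma regular_family_iter: "regular_family (iter f0 m)"
proof (induction m)
  case 0
  show ?case by (auto simp: regular_family_def regular_def mono_def)
next
  case (Suc m)
  then show ?case by (simp add: regular_family_picard[OF f0])
qed

lemma regular_iter: "regular (iter f0 m t)"
  using regular_family_iter[of m] by (simp add: regular_family_def)

lemma iter_decreasing: "iter f0 (Suc m) t x \<le> iter f0 m t x"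
proof (induction m arbitrary: t x)
  case 0
  show ?case using regularD(3)[OF regular_iter[of "Suc 0" t], of x] by simp
next
  case (Suc m)
  then show ?case
    using picard_mono[OF regular_family_iter[of "Suc m"] regular_family_iter[of m]] by simp
qed

definition sol :: "real \<Rightarrow> real \<Rightarrow> real" where "sol t x = lim (\<lambda>m. iter f0 m t x)"

lemma iter_tendsto: "(\<lambda>m. iter f0 m t x) \<longlonglongrightarrow> sol t x"
proof -
  have "decseq (\<lambda>m. iter f0 m t x)" using iter_decreasing by (auto simp: decseq_Suc_iff)
  then have "convergent (\<lambda>m. iter f0 m t x)"
    using decseq_convergent[of "\<lambda>m. iter f0 m t x" 0] regularD(2)[OF regular_iter]
    unfolding convergent_def by metis
  then show ?thesis unfolding sol_def by (simp add: convergent_LIMSEQ_iff)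
qed

lemma sol_le_iter: "sol t x \<le> iter f0 m t x"
  using iter_decreasing by (intro decseq_ge[OF _ iter_tendsto]) (auto simp: decseq_Suc_iff)

lemma regular_family_sol: "regular_family sol"
  unfolding regular_family_def
proof (intro conjI allI)
  fix t
  have mono: "sol t x \<le> sol t y" if "x \<le> y" for x y
    using regularD(1)[OF regular_iter] that
    by (intro LIMSEQ_le[OF iter_tendsto iter_tendsto]) (auto simp: mono_def)
  have "0 \<le> sol t x" "sol t x \<le> 1" for x
    using regularD(2,3)[OF regular_iter]
    by (auto intro!: LIMSEQ_le_const[OF iter_tendsto] LIMSEQ_le_const2[OF iter_tendsto])
  \<comment> \<open>A decreasing limit of right-continuous nondecreasing functions is
    right-continuous: an iterate that is close to the limit at x bounds it from above to the right
    of x, and monotonicity bounds it from below.\<close>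
  moreover have "continuous (at_right x) (sol t)" for x
    unfolding continuous_within
  proof (rule tendstoI)
    fix e :: real assume e: "0 < e"
    have "\<forall>\<^sub>F m in sequentially. dist (iter f0 m t x) (sol t x) < e / 2"
      using iter_tendsto e by (intro tendstoD) auto
    then obtain m where m: "dist (iter f0 m t x) (sol t x) < e / 2" by (auto simp: eventually_sequentially)
    have "(iter f0 m t \<longlongrightarrow> iter f0 m t x) (at_right x)"
      using regularD(4)[OF regular_iter] by (simp add: continuous_within)
    then have "\<forall>\<^sub>F y in at_right x. dist (iter f0 m t y) (iter f0 m t x) < e / 2"
      using e by (intro tendstoD) auto
    then show "\<forall>\<^sub>F y in at_right x. dist (sol t y) (sol t x) < e"
      using eventually_at_right_less[of x]
    proof eventually_elim
      case (elim y)
      have "sol t y \<le> iter f0 m t y" by (rule sol_le_iter)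
      moreover have "sol t x \<le> sol t y" using mono elim by simp
      ultimately show ?case using m elim(1) unfolding dist_real_def by linarith
    qed
  qed
  ultimately show "regular (sol t)" using mono by (auto simp: regular_def mono_def)
next
  show "(\<lambda>(s, x). sol s x) \<in> borel_measurable (borel \<Otimes>\<^sub>M borel)"
  proof (rule borel_measurable_LIMSEQ_real)
    show "(\<lambda>m. case p of (s, x) \<Rightarrow> iter f0 m s x) \<longlonglongrightarrow> (case p of (s, x) \<Rightarrow> sol s x)" for p
      using iter_tendsto by (cases p) simp
    show "(\<lambda>(s, x). iter f0 m s x) \<in> borel_measurable (borel \<Otimes>\<^sub>M borel)" for m
      using regular_family_iter by (simp add: regular_family_def)
  qed
qed

lemma regular_sol: "regular (sol t)"
  using regular_family_sol by (simp add: regular_family_def)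

lemma gain_iter_tendsto: "(\<lambda>m. gain A (iter f0 m s) x) \<longlonglongrightarrow> gain A (sol s) x"
  unfolding gain_def jump_def
proof (intro tendsto_intros iter_tendsto)
  show "(\<lambda>m. \<integral>z. shifted A (iter f0 m s) x z \<partial>\<zeta>) \<longlonglongrightarrow> (\<integral>z. shifted A (sol s) x z \<partial>\<zeta>)"
  proof (rule integral_dominated_convergence[where w="\<lambda>_. 1"])
    show "AE z in \<zeta>. (\<lambda>m. shifted A (iter f0 m s) x z) \<longlonglongrightarrow> shifted A (sol s) x z"
      using iter_tendsto by (auto simp: shifted_def)
  qed (use shifted_bounds[OF regular_iter] regular_measurable[OF regular_sol] regular_measurable[OF regular_iter] in auto)
qed

text \<open>Dominated convergence, once over the jump size and once over time, lets both sides of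
  the recursion pass to the limit.\<close>

lemma picard_sol: "picard f0 sol t x = sol t x"
proof -
  have "(\<lambda>m. picard f0 (iter f0 m) t x) \<longlonglongrightarrow> picard f0 sol t x"
    unfolding picard_def
  proof (intro tendsto_intros)
    let ?t = "max 0 t"
    show "(\<lambda>m. \<integral>s. weight ?t s * gain (bdry s) (iter f0 m s) x \<partial>lborel)
       \<longlonglongrightarrow> (\<integral>s. weight ?t s * gain (bdry s) (sol s) x \<partial>lborel)"
    proof (rule integral_dominated_convergence[where w="\<lambda>s. rate * weight ?t s"])
      show "integrable lborel (\<lambda>s. rate * weight ?t s)" using integral_weight(1)[of ?t] by simp
      show "AE s in lborel. (\<lambda>m. weight ?t s * gain (bdry s) (iter f0 m s) x) \<longlonglongrightarrow> weight ?t s * gain (bdry s) (sol s) x"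
        by (intro AE_I2 tendsto_intros gain_iter_tendsto)
      show "AE s in lborel. norm (weight ?t s * gain (bdry s) (iter f0 m s) x) \<le> rate * weight ?t s" for m
        using mult_left_mono[OF gain_bounds(3)[OF regular_iter] weight_nonneg] weight_nonneg[of ?t]
        by (simp add: abs_mult rate_def mult.commute)
    qed (use gain_measurable[OF regular_family_sol] gain_measurable[OF regular_family_iter] in auto)
  qed
  moreover have "(\<lambda>m. picard f0 (iter f0 m) t x) \<longlonglongrightarrow> sol t x"
    using LIMSEQ_Suc[OF iter_tendsto[of t x]] by simp
  ultimately show ?thesis by (rule LIMSEQ_unique)
qed

end

end

section \<open>Mild solutions: stability, time derivative, monotonicity\<close>

lemma real_distribution_cdfs:
  assumes "F \<in> cdfs" shows "real_distribution (interval_measure F)"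
  using cdfsD[OF assms] by (intro real_distribution_interval_measure) (auto simp: mono_def)

lemma measure_cdfs_Iic:
  assumes "F \<in> cdfs" shows "measure (interval_measure F) {..x} = F x"
  using cdfsD[OF assms] by (intro measure_interval_measure_Iic) (auto simp: mono_def)

context moving_boundary
begin

lemma cdfs_regular: "F \<in> cdfs \<Longrightarrow> regular F"
  using cdfs_nonneg cdfs_le_1 by (auto simp: cdfs_def regular_def)

text \<open>The fixed point equation of \<open>picard\<close> as a gauge integral, for which
  \<open>has_integral\<close> already contains integrability. This makes it reachable from a
  mean-field model, about whose measurability in time nothing is known beforehand.\<close>

definition mild :: "(real \<Rightarrow> real \<Rightarrow> real) \<Rightarrow> bool" where
  "mild f \<longleftrightarrow> (\<forall>t\<ge>0. f t \<in> cdfs) \<and> (\<forall>x. rate-lipschitz_on {0..} (\<lambda>t. f t x)) \<and>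
     (\<forall>t\<ge>0. \<forall>x. ((\<lambda>s. exp (rate * s) * gain (bdry s) (f s) x) has_integral
        (exp (rate * t) * f t x - f 0 x)) {0..t})"

lemma mildD:
  assumes "mild f"
  shows "0 \<le> t \<Longrightarrow> f t \<in> cdfs" "rate-lipschitz_on {0..} (\<lambda>t. f t x)"
    "0 \<le> t \<Longrightarrow> ((\<lambda>s. exp (rate * s) * gain (bdry s) (f s) x) has_integral
        (exp (rate * t) * f t x - f 0 x)) {0..t}"
  using assms by (auto simp: mild_def)

lemma mild_diff_le:
  assumes "mild f" "0 \<le> s" "0 \<le> t" shows "\<bar>f t x - f s x\<bar> \<le> rate * \<bar>t - s\<bar>"
  using lipschitz_onD[OF mildD(2)[OF assms(1)], of t s x] assms(2,3) by (simp add: dist_real_def)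

text \<open>Gronwall for the supremum over x of the positive part of
  \<open>f t x - g t (x + e)\<close>. With \<open>e = 0\<close> it gives uniqueness; with
  \<open>a = e\<close> it bounds the growth of the Levy distance.\<close>

lemma mild_shift_comparison:
  assumes f: "mild f" and g: "mild g" and a: "0 \<le> a" and e: "0 \<le> e"
    and init: "\<And>x. f 0 x \<le> g 0 (x + e) + a" and t: "0 \<le> t"
  shows "f t x \<le> g t (x + e) + a * exp t"
proof -
  define p where "p t x = max 0 (f t x - g t (x + e))" for t x
  define w where "w t = (SUP x. p t x)" for t
  have rf: "regular (f s)" and rg: "regular (g s)" if "0 \<le> s" for s
    using mildD(1)[OF f that] mildD(1)[OF g that] cdfs_regular by auto
  have p01: "0 \<le> p s x" "p s x \<le> 1" if "0 \<le> s" for s x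
    using regularD(2,3)[OF rf[OF that]] regularD(2,3)[OF rg[OF that]] by (auto simp: p_def intro: order_trans) (smt (verit))
  have bdd: "bdd_above (range (p s))" if "0 \<le> s" for s
    using p01[OF that] by (intro bdd_aboveI[of _ 1]) auto
  have pw: "p s x \<le> w s" if "0 \<le> s" for s x
    unfolding w_def using bdd[OF that] by (intro cSUP_upper) auto
  have w01: "0 \<le> w s" "w s \<le> 1" if "0 \<le> s" for s
    using pw[OF that, of 0] p01[OF that] by (auto intro!: cSUP_least simp: w_def intro: order_trans)
  have plip: "p s x \<le> p r x + 2 * rate * \<bar>s - r\<bar>" if "0 \<le> s" "0 \<le> r" for s r x
    using mild_diff_le[OF f that(2,1), of x] mild_diff_le[OF g that(2,1), of "x + e"] by (auto simp: p_def)
  have wle: "w s \<le> w r + 2 * rate * \<bar>s - r\<bar>" if "0 \<le> s" "0 \<le> r" for s r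
    unfolding w_def[of s]
  proof (rule cSUP_least)
    fix x show "p s x \<le> w r + 2 * rate * \<bar>s - r\<bar>" using plip[OF that, of x] pw[OF that(2), of x] by simp
  qed simp
  \<comment> \<open>The Lipschitz bound in time is uniform in x, so it survives the supremum and
    makes it integrable.\<close>
  have wcont: "continuous_on {0..} w"
  proof (rule lipschitz_on_continuous_on[where L="2 * rate"], rule lipschitz_onI)
    fix s r :: real assume "s \<in> {0..}" "r \<in> {0..}"
    then show "dist (w s) (w r) \<le> 2 * rate * dist s r"
      using wle[of s r] wle[of r s] by (auto simp: dist_real_def abs_minus_commute)
  qed (use rate_pos in simp)
  define W where "W s = exp (rate * s) * w s" for s
  have Wcont: "continuous_on {0..} W" unfolding W_def using wcont by (intro continuous_intros)
  have Wint: "W integrable_on {0..s}" for s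
    using Wcont continuous_on_subset by (intro integrable_continuous_interval) fastforce
  have gain_diff: "gain A (f s) x - gain A (g s) (x + e) \<le> (rate + 1) * w s" if s: "0 \<le> s" for A s x
  proof -
    have "shifted A (f s) x z - shifted A (g s) (x + e) z \<le> w s" for z
    proof -
      \<comment> \<open>If the first cutoff \<open>A \<le> x - z\<close> holds, so does
        \<open>A \<le> x + e - z\<close>: a shift to the right never removes the second term alone.
        If the first cutoff fails, the difference is nonpositive.\<close>
      have "shifted A (f s) x z - shifted A (g s) (x + e) z \<le> p s (x - z)"
        using regularD(2)[OF rg[OF s], of "x + e - z"] e
        by (auto simp: shifted_def p_def algebra_simps)
      then show ?thesis using pw[OF s, of "x - z"] by simp
    qed
    then have "(\<integral>z. shifted A (f s) x z - shifted A (g s) (x + e) z \<partial>\<zeta>) \<le> (\<integral>z. w s \<partial>\<zeta>)"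
      by (intro integral_mono Bochner_Integration.integrable_diff integrable_shifted rf rg s) auto
    then have j: "jump A (f s) x - jump A (g s) (x + e) \<le> w s"
      using zeta.prob_space unfolding jump_def
      by (subst (asm) Bochner_Integration.integral_diff) (auto intro: integrable_shifted rf rg s)
    have "(f s x)\<^sup>2 - (g s (x + e))\<^sup>2 = (f s x + g s (x + e)) * (f s x - g s (x + e))"
      by (simp add: power2_eq_square algebra_simps)
    also have "\<dots> \<le> (f s x + g s (x + e)) * w s"
      using pw[OF s, of x] regularD(2)[OF rf[OF s]] regularD(2)[OF rg[OF s]]
      by (intro mult_left_mono) (auto simp: p_def)
    also have "\<dots> \<le> 2 * w s"
      using regularD(3)[OF rf[OF s], of x] regularD(3)[OF rg[OF s], of "x + e"] w01[OF s]
      by (intro mult_right_mono) auto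
    finally have "(f s x)\<^sup>2 - (g s (x + e))\<^sup>2 \<le> 2 * w s" .
    moreover have "lam * (jump A (f s) x - jump A (g s) (x + e)) \<le> lam * w s"
      using j lam by (rule mult_left_mono)
    ultimately show ?thesis by (simp add: gain_def rate_def algebra_simps)
  qed
  have main: "W s \<le> a + (rate + 1) * integral {0..s} W" if s: "0 \<le> s" for s
  proof -
    have "exp (rate * s) * p s x \<le> a + (rate + 1) * integral {0..s} W" for x
    proof -
      have I: "((\<lambda>u. exp (rate * u) * gain (bdry u) (f u) x - exp (rate * u) * gain (bdry u) (g u) (x + e)) has_integral
         (exp (rate * s) * f s x - f 0 x - (exp (rate * s) * g s (x + e) - g 0 (x + e)))) {0..s}"
        using mildD(3)[OF f s] mildD(3)[OF g s] by (rule has_integral_diff)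
      have J: "((\<lambda>u. (rate + 1) * W u) has_integral ((rate + 1) * integral {0..s} W)) {0..s}"
        using Wint by (intro has_integral_mult_right integrable_integral)
      have "exp (rate * s) * f s x - f 0 x - (exp (rate * s) * g s (x + e) - g 0 (x + e)) \<le> (rate + 1) * integral {0..s} W"
      proof (rule has_integral_le[OF I J])
        fix u assume "u \<in> {0..s}"
        then have "exp (rate * u) * (gain (bdry u) (f u) x - gain (bdry u) (g u) (x + e)) \<le> exp (rate * u) * ((rate + 1) * w u)"
          using gain_diff[of u] by (intro mult_left_mono) auto
        then show "exp (rate * u) * gain (bdry u) (f u) x - exp (rate * u) * gain (bdry u) (g u) (x + e) \<le> (rate + 1) * W u"
          by (simp add: W_def algebra_simps)
      qed
      then have "exp (rate * s) * (f s x - g s (x + e)) \<le> a + (rate + 1) * integral {0..s} W"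
        using init[of x] by (simp add: algebra_simps)
      moreover have "0 \<le> integral {0..s} W"
        using w01 by (intro integral_nonneg Wint) (auto simp: W_def)
      then have "0 \<le> a + (rate + 1) * integral {0..s} W" using a rate_pos by simp
      ultimately show ?thesis by (auto simp: p_def max_def)
    qed
    then have "p s x \<le> exp (- rate * s) * (a + (rate + 1) * integral {0..s} W)" for x
      by (simp add: exp_minus field_simps)
    then have "w s \<le> exp (- rate * s) * (a + (rate + 1) * integral {0..s} W)"
      unfolding w_def by (intro cSUP_least) auto
    then show ?thesis by (simp add: W_def exp_minus field_simps)
  qed
  \<comment> \<open>The exponent \<open>rate + 1 = lam + 2\<close> collects \<open>lam\<close> from
    the jumps and 2 from the square; dividing by \<open>exp (rate * t)\<close> leaves
    \<open>exp t\<close>.\<close>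
  have "W t \<le> a * exp ((rate + 1) * t)"
  proof (rule gronwall_integral[where T=t and B="exp (rate * t)"])
    fix s assume s: "0 \<le> s" "s \<le> t"
    have "exp (rate * s) * w s \<le> exp (rate * t) * 1"
      using s w01[OF s(1)] rate_pos by (intro mult_mono) auto
    then show "W s \<le> exp (rate * t)" by (simp add: W_def)
  qed (use main Wint rate_pos t in auto)
  then have "exp (rate * t) * w t \<le> exp (rate * t) * (a * exp t)"
    by (simp add: W_def algebra_simps exp_add)
  then have "w t \<le> a * exp t" by simp
  with pw[OF t, of x] show ?thesis by (auto simp: p_def)
qed

lemma mild_unique:
  assumes "mild f" "mild g" "f 0 = g 0" "0 \<le> t" shows "f t = g t"
proof
  fix x show "f t x = g t x"
    using mild_shift_comparison[OF assms(1,2), of 0 0 t x] mild_shift_comparison[OF assms(2,1), of 0 0 t x] assms(3,4)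
    by simp
qed

text \<open>Before time t the boundary is further left, so the cutoff
  \<open>bdry s \<le> x - z\<close> is continuous from the left at t for every z. Continuity from
  the right fails at t when \<open>\<zeta>\<close> has an atom at \<open>x - bdry t\<close> and
  \<open>f t\<close> is positive at the boundary.\<close>

lemma mild_left_continuous:
  assumes f: "\<And>s. 0 \<le> s \<Longrightarrow> f s \<in> cdfs" and lip: "\<And>x. L-lipschitz_on {0..} (\<lambda>t. f t x)" and t: "0 < t"
  shows "((\<lambda>s. gain (bdry s) (f s) x) \<longlongrightarrow> gain (bdry t) (f t) x) (at t within {0..t})"
proof -
  have c: "((\<lambda>s. f s y) \<longlongrightarrow> f t y) (at t within {0..t})" for y
    using lipschitz_on_continuous_on[OF lip[of y]] t
    by (meson atLeastAtMost_iff atLeast_iff continuous_on continuous_on_subset less_imp_le order_refl subsetI)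
  have r: "regular (f s)" if "0 \<le> s" for s using f[OF that] by (rule cdfs_regular)
  \<comment> \<open>Constant extension to negative times, since the convergence theorem asks for
    measurability and a bound at every time.\<close>
  define h where "h s = (if 0 \<le> s then f s else f 0)" for s
  have rh: "regular (h s)" for s using r by (simp add: h_def)
  have sh: "((\<lambda>s. shifted (bdry s) (h s) x z) \<longlongrightarrow> shifted (bdry t) (h t) x z) (at t within {0..t})" for z
  proof (cases "bdry t \<le> x - z")
    case True
    have ev: "\<forall>\<^sub>F s in at t within {0..t}. f s (x - z) = shifted (bdry s) (h s) x z"
    proof -
      have "f s (x - z) = shifted (bdry s) (h s) x z" if "s \<in> {0..t}" for s
      proof -
        have "v * s \<le> v * t" using that v by simp
        then show ?thesis using True that by (auto simp: shifted_def bdry_def h_def)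
      qed
      then show ?thesis by (auto simp: eventually_at_filter)
    qed
    show ?thesis using Lim_transform_eventually[OF c ev] True t by (simp add: shifted_def h_def)
  next
    case False
    \<comment> \<open>The time the boundary needs to travel from \<open>x - z\<close> to its
      position at t; for less than this time before t it was already beyond
      \<open>x - z\<close>.\<close>
    define d where "d = (bdry t - (x - z)) / v"
    have d: "d > 0" using False v by (simp add: d_def)
    have "\<forall>\<^sub>F s in at t within {0..t}. dist s t < d" using d by (auto simp: eventually_at)
    then have ev: "\<forall>\<^sub>F s in at t within {0..t}. 0 = shifted (bdry s) (h s) x z"
    proof eventually_elim
      case (elim s)
      then have "v * (t - s) < v * d" using v by (auto simp: dist_real_def)
      moreover have "v * d = bdry t - (x - z)" using v by (simp add: d_def)
      ultimately have "x - z < bdry s" by (simp add: bdry_def algebra_simps)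
      then show ?case by (simp add: shifted_def)
    qed
    show ?thesis using Lim_transform_eventually[OF tendsto_const ev] False by (simp add: shifted_def)
  qed
  have "((\<lambda>s. jump (bdry s) (h s) x) \<longlongrightarrow> jump (bdry t) (h t) x) (at t within {0..t})"
    unfolding jump_def
    by (rule dominated_convergence_within[where B="\<lambda>_. 1"])
      (use sh shifted_bounds[OF rh] regular_measurable[OF rh] in auto)
  moreover have "\<forall>\<^sub>F s in at t within {0..t}. jump (bdry s) (h s) x = jump (bdry s) (f s) x"
    by (auto simp: eventually_at_filter h_def)
  ultimately have "((\<lambda>s. jump (bdry s) (f s) x) \<longlongrightarrow> jump (bdry t) (f t) x) (at t within {0..t})"
    using Lim_transform_eventually t by (fastforce simp: h_def)
  then show ?thesis unfolding gain_def using c by (intro tendsto_intros)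
qed

text \<open>The fundamental theorem at the endpoint t, where left continuity of the integrand
  suffices, followed by removal of the integrating factor.\<close>

lemma mild_left_derivative:
  assumes "mild f" "0 < t"
  shows "((\<lambda>s. f s x) has_real_derivative (gain (bdry t) (f t) x - rate * f t x)) (at t within {0..t})"
proof -
  define I where "I s = exp (rate * s) * f s x - f 0 x" for s
  let ?k = "\<lambda>s. exp (rate * s) * gain (bdry s) (f s) x"
  have k: "?k integrable_on {0..t}" "\<And>s. 0 \<le> s \<Longrightarrow> integral {0..s} ?k = I s"
    using has_integral_integrable[OF mildD(3)[OF assms(1)]] integral_unique[OF mildD(3)[OF assms(1)]] assms(2)
    by (auto simp: I_def)
  have "continuous (at t within {0..t} - {}) ?k"
    using mild_left_continuous[OF mildD(1)[OF assms(1)] mildD(2)[OF assms(1)] assms(2), of x]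
    unfolding continuous_within by (auto intro!: tendsto_intros)
  then have "((\<lambda>u. integral {0..u} ?k) has_vector_derivative ?k t) (at t within {0..t} - {})"
    using integral_has_vector_derivative_continuous_at[OF k(1), of t "{}"] assms(2) by simp
  then have "((\<lambda>u. integral {0..u} ?k) has_real_derivative ?k t) (at t within {0..t})"
    by (simp add: has_real_derivative_iff_has_vector_derivative)
  then have "(I has_real_derivative ?k t) (at t within {0..t})"
    by (rule has_field_derivative_transform_within[of _ _ _ _ 1]) (use k(2) assms(2) in auto)
  then have "((\<lambda>s. exp (- rate * s) * (I s + f 0 x)) has_real_derivative
      (- rate * exp (- rate * t) * (I t + f 0 x) + exp (- rate * t) * ?k t)) (at t within {0..t})"
    by (auto intro!: derivative_eq_intros)
  moreover have "exp (- rate * s) * (I s + f 0 x) = f s x" for s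
    by (simp add: I_def exp_minus field_simps)
  moreover have "- rate * exp (- rate * t) * (I t + f 0 x) + exp (- rate * t) * ?k t = gain (bdry t) (f t) x - rate * f t x"
    by (simp add: I_def exp_minus field_simps)
  ultimately show ?thesis by simp
qed

text \<open>Wherever the two-sided derivative in time exists it equals the left derivative just
  computed, and a Lipschitz function is the integral of any such function. This removes the
  integrating factor without differentiating at the exceptional times.\<close>

lemma mild_integral_equation:
  assumes "mild f" "0 \<le> t"
  shows "((\<lambda>s. gain (bdry s) (f s) x - rate * f s x) has_integral (f t x - f 0 x)) {0..t}"
proof (cases "t = 0")
  case False
  then have t: "0 < t" using assms(2) by simp
  show ?thesis
  proof (rule lipschitz_has_integral_derivative[OF _ t])
    show "rate-lipschitz_on {0..t} (\<lambda>s. f s x)"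
      by (rule lipschitz_on_subset[OF mildD(2)[OF assms(1)]]) auto
    fix s d assume s: "0 < s" "s < t" and d: "((\<lambda>s. f s x) has_real_derivative d) (at s)"
    have "((\<lambda>s. f s x) has_real_derivative d) (at s within {0..s})" using d by (rule has_field_derivative_at_within)
    moreover have "at s within {0..s} \<noteq> bot" using s by (simp add: trivial_limit_within islimpt_Icc)
    ultimately show "d = gain (bdry s) (f s) x - rate * f s x"
      using mild_left_derivative[OF assms(1) s(1)] unfolding has_field_derivative_iff
      by (meson tendsto_unique)
  qed
next
  case True
  then show ?thesis using has_integral_null_real[of 0 0] by simp
qed

lemma jump_le:
  assumes "regular F" and pos: "AE z in \<zeta>. z > 0" shows "jump A F x \<le> F x"
proof -
  have "jump A F x \<le> (\<integral>z. F x \<partial>\<zeta>)"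
    unfolding jump_def
  proof (rule integral_mono_AE[OF integrable_shifted[OF assms(1)]])
    show "AE z in \<zeta>. shifted A F x z \<le> F x"
      using pos by eventually_elim (use regularD(1,2)[OF assms(1)] in \<open>auto simp: shifted_def mono_def\<close>)
  qed simp
  then show ?thesis using zeta.prob_space by simp
qed

text \<open>The integrand is nonpositive: \<open>jump \<le> F\<close> because jumps go forward, and
  \<open>F\<^sup>2 \<le> F\<close>.\<close>

lemma mild_antimono:
  assumes f: "mild f" and pos: "AE z in \<zeta>. z > 0" and "0 \<le> s" "s \<le> t" shows "f t x \<le> f s x"
proof -
  let ?k = "\<lambda>s. gain (bdry s) (f s) x - rate * f s x"
  have "(?k has_integral (f t x - f 0 x - (f s x - f 0 x))) {s..t}"
  proof -
    have a: "(?k has_integral (f s x - f 0 x)) {0..s}" and b: "(?k has_integral (f t x - f 0 x)) {0..t}"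
      using mild_integral_equation[OF f] assms by auto
    have "?k integrable_on {s..t}" using integrable_on_subinterval[OF has_integral_integrable[OF b], of s t] assms by auto
    then obtain j where j: "(?k has_integral j) {s..t}" by blast
    from has_integral_combine[OF assms(3,4) a j] b have "f s x - f 0 x + j = f t x - f 0 x"
      by (rule has_integral_unique)
    then have "j = f t x - f 0 x - (f s x - f 0 x)" by simp
    then show ?thesis using j by simp
  qed
  moreover have "?k u \<le> 0" if "u \<in> {s..t}" for u
  proof -
    have c: "f u \<in> cdfs" using mildD(1)[OF f] that assms(3) by auto
    have "lam * jump (bdry u) (f u) x \<le> lam * f u x"
      using jump_le[OF cdfs_regular[OF c] pos] lam by (rule mult_left_mono)
    moreover have "(f u x)\<^sup>2 \<le> f u x"
      using cdfs_nonneg[OF c, of x] cdfs_le_1[OF c, of x] by (simp add: power2_eq_square mult_left_le)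
    ultimately show ?thesis by (simp add: gain_def rate_def algebra_simps)
  qed
  ultimately have "f t x - f 0 x - (f s x - f 0 x) \<le> 0"
    using has_integral_le[OF _ has_integral_0] by blast
  then show ?thesis by simp
qed

end

section \<open>The Picard limit is a mild solution made of proper distribution functions\<close>

lemma mono_tendsto_SUP_at_top:
  fixes F :: "real \<Rightarrow> real"
  assumes "mono F" "bdd_above (range F)" shows "(F \<longlongrightarrow> (SUP x. F x)) at_top"
proof (rule order_tendstoI)
  fix a assume "a < (SUP x. F x)"
  then obtain x where x: "a < F x" using less_cSUP_iff[OF _ assms(2)] by auto
  show "\<forall>\<^sub>F y in at_top. a < F y"
    using eventually_ge_at_top[of x] by eventually_elim (use x assms(1) in \<open>auto simp: mono_def intro: less_le_trans\<close>)
next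
  fix a assume "(SUP x. F x) < a"
  then show "\<forall>\<^sub>F y in at_top. F y < a"
    using cSUP_upper[OF _ assms(2)] by (intro always_eventually) (auto intro: le_less_trans)
qed

context moving_boundary
begin

lemma sol_mild_eq:
  assumes f0: "regular f0" and t: "0 \<le> t"
  shows "exp (rate * t) * sol f0 t x = f0 x + (\<integral>s. weight t s * gain (bdry s) (sol f0 s) x \<partial>lborel)"
proof -
  have "exp (rate * t) * sol f0 t x = exp (rate * t) * picard f0 (sol f0) t x" by (simp add: picard_sol[OF f0])
  then show ?thesis using t by (simp add: picard_def exp_minus)
qed

lemma sol_zero: assumes "regular f0" shows "sol f0 0 = f0"
proof
  fix x
  have "AE s in lborel. weight 0 s * gain (bdry s) (sol f0 s) x = 0"
    using AE_lborel_singleton[of 0] by eventually_elim (auto simp: weight_def)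
  then have "(\<integral>s. weight 0 s * gain (bdry s) (sol f0 s) x \<partial>lborel) = 0"
    by (rule integral_eq_zero_AE)
  then show "sol f0 0 x = f0 x" using sol_mild_eq[OF assms, of 0 x] by simp
qed

lemma weight_has_integral:
  assumes "integrable lborel (\<lambda>s. weight t s * k s)"
  shows "((\<lambda>s. exp (rate * s) * k s) has_integral (\<integral>s. weight t s * k s \<partial>lborel)) {0..t}"
proof -
  have "((\<lambda>s. weight t s * k s) has_integral (\<integral>s. weight t s * k s \<partial>lborel)) UNIV"
    using assms by (rule has_integral_integral_lborel)
  moreover have "(\<lambda>s. weight t s * k s) = (\<lambda>s. if s \<in> {0..t} then exp (rate * s) * k s else 0)"
    by (auto simp: weight_def fun_eq_iff)
  ultimately show ?thesis by (simp only: has_integral_restrict_UNIV)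
qed

lemma sol_has_integral:
  assumes f0: "regular f0" and t: "0 \<le> t"
  shows "((\<lambda>s. exp (rate * s) * gain (bdry s) (sol f0 s) x) has_integral
        (exp (rate * t) * sol f0 t x - sol f0 0 x)) {0..t}"
  using weight_has_integral[OF integrable_weight_gain[OF regular_family_sol[OF f0] t], of x]
    sol_mild_eq[OF f0 t, of x] sol_zero[OF f0] by simp

text \<open>The value at t consists of the discounted value at s and the discounted gain collected
  in between; both parts are at most what the constant solution 1 would contribute.\<close>

lemma sol_lipschitz:
  assumes f0: "regular f0" shows "rate-lipschitz_on {0..} (\<lambda>t. sol f0 t x)"
proof -
  have step: "\<bar>sol f0 t x - sol f0 s x\<bar> \<le> rate * (t - s)" if st: "0 \<le> s" "s \<le> t" for s t
  proof -
    let ?g = "\<lambda>u. gain (bdry u) (sol f0 u) x"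
    let ?I = "\<lambda>t. \<integral>u. weight t u * ?g u \<partial>lborel"
    have t: "0 \<le> t" using st by simp
    have i: "integrable lborel (\<lambda>u. weight r u * ?g u)" if "0 \<le> r" for r
      by (rule integrable_weight_gain[OF regular_family_sol[OF f0] that])
    have ww: "weight s u \<le> weight t u" for u using st by (auto simp: weight_def indicator_def)
    have g: "0 \<le> ?g u" "?g u \<le> rate" for u
      using gain_bounds[OF regular_sol[OF f0]] by (auto simp: rate_def)
    have low: "?I s \<le> ?I t"
      using ww g by (intro integral_mono i st t mult_right_mono) auto
    have "?I t - ?I s = (\<integral>u. weight t u * ?g u - weight s u * ?g u \<partial>lborel)"
      using i st t by simp
    also have "\<dots> \<le> (\<integral>u. rate * weight t u - rate * weight s u \<partial>lborel)"
    proof (rule integral_mono)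
      show "integrable lborel (\<lambda>u. rate * weight t u - rate * weight s u)"
        using integral_weight(1)[OF t] integral_weight(1)[OF st(1)] by simp
      fix u show "weight t u * ?g u - weight s u * ?g u \<le> rate * weight t u - rate * weight s u"
        using mult_left_mono[OF g(2)[of u], of "weight t u - weight s u"] ww[of u] by (simp add: algebra_simps)
    qed (use i st t in simp)
    also have "\<dots> = exp (rate * t) - exp (rate * s)"
      using integral_weight[OF t] integral_weight[OF st(1)] by simp
    finally have up: "?I t - ?I s \<le> exp (rate * t) - exp (rate * s)" .
    \<comment> \<open>The discount factor from s to t. As the gain lies between 0 and
      \<open>rate\<close>, the remainder \<open>sol f0 t x - e * sol f0 s x\<close> lies between 0
      and \<open>1 - e\<close>.\<close>
    define e where "e = exp (- rate * (t - s))"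
    have e: "0 < e" "e \<le> 1" "1 - e \<le> rate * (t - s)"
      using st rate_pos exp_ge_add_one_self[of "- rate * (t - s)"] by (auto simp: e_def)
    have es: "exp (rate * s) = exp (rate * t) * e" by (simp add: e_def exp_add[symmetric] algebra_simps)
    have a: "0 \<le> sol f0 s x" "sol f0 s x \<le> 1" using regularD(2,3)[OF regular_sol[OF f0]] by auto
    have eq: "exp (rate * t) * (sol f0 t x - e * sol f0 s x) = ?I t - ?I s"
      using sol_mild_eq[OF f0 t, of x] sol_mild_eq[OF f0 st(1), of x] es by (simp add: algebra_simps)
    have "0 \<le> exp (rate * t) * (sol f0 t x - e * sol f0 s x)" using eq low by linarith
    then have "0 \<le> sol f0 t x - e * sol f0 s x" by (simp add: zero_le_mult_iff)
    moreover have "exp (rate * t) * (sol f0 t x - e * sol f0 s x) \<le> exp (rate * t) * (1 - e)"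
      using eq up es by (simp add: algebra_simps)
    then have "sol f0 t x - e * sol f0 s x \<le> 1 - e" by simp
    moreover have "(1 - e) * sol f0 s x \<le> (1 - e) * 1" "0 \<le> (1 - e) * sol f0 s x"
      using a e by (intro mult_left_mono mult_nonneg_nonneg; simp)+
    ultimately show ?thesis using e(3) by (simp add: algebra_simps)
  qed
  show ?thesis
  proof (rule lipschitz_onI)
    fix s t :: real assume "s \<in> {0..}" "t \<in> {0..}"
    then show "dist (sol f0 s x) (sol f0 t x) \<le> rate * dist s t"
      using step[of s t] step[of t s] by (cases "s \<le> t") (auto simp: dist_real_def abs_minus_commute)
  qed (use rate_pos in simp)
qed

text \<open>Gronwall at a fixed x, from \<open>gain \<le> rate * sol\<close>. The purpose is the
  limit 0 at minus infinity, which is part of \<open>mild\<close>; for this reason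
  \<open>mild_antimono\<close> cannot be used here.\<close>

lemma sol_le_initial:
  assumes f0: "regular f0" and pos: "AE z in \<zeta>. z > 0" and t: "0 \<le> t"
  shows "sol f0 t x \<le> f0 x"
proof -
  define W where "W s = exp (rate * s) * sol f0 s x" for s
  have "continuous_on {0..} W"
    unfolding W_def using lipschitz_on_continuous_on[OF sol_lipschitz[OF f0]] by (intro continuous_intros) auto
  then have Wint: "W integrable_on {0..s}" for s
    using continuous_on_subset by (intro integrable_continuous_interval) fastforce
  have "W t \<le> f0 x * exp (rate * t)"
  proof (rule gronwall_integral[where T=t and B="exp (rate * t)"])
    fix s assume s: "0 \<le> s" "s \<le> t"
    have "exp (rate * s) * sol f0 s x \<le> exp (rate * t) * 1"
      using s regularD(2,3)[OF regular_sol[OF f0]] rate_pos by (intro mult_mono) auto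
    then show "W s \<le> exp (rate * t)" by (simp add: W_def)
    have J: "((\<lambda>u. rate * W u) has_integral (rate * integral {0..s} W)) {0..s}"
      using Wint by (intro has_integral_mult_right integrable_integral)
    have "exp (rate * s) * sol f0 s x - sol f0 0 x \<le> rate * integral {0..s} W"
    proof (rule has_integral_le[OF sol_has_integral[OF f0 s(1)] J])
      fix u
      have r: "regular (sol f0 u)" by (rule regular_sol[OF f0])
      have "lam * jump (bdry u) (sol f0 u) x \<le> lam * sol f0 u x"
        using jump_le[OF r pos] lam by (rule mult_left_mono)
      moreover have "(sol f0 u x)\<^sup>2 \<le> sol f0 u x"
        using regularD(2,3)[OF r, of x] by (simp add: power2_eq_square mult_left_le)
      ultimately have "gain (bdry u) (sol f0 u) x \<le> rate * sol f0 u x"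
        by (simp add: gain_def rate_def algebra_simps)
      then show "exp (rate * u) * gain (bdry u) (sol f0 u) x \<le> rate * W u" by (simp add: W_def)
    qed
    then show "W s \<le> f0 x + rate * integral {0..s} W" using sol_zero[OF f0] by (simp add: W_def)
  qed (use Wint rate_pos t in auto)
  then show ?thesis by (simp add: W_def mult.commute)
qed

text \<open>No mass escapes to plus infinity. The limits \<open>l s\<close> at plus infinity satisfy
  the mild equation without space: there the jump term is \<open>lam * l\<close> and the initial
  value is 1. The constant 1 solves this equation, and Gronwall applied to \<open>1 - l\<close>
  shows that l coincides with it.\<close>

lemma sol_tendsto_at_top:
  assumes f0: "f0 \<in> cdfs" and t: "0 \<le> t"
  shows "(sol f0 t \<longlongrightarrow> 1) at_top"
proof -
  have r0: "regular f0" using f0 by (rule cdfs_regular)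
  have r: "regular (sol f0 s)" for s by (rule regular_sol[OF r0])
  define l where "l s = (SUP x. sol f0 s x)" for s
  have l: "(sol f0 s \<longlongrightarrow> l s) at_top" for s
    unfolding l_def using regularD(1,3)[OF r] by (intro mono_tendsto_SUP_at_top bdd_aboveI[of _ 1]) auto
  have l01: "0 \<le> l s" "l s \<le> 1" for s
    using regularD(2,3)[OF r] by (auto intro!: tendsto_lowerbound[OF l] tendsto_upperbound[OF l])
  have ln: "(\<lambda>n. sol f0 s (real n - z)) \<longlonglongrightarrow> l s" for s z
  proof (rule filterlim_compose[OF l])
    show "filterlim (\<lambda>n. real n - z) at_top sequentially"
      using filterlim_tendsto_add_at_top[OF tendsto_const filterlim_real_sequentially, of "-z"]
      by (simp add: algebra_simps)
  qed
  have l_meas: "l \<in> borel_measurable borel"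
  proof (rule borel_measurable_LIMSEQ_real)
    show "(\<lambda>n. sol f0 s (real n - 0)) \<longlonglongrightarrow> l s" for s by (rule ln)
    show "(\<lambda>s. sol f0 s (real n - 0)) \<in> borel_measurable borel" for n
    proof -
      have "(\<lambda>s. (s, real n - 0)) \<in> borel \<rightarrow>\<^sub>M borel \<Otimes>\<^sub>M borel" by measurable
      from measurable_compose[OF this] show ?thesis
        using regular_family_sol[OF r0] by (fastforce simp: regular_family_def)
    qed
  qed
  have jl: "(\<lambda>n. gain (bdry s) (sol f0 s) (real n)) \<longlonglongrightarrow> lam * l s + (l s)\<^sup>2" for s
    unfolding gain_def
  proof (intro tendsto_intros)
    show "(\<lambda>n. sol f0 s (real n)) \<longlonglongrightarrow> l s" using ln[of s 0] by simp
    have "(\<lambda>n. jump (bdry s) (sol f0 s) (real n)) \<longlonglongrightarrow> (\<integral>z. l s \<partial>\<zeta>)"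
      unfolding jump_def
    proof (rule integral_dominated_convergence[where w="\<lambda>_. 1"])
      show "AE z in \<zeta>. (\<lambda>n. shifted (bdry s) (sol f0 s) (real n) z) \<longlonglongrightarrow> l s"
      proof (rule AE_I2)
        fix z
        have "\<forall>\<^sub>F n in sequentially. bdry s + z \<le> real n"
          using filterlim_real_sequentially unfolding filterlim_at_top by blast
        then have "\<forall>\<^sub>F n in sequentially. sol f0 s (real n - z) = shifted (bdry s) (sol f0 s) (real n) z"
          by eventually_elim (simp add: shifted_def)
        then show "(\<lambda>n. shifted (bdry s) (sol f0 s) (real n) z) \<longlonglongrightarrow> l s"
          by (rule Lim_transform_eventually[OF ln])
      qed
    qed (use shifted_bounds[OF r] regular_measurable[OF r] in auto)
    then show "(\<lambda>n. jump (bdry s) (sol f0 s) (real n)) \<longlonglongrightarrow> l s"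
      using zeta.prob_space by simp
  qed
  let ?G = "\<lambda>s. lam * l s + (l s)\<^sup>2"
  have Gb: "0 \<le> ?G s" "?G s \<le> rate" for s
  proof -
    show "0 \<le> ?G s" using l01[of s] lam by simp
    have "lam * l s \<le> lam * 1" using l01 lam by (intro mult_left_mono)
    moreover have "(l s)\<^sup>2 \<le> 1" using l01[of s] by (simp add: power_le_one)
    ultimately show "?G s \<le> rate" by (simp add: rate_def)
  qed
  have wint: "integrable lborel (\<lambda>u. weight s u * k u)"
    if "0 \<le> s" "k \<in> borel_measurable borel" "\<And>u. \<bar>k u\<bar> \<le> B" for s k B
  proof (rule Bochner_Integration.integrable_bound)
    show "integrable lborel (\<lambda>u. B * weight s u)" using integral_weight(1)[OF that(1)] by simp
    show "AE u in lborel. norm (weight s u * k u) \<le> norm (B * weight s u)"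
      using that(3) weight_nonneg[of s]
      by (intro AE_I2) (auto simp: abs_mult mult.commute intro!: mult_right_mono order_trans[OF that(3) abs_ge_self])
  qed (use that in simp)
  have leq: "exp (rate * s) * l s = 1 + (\<integral>u. weight s u * ?G u \<partial>lborel)" if s: "0 \<le> s" for s
  proof -
    have "(\<lambda>n. f0 (real n) + (\<integral>u. weight s u * gain (bdry u) (sol f0 u) (real n) \<partial>lborel)) \<longlonglongrightarrow>
        1 + (\<integral>u. weight s u * ?G u \<partial>lborel)"
    proof (intro tendsto_add)
      show "(\<lambda>n. f0 (real n)) \<longlonglongrightarrow> 1"
        using filterlim_compose[OF cdfsD(4)[OF f0] filterlim_real_sequentially] .
      show "(\<lambda>n. \<integral>u. weight s u * gain (bdry u) (sol f0 u) (real n) \<partial>lborel) \<longlonglongrightarrow> (\<integral>u. weight s u * ?G u \<partial>lborel)"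
      proof (rule integral_dominated_convergence[where w="\<lambda>u. rate * weight s u"])
        show "integrable lborel (\<lambda>u. rate * weight s u)" using integral_weight(1)[OF s] by simp
        show "AE u in lborel. (\<lambda>n. weight s u * gain (bdry u) (sol f0 u) (real n)) \<longlonglongrightarrow> weight s u * ?G u"
          by (intro AE_I2 tendsto_mult tendsto_const jl)
        show "AE u in lborel. norm (weight s u * gain (bdry u) (sol f0 u) (real n)) \<le> rate * weight s u" for n
          using mult_left_mono[OF gain_bounds(3)[OF r] weight_nonneg] weight_nonneg[of s]
          by (simp add: abs_mult rate_def mult.commute)
      qed (use gain_measurable[OF regular_family_sol[OF r0]] l_meas in auto)
    qed
    moreover have "(\<lambda>n. exp (rate * s) * sol f0 s (real n)) \<longlonglongrightarrow> exp (rate * s) * l s"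
      using ln[of s 0] by (intro tendsto_intros) simp
    ultimately show ?thesis using sol_mild_eq[OF r0 s] by (simp add: LIMSEQ_unique)
  qed
  define W where "W s = exp (rate * s) * (1 - l s)" for s
  have Wi: "(W has_integral (\<integral>u. weight s u * (1 - l u) \<partial>lborel)) {0..s}" if "0 \<le> s" for s
    unfolding W_def by (rule weight_has_integral, rule wint[of _ _ 1]) (use that l_meas l01 in auto)
  have "W t \<le> 0 * exp ((rate + 1) * t)"
  proof (rule gronwall_integral[where T=t and B="exp (rate * t)"])
    fix s assume s: "0 \<le> s" "s \<le> t"
    have "exp (rate * s) * (1 - l s) \<le> exp (rate * t) * 1"
      using s l01[of s] rate_pos by (intro mult_mono) auto
    then show "W s \<le> exp (rate * t)" by (simp add: W_def)
    have "W s = (\<integral>u. rate * weight s u \<partial>lborel) - (\<integral>u. weight s u * ?G u \<partial>lborel)"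
      using leq[OF s(1)] integral_weight[OF s(1)] by (simp add: W_def algebra_simps)
    also have "\<dots> = (\<integral>u. rate * weight s u - weight s u * ?G u \<partial>lborel)"
      using wint[OF s(1), of ?G rate] Gb l_meas integral_weight(1)[OF s(1)] by simp
    also have "\<dots> \<le> (\<integral>u. (rate + 1) * (weight s u * (1 - l u)) \<partial>lborel)"
    proof (rule integral_mono)
      show "integrable lborel (\<lambda>u. rate * weight s u - weight s u * ?G u)"
        using wint[OF s(1), of ?G rate] Gb l_meas integral_weight(1)[OF s(1)] by simp
      have "integrable lborel (\<lambda>u. weight s u * (1 - l u))"
        by (rule wint[of _ _ 1]) (use s l_meas l01 in auto)
      then show "integrable lborel (\<lambda>u. (rate + 1) * (weight s u * (1 - l u)))" by simp
      fix u
      \<comment> \<open>The gain of the constant 1 is \<open>rate\<close>. The deficit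
        \<open>rate - ?G u\<close> is \<open>lam * (1 - l u)\<close> from the jumps plus this term,
        hence the factor \<open>lam + 2 = rate + 1\<close>.\<close>
      have "1 - (l u)\<^sup>2 = (1 + l u) * (1 - l u)" by (simp add: power2_eq_square algebra_simps)
      also have "\<dots> \<le> 2 * (1 - l u)" using l01[of u] by (intro mult_right_mono) auto
      finally have "rate - ?G u \<le> (rate + 1) * (1 - l u)" by (simp add: rate_def algebra_simps)
      then have "weight s u * (rate - ?G u) \<le> weight s u * ((rate + 1) * (1 - l u))"
        by (intro mult_left_mono weight_nonneg)
      then show "rate * weight s u - weight s u * ?G u \<le> (rate + 1) * (weight s u * (1 - l u))"
        by (simp add: algebra_simps)
    qed
    also have "\<dots> = (rate + 1) * integral {0..s} W" using integral_unique[OF Wi[OF s(1)]] by simp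
    finally show "W s \<le> 0 + (rate + 1) * integral {0..s} W" by simp
  qed (use Wi rate_pos t in \<open>auto intro: has_integral_integrable\<close>)
  then have "l t = 1" using l01(2)[of t] by (simp add: W_def mult_le_0_iff)
  then show ?thesis using l[of t] by simp
qed

lemma sol_cdfs:
  assumes f0: "f0 \<in> cdfs" and pos: "AE z in \<zeta>. z > 0" and t: "0 \<le> t"
  shows "sol f0 t \<in> cdfs"
proof -
  have r0: "regular f0" using f0 by (rule cdfs_regular)
  have r: "regular (sol f0 t)" by (rule regular_sol[OF r0])
  have "(sol f0 t \<longlongrightarrow> 0) at_bot"
  proof (rule tendsto_sandwich[OF _ _ tendsto_const cdfsD(3)[OF f0]])
    show "\<forall>\<^sub>F x in at_bot. 0 \<le> sol f0 t x" using regularD(2)[OF r] by simp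
    show "\<forall>\<^sub>F x in at_bot. sol f0 t x \<le> f0 x" using sol_le_initial[OF r0 pos t] by simp
  qed
  then show ?thesis using sol_tendsto_at_top[OF f0 t] regularD[OF r] by (simp add: cdfs_def)
qed

lemma sol_mild:
  assumes "f0 \<in> cdfs" and "AE z in \<zeta>. z > 0" shows "mild (sol f0)"
  unfolding mild_def
  using sol_cdfs[OF assms] sol_lipschitz[OF cdfs_regular[OF assms(1)]] sol_has_integral[OF cdfs_regular[OF assms(1)]]
  by blast

end

section \<open>Mild solutions are exactly the mean-field models\<close>

context moving_boundary
begin

text \<open>Both sides describe \<open>max Y A + Z\<close> for independent Y and Z:
  \<open>jump\<close> integrates over Y inside, the model over Z inside. Fubini identifies the two
  orders.\<close>

lemma jump_eq_model:
  assumes F: "F \<in> cdfs" and pos: "AE z in \<zeta>. z > 0"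
  shows "x \<le> A \<Longrightarrow> jump A F x = 0"
    and "A < x \<Longrightarrow> jump A F x - F x = - F A * (1 - cdf \<zeta> (x - A))
           - (LINT y:{A<..x}|interval_measure F. 1 - cdf \<zeta> (x - y))"
proof -
  have r: "regular F" using F by (rule cdfs_regular)
  show "jump A F x = 0" if "x \<le> A"
  proof -
    have "AE z in \<zeta>. shifted A F x z = 0"
      using pos by eventually_elim (use that in \<open>auto simp: shifted_def\<close>)
    then show ?thesis unfolding jump_def by (rule integral_eq_zero_AE)
  qed
  assume Ax: "A < x"
  let ?\<mu> = "interval_measure F"
  interpret mu: real_distribution ?\<mu> using real_distribution_cdfs[OF F] .
  interpret P: pair_sigma_finite \<zeta> ?\<mu> ..
  let ?J = "cdf \<zeta>"
  \<comment> \<open>Positivity of the jumps, in the form that positions \<open>y > x\<close>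
    contribute nothing to the mass at or below x.\<close>
  have J0: "?J u = 0" if "u \<le> 0" for u
  proof -
    have "AE z in \<zeta>. z \<notin> {..u}" using pos by eventually_elim (use that in auto)
    then have "emeasure \<zeta> {..u} = 0"
      by (subst AE_iff_measurable[symmetric, where P="\<lambda>z. z \<notin> {..u}"]) auto
    then show ?thesis by (simp add: cdf_def measure_def)
  qed
  have J1: "0 \<le> ?J u" "?J u \<le> 1" for u using zeta.prob_le_1 by (auto simp: cdf_def)
  have Jm: "?J \<in> borel_measurable borel"
    by (rule borel_measurable_mono) (auto intro: monoI zeta.cdf_nondecreasing)
  \<comment> \<open>The indicator of \<open>max y A + z \<le> x\<close>.\<close>
  define k where "k z y = (if z \<le> x - A \<and> z + y \<le> x then 1 else 0 :: real)" for z y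
  have km: "case_prod k \<in> borel_measurable (\<zeta> \<Otimes>\<^sub>M ?\<mu>)"
    unfolding k_def case_prod_unfold by measurable
  have kint: "integrable (\<zeta> \<Otimes>\<^sub>M ?\<mu>) (case_prod k)"
  proof -
    interpret PP: pair_prob_space \<zeta> ?\<mu> ..
    show ?thesis by (rule PP.integrable_const_bound[where B=1]) (use km in \<open>auto simp: k_def\<close>)
  qed
  have inner: "(\<integral>y. k z y \<partial>?\<mu>) = shifted A F x z" for z
  proof -
    have "(\<integral>y. k z y \<partial>?\<mu>) = (\<integral>y. (if z \<le> x - A then 1 else 0) * indicator {..x - z} y \<partial>?\<mu>)"
      by (intro Bochner_Integration.integral_cong) (auto simp: k_def indicator_def)
    also have "\<dots> = (if z \<le> x - A then 1 else 0) * measure ?\<mu> {..x - z}" by simp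
    finally show ?thesis using measure_cdfs_Iic[OF F] by (auto simp: shifted_def algebra_simps)
  qed
  have outer: "(\<integral>z. k z y \<partial>\<zeta>) = ?J (x - A) * indicator {..A} y + indicator {A<..x} y * ?J (x - y)" for y
  proof -
    have "(\<integral>z. k z y \<partial>\<zeta>) = (\<integral>z. indicator {..min (x - A) (x - y)} z \<partial>\<zeta>)"
      by (intro Bochner_Integration.integral_cong) (auto simp: k_def indicator_def)
    also have "\<dots> = ?J (min (x - A) (x - y))" by (simp add: cdf_def)
    finally show ?thesis using J0[of "x - y"] by (auto simp: indicator_def min_def)
  qed
  have i1: "integrable ?\<mu> (\<lambda>y. indicator {A<..x} y * ?J (x - y))"
    by (rule mu.integrable_const_bound[where B=1]) (use J1 Jm in \<open>auto simp: indicator_def\<close>)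
  have i2: "integrable ?\<mu> (indicat_real {..A})"
    by (rule mu.integrable_const_bound[where B=1]) (auto simp: indicator_def)
  have "jump A F x = (\<integral>z. (\<integral>y. k z y \<partial>?\<mu>) \<partial>\<zeta>)" unfolding jump_def inner ..
  also have "\<dots> = (\<integral>y. (\<integral>z. k z y \<partial>\<zeta>) \<partial>?\<mu>)" using P.Fubini_integral[OF kint] by simp
  also have "\<dots> = (\<integral>y. ?J (x - A) * indicator {..A} y + indicator {A<..x} y * ?J (x - y) \<partial>?\<mu>)"
    unfolding outer ..
  also have "\<dots> = ?J (x - A) * F A + (\<integral>y. indicator {A<..x} y * ?J (x - y) \<partial>?\<mu>)"
    using i1 i2 measure_cdfs_Iic[OF F] by (subst Bochner_Integration.integral_add) auto
  finally have jmp: "jump A F x = ?J (x - A) * F A + (\<integral>y. indicator {A<..x} y * ?J (x - y) \<partial>?\<mu>)" .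
  have "(LINT y:{A<..x}|?\<mu>. 1 - ?J (x - y)) = (\<integral>y. indicator {A<..x} y - indicator {A<..x} y * ?J (x - y) \<partial>?\<mu>)"
    unfolding set_lebesgue_integral_def by (simp add: algebra_simps)
  also have "\<dots> = measure ?\<mu> {A<..x} - (\<integral>y. indicator {A<..x} y * ?J (x - y) \<partial>?\<mu>)"
    using i1 by (subst Bochner_Integration.integral_diff) (auto simp: mu.emeasure_eq_measure)
  also have "measure ?\<mu> {A<..x} = F x - F A"
    using cdfsD[OF F] Ax by (intro measure_interval_measure_Ioc) (auto simp: mono_def)
  finally show "jump A F x - F x = - F A * (1 - ?J (x - A)) - (LINT y:{A<..x}|?\<mu>. 1 - ?J (x - y))"
    using jmp by (simp add: algebra_simps)
qed

definition model_rhs :: "real \<Rightarrow> (real \<Rightarrow> real) \<Rightarrow> real \<Rightarrow> real" where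
  "model_rhs A F x = gain A F x - rate * F x"

lemma model_rhs_eq:
  assumes F: "F \<in> cdfs" and pos: "AE z in \<zeta>. z > 0"
  shows "x \<le> A \<Longrightarrow> model_rhs A F x = - lam * F x - F x * (1 - F x)"
    and "A < x \<Longrightarrow> model_rhs A F x = - lam * F A * (1 - cdf \<zeta> (x - A))
        - lam * (LINT y:{A<..x}|interval_measure F. 1 - cdf \<zeta> (x - y)) - F x * (1 - F x)"
proof -
  have e: "model_rhs A F x = lam * (jump A F x - F x) - F x * (1 - F x)"
    by (simp add: model_rhs_def gain_def rate_def power2_eq_square algebra_simps)
  show "x \<le> A \<Longrightarrow> model_rhs A F x = - lam * F x - F x * (1 - F x)"
    using jump_eq_model(1)[OF F pos] e by simp
  assume "A < x"
  then show "model_rhs A F x = - lam * F A * (1 - cdf \<zeta> (x - A))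
        - lam * (LINT y:{A<..x}|interval_measure F. 1 - cdf \<zeta> (x - y)) - F x * (1 - F x)"
    unfolding e jump_eq_model(2)[OF F pos \<open>A < x\<close>] by (simp add: algebra_simps)
qed

text \<open>On distribution functions the two-case formula of the model is the single expression
  \<open>gain - rate * F\<close>, which is the form in which it can be integrated.\<close>

lemma mean_field_model_alt:
  assumes pos: "AE z in \<zeta>. z > 0"
  shows "mean_field_model lam (cdf \<zeta>) A0 v f \<longleftrightarrow>
     (\<forall>t\<ge>0. f t \<in> cdfs) \<and>
     (\<forall>x. antimono_on {0..} (\<lambda>t. f t x) \<and> rate-lipschitz_on {0..} (\<lambda>t. f t x)) \<and>
     (\<forall>x. \<forall>t>0. \<forall>D. ((\<lambda>s. f s x) has_real_derivative D) (at t) \<longrightarrow> D = model_rhs (bdry t) (f t) x)"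
proof (cases "\<forall>t\<ge>0. f t \<in> cdfs")
  case True
  have "(let A = A0 + v * t in
         (x \<le> A \<longrightarrow> D = - lam * f t x - f t x * (1 - f t x)) \<and>
         (x > A \<longrightarrow> D = - lam * f t A * (1 - cdf \<zeta> (x - A))
            - lam * (LINT y:{A<..x}|interval_measure (f t). 1 - cdf \<zeta> (x - y))
            - f t x * (1 - f t x))) \<longleftrightarrow> D = model_rhs (bdry t) (f t) x" if "t > 0" for x t D
  proof (cases "x \<le> bdry t")
    case xA: True
    then show ?thesis using model_rhs_eq(1)[OF True[rule_format, of t] pos xA] that
      by (simp add: bdry_def Let_def)
  next
    case False
    then have xA: "bdry t < x" by simp
    then show ?thesis using model_rhs_eq(2)[OF True[rule_format, of t] pos xA] that
      by (simp add: bdry_def Let_def)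
  qed
  then show ?thesis unfolding mean_field_model_def rate_def by auto
next
  case False
  then show ?thesis unfolding mean_field_model_def by auto
qed

lemma mild_mean_field_model:
  assumes f: "mild f" and pos: "AE z in \<zeta>. z > 0"
  shows "mean_field_model lam (cdf \<zeta>) A0 v f"
  unfolding mean_field_model_alt[OF pos]
proof (intro conjI allI impI)
  fix x
  show "antimono_on {0..} (\<lambda>t. f t x)"
    using mild_antimono[OF f pos] by (intro monotone_onI) auto
  fix t D assume t: "0 < t" and d: "((\<lambda>s. f s x) has_real_derivative D) (at t)"
  have "((\<lambda>s. f s x) has_real_derivative D) (at t within {0..t})" using d by (rule has_field_derivative_at_within)
  moreover have "at t within {0..t} \<noteq> bot" using t by (simp add: trivial_limit_within islimpt_Icc)
  ultimately show "D = model_rhs (bdry t) (f t) x"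
    using mild_left_derivative[OF f t] unfolding has_field_derivative_iff model_rhs_def
    by (meson tendsto_unique)
qed (use mildD[OF f] in auto)

text \<open>The product \<open>exp (rate * s) * f s x\<close> is Lipschitz on bounded intervals, and
  wherever it is differentiable in time so is f, with the derivative that the model prescribes. The
  integral of this derivative is the mild equation.\<close>

lemma mean_field_model_mild:
  assumes m: "mean_field_model lam (cdf \<zeta>) A0 v f" and pos: "AE z in \<zeta>. z > 0"
  shows "mild f"
proof -
  note m' = m[unfolded mean_field_model_alt[OF pos]]
  have lip: "rate-lipschitz_on {0..} (\<lambda>t. f t x)" and c: "0 \<le> t \<Longrightarrow> f t \<in> cdfs"
    and der: "0 < t \<Longrightarrow> ((\<lambda>s. f s x) has_real_derivative D) (at t) \<Longrightarrow> D = model_rhs (bdry t) (f t) x" for x t D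
    using m' by auto
  have "((\<lambda>s. exp (rate * s) * gain (bdry s) (f s) x) has_integral (exp (rate * t) * f t x - f 0 x)) {0..t}"
    if "0 \<le> t" for t x
  proof (cases "t = 0")
    case True
    then show ?thesis using has_integral_refl(2)[of _ "0::real"] by simp
  next
    case False
    then have t: "0 < t" using that by simp
    let ?u = "\<lambda>s. exp (rate * s) * f s x"
    \<comment> \<open>One summand for each factor of the product, both bounded through
      \<open>exp (rate * t)\<close>, \<open>f \<le> 1\<close> and the common constant
      \<open>rate\<close>.\<close>
    let ?C = "rate * exp (rate * t) + exp (rate * t) * rate"
    have "?C-lipschitz_on {0..t} ?u"
    proof (rule lipschitz_onI)
      have step: "\<bar>?u r - ?u s\<bar> \<le> ?C * (r - s)" if sr: "0 \<le> s" "s \<le> r" "r \<le> t" for r s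
      proof -
        have "exp (rate * s) = exp (rate * r) * exp (- rate * (r - s))" by (simp add: exp_add[symmetric] algebra_simps)
        moreover have "1 - rate * (r - s) \<le> exp (- rate * (r - s))"
          using exp_ge_add_one_self[of "- rate * (r - s)"] by simp
        then have "exp (rate * r) * (1 - exp (- rate * (r - s))) \<le> exp (rate * r) * (rate * (r - s))"
          by (intro mult_left_mono) auto
        ultimately have "exp (rate * r) - exp (rate * s) \<le> exp (rate * r) * (rate * (r - s))"
          by (simp add: algebra_simps)
        also have "\<dots> \<le> exp (rate * t) * (rate * (r - s))" using sr rate_pos by (intro mult_right_mono) auto
        finally have e: "exp (rate * r) - exp (rate * s) \<le> exp (rate * t) * (rate * (r - s))" .
        have e0: "0 \<le> exp (rate * r) - exp (rate * s)" using sr rate_pos by simp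
        have f1: "0 \<le> f r x" "f r x \<le> 1" using cdfs_nonneg cdfs_le_1 c sr by auto
        have l: "\<bar>f r x - f s x\<bar> \<le> rate * (r - s)"
          using lipschitz_onD[OF lip[of x], of r s] sr by (simp add: dist_real_def)
        have "?u r - ?u s = (exp (rate * r) - exp (rate * s)) * f r x + exp (rate * s) * (f r x - f s x)"
          by (simp add: algebra_simps)
        then have "\<bar>?u r - ?u s\<bar> \<le> \<bar>(exp (rate * r) - exp (rate * s)) * f r x\<bar> + \<bar>exp (rate * s) * (f r x - f s x)\<bar>"
          by (simp only: abs_triangle_ineq)
        also have "\<dots> = (exp (rate * r) - exp (rate * s)) * f r x + exp (rate * s) * \<bar>f r x - f s x\<bar>"
          using e0 f1 by (simp add: abs_mult)
        also have "\<dots> \<le> (exp (rate * t) * (rate * (r - s))) * 1 + exp (rate * t) * (rate * (r - s))"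
          using e e0 f1 l sr rate_pos by (intro add_mono mult_mono) auto
        finally show ?thesis by (simp add: algebra_simps)
      qed
      fix r s assume "r \<in> {0..t}" "s \<in> {0..t}"
      then show "dist (?u r) (?u s) \<le> ?C * dist r s"
        using step[of s r] step[of r s] by (cases "s \<le> r") (auto simp: dist_real_def abs_minus_commute)
    qed (use rate_pos in simp)
    then have "((\<lambda>s. exp (rate * s) * gain (bdry s) (f s) x) has_integral (?u t - ?u 0)) {0..t}"
    proof (rule lipschitz_has_integral_derivative[OF _ t])
      fix s d assume s: "0 < s" "s < t" and d: "(?u has_real_derivative d) (at s)"
      have "((\<lambda>s. exp (- rate * s) * ?u s) has_real_derivative
          (- rate * exp (- rate * s) * ?u s + exp (- rate * s) * d)) (at s)"
      proof -
        have e: "((\<lambda>s. exp (- rate * s)) has_real_derivative (- rate * exp (- rate * s))) (at s)"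
          by (auto intro!: derivative_eq_intros)
        show ?thesis using DERIV_mult[OF e d] by (simp add: mult.commute)
      qed
      then have "((\<lambda>s. f s x) has_real_derivative (- rate * exp (- rate * s) * ?u s + exp (- rate * s) * d)) (at s)"
        by (simp add: mult.assoc[symmetric] exp_add[symmetric])
      from der[OF s(1) this] show "d = exp (rate * s) * gain (bdry s) (f s) x"
        by (simp add: model_rhs_def exp_minus field_simps)
    qed
    then show ?thesis by simp
  qed
  then show ?thesis using lip c by (auto simp: mild_def)
qed

end

section \<open>The weak equation for test functions\<close>

lemma (in pair_prob_space) iterated_integral_bounded:
  fixes k :: "'a \<Rightarrow> 'b \<Rightarrow> real"
  assumes k: "case_prod k \<in> borel_measurable (M1 \<Otimes>\<^sub>M M2)" and B: "\<And>x y. \<bar>k x y\<bar> \<le> B"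
  shows "integrable (M1 \<Otimes>\<^sub>M M2) (case_prod k)"
    and "(\<integral>x. (\<integral>y. k x y \<partial>M2) \<partial>M1) = integral\<^sup>L (M1 \<Otimes>\<^sub>M M2) (case_prod k)"
    and "\<bar>integral\<^sup>L (M1 \<Otimes>\<^sub>M M2) (case_prod k)\<bar> \<le> B"
proof -
  show i: "integrable (M1 \<Otimes>\<^sub>M M2) (case_prod k)"
    by (rule integrable_const_bound[where B=B]) (use k B in auto)
  show "(\<integral>x. (\<integral>y. k x y \<partial>M2) \<partial>M1) = integral\<^sup>L (M1 \<Otimes>\<^sub>M M2) (case_prod k)"
    using integral_fst'[OF i] by simp
  have "\<bar>integral\<^sup>L (M1 \<Otimes>\<^sub>M M2) (case_prod k)\<bar> \<le> (\<integral>p. \<bar>case_prod k p\<bar> \<partial>(M1 \<Otimes>\<^sub>M M2))"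
    using integral_norm_bound[of "M1 \<Otimes>\<^sub>M M2" "case_prod k"] by simp
  also have "\<dots> \<le> (\<integral>p. B \<partial>(M1 \<Otimes>\<^sub>M M2))"
    using i B by (intro integral_mono) auto
  finally show "\<bar>integral\<^sup>L (M1 \<Otimes>\<^sub>M M2) (case_prod k)\<bar> \<le> B" by (simp add: prob_space)
qed

lemma tendsto_of_abs_diff_le:
  fixes X :: "nat \<Rightarrow> real"
  assumes "\<And>n. \<bar>l - X n\<bar> \<le> e n" "e \<longlonglongrightarrow> 0" shows "X \<longlonglongrightarrow> l"
proof -
  have "(\<lambda>n. X n - l) \<longlonglongrightarrow> 0"
    by (rule Lim_null_comparison[OF _ assms(2)]) (use assms(1) in \<open>simp add: abs_minus_commute\<close>)
  then show ?thesis by (simp add: LIM_zero_iff)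
qed

text \<open>The approximating step function takes at x the value of h at the next grid point;
  summation by parts writes it through indicators of half-lines, on which \<open>L_op\<close> is
  explicit.\<close>

lemma test_function_step_approx:
  assumes h: "h \<in> test_functions" and e: "0 < e"
  shows "\<exists>(m :: nat) c0 c xs. \<forall>x. \<bar>h x - (c0 + (\<Sum>j<m. c j * indicator {..xs j} x))\<bar> \<le> (e :: real)"
proof -
  obtain a b where ab: "a \<le> b" "\<And>x. x \<le> a \<Longrightarrow> h x = h a" "\<And>x. b \<le> x \<Longrightarrow> h x = h b" and c: "continuous_on UNIV h"
    using h by (auto simp: test_functions_def)
  have "uniformly_continuous_on {a..b} h"
    by (intro compact_uniformly_continuous continuous_on_subset[OF c]) auto
  then obtain d where d: "d > 0" "\<And>x y. x \<in> {a..b} \<Longrightarrow> y \<in> {a..b} \<Longrightarrow> dist y x < d \<Longrightarrow> dist (h y) (h x) < e"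
    using e unfolding uniformly_continuous_on_def by metis
  obtain m :: nat where m: "(b - a) / d < real m" using reals_Archimedean2 by blast
  define m' where "m' = Suc m"
  define w where "w = (b - a) / real m'"
  have w: "0 \<le> w" "w < d" "real m' * w = b - a"
  proof -
    show "0 \<le> w" "real m' * w = b - a" using ab by (auto simp: w_def m'_def)
    have "b - a < d * real m" using m d(1) by (simp add: field_simps)
    also have "\<dots> \<le> d * real m'" using d(1) by (simp add: m'_def)
    finally show "w < d" by (simp add: w_def m'_def field_simps)
  qed
  define xs where "xs j = a + real j * w" for j
  define c where "c j = h (xs j) - h (xs (Suc j))" for j
  have "\<bar>h x - (h b + (\<Sum>j<m'. c j * indicator {..xs j} x))\<bar> \<le> e" for x
  proof -
    have xs_in: "xs j \<in> {a..b}" if "j \<le> m'" for j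
    proof -
      have "real j * w \<le> real m' * w" using that w by (intro mult_right_mono) auto
      then show ?thesis using w ab by (auto simp: xs_def)
    qed
    have xsm: "xs m' = b" using w by (simp add: xs_def)
    have xs_mono: "xs i \<le> xs j" if "i \<le> j" for i j using that w by (auto simp: xs_def intro: mult_right_mono)
    \<comment> \<open>The first grid point at or to the right of x; the default \<open>m'\<close>
      serves the points beyond b, where h is constant and the sum below is empty.\<close>
    define i where "i = (LEAST i. x \<le> xs i \<or> i = m')"
    have i1: "x \<le> xs i \<or> i = m'" unfolding i_def by (rule LeastI[of _ m']) simp
    have im: "i \<le> m'" unfolding i_def by (rule Least_le) simp
    have i2: "\<not> x \<le> xs j" if "j < i" for j using not_less_Least[OF that[unfolded i_def]] that im by auto
    have "(\<Sum>j<m'. c j * indicator {..xs j} x) = (\<Sum>j\<in>{i..<m'}. c j)"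
    proof -
      have "(\<Sum>j<m'. c j * indicator {..xs j} x) = (\<Sum>j\<in>{i..<m'}. c j * indicator {..xs j} x)"
        using i2 by (intro sum.mono_neutral_right) (auto simp: indicator_def not_le)
      also have "\<dots> = (\<Sum>j\<in>{i..<m'}. c j)"
      proof (rule sum.cong[OF refl])
        fix j assume "j \<in> {i..<m'}"
        then have "x \<le> xs j" using i1 xs_mono[of i j] by auto
        then show "c j * indicator {..xs j} x = c j" by simp
      qed
      finally show ?thesis .
    qed
    also have "\<dots> = h (xs i) - h (xs m')"
      using im sum_Suc_diff'[of i m' "\<lambda>j. - h (xs j)"] by (simp add: c_def)
    finally have eq: "h b + (\<Sum>j<m'. c j * indicator {..xs j} x) = h (xs i)" by (simp add: xsm)
    have "dist (h x) (h (xs i)) \<le> e"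
    proof -
      consider "x \<le> a" | "b \<le> x" "a < x" | "a < x" "x < b" by linarith
      then show ?thesis
      proof cases
        case 1
        then have "i = 0" using Least_le[of "\<lambda>i. x \<le> xs i \<or> i = m'" 0] by (simp add: i_def xs_def)
        then show ?thesis using ab(2)[OF 1] e by (simp add: xs_def)
      next
        case 2
        then have "x \<le> xs i \<Longrightarrow> xs i = b" using xs_in[OF im] by auto
        then have "xs i = b" using i1 xsm by auto
        then show ?thesis using ab(3)[OF 2(1)] e by simp
      next
        case 3
        have xi: "x \<le> xs i" using i1 xsm 3 by auto
        have "i \<noteq> 0"
        proof
          assume "i = 0"
          then have "x \<le> a" using xi by (simp add: xs_def)
          then show False using 3 by simp
        qed
        then obtain k where k: "i = Suc k" by (cases i) auto
        have "xs k < x" using i2[of k] k by simp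
        then have "dist x (xs i) < d" using xi w k by (simp add: dist_real_def xs_def algebra_simps)
        then show ?thesis using d(2)[of "xs i" x] xs_in[OF im] 3 by auto
      qed
    qed
    then show ?thesis using eq by (simp add: dist_real_def)
  qed
  then have *: "\<forall>x. \<bar>h x - (h b + (\<Sum>j<m'. c j * indicator {..xs j} x))\<bar> \<le> e" by blast
  show ?thesis
    by (rule exI[of _ m'], rule exI[of _ "h b"], rule exI[of _ c], rule exI[of _ xs]) (rule *)
qed

context moving_boundary
begin

text \<open>As integrals over product measures the two terms are visibly linear in h, and the bound
  \<open>2 * rate * B\<close> says that \<open>L_op\<close> is continuous for the supremum
  norm.\<close>

lemma L_op_alt:
  fixes A :: real
  assumes F: "F \<in> cdfs" and h: "h \<in> borel_measurable borel" "\<And>x. \<bar>h x\<bar> \<le> B"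
  defines "\<mu> \<equiv> interval_measure F"
  defines "k1 \<equiv> \<lambda>z y. h (max y A + z) - h y"
  defines "k2 \<equiv> \<lambda>y \<xi>. indicator {y<..} \<xi> *\<^sub>R (h \<xi> - h y)"
  shows "L_op lam \<zeta> A F h = lam * integral\<^sup>L (\<zeta> \<Otimes>\<^sub>M \<mu>) (case_prod k1) + integral\<^sup>L (\<mu> \<Otimes>\<^sub>M \<mu>) (case_prod k2)"
    and "integrable (\<zeta> \<Otimes>\<^sub>M \<mu>) (case_prod k1)" and "integrable (\<mu> \<Otimes>\<^sub>M \<mu>) (case_prod k2)"
    and "\<bar>L_op lam \<zeta> A F h\<bar> \<le> 2 * rate * B"
proof -
  interpret mu: real_distribution \<mu> unfolding \<mu>_def using real_distribution_cdfs[OF F] .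
  interpret P: pair_prob_space \<zeta> \<mu> ..
  interpret Q: pair_prob_space \<mu> \<mu> ..
  note [measurable] = h(1)
  have m1: "case_prod k1 \<in> borel_measurable (\<zeta> \<Otimes>\<^sub>M \<mu>)"
    unfolding k1_def case_prod_unfold by measurable
  have b1: "\<bar>k1 z y\<bar> \<le> 2 * B" for z y
    using h(2)[of "max y A + z"] h(2)[of y] unfolding k1_def by linarith
  have k2': "case_prod k2 = (\<lambda>p. if fst p < snd p then h (snd p) - h (fst p) else 0)"
    by (auto simp: k2_def fun_eq_iff)
  have m2: "case_prod k2 \<in> borel_measurable (\<mu> \<Otimes>\<^sub>M \<mu>)"
    unfolding k2' by measurable
  have B: "0 \<le> B" using h(2)[of 0] by simp
  have b2: "\<bar>k2 y \<xi>\<bar> \<le> 2 * B" for y \<xi>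
    using h(2)[of \<xi>] h(2)[of y] B unfolding k2_def indicator_def by auto
  show "integrable (\<zeta> \<Otimes>\<^sub>M \<mu>) (case_prod k1)" "integrable (\<mu> \<Otimes>\<^sub>M \<mu>) (case_prod k2)"
    using P.iterated_integral_bounded(1)[OF m1 b1] Q.iterated_integral_bounded(1)[OF m2 b2] .
  show eq: "L_op lam \<zeta> A F h = lam * integral\<^sup>L (\<zeta> \<Otimes>\<^sub>M \<mu>) (case_prod k1) + integral\<^sup>L (\<mu> \<Otimes>\<^sub>M \<mu>) (case_prod k2)"
    unfolding P.iterated_integral_bounded(2)[OF m1 b1, symmetric] Q.iterated_integral_bounded(2)[OF m2 b2, symmetric]
    by (simp add: L_op_def k1_def k2_def \<mu>_def set_lebesgue_integral_def)
  have "\<bar>L_op lam \<zeta> A F h\<bar> \<le> \<bar>lam * integral\<^sup>L (\<zeta> \<Otimes>\<^sub>M \<mu>) (case_prod k1)\<bar> + \<bar>integral\<^sup>L (\<mu> \<Otimes>\<^sub>M \<mu>) (case_prod k2)\<bar>"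
    unfolding eq by (rule abs_triangle_ineq)
  also have "\<dots> \<le> lam * (2 * B) + 2 * B"
    using P.iterated_integral_bounded(3)[OF m1 b1] Q.iterated_integral_bounded(3)[OF m2 b2] lam
    by (intro add_mono) (auto simp: abs_mult intro!: mult_left_mono)
  finally show "\<bar>L_op lam \<zeta> A F h\<bar> \<le> 2 * rate * B" by (simp add: rate_def algebra_simps)
qed

lemma L_op_linear:
  assumes F: "F \<in> cdfs" and h: "h \<in> borel_measurable borel" "\<And>x. \<bar>h x\<bar> \<le> B"
    and g: "g \<in> borel_measurable borel" "\<And>x. \<bar>g x\<bar> \<le> C"
  shows "L_op lam \<zeta> A F (\<lambda>x. h x + c * g x) = L_op lam \<zeta> A F h + c * L_op lam \<zeta> A F g"
proof -
  have m: "(\<lambda>x. h x + c * g x) \<in> borel_measurable borel" using h g by simp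
  have b: "\<bar>h x + c * g x\<bar> \<le> B + \<bar>c\<bar> * C" for x
  proof -
    have "\<bar>h x + c * g x\<bar> \<le> \<bar>h x\<bar> + \<bar>c\<bar> * \<bar>g x\<bar>" by (metis abs_mult abs_triangle_ineq)
    also have "\<dots> \<le> B + \<bar>c\<bar> * C" using h g by (intro add_mono mult_left_mono) auto
    finally show ?thesis .
  qed
  note H = L_op_alt[OF F h] and G = L_op_alt[OF F g] and HG = L_op_alt[OF F m b]
  let ?\<mu> = "interval_measure F"
  let ?J = "\<lambda>h (z, y). h (max y A + z) - h y" and ?S = "\<lambda>h (y, \<xi>). indicator {y<..} \<xi> *\<^sub>R (h \<xi> - h y)"
  have 1: "integral\<^sup>L (\<zeta> \<Otimes>\<^sub>M ?\<mu>) (?J (\<lambda>x. h x + c * g x)) = integral\<^sup>L (\<zeta> \<Otimes>\<^sub>M ?\<mu>) (?J h) + c * integral\<^sup>L (\<zeta> \<Otimes>\<^sub>M ?\<mu>) (?J g)"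
  proof -
    have "?J (\<lambda>x. h x + c * g x) = (\<lambda>p. ?J h p + c * ?J g p)" by (auto simp: fun_eq_iff algebra_simps)
    then show ?thesis using H(2)[of A] G(2)[of A] by (simp only:) (subst Bochner_Integration.integral_add, auto)
  qed
  have 2: "integral\<^sup>L (?\<mu> \<Otimes>\<^sub>M ?\<mu>) (?S (\<lambda>x. h x + c * g x)) = integral\<^sup>L (?\<mu> \<Otimes>\<^sub>M ?\<mu>) (?S h) + c * integral\<^sup>L (?\<mu> \<Otimes>\<^sub>M ?\<mu>) (?S g)"
  proof -
    have "?S (\<lambda>x. h x + c * g x) = (\<lambda>p. ?S h p + c * ?S g p)" by (auto simp: fun_eq_iff algebra_simps)
    then show ?thesis using H(3) G(3) by (simp only:) (subst Bochner_Integration.integral_add, auto)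
  qed
  show ?thesis unfolding H(1) G(1) HG(1) 1 2 by (simp add: algebra_simps)
qed

text \<open>The link between the weak and the pointwise equation. Indicators of half-lines are not
  continuous, hence not test functions; they enter as building blocks of approximations.\<close>

lemma L_op_indicator:
  assumes F: "F \<in> cdfs"
  shows "L_op lam \<zeta> A F (indicator {..x}) = model_rhs A F x"
proof -
  let ?\<mu> = "interval_measure F"
  interpret mu: real_distribution ?\<mu> using real_distribution_cdfs[OF F] .
  have Iic: "(\<integral>y. indicator {..u} y \<partial>?\<mu>) = F u" for u
    using measure_cdfs_Iic[OF F] by simp
  have ii: "integrable ?\<mu> (\<lambda>y. indicator S y :: real)" if "S \<in> sets borel" for S
    by (rule mu.integrable_const_bound[where B=1]) (use that in \<open>auto simp: indicator_def\<close>)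
  have 1: "(\<integral>y. indicat_real {..x} (max y A + z) - indicat_real {..x} y \<partial>?\<mu>) = shifted A F x z - F x" for z
  proof -
    have "(\<integral>y. indicat_real {..x} (max y A + z) - indicat_real {..x} y \<partial>?\<mu>) =
        (\<integral>y. (if A \<le> x - z then 1 else 0) * indicator {..x - z} y - indicator {..x} y \<partial>?\<mu>)"
      by (intro Bochner_Integration.integral_cong) (auto simp: indicator_def)
    also have "\<dots> = (if A \<le> x - z then 1 else 0) * F (x - z) - F x"
      using ii[of "{..x - z}"] ii[of "{..x}"] Iic by (subst Bochner_Integration.integral_diff) auto
    finally show ?thesis by (simp add: shifted_def)
  qed
  have 2: "(LINT \<xi>:{y<..}|?\<mu>. indicat_real {..x} \<xi> - indicat_real {..x} y) = - indicator {..x} y * (1 - F x)" for y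
  proof -
    have "(LINT \<xi>:{y<..}|?\<mu>. indicat_real {..x} \<xi> - indicat_real {..x} y) = (\<integral>\<xi>. - indicator {..x} y * (1 - indicator {..x} \<xi>) \<partial>?\<mu>)"
      unfolding set_lebesgue_integral_def by (intro Bochner_Integration.integral_cong) (auto simp: indicator_def)
    also have "\<dots> = - indicator {..x} y * (1 - F x)"
      using ii[of "{..x}"] Iic mu.prob_space by (subst integral_mult_right_zero, subst Bochner_Integration.integral_diff) auto
    finally show ?thesis .
  qed
  have 3: "(\<integral>z. shifted A F x z - F x \<partial>\<zeta>) = jump A F x - F x"
    using integrable_shifted[OF cdfs_regular[OF F], of A x] zeta.prob_space
    by (subst Bochner_Integration.integral_diff) (auto simp: jump_def)
  have 4: "(\<integral>y. - indicator {..x} y * (1 - F x) \<partial>?\<mu>) = - F x * (1 - F x)"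
    using Iic by (subst integral_mult_left_zero) auto
  show ?thesis
    unfolding L_op_def 1 2 3 4
    by (simp add: model_rhs_def gain_def rate_def power2_eq_square algebra_simps)
qed

lemma L_op_step:
  fixes m :: nat and xs :: "nat \<Rightarrow> real"
  assumes F: "F \<in> cdfs"
  shows "L_op lam \<zeta> A F (\<lambda>x. c0 + (\<Sum>j<m. c j * indicator {..xs j} x)) = (\<Sum>j<m. c j * model_rhs A F (xs j))"
    and "cdf_integral F (\<lambda>x. c0 + (\<Sum>j<m. c j * indicator {..xs j} x)) = c0 + (\<Sum>j<m. c j * F (xs j))"
proof -
  show "L_op lam \<zeta> A F (\<lambda>x. c0 + (\<Sum>j<m. c j * indicator {..xs j} x)) = (\<Sum>j<m. c j * model_rhs A F (xs j))"
  proof (induction m)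
    case 0
    show ?case by (simp add: L_op_def)
  next
    case (Suc m)
    have b: "\<bar>c0 + (\<Sum>j<m. c j * indicator {..xs j} x)\<bar> \<le> \<bar>c0\<bar> + (\<Sum>j<m. \<bar>c j\<bar>)" for x
    proof -
      have "\<bar>\<Sum>j<m. c j * indicator {..xs j} x\<bar> \<le> (\<Sum>j<m. \<bar>c j\<bar>)"
        by (rule order_trans[OF sum_abs], rule sum_mono) (simp add: abs_mult indicator_def)
      then show ?thesis by linarith
    qed
    have im: "indicat_real {..xs m} \<in> borel_measurable borel" by (rule borel_measurable_indicator) simp
    have "L_op lam \<zeta> A F (\<lambda>x. (c0 + (\<Sum>j<m. c j * indicator {..xs j} x)) + c m * indicator {..xs m} x) =
      L_op lam \<zeta> A F (\<lambda>x. c0 + (\<Sum>j<m. c j * indicator {..xs j} x)) + c m * L_op lam \<zeta> A F (indicator {..xs m})"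
    proof (rule L_op_linear[OF F _ b im])
      show "(\<lambda>x. c0 + (\<Sum>j<m. c j * indicat_real {..xs j} x)) \<in> borel_measurable borel"
        by (intro borel_measurable_add borel_measurable_const borel_measurable_sum borel_measurable_times
            borel_measurable_indicator) simp
      show "\<bar>indicat_real {..xs m} x\<bar> \<le> 1" for x by (simp add: indicator_def)
    qed
    then show ?case using Suc.IH L_op_indicator[OF F] by (simp add: add.assoc)
  qed
  interpret mu: real_distribution "interval_measure F" using real_distribution_cdfs[OF F] .
  have ii: "integrable (interval_measure F) (\<lambda>y. c j * indicator {..xs j} y)" for j
    by (rule mu.integrable_const_bound[where B="\<bar>c j\<bar>"]) (auto simp: indicator_def)
  have ci: "(\<integral>y. c j * indicator {..xs j} y \<partial>interval_measure F) = c j * F (xs j)" for j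
    using measure_cdfs_Iic[OF F] by simp
  have "cdf_integral F (\<lambda>x. c0 + (\<Sum>j<m. c j * indicator {..xs j} x)) =
      (\<integral>x. c0 \<partial>interval_measure F) + (\<integral>x. (\<Sum>j<m. c j * indicator {..xs j} x) \<partial>interval_measure F)"
    unfolding cdf_integral_def
    by (intro Bochner_Integration.integral_add Bochner_Integration.integrable_sum ii) simp
  also have "(\<integral>x. (\<Sum>j<m. c j * indicator {..xs j} x) \<partial>interval_measure F) =
      (\<Sum>j<m. \<integral>x. c j * indicator {..xs j} x \<partial>interval_measure F)"
    by (intro Bochner_Integration.integral_sum ii)
  finally show "cdf_integral F (\<lambda>x. c0 + (\<Sum>j<m. c j * indicator {..xs j} x)) = c0 + (\<Sum>j<m. c j * F (xs j))"
    unfolding ci using mu.prob_space by simp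
qed

lemma cdf_integral_close:
  assumes F: "F \<in> cdfs" and h: "h \<in> borel_measurable borel" "\<And>x. \<bar>h x\<bar> \<le> B"
    and g: "g \<in> borel_measurable borel" "\<And>x. \<bar>g x\<bar> \<le> C" and e: "\<And>x. \<bar>h x - g x\<bar> \<le> e"
  shows "\<bar>cdf_integral F h - cdf_integral F g\<bar> \<le> e"
proof -
  interpret mu: real_distribution "interval_measure F" using real_distribution_cdfs[OF F] .
  have i: "integrable (interval_measure F) h" "integrable (interval_measure F) g"
    by (rule mu.integrable_const_bound[where B=B], use h in auto)
      (rule mu.integrable_const_bound[where B=C], use g in auto)
  have "\<bar>cdf_integral F h - cdf_integral F g\<bar> = \<bar>\<integral>x. h x - g x \<partial>interval_measure F\<bar>"
    unfolding cdf_integral_def using i by simp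
  also have "\<dots> \<le> (\<integral>x. \<bar>h x - g x\<bar> \<partial>interval_measure F)"
    using integral_norm_bound[of "interval_measure F" "\<lambda>x. h x - g x"] by simp
  also have "\<dots> \<le> (\<integral>x. e \<partial>interval_measure F)" using i e by (intro integral_mono) auto
  finally show ?thesis using mu.prob_space by simp
qed

lemma model_rhs_sol_measurable:
  assumes "regular f0" shows "(\<lambda>s. model_rhs (bdry s) (sol f0 s) x) \<in> borel_measurable borel"
proof -
  have "(\<lambda>s. (s, x)) \<in> borel \<rightarrow>\<^sub>M borel \<Otimes>\<^sub>M borel" by measurable
  from measurable_compose[OF this] have "(\<lambda>s. sol f0 s x) \<in> borel_measurable borel"
    using regular_family_sol[OF assms] by (fastforce simp: regular_family_def)
  then show ?thesis unfolding model_rhs_def using gain_measurable[OF regular_family_sol[OF assms]] by simp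
qed

lemma model_rhs_bound: "regular F \<Longrightarrow> \<bar>model_rhs A F x\<bar> \<le> 2 * rate"
proof -
  assume F: "regular F"
  have "0 \<le> rate * F x" "rate * F x \<le> rate * 1" using regularD(2,3)[OF F] rate_pos by (auto intro!: mult_left_mono)
  moreover have "0 \<le> gain A F x" "gain A F x \<le> rate" using gain_bounds[OF F, of A x] by (simp_all add: rate_def)
  ultimately show ?thesis unfolding model_rhs_def by linarith
qed

lemma sol_step_equation:
  assumes f0: "f0 \<in> cdfs" and pos: "AE z in \<zeta>. z > 0" and t: "0 \<le> t"
  shows "set_integrable lborel {0..t} (\<lambda>s. model_rhs (bdry s) (sol f0 s) x)"
    and "(LBINT s:{0..t}. model_rhs (bdry s) (sol f0 s) x) = sol f0 t x - f0 x"
proof -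
  have r: "regular f0" using f0 by (rule cdfs_regular)
  show i: "set_integrable lborel {0..t} (\<lambda>s. model_rhs (bdry s) (sol f0 s) x)"
  proof (rule set_integrable_bound[where f="\<lambda>s. 2 * rate"])
    have "integrable lborel (indicat_real {0..t})"
      by (rule integrable_real_indicator) (auto simp: emeasure_lborel_Icc_eq)
    then show "set_integrable lborel {0..t} (\<lambda>s. 2 * rate)" by (simp add: set_integrable_def)
    show "set_borel_measurable lborel {0..t} (\<lambda>s. model_rhs (bdry s) (sol f0 s) x)"
      using model_rhs_sol_measurable[OF r] by (simp add: set_borel_measurable_def)
    show "AE s in lborel. s \<in> {0..t} \<longrightarrow> norm (model_rhs (bdry s) (sol f0 s) x) \<le> norm (2 * rate)"
      using model_rhs_bound[OF regular_sol[OF r]] rate_pos by simp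
  qed
  show "(LBINT s:{0..t}. model_rhs (bdry s) (sol f0 s) x) = sol f0 t x - f0 x"
    using set_borel_integral_eq_integral(2)[OF i] integral_unique[OF mild_integral_equation[OF sol_mild[OF f0 pos] t]]
    by (simp add: model_rhs_def sol_zero[OF r])
qed

text \<open>For step functions the equation is a finite combination of
  \<open>sol_step_equation\<close> at the jump points. Both sides are continuous under uniform
  approximation; measurability of \<open>L_op\<close> in time is obtained in the same limit.\<close>

lemma sol_weak_equation:
  assumes f0: "f0 \<in> cdfs" and pos: "AE z in \<zeta>. z > 0" and t: "0 \<le> t" and h: "h \<in> test_functions"
  shows "set_integrable lborel {0..t} (\<lambda>s. L_op lam \<zeta> (bdry s) (sol f0 s) h)"
    and "cdf_integral (sol f0 t) h - cdf_integral f0 h = (LBINT s:{0..t}. L_op lam \<zeta> (bdry s) (sol f0 s) h)"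
proof -
  have r: "regular f0" using f0 by (rule cdfs_regular)
  have sc: "sol f0 s \<in> cdfs" if "0 \<le> s" for s by (rule sol_cdfs[OF f0 pos that])
  have hm: "h \<in> borel_measurable borel" using h by (auto simp: test_functions_def intro: borel_measurable_continuous_onI)
  have "bounded (range h)" using h by (simp add: test_functions_def)
  then obtain B where hB: "\<And>x. \<bar>h x\<bar> \<le> B" unfolding bounded_iff by auto
  have B0: "0 \<le> B" using hB[of 0] by simp
  have "\<forall>n. \<exists>q :: nat \<times> real \<times> (nat \<Rightarrow> real) \<times> (nat \<Rightarrow> real). \<forall>x. \<bar>h x - (fst (snd q) + (\<Sum>j<fst q. fst (snd (snd q)) j * indicator {..snd (snd (snd q)) j} x))\<bar> \<le> 1 / real (Suc n)"
  proof
    fix n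
    have "0 < 1 / real (Suc n)" by simp
    from test_function_step_approx[OF h this] obtain m :: nat and c0 c xs where
      *: "\<forall>x. \<bar>h x - (c0 + (\<Sum>j<m. c j * indicator {..xs j} x))\<bar> \<le> 1 / real (Suc n)" by blast
    show "\<exists>q :: nat \<times> real \<times> (nat \<Rightarrow> real) \<times> (nat \<Rightarrow> real). \<forall>x. \<bar>h x - (fst (snd q) + (\<Sum>j<fst q. fst (snd (snd q)) j * indicator {..snd (snd (snd q)) j} x))\<bar> \<le> 1 / real (Suc n)"
      by (rule exI[of _ "(m, c0, c, xs)"]) (unfold fst_conv snd_conv, rule *)
  qed
  from choice[OF this] obtain q :: "nat \<Rightarrow> nat \<times> real \<times> (nat \<Rightarrow> real) \<times> (nat \<Rightarrow> real)"
    where q: "\<forall>n x. \<bar>h x - (fst (snd (q n)) + (\<Sum>j<fst (q n).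
      fst (snd (snd (q n))) j * indicator {..snd (snd (snd (q n))) j} x))\<bar> \<le> 1 / real (Suc n)" by blast
  define m where "m n = fst (q n)" for n
  define c0 where "c0 n = fst (snd (q n))" for n
  define c where "c n = fst (snd (snd (q n)))" for n
  define xs where "xs n = snd (snd (snd (q n)))" for n
  have app: "\<bar>h x - (c0 n + (\<Sum>j<m n. c n j * indicator {..xs n j} x))\<bar> \<le> 1 / real (Suc n)" for n x
    unfolding m_def c0_def c_def xs_def by (rule q[rule_format])
  define k where "k n x = c0 n + (\<Sum>j<m n. c n j * indicator {..xs n j} x)" for n and x :: real
  have km: "k n \<in> borel_measurable borel" for n
    unfolding k_def by (intro borel_measurable_add borel_measurable_const borel_measurable_sum
        borel_measurable_times borel_measurable_indicator) simp
  have hk: "\<bar>h x - k n x\<bar> \<le> 1 / real (Suc n)" for n x using app by (simp add: k_def)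
  have inv1: "1 / real (Suc n) \<le> 1" for n by simp
  have kB: "\<bar>k n x\<bar> \<le> B + 1" for n x using hk[of x n] hB[of x] inv1[of n] by linarith
  define Lk where "Lk n s = indicator {0..t} s * (\<Sum>j<m n. c n j * model_rhs (bdry s) (sol f0 s) (xs n j))" for n s
  define Lh where "Lh s = indicator {0..t} s * L_op lam \<zeta> (bdry s) (sol f0 s) h" for s
  have Lk_eq: "Lk n s = indicator {0..t} s * L_op lam \<zeta> (bdry s) (sol f0 s) (k n)" for n s
  proof (cases "s \<in> {0..t}")
    case True
    then have "0 \<le> s" by simp
    then have "L_op lam \<zeta> (bdry s) (sol f0 s) (k n) = (\<Sum>j<m n. c n j * model_rhs (bdry s) (sol f0 s) (xs n j))"
      unfolding k_def by (intro L_op_step(1) sc)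
    then show ?thesis by (simp add: Lk_def)
  qed (simp add: Lk_def)
  \<comment> \<open>Linearity and the supremum bound of \<open>L_op\<close>, applied to the
    difference \<open>h - k n\<close>; the estimate is uniform in s.\<close>
  have close: "\<bar>Lh s - Lk n s\<bar> \<le> 2 * rate * (1 / real (Suc n))" for n s
  proof (cases "s \<in> {0..t}")
    case True
    have "L_op lam \<zeta> (bdry s) (sol f0 s) (\<lambda>x. h x + (-1) * k n x) =
      L_op lam \<zeta> (bdry s) (sol f0 s) h + (-1) * L_op lam \<zeta> (bdry s) (sol f0 s) (k n)"
      by (rule L_op_linear[OF sc hm hB km kB]) (use True in simp)
    moreover have "\<bar>L_op lam \<zeta> (bdry s) (sol f0 s) (\<lambda>x. h x + (-1) * k n x)\<bar> \<le> 2 * rate * (1 / real (Suc n))"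
      by (rule L_op_alt(4)[OF sc]) (use True hm km hk in auto)
    ultimately show ?thesis using True by (simp add: Lh_def Lk_eq)
  next
    case False
    then show ?thesis using rate_pos by (simp add: Lh_def Lk_def)
  qed
  have lim0: "(\<lambda>n. a * (1 / real (Suc n))) \<longlonglongrightarrow> 0" for a
    using tendsto_mult_right_zero[OF LIMSEQ_inverse_real_of_nat, of a] by (simp add: divide_inverse)
  have Lk_lim: "(\<lambda>n. Lk n s) \<longlonglongrightarrow> Lh s" for s
    by (rule tendsto_of_abs_diff_le[OF close lim0])
  have LkB: "\<bar>Lk n s\<bar> \<le> 2 * rate * (B + 1) * indicator {0..t} s" for n s
    using L_op_alt(4)[OF sc km kB, of s "bdry s" n] rate_pos B0 by (auto simp: Lk_eq indicator_def)
  have Lk_meas: "Lk n \<in> borel_measurable borel" for n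
    unfolding Lk_def using model_rhs_sol_measurable[OF r] by measurable
  have Lh_meas: "Lh \<in> borel_measurable borel"
    by (rule borel_measurable_LIMSEQ_real[OF Lk_lim Lk_meas])
  have dom: "integrable lborel (\<lambda>s. 2 * rate * (B + 1) * indicator {0..t} s)"
    by (intro integrable_mult_right integrable_real_indicator) (auto simp: emeasure_lborel_Icc_eq)
  have conv: "(\<lambda>n. \<integral>s. Lk n s \<partial>lborel) \<longlonglongrightarrow> (\<integral>s. Lh s \<partial>lborel)"
    by (rule integral_dominated_convergence[OF _ _ dom]) (use Lk_meas Lh_meas Lk_lim LkB in auto)
  have "integrable lborel Lh"
    by (rule integrable_dominated_convergence[OF _ _ dom, where s=Lk]) (use Lk_meas Lh_meas Lk_lim LkB in auto)
  then show "set_integrable lborel {0..t} (\<lambda>s. L_op lam \<zeta> (bdry s) (sol f0 s) h)"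
    unfolding set_integrable_def real_scaleR_def Lh_def .
  have step: "(\<integral>s. Lk n s \<partial>lborel) = cdf_integral (sol f0 t) (k n) - cdf_integral f0 (k n)" for n
  proof -
    note i = sol_step_equation[OF f0 pos t]
    have "(\<integral>s. Lk n s \<partial>lborel) = (\<integral>s. (\<Sum>j<m n. c n j * (indicator {0..t} s * model_rhs (bdry s) (sol f0 s) (xs n j))) \<partial>lborel)"
      by (intro Bochner_Integration.integral_cong) (auto simp: Lk_def sum_distrib_left mult_ac)
    also have "\<dots> = (\<Sum>j<m n. c n j * (sol f0 t (xs n j) - f0 (xs n j)))"
      using i by (subst Bochner_Integration.integral_sum) (auto simp: set_integrable_def set_lebesgue_integral_def)
    also have "\<dots> = cdf_integral (sol f0 t) (k n) - cdf_integral f0 (k n)"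
      unfolding k_def L_op_step(2)[OF sc[OF t]] L_op_step(2)[OF f0] by (simp add: sum_subtractf algebra_simps)
    finally show ?thesis .
  qed
  have ci: "(\<lambda>n. cdf_integral F (k n)) \<longlonglongrightarrow> cdf_integral F h" if "F \<in> cdfs" for F
  proof -
    have "\<bar>cdf_integral F h - cdf_integral F (k n)\<bar> \<le> 1 * (1 / real (Suc n))" for n
      using cdf_integral_close[OF that hm hB km kB hk] by simp
    then show ?thesis by (rule tendsto_of_abs_diff_le[OF _ lim0])
  qed
  have "(\<lambda>n. \<integral>s. Lk n s \<partial>lborel) \<longlonglongrightarrow> cdf_integral (sol f0 t) h - cdf_integral f0 h"
    unfolding step by (intro tendsto_diff ci sc t f0)
  with conv have "(\<integral>s. Lh s \<partial>lborel) = cdf_integral (sol f0 t) h - cdf_integral f0 h" by (rule LIMSEQ_unique)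
  then show "cdf_integral (sol f0 t) h - cdf_integral f0 h = (LBINT s:{0..t}. L_op lam \<zeta> (bdry s) (sol f0 s) h)"
    by (simp add: Lh_def set_lebesgue_integral_def)
qed

end

section \<open>The J1 distance\<close>

text \<open>f is the limit of its values at \<open>p n u\<close>, the grid point of mesh
  \<open>1 / Suc n\<close> strictly to the right of u. As a function of u each approximation depends
  only on an integer part.\<close>

lemma right_continuous_borel_measurable:
  fixes f :: "real \<Rightarrow> real"
  assumes "\<And>u. continuous (at_right u) f" shows "f \<in> borel_measurable borel"
proof -
  define p where "p n u = (real_of_int \<lfloor>u * real (Suc n)\<rfloor> + 1) / real (Suc n)" for n u
  have lim: "(\<lambda>n. f (p n u)) \<longlonglongrightarrow> f u" for u
  proof (rule filterlim_compose[of f "nhds (f u)" "at_right u"])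
    show "(f \<longlongrightarrow> f u) (at_right u)" using assms by (simp add: continuous_within)
    have gt: "u < p n u" for n
    proof -
      have "u * real (Suc n) < real_of_int \<lfloor>u * real (Suc n)\<rfloor> + 1" by linarith
      then show ?thesis unfolding p_def by (simp add: pos_less_divide_eq)
    qed
    have le: "p n u \<le> u + 1 / real (Suc n)" for n
    proof -
      have "real_of_int \<lfloor>u * real (Suc n)\<rfloor> + 1 \<le> u * real (Suc n) + 1" by linarith
      then have "p n u \<le> (u * real (Suc n) + 1) / real (Suc n)" unfolding p_def by (intro divide_right_mono) auto
      then show ?thesis by (simp add: add_divide_distrib del: of_nat_Suc)
    qed
    have up: "(\<lambda>n. u + 1 / real (Suc n)) \<longlonglongrightarrow> u"
      using LIMSEQ_inverse_real_of_nat_add[of u] by (simp add: divide_inverse)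
    have "(\<lambda>n. p n u) \<longlonglongrightarrow> u"
    proof (rule tendsto_sandwich[OF _ _ tendsto_const up])
      show "\<forall>\<^sub>F n in sequentially. u \<le> p n u" by (rule always_eventually, rule allI, rule less_imp_le, rule gt)
      show "\<forall>\<^sub>F n in sequentially. p n u \<le> u + 1 / real (Suc n)" using le by simp
    qed
    moreover have "\<forall>\<^sub>F n in sequentially. p n u \<in> {u<..} \<and> p n u \<noteq> u"
    proof (rule always_eventually, rule allI)
      fix n show "p n u \<in> {u<..} \<and> p n u \<noteq> u" using gt[of n] by auto
    qed
    ultimately show "filterlim (\<lambda>n. p n u) (at_right u) sequentially"
      unfolding filterlim_at by blast
  qed
  have meas: "(\<lambda>u. f (p n u)) \<in> borel_measurable borel" for n
  proof -
    have "(\<lambda>u. \<lfloor>u * real (Suc n)\<rfloor>) \<in> borel \<rightarrow>\<^sub>M count_space UNIV" by measurable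
    then have "(\<lambda>u. (\<lambda>i. f ((real_of_int i + 1) / real (Suc n))) \<lfloor>u * real (Suc n)\<rfloor>) \<in> borel_measurable borel"
      by (rule measurable_compose) simp
    then show ?thesis by (simp add: p_def)
  qed
  show ?thesis
    by (rule borel_measurable_LIMSEQ_real[where u="\<lambda>n u. f (p n u)"]) (simp_all add: lim meas)
qed

lemma skorohod_cdfs: "x \<in> skorohod_space \<Longrightarrow> 0 \<le> t \<Longrightarrow> x t \<in> cdfs"
  by (auto simp: skorohod_space_def cadlag_paths_def PiE_def Pi_def)

lemma skorohod_right:
  assumes x: "x \<in> skorohod_space" and t: "0 \<le> t" and e: "0 < e"
  shows "\<exists>d>0. \<forall>w. t \<le> w \<and> w < t + d \<longrightarrow> levy_dist (x t) (x w) < e"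
proof -
  have "limitin weak_topology x (x t) (at_right t)"
    using x t by (auto simp: skorohod_space_def cadlag_paths_def)
  moreover have "\<forall>\<^sub>F w in at_right t. x w \<in> cdfs"
    using eventually_at_right_less[of t] by eventually_elim (use skorohod_cdfs[OF x] t in auto)
  ultimately have "((\<lambda>w. levy_dist (x t) (x w)) \<longlongrightarrow> 0) (at_right t)"
    by (simp add: limitin_weak_topology_ev)
  then have "\<forall>\<^sub>F w in at_right t. dist (levy_dist (x t) (x w)) 0 < e" using e by (rule tendstoD)
  then obtain b where b: "t < b" "\<forall>w>t. w < b \<longrightarrow> dist (levy_dist (x t) (x w)) 0 < e"
    unfolding eventually_at_right_field by blast
  have "levy_dist (x t) (x w) < e" if "t \<le> w" "w < t + (b - t)" for w
  proof (cases "w = t")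
    case True
    then show ?thesis using levy_dist_self[OF skorohod_cdfs[OF x t]] e by simp
  next
    case False
    then have "dist (levy_dist (x t) (x w)) 0 < e" using b(2) that by simp
    then show ?thesis by (simp add: dist_real_def)
  qed
  then show ?thesis using b(1) by (intro exI[of _ "b - t"]) auto
qed

lemma skorohod_left:
  assumes x: "x \<in> skorohod_space" and t: "0 < t"
  obtains l where "l \<in> cdfs"
    "\<And>e. 0 < e \<Longrightarrow> \<exists>d>0. \<forall>w. t - d < w \<and> w < t \<and> 0 \<le> w \<longrightarrow> levy_dist l (x w) < e"
proof -
  obtain l where l: "limitin weak_topology x l (at_left t)"
    using x t by (auto simp: skorohod_space_def cadlag_paths_def)
  have "\<forall>\<^sub>F w in at_left t. 0 < w" using t by (auto simp: eventually_at_left_field)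
  then have "\<forall>\<^sub>F w in at_left t. x w \<in> cdfs" by eventually_elim (use skorohod_cdfs[OF x] in auto)
  then have l': "l \<in> cdfs" "((\<lambda>w. levy_dist l (x w)) \<longlongrightarrow> 0) (at_left t)"
    using l by (simp_all add: limitin_weak_topology_ev)
  have "\<exists>d>0. \<forall>w. t - d < w \<and> w < t \<and> 0 \<le> w \<longrightarrow> levy_dist l (x w) < e" if e: "0 < e" for e
  proof -
    have "\<forall>\<^sub>F w in at_left t. dist (levy_dist l (x w)) 0 < e" using l'(2) e by (rule tendstoD)
    then obtain b where b: "b < t" "\<forall>w>b. w < t \<longrightarrow> dist (levy_dist l (x w)) 0 < e"
      unfolding eventually_at_left_field by blast
    then have "levy_dist l (x w) < e" if "t - (t - b) < w" "w < t" for w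
    proof -
      have "dist (levy_dist l (x w)) 0 < e" using b(2) that by simp
      then show ?thesis by (simp add: dist_real_def)
    qed
    then show ?thesis using b(1) by (intro exI[of _ "t - b"]) auto
  qed
  with l'(1) that show ?thesis by blast
qed

section \<open>Time changes and the metric properties of the J1 distance\<close>

definition time_change_norm :: "(real \<Rightarrow> real) \<Rightarrow> real" where
  "time_change_norm \<psi> = Sup (log_slopes \<psi>)"

lemma log_slopes_I: "0 \<le> t \<Longrightarrow> t < s \<Longrightarrow> \<bar>ln ((\<psi> s - \<psi> t) / (s - t))\<bar> \<in> log_slopes \<psi>"
  unfolding log_slopes_def by blast

lemma log_slopes_nonempty: "log_slopes \<psi> \<noteq> {}"
  using log_slopes_I[of 0 1 \<psi>] by auto

lemma time_change_norm_upper: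
  assumes "\<psi> \<in> time_changes" "0 \<le> t" "t < s"
  shows "\<bar>ln ((\<psi> s - \<psi> t) / (s - t))\<bar> \<le> time_change_norm \<psi>"
  unfolding time_change_norm_def
  using assms log_slopes_I by (intro cSup_upper) (auto simp: time_changes_def)

lemma time_change_norm_nonneg: "\<psi> \<in> time_changes \<Longrightarrow> 0 \<le> time_change_norm \<psi>"
  using time_change_norm_upper[of \<psi> 0 1] by linarith

lemma time_change_norm_least:
  assumes "\<And>s t. 0 \<le> t \<Longrightarrow> t < s \<Longrightarrow> \<bar>ln ((\<psi> s - \<psi> t) / (s - t))\<bar> \<le> B"
  shows "time_change_norm \<psi> \<le> B" "bdd_above (log_slopes \<psi>)"
  unfolding time_change_norm_def using assms log_slopes_nonempty
  by (auto intro!: cSup_least bdd_aboveI[of _ B] simp: log_slopes_def)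

lemma time_changesD:
  assumes "\<psi> \<in> time_changes"
  shows "0 \<le> s \<Longrightarrow> s < t \<Longrightarrow> \<psi> s < \<psi> t" "0 \<le> s \<Longrightarrow> s \<le> t \<Longrightarrow> \<psi> s \<le> \<psi> t" "0 \<le> s \<Longrightarrow> 0 \<le> \<psi> s"
    "0 \<le> s \<Longrightarrow> \<exists>t\<ge>0. \<psi> t = s"
proof -
  have m: "strict_mono_on {0..} \<psi>" and i: "\<psi> ` {0..} = {0..}" using assms by (auto simp: time_changes_def)
  show 1: "0 \<le> s \<Longrightarrow> s < t \<Longrightarrow> \<psi> s < \<psi> t" for s t using m by (auto simp: strict_mono_on_def)
  show "0 \<le> s \<Longrightarrow> s \<le> t \<Longrightarrow> \<psi> s \<le> \<psi> t" using 1[of s t] by (cases "s = t") auto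
  show "0 \<le> s \<Longrightarrow> 0 \<le> \<psi> s" using i by auto
  show "0 \<le> s \<Longrightarrow> \<exists>t\<ge>0. \<psi> t = s" using i by (metis atLeast_iff imageE)
qed

lemma time_change_lipschitz:
  assumes "\<psi> \<in> time_changes" "0 \<le> t" "t \<le> s"
  shows "\<psi> s - \<psi> t \<le> exp (time_change_norm \<psi>) * (s - t)"
proof (cases "t = s")
  case False
  then have ts: "t < s" using assms by simp
  have "ln ((\<psi> s - \<psi> t) / (s - t)) \<le> time_change_norm \<psi>"
    using time_change_norm_upper[OF assms(1,2) ts] by linarith
  moreover have "0 < (\<psi> s - \<psi> t) / (s - t)" using time_changesD(1)[OF assms(1,2) ts] ts by simp
  ultimately have "(\<psi> s - \<psi> t) / (s - t) \<le> exp (time_change_norm \<psi>)"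
    by (metis exp_le_cancel_iff exp_ln)
  then show ?thesis using ts by (simp add: pos_divide_le_eq)
qed simp

lemma id_time_change: "(\<lambda>t. t) \<in> time_changes" "time_change_norm (\<lambda>t. t) = 0"
proof -
  have z: "\<bar>ln ((s - t) / (s - t))\<bar> \<le> 0" if "0 \<le> t" "t < s" for s t :: real using that by simp
  have b: "bdd_above (log_slopes (\<lambda>t. t))" by (rule time_change_norm_least(2)) (rule z)
  show i: "(\<lambda>t. t) \<in> time_changes" using b by (auto simp: time_changes_def strict_mono_on_def)
  have "time_change_norm (\<lambda>t. t) \<le> 0" by (rule time_change_norm_least(1)) (rule z)
  then show "time_change_norm (\<lambda>t. t) = 0" using time_change_norm_nonneg[OF i] by simp
qed

lemma time_change_comp:
  assumes \<psi>: "\<psi> \<in> time_changes" and \<phi>: "\<phi> \<in> time_changes"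
  shows "\<phi> \<circ> \<psi> \<in> time_changes" "time_change_norm (\<phi> \<circ> \<psi>) \<le> time_change_norm \<phi> + time_change_norm \<psi>"
proof -
  have b: "\<bar>ln (((\<phi> \<circ> \<psi>) s - (\<phi> \<circ> \<psi>) t) / (s - t))\<bar> \<le> time_change_norm \<phi> + time_change_norm \<psi>"
    if ts: "0 \<le> t" "t < s" for s t
  proof -
    have 1: "\<psi> t < \<psi> s" "0 \<le> \<psi> t" using time_changesD[OF \<psi>] ts by auto
    have 2: "\<phi> (\<psi> t) < \<phi> (\<psi> s)" using time_changesD(1)[OF \<phi> 1(2,1)] .
    have "((\<phi> \<circ> \<psi>) s - (\<phi> \<circ> \<psi>) t) / (s - t) = ((\<phi> (\<psi> s) - \<phi> (\<psi> t)) / (\<psi> s - \<psi> t)) * ((\<psi> s - \<psi> t) / (s - t))"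
      using 1 by simp
    then have "ln (((\<phi> \<circ> \<psi>) s - (\<phi> \<circ> \<psi>) t) / (s - t)) =
        ln ((\<phi> (\<psi> s) - \<phi> (\<psi> t)) / (\<psi> s - \<psi> t)) + ln ((\<psi> s - \<psi> t) / (s - t))"
      using 1 2 ts by (simp only: ln_mult_pos divide_pos_pos diff_gt_0_iff_gt)
    then show ?thesis
      using time_change_norm_upper[OF \<phi> 1(2,1)] time_change_norm_upper[OF \<psi> ts] by linarith
  qed
  show "time_change_norm (\<phi> \<circ> \<psi>) \<le> time_change_norm \<phi> + time_change_norm \<psi>"
    by (rule time_change_norm_least(1)) (rule b)
  have "bdd_above (log_slopes (\<phi> \<circ> \<psi>))" by (rule time_change_norm_least(2)) (rule b)
  moreover have "strict_mono_on {0..} (\<phi> \<circ> \<psi>)"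
    using time_changesD[OF \<psi>] time_changesD[OF \<phi>] by (auto simp: strict_mono_on_def)
  moreover have "(\<phi> \<circ> \<psi>) ` {0..} = {0..}"
    unfolding image_comp[symmetric] using \<psi> \<phi> by (simp add: time_changes_def)
  ultimately show "\<phi> \<circ> \<psi> \<in> time_changes" by (simp add: time_changes_def)
qed

text \<open>The slopes of the inverse are the reciprocals, so their logarithms differ only in
  sign.\<close>

lemma time_change_inverse:
  assumes \<psi>: "\<psi> \<in> time_changes"
  obtains \<phi> where "\<phi> \<in> time_changes" "time_change_norm \<phi> \<le> time_change_norm \<psi>"
    "\<And>t. 0 \<le> t \<Longrightarrow> \<psi> (\<phi> t) = t"
proof -
  define \<phi> where "\<phi> = inv_into {0..} \<psi>"
  have im: "\<psi> ` {0..} = {0..}" using \<psi> by (simp add: time_changes_def)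
  have \<psi>\<phi>: "\<psi> (\<phi> t) = t" and \<phi>0: "0 \<le> \<phi> t" if "0 \<le> t" for t
    using that im f_inv_into_f[of t \<psi> "{0..}"] inv_into_into[of t \<psi> "{0..}"] by (auto simp: \<phi>_def)
  have \<phi>mono: "\<phi> t < \<phi> s" if "0 \<le> t" "t < s" for s t
    using time_changesD(2)[OF \<psi>, of "\<phi> s" "\<phi> t"] \<psi>\<phi>[of s] \<psi>\<phi>[of t] \<phi>0[of s] that by linarith
  have b: "\<bar>ln ((\<phi> s - \<phi> t) / (s - t))\<bar> \<le> time_change_norm \<psi>" if ts: "0 \<le> t" "t < s" for s t
  proof -
    have "\<bar>ln ((\<psi> (\<phi> s) - \<psi> (\<phi> t)) / (\<phi> s - \<phi> t))\<bar> \<le> time_change_norm \<psi>"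
      by (rule time_change_norm_upper[OF \<psi> \<phi>0[OF ts(1)] \<phi>mono[OF ts]])
    moreover have "ln ((s - t) / (\<phi> s - \<phi> t)) = - ln ((\<phi> s - \<phi> t) / (s - t))"
      using \<phi>mono[OF ts] ts by (simp add: ln_div)
    ultimately show ?thesis using \<psi>\<phi>[of s] \<psi>\<phi>[of t] ts by simp
  qed
  have "bdd_above (log_slopes \<phi>)" by (rule time_change_norm_least(2)) (rule b)
  moreover have "\<phi> ` {0..} = {0..}"
  proof
    show "\<phi> ` {0..} \<subseteq> {0..}" using \<phi>0 by auto
    show "{0..} \<subseteq> \<phi> ` {0..}"
    proof
      fix t :: real assume t: "t \<in> {0..}"
      have "\<phi> (\<psi> t) = t"
      proof -
        have *: "0 \<le> \<psi> t" "0 \<le> \<phi> (\<psi> t)" "\<psi> (\<phi> (\<psi> t)) = \<psi> t"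
          using time_changesD(3)[OF \<psi>, of t] \<phi>0 \<psi>\<phi> t by auto
        then show ?thesis
          using time_changesD(1)[OF \<psi>, of t "\<phi> (\<psi> t)"] time_changesD(1)[OF \<psi>, of "\<phi> (\<psi> t)" t] t by force
      qed
      then show "t \<in> \<phi> ` {0..}" using time_changesD(3)[OF \<psi>, of t] t by (metis atLeast_iff image_eqI)
    qed
  qed
  ultimately have "\<phi> \<in> time_changes" using \<phi>mono by (auto simp: time_changes_def strict_mono_on_def)
  moreover have "time_change_norm \<phi> \<le> time_change_norm \<psi>" by (rule time_change_norm_least(1)) (rule b)
  ultimately show ?thesis using that \<psi>\<phi> by blast
qed

definition gap :: "(real \<Rightarrow> real) \<Rightarrow> (real \<Rightarrow> real \<Rightarrow> real) \<Rightarrow> (real \<Rightarrow> real \<Rightarrow> real) \<Rightarrow> real \<Rightarrow> real \<Rightarrow> real" where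
  "gap \<psi> x y u t = min 1 (levy_dist (x (min t u)) (y (min (\<psi> t) u)))"

definition sup_gap :: "(real \<Rightarrow> real) \<Rightarrow> (real \<Rightarrow> real \<Rightarrow> real) \<Rightarrow> (real \<Rightarrow> real \<Rightarrow> real) \<Rightarrow> real \<Rightarrow> real" where
  "sup_gap \<psi> x y u = (SUP t\<in>{0..}. gap \<psi> x y u t)"

definition J1_cost :: "(real \<Rightarrow> real) \<Rightarrow> (real \<Rightarrow> real \<Rightarrow> real) \<Rightarrow> (real \<Rightarrow> real \<Rightarrow> real) \<Rightarrow> real" where
  "J1_cost \<psi> x y = max (time_change_norm \<psi>) (LBINT u:{0..}. exp (- u) * sup_gap \<psi> x y u)"

lemma J1_dist_alt: "J1_dist levy_dist x y = (INF \<psi>\<in>time_changes. J1_cost \<psi> x y)"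
  by (simp add: J1_dist_def J1_cost_def time_change_norm_def sup_gap_def gap_def)

lemma J1_cost_nonneg: "\<psi> \<in> time_changes \<Longrightarrow> 0 \<le> J1_cost \<psi> x y"
  using time_change_norm_nonneg by (simp add: J1_cost_def le_max_iff_disj)

lemma J1_dist_le: "\<psi> \<in> time_changes \<Longrightarrow> J1_dist levy_dist x y \<le> J1_cost \<psi> x y"
  unfolding J1_dist_alt using J1_cost_nonneg by (intro cINF_lower bdd_belowI[of _ 0]) auto

lemma J1_dist_nonneg: "0 \<le> J1_dist levy_dist x y"
  unfolding J1_dist_alt using J1_cost_nonneg id_time_change(1) by (intro cINF_greatest) auto

lemma J1_dist_less:
  assumes "J1_dist levy_dist x y < e" obtains \<psi> where "\<psi> \<in> time_changes" "J1_cost \<psi> x y < e"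
proof -
  have "time_changes \<noteq> {}" using id_time_change(1) by blast
  moreover have "bdd_below ((\<lambda>\<psi>. J1_cost \<psi> x y) ` time_changes)"
    using J1_cost_nonneg by (intro bdd_belowI[of _ 0]) auto
  ultimately show ?thesis using assms that unfolding J1_dist_alt by (auto simp: cINF_less_iff)
qed

context
  fixes x y :: "real \<Rightarrow> real \<Rightarrow> real"
  assumes x: "x \<in> skorohod_space" and y: "y \<in> skorohod_space"
begin

lemma gap_bounds:
  assumes "\<psi> \<in> time_changes" "0 \<le> u" "0 \<le> t" shows "0 \<le> gap \<psi> x y u t" "gap \<psi> x y u t \<le> 1"
  using levy_dist_nonneg[OF skorohod_cdfs[OF x] skorohod_cdfs[OF y]] time_changesD(3)[OF assms(1,3)] assms
  by (auto simp: gap_def)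

lemma gap_le_sup:
  assumes "\<psi> \<in> time_changes" "0 \<le> u" "0 \<le> t" shows "gap \<psi> x y u t \<le> sup_gap \<psi> x y u"
  unfolding sup_gap_def using assms gap_bounds[OF assms(1,2)] by (intro cSUP_upper bdd_aboveI[of _ 1]) auto

lemma sup_gap_bounds:
  assumes "\<psi> \<in> time_changes" "0 \<le> u" shows "0 \<le> sup_gap \<psi> x y u" "sup_gap \<psi> x y u \<le> 1"
proof -
  show "0 \<le> sup_gap \<psi> x y u" using gap_le_sup[OF assms, of 0] gap_bounds[OF assms, of 0] by simp
  show "sup_gap \<psi> x y u \<le> 1" unfolding sup_gap_def using gap_bounds[OF assms] by (intro cSUP_least) auto
qed

text \<open>Formulated with two inner functions because it serves both arguments of
  \<open>gap\<close>: the time t, with the time change inside, and the truncation level u. Monotone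
  inner functions keep the paths on their right-continuous side.\<close>

lemma levy_right_continuous:
  fixes t :: real and a b :: "real \<Rightarrow> real"
  assumes a: "continuous (at_right t) a" "\<And>s. t \<le> s \<Longrightarrow> a t \<le> a s" "0 \<le> a t"
    and b: "continuous (at_right t) b" "\<And>s. t \<le> s \<Longrightarrow> b t \<le> b s" "0 \<le> b t"
  shows "continuous (at_right t) (\<lambda>s. min 1 (levy_dist (x (a s)) (y (b s))))"
proof -
  have "((\<lambda>s. levy_dist (x (a s)) (y (b s))) \<longlongrightarrow> levy_dist (x (a t)) (y (b t))) (at_right t)"
  proof (rule tendstoI)
    fix e :: real assume e: "0 < e"
    then have e2: "0 < e / 2" by simp
    obtain d1 where d1: "d1 > 0" "\<And>w. a t \<le> w \<Longrightarrow> w < a t + d1 \<Longrightarrow> levy_dist (x (a t)) (x w) < e / 2"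
      using skorohod_right[OF x a(3) e2] by blast
    obtain d2 where d2: "d2 > 0" "\<And>w. b t \<le> w \<Longrightarrow> w < b t + d2 \<Longrightarrow> levy_dist (y (b t)) (y w) < e / 2"
      using skorohod_right[OF y b(3) e2] by blast
    have "\<forall>\<^sub>F s in at_right t. dist (a s) (a t) < d1" "\<forall>\<^sub>F s in at_right t. dist (b s) (b t) < d2"
      using a(1) b(1) d1(1) d2(1) by (auto simp: continuous_within intro!: tendstoD)
    then show "\<forall>\<^sub>F s in at_right t. dist (levy_dist (x (a s)) (y (b s))) (levy_dist (x (a t)) (y (b t))) < e"
      using eventually_at_right_less[of t]
    proof eventually_elim
      case (elim s)
      have as: "a t \<le> a s" "b t \<le> b s" using a(2)[of s] b(2)[of s] elim(3) by auto
      have "levy_dist (x (a t)) (x (a s)) < e / 2" using elim(1) as by (intro d1(2)) (auto simp: dist_real_def)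
      moreover have "levy_dist (y (b t)) (y (b s)) < e / 2" using elim(2) as by (intro d2(2)) (auto simp: dist_real_def)
      moreover have "\<bar>levy_dist (x (a t)) (y (b t)) - levy_dist (x (a s)) (y (b s))\<bar>
          \<le> levy_dist (x (a t)) (x (a s)) + levy_dist (y (b t)) (y (b s))"
        using as a(3) b(3) by (intro levy_dist_diff_le skorohod_cdfs[OF x] skorohod_cdfs[OF y]) auto
      ultimately show ?case by (simp add: dist_real_def abs_minus_commute)
    qed
  qed
  then show ?thesis unfolding continuous_within by (intro tendsto_intros)
qed

text \<open>Right continuity in t reduces the supremum to rational times; a countable supremum is
  measurable in u, which gives meaning to the integral in the distance.\<close>

lemma sup_gap_rat:
  assumes \<psi>: "\<psi> \<in> time_changes" and u: "0 \<le> u"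
  shows "sup_gap \<psi> x y u = (SUP t\<in>\<rat> \<inter> {0..}. gap \<psi> x y u t)"
proof (rule antisym)
  have ne: "\<rat> \<inter> {0::real..} \<noteq> {}" using Rats_0 by fastforce
  have bdd: "bdd_above (gap \<psi> x y u ` (\<rat> \<inter> {0..}))"
    using gap_bounds[OF \<psi> u] by (intro bdd_aboveI[of _ 1]) auto
  show "(SUP t\<in>\<rat> \<inter> {0..}. gap \<psi> x y u t) \<le> sup_gap \<psi> x y u"
    using gap_le_sup[OF \<psi> u] ne by (intro cSUP_least) auto
  show "sup_gap \<psi> x y u \<le> (SUP t\<in>\<rat> \<inter> {0..}. gap \<psi> x y u t)"
    unfolding sup_gap_def
  proof (rule cSUP_least)
    fix t :: real assume t: "t \<in> {0..}"
    have cont: "continuous (at_right t) (gap \<psi> x y u)"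
      unfolding gap_def
    proof (rule levy_right_continuous)
      show "continuous (at_right t) (\<lambda>s. min s u)" by (intro continuous_intros)
      have "continuous (at_right t) \<psi>"
        unfolding continuous_within
      proof (rule tendsto_sandwich)
        let ?g = "\<lambda>s. \<psi> t + exp (time_change_norm \<psi>) * (s - t)"
        show "\<forall>\<^sub>F s in at_right t. \<psi> t \<le> \<psi> s"
          using eventually_at_right_less[of t] by eventually_elim (use time_changesD(2)[OF \<psi>] t in auto)
        show "\<forall>\<^sub>F s in at_right t. \<psi> s \<le> ?g s"
          using eventually_at_right_less[of t]
        proof eventually_elim
          case (elim s) then show ?case using time_change_lipschitz[OF \<psi>, of t s] t by auto
        qed
        show "(?g \<longlongrightarrow> \<psi> t) (at_right t)" by (auto intro!: tendsto_eq_intros)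
      qed auto
      then show "continuous (at_right t) (\<lambda>s. min (\<psi> s) u)" by (intro continuous_intros)
      show "min (\<psi> t) u \<le> min (\<psi> s) u" if "t \<le> s" for s
        using time_changesD(2)[OF \<psi>, of t s] that t by auto
    qed (use t u time_changesD(3)[OF \<psi>] in auto)
    show "gap \<psi> x y u t \<le> (SUP t\<in>\<rat> \<inter> {0..}. gap \<psi> x y u t)"
    proof (rule ccontr)
      assume "\<not> ?thesis"
      then have lt: "(SUP t\<in>\<rat> \<inter> {0..}. gap \<psi> x y u t) < gap \<psi> x y u t" by simp
      have "(gap \<psi> x y u \<longlongrightarrow> gap \<psi> x y u t) (at_right t)" using cont by (simp add: continuous_within)
      from order_tendstoD(1)[OF this lt] obtain b where b: "t < b"
        "\<forall>s>t. s < b \<longrightarrow> (SUP t\<in>\<rat> \<inter> {0..}. gap \<psi> x y u t) < gap \<psi> x y u s"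
        unfolding eventually_at_right_field by blast
      obtain q where q: "q \<in> \<rat>" "t < q" "q < b" using Rats_dense_in_real[OF b(1)] by blast
      have "gap \<psi> x y u q \<le> (SUP t\<in>\<rat> \<inter> {0..}. gap \<psi> x y u t)"
        using q t by (intro cSUP_upper bdd) auto
      then show False using b(2) q(2,3) by fastforce
    qed
  qed simp
qed

lemma sup_gap_measurable:
  assumes \<psi>: "\<psi> \<in> time_changes"
  shows "(\<lambda>u. sup_gap \<psi> x y (max 0 u)) \<in> borel_measurable borel"
proof -
  have "(\<lambda>u. SUP t\<in>\<rat> \<inter> {0..}. gap \<psi> x y (max 0 u) t) \<in> borel_measurable borel"
  proof (rule borel_measurable_cSUP)
    show "countable (\<rat> \<inter> {0::real..})" using countable_rat by (rule countable_Int1)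
    show "(\<lambda>u. gap \<psi> x y (max 0 u) t) \<in> borel_measurable borel" if "t \<in> \<rat> \<inter> {0..}" for t
      unfolding gap_def
      by (intro right_continuous_borel_measurable levy_right_continuous)
        (use that time_changesD(3)[OF \<psi>, of t] in \<open>auto intro!: continuous_intros\<close>)
    show "bdd_above ((\<lambda>t. gap \<psi> x y (max 0 u) t) ` (\<rat> \<inter> {0..}))" for u
      using gap_bounds[OF \<psi>, of "max 0 u"] by (intro bdd_aboveI[of _ 1]) auto
  qed
  then show ?thesis using sup_gap_rat[OF \<psi>] by simp
qed

end

lemma exp_tail_integral:
  shows "integrable lborel (\<lambda>u. exp (- u) * indicator {T..} u :: real)"
    and "(\<integral>u. exp (- u) * indicator {T..} u \<partial>lborel) = exp (- T :: real)"
proof -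
  have n: "(\<integral>\<^sup>+u. ennreal (exp (- u)) * indicator {T..} u \<partial>lborel) = ennreal (0 - (- exp (- T)))"
  proof (rule nn_integral_FTC_atLeast)
    show "((\<lambda>u. - exp (- u)) has_real_derivative exp (- u)) (at u)" for u :: real
      by (auto intro!: derivative_eq_intros)
    show "((\<lambda>u::real. - exp (- u)) \<longlongrightarrow> 0) at_top"
      using tendsto_minus[OF filterlim_compose[OF exp_at_bot filterlim_uminus_at_bot_at_top]] by simp
  qed auto
  have n': "(\<integral>\<^sup>+u. ennreal (exp (- u) * indicator {T..} u) \<partial>lborel) = ennreal (exp (- T))"
    using n by (simp add: ennreal_mult' ennreal_indicator)
  have "has_bochner_integral lborel (\<lambda>u. exp (- u) * indicator {T..} u) (exp (- T))"
    by (rule has_bochner_integral_nn_integral[OF _ _ _ n']) auto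
  then show "integrable lborel (\<lambda>u. exp (- u) * indicator {T..} u :: real)"
    "(\<integral>u. exp (- u) * indicator {T..} u \<partial>lborel) = exp (- T :: real)"
    by (auto simp: has_bochner_integral_iff)
qed

lemma J1_integrable:
  assumes "x \<in> skorohod_space" "y \<in> skorohod_space" "\<psi> \<in> time_changes"
  shows "set_integrable lborel {0..} (\<lambda>u. exp (- u) * sup_gap \<psi> x y u)"
proof -
  have "integrable lborel (\<lambda>u. exp (- u) * indicator {0..} u * sup_gap \<psi> x y (max 0 u))"
  proof (rule Bochner_Integration.integrable_bound[OF exp_tail_integral(1)[of 0]])
    show "AE u in lborel. norm (exp (- u) * indicator {0..} u * sup_gap \<psi> x y (max 0 u)) \<le> norm (exp (- u) * indicat_real {0..} u)"
    proof (rule AE_I2)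
      fix u :: real
      have "\<bar>sup_gap \<psi> x y (max 0 u)\<bar> \<le> 1" using sup_gap_bounds[OF assms, of "max 0 u"] by simp
      then show "norm (exp (- u) * indicator {0..} u * sup_gap \<psi> x y (max 0 u)) \<le> norm (exp (- u) * indicat_real {0..} u)"
        by (auto simp: abs_mult indicator_def)
    qed
  qed (use sup_gap_measurable[OF assms] in simp)
  also have "(\<lambda>u. exp (- u) * indicator {0..} u * sup_gap \<psi> x y (max 0 u)) =
      (\<lambda>u. indicator {0..} u *\<^sub>R (exp (- u) * sup_gap \<psi> x y u))"
    by (auto simp: fun_eq_iff indicator_def)
  finally show ?thesis by (simp add: set_integrable_def)
qed

text \<open>The inverse time change has no larger norm and turns the gap at t into the original gap
  at the image of t. Exchanging x and y gives the reverse inequality.\<close>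

lemma J1_dist_sym:
  assumes x: "x \<in> skorohod_space" and y: "y \<in> skorohod_space"
  shows "J1_dist levy_dist y x \<le> J1_dist levy_dist x y"
proof (rule field_le_epsilon)
  fix e :: real assume "0 < e"
  then obtain \<psi> where \<psi>: "\<psi> \<in> time_changes" "J1_cost \<psi> x y < J1_dist levy_dist x y + e"
    using J1_dist_less[of x y "J1_dist levy_dist x y + e"] by auto
  obtain \<phi> where \<phi>: "\<phi> \<in> time_changes" "time_change_norm \<phi> \<le> time_change_norm \<psi>"
    "\<And>t. 0 \<le> t \<Longrightarrow> \<psi> (\<phi> t) = t"
    using time_change_inverse[OF \<psi>(1)] by blast
  have "sup_gap \<phi> y x u \<le> sup_gap \<psi> x y u" if u: "0 \<le> u" for u
    unfolding sup_gap_def[of \<phi>]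
  proof (rule cSUP_least)
    fix t :: real assume t: "t \<in> {0..}"
    have "gap \<phi> y x u t = gap \<psi> x y u (\<phi> t)"
      using \<phi>(3)[of t] t by (simp add: gap_def levy_dist_sym)
    also have "\<dots> \<le> sup_gap \<psi> x y u" using time_changesD(3)[OF \<phi>(1), of t] t u by (intro gap_le_sup[OF x y \<psi>(1)]) auto
    finally show "gap \<phi> y x u t \<le> sup_gap \<psi> x y u" .
  qed simp
  then have "(LBINT u:{0..}. exp (- u) * sup_gap \<phi> y x u) \<le> (LBINT u:{0..}. exp (- u) * sup_gap \<psi> x y u)"
    by (intro set_integral_mono J1_integrable x y \<psi> \<phi>) auto
  then have "J1_cost \<phi> y x \<le> J1_cost \<psi> x y" using \<phi>(2) unfolding J1_cost_def by (rule max.mono[rotated])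
  then show "J1_dist levy_dist y x \<le> J1_dist levy_dist x y + e"
    using J1_dist_le[OF \<phi>(1), of y x] \<psi>(2) by linarith
qed

lemma J1_dist_triangle:
  assumes x: "x \<in> skorohod_space" and y: "y \<in> skorohod_space" and z: "z \<in> skorohod_space"
  shows "J1_dist levy_dist x z \<le> J1_dist levy_dist x y + J1_dist levy_dist y z"
proof (rule field_le_epsilon)
  fix e :: real assume e: "0 < e"
  obtain \<psi> where \<psi>: "\<psi> \<in> time_changes" "J1_cost \<psi> x y < J1_dist levy_dist x y + e / 2"
    using J1_dist_less[of x y "J1_dist levy_dist x y + e / 2"] e by auto
  obtain \<phi> where \<phi>: "\<phi> \<in> time_changes" "J1_cost \<phi> y z < J1_dist levy_dist y z + e / 2"
    using J1_dist_less[of y z "J1_dist levy_dist y z + e / 2"] e by auto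
  note c = time_change_comp[OF \<psi>(1) \<phi>(1)]
  have "sup_gap (\<phi> \<circ> \<psi>) x z u \<le> sup_gap \<psi> x y u + sup_gap \<phi> y z u" if u: "0 \<le> u" for u
    unfolding sup_gap_def[of "\<phi> \<circ> \<psi>"]
  proof (rule cSUP_least)
    fix t :: real assume t: "t \<in> {0..}"
    have p: "0 \<le> \<psi> t" "0 \<le> \<phi> (\<psi> t)" using t time_changesD(3)[OF \<psi>(1)] time_changesD(3)[OF \<phi>(1)] by auto
    have cd: "x (min t u) \<in> cdfs" "y (min (\<psi> t) u) \<in> cdfs" "z (min (\<phi> (\<psi> t)) u) \<in> cdfs"
      using t u p by (auto intro!: skorohod_cdfs[OF x] skorohod_cdfs[OF y] skorohod_cdfs[OF z])
    have "gap (\<phi> \<circ> \<psi>) x z u t \<le> gap \<psi> x y u t + gap \<phi> y z u (\<psi> t)"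
      using levy_dist_triangle[OF cd] levy_dist_nonneg[OF cd(1,2)] levy_dist_nonneg[OF cd(2,3)]
      by (auto simp: gap_def min_def)
    also have "\<dots> \<le> sup_gap \<psi> x y u + sup_gap \<phi> y z u"
      using t u p by (intro add_mono gap_le_sup[OF x y \<psi>(1)] gap_le_sup[OF y z \<phi>(1)]) auto
    finally show "gap (\<phi> \<circ> \<psi>) x z u t \<le> sup_gap \<psi> x y u + sup_gap \<phi> y z u" .
  qed simp
  then have "(LBINT u:{0..}. exp (- u) * sup_gap (\<phi> \<circ> \<psi>) x z u) \<le>
      (LBINT u:{0..}. exp (- u) * sup_gap \<psi> x y u + exp (- u) * sup_gap \<phi> y z u)"
    by (intro set_integral_mono J1_integrable x y z \<psi> \<phi> c set_integral_add) (auto simp: distrib_left[symmetric])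
  also have "\<dots> = (LBINT u:{0..}. exp (- u) * sup_gap \<psi> x y u) + (LBINT u:{0..}. exp (- u) * sup_gap \<phi> y z u)"
    by (intro set_integral_add J1_integrable x y z \<psi> \<phi>)
  finally have "J1_cost (\<phi> \<circ> \<psi>) x z \<le> J1_cost \<psi> x y + J1_cost \<phi> y z"
    using c(2) unfolding J1_cost_def by linarith
  then show "J1_dist levy_dist x z \<le> J1_dist levy_dist x y + J1_dist levy_dist y z + e"
    using J1_dist_le[OF c(1), of x z] \<psi>(2) \<phi>(2) by linarith
qed

text \<open>The integrand is at most \<open>e * exp (-u)\<close> at ordinary levels, at most 1 on
  the exceptional set B, and at most \<open>exp (-u)\<close> beyond T. The set B is there for
  truncation levels close to a jump, where no time change helps.\<close>

lemma J1_cost_bound: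
  assumes x: "x \<in> skorohod_space" and y: "y \<in> skorohod_space" and \<psi>: "\<psi> \<in> time_changes"
    and B: "B \<in> sets borel" "emeasure lborel B < \<infinity>" and e: "0 \<le> e"
    and le: "\<And>u t. 0 \<le> u \<Longrightarrow> u < T \<Longrightarrow> u \<notin> B \<Longrightarrow> 0 \<le> t \<Longrightarrow> levy_dist (x (min t u)) (y (min (\<psi> t) u)) \<le> e"
  shows "(LBINT u:{0..}. exp (- u) * sup_gap \<psi> x y u) \<le> e + measure lborel B + exp (- T)"
proof -
  let ?k = "\<lambda>u::real. e * (exp (- u) * indicator {0..} u) + indicator B u + exp (- u) * indicator {T..} u"
  have iB: "integrable lborel (indicat_real B)" using B by (intro integrable_real_indicator) auto
  have ki: "integrable lborel ?k" using exp_tail_integral(1) iB by simp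
  have "(LBINT u:{0..}. exp (- u) * sup_gap \<psi> x y u) \<le> (\<integral>u. ?k u \<partial>lborel)"
    unfolding set_lebesgue_integral_def
  proof (rule integral_mono[OF _ ki])
    show "integrable lborel (\<lambda>u. indicator {0..} u *\<^sub>R (exp (- u) * sup_gap \<psi> x y u))"
      using J1_integrable[OF x y \<psi>] by (simp add: set_integrable_def)
    fix u :: real
    show "indicator {0..} u *\<^sub>R (exp (- u) * sup_gap \<psi> x y u) \<le> ?k u"
    proof (cases "0 \<le> u")
      case u: True
      have s1: "sup_gap \<psi> x y u \<le> 1" using sup_gap_bounds[OF x y \<psi> u] by simp
      have nn: "0 \<le> e * (exp (- u) * indicator {0..} u)" "0 \<le> indicat_real B u" "0 \<le> exp (- u) * indicat_real {T..} u"
        using e by auto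
      have L: "indicator {0..} u *\<^sub>R (exp (- u) * sup_gap \<psi> x y u) = exp (- u) * sup_gap \<psi> x y u"
        using u by simp
      consider "u \<in> B" | "T \<le> u" | "u \<notin> B" "u < T" by fastforce
      then show ?thesis
      proof cases
        case 1
        have "exp (- u) * sup_gap \<psi> x y u \<le> 1 * 1" using s1 u sup_gap_bounds[OF x y \<psi> u] by (intro mult_mono) auto
        moreover have "indicat_real B u = 1" using 1 by simp
        ultimately show ?thesis using nn unfolding L by linarith
      next
        case 2
        have "exp (- u) * sup_gap \<psi> x y u \<le> exp (- u) * 1" using s1 by (intro mult_left_mono) auto
        moreover have "exp (- u) * indicat_real {T..} u = exp (- u)" using 2 by simp
        ultimately show ?thesis using nn unfolding L by linarith
      next
        case 3
        have "sup_gap \<psi> x y u \<le> e"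
          unfolding sup_gap_def gap_def using le[OF u 3(2,1)] by (intro cSUP_least) (auto intro: min.coboundedI2)
        then have "exp (- u) * sup_gap \<psi> x y u \<le> exp (- u) * e" by (intro mult_left_mono) auto
        moreover have "e * (exp (- u) * indicat_real {0..} u) = exp (- u) * e" using u by simp
        ultimately show ?thesis using nn unfolding L by linarith
      qed
    qed (use e in simp)
  qed
  also have "\<dots> = e + measure lborel B + exp (- T)"
    using exp_tail_integral iB B by simp
  finally show ?thesis .
qed

lemma J1_dist_uniform:
  assumes x: "x \<in> skorohod_space" and y: "y \<in> skorohod_space" and e: "0 \<le> e"
    and le: "\<And>t. 0 \<le> t \<Longrightarrow> t < T \<Longrightarrow> levy_dist (x t) (y t) \<le> e"
  shows "J1_dist levy_dist x y \<le> e + exp (- T)"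
proof -
  have "(LBINT u:{0..}. exp (- u) * sup_gap (\<lambda>t. t) x y u) \<le> e + measure lborel ({} :: real set) + exp (- T)"
    by (rule J1_cost_bound[OF x y id_time_change(1)]) (use e le in auto)
  then have "J1_cost (\<lambda>t. t) x y \<le> e + exp (- T)"
    using e unfolding J1_cost_def id_time_change(2) by simp
  then show ?thesis using J1_dist_le[OF id_time_change(1), of x y] by linarith
qed

lemma chain_mono:
  fixes a :: "nat \<Rightarrow> real"
  assumes a: "\<And>j. j < p \<Longrightarrow> a j < a (Suc j)" and "i \<le> j" "j \<le> p" shows "a i \<le> a j"
  using assms(2,3)
proof (induction j)
  case (Suc j)
  show ?case
  proof (cases "i = Suc j")
    case False
    then have "a i \<le> a j" using Suc by simp
    then show ?thesis using a[of j] Suc.prems by simp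
  qed simp
qed simp

section \<open>Empirical processes as random elements of the Skorohod space\<close>

lemma limitin_eventually_eq:
  assumes "l \<in> topspace T" "\<forall>\<^sub>F t in F. x t = l" shows "limitin T x l F"
  unfolding limitin_def
proof (intro conjI allI impI)
  fix U assume "openin T U \<and> l \<in> U"
  then show "\<forall>\<^sub>F t in F. x t \<in> U" using assms(2) by (auto elim!: eventually_mono)
qed (rule assms(1))

lemma empirical_cdf_in_cdfs:
  assumes n: "0 < n" shows "empirical_cdf n x \<in> cdfs"
proof -
  have ev: "(empirical_cdf n x \<longlongrightarrow> real (card I) / real n) F"
    if "\<And>i. i < n \<Longrightarrow> \<forall>\<^sub>F y in F. x i \<le> y \<longleftrightarrow> i \<in> I" "I \<subseteq> {..<n}" for I F
  proof (rule tendsto_eventually)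
    have "\<forall>\<^sub>F y in F. \<forall>i\<in>{..<n}. x i \<le> y \<longleftrightarrow> i \<in> I"
      using that(1) by (intro eventually_ball_finite) auto
    then show "\<forall>\<^sub>F y in F. empirical_cdf n x y = real (card I) / real n"
    proof eventually_elim
      case (elim y)
      then have "{i \<in> {..<n}. x i \<le> y} = I" using that(2) by auto
      then show ?case by (simp add: empirical_cdf_def)
    qed
  qed
  have "mono (empirical_cdf n x)"
    unfolding empirical_cdf_def
    by (intro monoI divide_right_mono of_nat_mono card_mono) auto
  moreover have "continuous (at_right y) (empirical_cdf n x)" for y
    unfolding continuous_within empirical_cdf_def[of n x y]
  proof (rule ev)
    fix i assume "i < n"
    show "\<forall>\<^sub>F z in at_right y. x i \<le> z \<longleftrightarrow> i \<in> {i \<in> {..<n}. x i \<le> y}"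
    proof (cases "x i \<le> y")
      case True
      show ?thesis using eventually_at_right_less[of y] by eventually_elim (use True \<open>i < n\<close> in auto)
    next
      case False
      then have "\<forall>\<^sub>F z in at_right y. z < x i"
        unfolding eventually_at_right_field by (intro exI[of _ "x i"]) auto
      then show ?thesis by eventually_elim (use False in auto)
    qed
  qed auto
  moreover have "(empirical_cdf n x \<longlongrightarrow> real (card ({} :: nat set)) / real n) at_bot"
  proof (rule ev)
    fix i
    show "\<forall>\<^sub>F y in at_bot. (x i \<le> y) = (i \<in> {})"
      using eventually_gt_at_bot[of "x i"] by eventually_elim auto
  qed simp
  moreover have "(empirical_cdf n x \<longlongrightarrow> real (card {..<n}) / real n) at_top"
  proof (rule ev)
    fix i assume "i < n"
    then show "\<forall>\<^sub>F y in at_top. (x i \<le> y) = (i \<in> {..<n})"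
      using eventually_ge_at_top[of "x i"] by (auto elim: eventually_mono)
  qed simp
  ultimately show ?thesis using n by (simp add: cdfs_def)
qed

text \<open>Particles are matched by their numbers, so moving each of them by at most e costs at
  most e in the Levy distance.\<close>

lemma levy_dist_empirical:
  assumes n: "0 < n" and ab: "\<And>i. i < n \<Longrightarrow> \<bar>a i - b i\<bar> \<le> e"
  shows "levy_dist (empirical_cdf n a) (empirical_cdf n b) \<le> e"
proof (rule field_le_epsilon)
  fix d :: real assume d: "0 < d"
  have e: "0 \<le> e" using ab[OF n] by linarith
  have le: "empirical_cdf n p (x - (e + d)) \<le> empirical_cdf n q x" if "\<And>i. i < n \<Longrightarrow> \<bar>p i - q i\<bar> \<le> e" for p q x
    unfolding empirical_cdf_def
  proof (intro divide_right_mono of_nat_mono card_mono)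
    show "{i \<in> {..<n}. p i \<le> x - (e + d)} \<subseteq> {i \<in> {..<n}. q i \<le> x}" using that d by fastforce
  qed auto
  have ba: "\<bar>b i - a i\<bar> \<le> e" if "i < n" for i using ab[OF that] by (simp add: abs_minus_commute)
  have "levy_within (empirical_cdf n a) (empirical_cdf n b) (e + d)"
    unfolding levy_within_def
  proof (intro allI conjI)
    fix x
    show "empirical_cdf n a (x - (e + d)) - (e + d) \<le> empirical_cdf n b x"
      using le[of a b x, OF ab] e d by linarith
    show "empirical_cdf n b x \<le> empirical_cdf n a (x + (e + d)) + (e + d)"
      using le[of b a "x + (e + d)", OF ba] e d by simp
  qed
  then show "levy_dist (empirical_cdf n a) (empirical_cdf n b) \<le> e + d"
    using e d by (intro levy_dist_le) auto
qed

lemma empirical_path_tendsto: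
  assumes n: "0 < n" and lim: "\<And>i. i < n \<Longrightarrow> ((\<lambda>t. x i t) \<longlongrightarrow> l i) F"
  shows "limitin weak_topology (\<lambda>t. empirical_cdf n (\<lambda>i. x i t)) (empirical_cdf n l) F"
proof -
  have "((\<lambda>t. levy_dist (empirical_cdf n l) (empirical_cdf n (\<lambda>i. x i t))) \<longlongrightarrow> 0) F"
  proof (rule tendstoI)
    fix e :: real assume e: "0 < e"
    have "\<forall>\<^sub>F t in F. \<forall>i\<in>{..<n}. dist (x i t) (l i) < e / 2"
      by (intro eventually_ball_finite ballI tendstoD) (use lim e in auto)
    then show "\<forall>\<^sub>F t in F. dist (levy_dist (empirical_cdf n l) (empirical_cdf n (\<lambda>i. x i t))) 0 < e"
    proof eventually_elim
      case (elim t)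
      have "levy_dist (empirical_cdf n l) (empirical_cdf n (\<lambda>i. x i t)) \<le> e / 2"
        using elim by (intro levy_dist_empirical n) (auto simp: dist_real_def abs_minus_commute less_imp_le)
      then show ?case
        using levy_dist_nonneg[OF empirical_cdf_in_cdfs[OF n] empirical_cdf_in_cdfs[OF n], of l "\<lambda>i. x i t"] e
        by (simp add: dist_real_def)
    qed
  qed
  then show ?thesis by (simp add: limitin_weak_topology empirical_cdf_in_cdfs[OF n])
qed

lemma empirical_process_skorohod:
  assumes n: "0 < n" and X: "\<And>i. i < n \<Longrightarrow> (\<lambda>t\<in>{0..}. X i t \<omega>) \<in> cadlag_paths euclideanreal"
  shows "empirical_process n X \<omega> \<in> skorohod_space"
  unfolding skorohod_space_def cadlag_paths_def
proof (intro CollectI conjI allI impI)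
  show "empirical_process n X \<omega> \<in> {0..} \<rightarrow>\<^sub>E topspace weak_topology"
    using empirical_cdf_in_cdfs[OF n] by (auto simp: empirical_process_def)
  fix t :: real
  show "limitin weak_topology (empirical_process n X \<omega>) (empirical_process n X \<omega> t) (at_right t)" if t: "0 \<le> t"
  proof -
    have ev: "\<forall>\<^sub>F s in at_right t. 0 \<le> s" using eventually_at_right_less[of t] by eventually_elim (use t in auto)
    have "((\<lambda>s. X i s \<omega>) \<longlongrightarrow> X i t \<omega>) (at_right t)" if i: "i < n" for i
    proof -
      have "((\<lambda>t\<in>{0..}. X i t \<omega>) \<longlongrightarrow> X i t \<omega>) (at_right t)"
        using X[OF i] t by (auto simp: cadlag_paths_def)
      then show ?thesis by (rule Lim_transform_eventually) (use ev in \<open>auto elim: eventually_mono\<close>)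
    qed
    from empirical_path_tendsto[OF n this]
    have "limitin weak_topology (\<lambda>s. empirical_cdf n (\<lambda>i. X i s \<omega>)) (empirical_process n X \<omega> t) (at_right t)"
      using t by (simp add: empirical_process_def)
    then show ?thesis
      by (rule limitin_cong_ev[rotated]) (use ev in \<open>auto simp: empirical_process_def elim: eventually_mono\<close>)
  qed
  show "\<exists>l. limitin weak_topology (empirical_process n X \<omega>) l (at_left t)" if t: "0 < t"
  proof -
    have ev: "\<forall>\<^sub>F s in at_left t. 0 \<le> s" unfolding eventually_at_left_field using t by (intro exI[of _ 0]) auto
    have "\<exists>l. ((\<lambda>s. X i s \<omega>) \<longlongrightarrow> l) (at_left t)" if i: "i < n" for i
    proof -
      obtain l where "((\<lambda>t\<in>{0..}. X i t \<omega>) \<longlongrightarrow> l) (at_left t)"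
        using X[OF i] t by (auto simp: cadlag_paths_def)
      then have "((\<lambda>s. X i s \<omega>) \<longlongrightarrow> l) (at_left t)"
        by (rule Lim_transform_eventually) (use ev in \<open>auto elim: eventually_mono\<close>)
      then show ?thesis by blast
    qed
    then obtain l where "\<And>i. i < n \<Longrightarrow> ((\<lambda>s. X i s \<omega>) \<longlongrightarrow> l i) (at_left t)" by metis
    from empirical_path_tendsto[OF n this]
    have "limitin weak_topology (\<lambda>s. empirical_cdf n (\<lambda>i. X i s \<omega>)) (empirical_cdf n l) (at_left t)" .
    then have "limitin weak_topology (empirical_process n X \<omega>) (empirical_cdf n l) (at_left t)"
      by (rule limitin_cong_ev[rotated]) (use ev in \<open>auto simp: empirical_process_def elim: eventually_mono\<close>)
    then show ?thesis by blast
  qed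
qed

lemma grid_path_skorohod:
  assumes G: "\<And>k. G k \<in> cdfs" and N: "0 < N"
  shows "(\<lambda>t\<in>{0..}. G (nat \<lfloor>t * real N\<rfloor>)) \<in> skorohod_space"
  unfolding skorohod_space_def cadlag_paths_def
proof (intro CollectI conjI allI impI)
  let ?x = "\<lambda>t\<in>{0..}. G (nat \<lfloor>t * real N\<rfloor>)"
  show "?x \<in> {0..} \<rightarrow>\<^sub>E topspace weak_topology" using G by auto
  fix t :: real
  show "limitin weak_topology ?x (?x t) (at_right t)" if t: "0 \<le> t"
  proof (rule limitin_eventually_eq)
    let ?b = "(real_of_int \<lfloor>t * real N\<rfloor> + 1) / real N"
    have "t * real N < real_of_int \<lfloor>t * real N\<rfloor> + 1" by linarith
    then have "t < ?b" using N by (simp add: pos_less_divide_eq)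
    moreover have "?x s = ?x t" if "t < s" "s < ?b" for s
    proof -
      have "s * real N < real_of_int \<lfloor>t * real N\<rfloor> + 1" using that(2) N by (simp add: pos_less_divide_eq)
      moreover have "t * real N \<le> s * real N" using that(1) by (intro mult_right_mono) auto
      ultimately have "\<lfloor>s * real N\<rfloor> = \<lfloor>t * real N\<rfloor>" by linarith
      then show ?thesis using that t by simp
    qed
    ultimately show "\<forall>\<^sub>F s in at_right t. ?x s = ?x t" unfolding eventually_at_right_field by blast
  qed (use G t in auto)
  show "\<exists>l. limitin weak_topology ?x l (at_left t)" if t: "0 < t"
  proof (rule exI, rule limitin_eventually_eq)
    \<comment> \<open>The index of the last cell before t; the ceiling gives the correct one also
      when t is itself a grid time.\<close>
    let ?l = "G (nat (\<lceil>t * real N\<rceil> - 1))"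
    let ?b = "max 0 ((real_of_int \<lceil>t * real N\<rceil> - 1) / real N)"
    have "real_of_int \<lceil>t * real N\<rceil> - 1 < t * real N" by linarith
    then have "?b < t" using N t by (simp add: pos_divide_less_eq)
    moreover have "?x s = ?l" if "?b < s" "s < t" for s
    proof -
      have "real_of_int \<lceil>t * real N\<rceil> - 1 < s * real N" using that(1) N by (simp add: pos_divide_less_eq)
      moreover have "s * real N < t * real N" using that(2) N by simp
      ultimately have "\<lfloor>s * real N\<rfloor> = \<lceil>t * real N\<rceil> - 1" by linarith
      then show ?thesis using that by simp
    qed
    ultimately show "\<forall>\<^sub>F s in at_left t. ?x s = ?l" unfolding eventually_at_left_field by blast
    show "?l \<in> topspace weak_topology" using G by simp
  qed
qed

text \<open>A supremum argument: \<open>R b\<close> says that \<open>[0, b)\<close> splits into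
  finitely many pieces of oscillation at most e. Left limits show that the supremum of such b is
  attained, right continuity that it cannot lie below T.\<close>

lemma cadlag_partition:
  assumes y: "y \<in> skorohod_space" and T: "0 < T" and e: "0 < e"
  obtains p :: nat and ts where "ts 0 = 0" "ts p = T" "\<And>j. j < p \<Longrightarrow> ts j < ts (Suc j)"
    "\<And>j w w'. j < p \<Longrightarrow> ts j \<le> w \<Longrightarrow> w < ts (Suc j) \<Longrightarrow> ts j \<le> w' \<Longrightarrow> w' < ts (Suc j) \<Longrightarrow>
       levy_dist (y w) (y w') \<le> e"
proof -
  define good where "good a b \<longleftrightarrow> (\<forall>w w'. a \<le> w \<and> w < b \<and> a \<le> w' \<and> w' < b \<longrightarrow> levy_dist (y w) (y w') \<le> e)" for a b
  define R where "R b \<longleftrightarrow> (\<exists>p ts. ts 0 = 0 \<and> ts (p::nat) = b \<and> (\<forall>j<p. ts j < ts (Suc j) \<and> good (ts j) (ts (Suc j))))" for b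
  have R0: "R 0" unfolding R_def by (rule exI[of _ 0], rule exI[of _ "\<lambda>_. 0"]) simp
  have Rstep: "R b" if a: "R a" and "a < b" "good a b" for a b
  proof -
    obtain p ts where p: "ts 0 = 0" "ts (p::nat) = a" "\<forall>j<p. ts j < ts (Suc j) \<and> good (ts j) (ts (Suc j))"
      using a unfolding R_def by blast
    have "\<forall>j<Suc p. (ts(Suc p := b)) j < (ts(Suc p := b)) (Suc j) \<and> good ((ts(Suc p := b)) j) ((ts(Suc p := b)) (Suc j))"
      using p that by (auto simp: less_Suc_eq)
    then show ?thesis unfolding R_def using p(1) by (intro exI[of _ "Suc p"] exI[of _ "ts(Suc p := b)"]) auto
  qed
  have e2: "0 < e / 2" using e by simp
  have near: "levy_dist (y w) (y w') \<le> e"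
    if "l \<in> cdfs" "0 \<le> w" "0 \<le> w'" "levy_dist l (y w) < e / 2" "levy_dist l (y w') < e / 2" for l w w'
    using levy_dist_triangle[OF skorohod_cdfs[OF y that(2)] that(1) skorohod_cdfs[OF y that(3)]]
      levy_dist_sym[of l "y w"] that by linarith
  have right: "\<exists>d>0. good t (t + d)" if t: "0 \<le> t" for t
  proof -
    obtain d where d: "d > 0" "\<forall>w. t \<le> w \<and> w < t + d \<longrightarrow> levy_dist (y t) (y w) < e / 2"
      using skorohod_right[OF y t e2] by blast
    have "good t (t + d)" unfolding good_def
    proof (intro allI impI)
      fix w w' assume *: "t \<le> w \<and> w < t + d \<and> t \<le> w' \<and> w' < t + d"
      show "levy_dist (y w) (y w') \<le> e"
        by (rule near[OF skorohod_cdfs[OF y t]]) (use * d t in auto)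
    qed
    then show ?thesis using d(1) by blast
  qed
  have left: "\<exists>d>0. \<forall>b. t - d < b \<and> 0 \<le> b \<longrightarrow> good b t" if t: "0 < t" for t
  proof -
    obtain l where l: "l \<in> cdfs"
      "\<And>e. 0 < e \<Longrightarrow> \<exists>d>0. \<forall>w. t - d < w \<and> w < t \<and> 0 \<le> w \<longrightarrow> levy_dist l (y w) < e"
      using skorohod_left[OF y t] by blast
    obtain d where d: "d > 0" "\<forall>w. t - d < w \<and> w < t \<and> 0 \<le> w \<longrightarrow> levy_dist l (y w) < e / 2"
      using l(2)[OF e2] by blast
    have "good b t" if "t - d < b" "0 \<le> b" for b unfolding good_def
    proof (intro allI impI)
      fix w w' assume *: "b \<le> w \<and> w < t \<and> b \<le> w' \<and> w' < t"
      show "levy_dist (y w) (y w') \<le> e" by (rule near[OF l(1)]) (use * d that in auto)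
    qed
    then show ?thesis using d(1) by blast
  qed
  have good_sub: "good a c" if "good a b" "c \<le> b" for a b c using that unfolding good_def by fastforce
  define B where "B = {b. 0 \<le> b \<and> b \<le> T \<and> R b}"
  have B0: "0 \<in> B" using R0 T by (simp add: B_def)
  have bdd: "bdd_above B" by (rule bdd_aboveI[of _ T]) (simp add: B_def)
  define s where "s = Sup B"
  have s0: "0 \<le> s" unfolding s_def by (rule cSup_upper[OF B0 bdd])
  have sT: "s \<le> T" unfolding s_def using B0 by (intro cSup_least) (auto simp: B_def)
  have Rs: "R s"
  proof (cases "s = 0")
    case True then show ?thesis using R0 by simp
  next
    case False
    then obtain d where d: "d > 0" "\<forall>b. s - d < b \<and> 0 \<le> b \<longrightarrow> good b s" using left[of s] s0 by auto
    have "s - d < Sup B" using d by (simp add: s_def)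
    then obtain b where b: "b \<in> B" "s - d < b" using less_cSup_iff[OF _ bdd] B0 by blast
    have "b \<le> s" unfolding s_def by (rule cSup_upper[OF b(1) bdd])
    then show ?thesis using b d(2) Rstep[of b s] by (cases "b = s") (auto simp: B_def)
  qed
  have "s = T"
  proof (rule ccontr)
    assume "s \<noteq> T"
    then have lt: "s < T" using sT by simp
    obtain d where d: "d > 0" "good s (s + d)" using right[OF s0] by blast
    have g: "good s (min T (s + d))" by (rule good_sub[OF d(2)]) simp
    have "R (min T (s + d))" by (rule Rstep[OF Rs _ g]) (use lt d in simp)
    then have "min T (s + d) \<in> B" using s0 T d by (simp add: B_def)
    then have "min T (s + d) \<le> s" unfolding s_def by (rule cSup_upper[OF _ bdd])
    then show False using lt d by auto
  qed
  then have "R T" using Rs by simp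
  then obtain p ts where q: "ts 0 = 0" "ts (p::nat) = T"
    "\<forall>j<p. ts j < ts (Suc j) \<and> good (ts j) (ts (Suc j))"
    unfolding R_def by blast
  show ?thesis
  proof (rule that[of ts p, OF q(1,2)])
    fix j w w' assume j: "j < p"
    then show "ts j < ts (Suc j)" using q(3) by blast
    assume w: "ts j \<le> w" "w < ts (Suc j)" "ts j \<le> w'" "w' < ts (Suc j)"
    have "good (ts j) (ts (Suc j))" using q(3) j by blast
    then show "levy_dist (y w) (y w') \<le> e" using w unfolding good_def by blast
  qed
qed

section \<open>Piecewise linear time changes and approximation on a time grid\<close>

lemma time_changeI:
  assumes z: "\<psi> 0 = 0" and h: "0 \<le> h"
    and low: "\<And>s t. 0 \<le> t \<Longrightarrow> t < s \<Longrightarrow> exp (- h) * (s - t) \<le> \<psi> s - \<psi> t"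
    and up: "\<And>s t. 0 \<le> t \<Longrightarrow> t < s \<Longrightarrow> \<psi> s - \<psi> t \<le> exp h * (s - t)"
  shows "\<psi> \<in> time_changes" "time_change_norm \<psi> \<le> h"
proof -
  have b: "\<bar>ln ((\<psi> s - \<psi> t) / (s - t))\<bar> \<le> h" if "0 \<le> t" "t < s" for s t
  proof -
    let ?q = "(\<psi> s - \<psi> t) / (s - t)"
    have q: "exp (- h) \<le> ?q" "?q \<le> exp h"
      using low[OF that] up[OF that] that by (auto simp: pos_le_divide_eq pos_divide_le_eq)
    have "0 < ?q" using q(1) by (rule less_le_trans[OF exp_gt_zero])
    then have "ln (exp (- h)) \<le> ln ?q" "ln ?q \<le> ln (exp h)" using q by (simp_all only: ln_le_cancel_iff exp_gt_zero)
    then show ?thesis by simp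
  qed
  show "time_change_norm \<psi> \<le> h" by (rule time_change_norm_least(1)) (rule b)
  have bd: "bdd_above (log_slopes \<psi>)" by (rule time_change_norm_least(2)) (rule b)
  have sm: "\<psi> t < \<psi> s" if "0 \<le> t" "t < s" for s t
  proof -
    have "0 < exp (- h) * (s - t)" using that by simp
    then show ?thesis using low[OF that] by linarith
  qed
  have nn: "0 \<le> \<psi> t" if "0 \<le> t" for t using sm[of 0 t] that z by (cases "t = 0") auto
  have cont: "continuous_on {0..} \<psi>"
  proof (rule lipschitz_on_continuous_on[where L="exp h"], rule lipschitz_onI)
    fix s t :: real assume "s \<in> {0..}" "t \<in> {0..}"
    then show "dist (\<psi> s) (\<psi> t) \<le> exp h * dist s t"
      using up[of s t] up[of t s] sm[of s t] sm[of t s]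
      by (cases s t rule: linorder_cases) (auto simp: dist_real_def)
  qed simp
  have "{0..} \<subseteq> \<psi> ` {0..}"
  proof
    fix w :: real assume w: "w \<in> {0..}"
    define b where "b = w * exp h"
    have b0: "0 \<le> b" using w by (simp add: b_def)
    have "w \<le> \<psi> b"
    proof (cases "b = 0")
      case True then show ?thesis using z by (simp add: b_def)
    next
      case False
      then have "exp (- h) * b \<le> \<psi> b" using low[of 0 b] b0 z by simp
      moreover have "exp (- h) * b = w" by (simp add: b_def exp_minus)
      ultimately show ?thesis by simp
    qed
    then obtain t where "0 \<le> t" "\<psi> t = w"
      using IVT'[of \<psi> 0 w b] z w b0 continuous_on_subset[OF cont, of "{0..b}"] by auto
    then show "w \<in> \<psi> ` {0..}" by force
  qed
  then have "\<psi> ` {0..} = {0..}" using nn by auto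
  then show "\<psi> \<in> time_changes" using bd sm by (auto simp: time_changes_def strict_mono_on_def)
qed

text \<open>\<open>\<psi>\<close> adds up the slopes \<open>c j\<close> times the part of
  \<open>[0, t]\<close> inside the j-th interval, with slope 1 after the last one. The slope bounds
  hold term by term, as these parts add up to t.\<close>

lemma piecewise_linear_time_change:
  fixes ss ts :: "nat \<Rightarrow> real"
  assumes 0: "ss 0 = 0" "ts 0 = 0" and ss: "\<And>j. j < p \<Longrightarrow> ss j < ss (Suc j)" and h: "0 \<le> h"
    and slopes: "\<And>j. j < p \<Longrightarrow> exp (- h) * (ss (Suc j) - ss j) \<le> ts (Suc j) - ts j"
      "\<And>j. j < p \<Longrightarrow> ts (Suc j) - ts j \<le> exp h * (ss (Suc j) - ss j)"
  obtains \<psi> where "\<psi> \<in> time_changes" "time_change_norm \<psi> \<le> h" "\<And>j. j \<le> p \<Longrightarrow> \<psi> (ss j) = ts j"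
proof -
  define c where "c j = (ts (Suc j) - ts j) / (ss (Suc j) - ss j)" for j
  have c: "exp (- h) \<le> c j" "c j \<le> exp h" if "j < p" for j
    using slopes[OF that] ss[OF that] by (auto simp: c_def pos_le_divide_eq pos_divide_le_eq)
  have ssm: "i \<le> j \<Longrightarrow> j \<le> p \<Longrightarrow> ss i \<le> ss j" for i j
    by (rule chain_mono[of p ss i j, OF ss])
  define d where "d j t = min t (ss (Suc j)) - min t (ss j)" for j t
  define \<psi> where "\<psi> t = (\<Sum>j<p. c j * d j t) + (t - min t (ss p))" for t
  have tele: "(\<Sum>j<q. d j t) = min t (ss q) - min t 0" for t q
    by (induction q) (auto simp: d_def 0)
  have dmono: "d j t \<le> d j s" if "j < p" "t \<le> s" for j s t
    using ss[OF that(1)] that(2) by (auto simp: d_def min_def)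
  have rmono: "t - min t (ss p) \<le> s - min s (ss p)" if "t \<le> s" for s t using that by (auto simp: min_def)
  have tot: "(\<Sum>j<p. d j s - d j t) + ((s - min s (ss p)) - (t - min t (ss p))) = s - t" if "0 \<le> t" "t < s" for s t
    using that by (simp add: sum_subtractf tele)
  have diff: "\<psi> s - \<psi> t = (\<Sum>j<p. c j * (d j s - d j t)) + ((s - min s (ss p)) - (t - min t (ss p)))" for s t
    by (simp add: \<psi>_def sum_subtractf right_diff_distrib)
  have e1: "exp (- h) \<le> 1" "1 \<le> exp h" using h by auto
  have low: "exp (- h) * (s - t) \<le> \<psi> s - \<psi> t" if "0 \<le> t" "t < s" for s t
  proof -
    have "exp (- h) * (s - t) = (\<Sum>j<p. exp (- h) * (d j s - d j t)) + exp (- h) * ((s - min s (ss p)) - (t - min t (ss p)))"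
      unfolding tot[OF that, symmetric] distrib_left sum_distrib_left ..
    also have "\<dots> \<le> (\<Sum>j<p. c j * (d j s - d j t)) + 1 * ((s - min s (ss p)) - (t - min t (ss p)))"
      using c(1) dmono[of _ t s] rmono[of t s] that e1
      by (intro add_mono sum_mono mult_right_mono) auto
    finally show ?thesis by (simp add: diff)
  qed
  have up: "\<psi> s - \<psi> t \<le> exp h * (s - t)" if "0 \<le> t" "t < s" for s t
  proof -
    have "\<psi> s - \<psi> t = (\<Sum>j<p. c j * (d j s - d j t)) + 1 * ((s - min s (ss p)) - (t - min t (ss p)))"
      by (simp add: diff)
    also have "\<dots> \<le> (\<Sum>j<p. exp h * (d j s - d j t)) + exp h * ((s - min s (ss p)) - (t - min t (ss p)))"
      using c(2) dmono[of _ t s] rmono[of t s] that e1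
      by (intro add_mono sum_mono mult_right_mono) auto
    also have "\<dots> = exp h * (s - t)"
      unfolding tot[OF that, symmetric] distrib_left sum_distrib_left ..
    finally show ?thesis .
  qed
  have val: "\<psi> (ss i) = ts i" if i: "i \<le> p" for i
  proof -
    have "(\<Sum>j<p. c j * d j (ss i)) = (\<Sum>j<i. c j * d j (ss i))"
    proof (rule sum.mono_neutral_right)
      show "\<forall>j\<in>{..<p} - {..<i}. c j * d j (ss i) = 0"
      proof
        fix j assume "j \<in> {..<p} - {..<i}"
        then have "ss i \<le> ss j" "ss i \<le> ss (Suc j)" using ssm by auto
        then show "c j * d j (ss i) = 0" by (simp add: d_def)
      qed
    qed (use i in auto)
    also have "\<dots> = (\<Sum>j<i. ts (Suc j) - ts j)"
    proof (rule sum.cong[OF refl])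
      fix j assume "j \<in> {..<i}"
      then have "ss j \<le> ss i" "ss (Suc j) \<le> ss i" "ss j < ss (Suc j)" using ssm i ss by auto
      then show "c j * d j (ss i) = ts (Suc j) - ts j" by (simp add: d_def c_def)
    qed
    also have "\<dots> = ts i" by (simp add: sum_lessThan_telescope 0)
    finally show ?thesis using ssm[OF i] by (simp add: \<psi>_def)
  qed
  have z: "\<psi> 0 = 0" using val[of 0] 0 by simp
  show ?thesis
    using that[OF time_changeI(1)[OF z h low up] time_changeI(2)[OF z h low up] val] .
qed

text \<open>The grid path jumps only at grid times, y at arbitrary ones. The time change sends the
  first grid time at or after each partition point of y to that point, and its slopes tend to 1. At
  corresponding times both arguments of y lie in one partition interval, where y oscillates by at
  most e.\<close>

lemma J1_grid_approximation:
  assumes y: "y \<in> skorohod_space" and Z: "\<And>N. Z N \<in> skorohod_space"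
    and close: "\<And>N t. 0 \<le> t \<Longrightarrow> t < real (Suc N) \<Longrightarrow>
       levy_dist (Z N t) (y (real_of_int \<lfloor>t * real (Suc N)\<rfloor> / real (Suc N))) \<le> 1 / real (Suc N)"
  shows "(\<lambda>N. J1_dist levy_dist (Z N) y) \<longlonglongrightarrow> 0"
proof (rule tendstoI)
  fix e0 :: real assume e0: "0 < e0"
  \<comment> \<open>The total cost is at most \<open>4 * e\<close>: \<open>2 * e\<close> from the
    gap, e from exceptional levels and e from the tail.\<close>
  define e where "e = e0 / 5"
  have e: "0 < e" using e0 by (simp add: e_def)
  define T where "T = max 1 (- ln e)"
  have T: "0 < T" "exp (- T) \<le> e"
  proof -
    show "0 < T" by (simp add: T_def)
    have "exp (- T) \<le> exp (ln e)" by (simp add: T_def)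
    then show "exp (- T) \<le> e" using e by simp
  qed
  obtain p ts where ts: "ts 0 = 0" "ts p = T" "\<And>j. j < p \<Longrightarrow> ts j < ts (Suc j)"
    and osc: "\<And>j w w'. j < p \<Longrightarrow> ts j \<le> w \<Longrightarrow> w < ts (Suc j) \<Longrightarrow> ts j \<le> w' \<Longrightarrow> w' < ts (Suc j) \<Longrightarrow>
       levy_dist (y w) (y w') \<le> e"
    using cadlag_partition[OF y T(1) e] by blast
  have tsm: "i \<le> j \<Longrightarrow> j \<le> p \<Longrightarrow> ts i \<le> ts j" for i j
    by (rule chain_mono[of p ts i j, OF ts(3)])
  have ts0: "j \<le> p \<Longrightarrow> 0 \<le> ts j" for j using tsm[of 0 j] ts(1) by simp
  define ss where "ss N j = real_of_int \<lceil>ts j * real (Suc N)\<rceil> / real (Suc N)" for N j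
  have ss_ge: "ts j \<le> ss N j" for N j
  proof -
    have "ts j * real (Suc N) \<le> real_of_int \<lceil>ts j * real (Suc N)\<rceil>" by linarith
    then show ?thesis unfolding ss_def by (simp add: pos_le_divide_eq del: of_nat_Suc)
  qed
  have ss_le: "ss N j \<le> ts j + 1 / real (Suc N)" for N j
  proof -
    have "real_of_int \<lceil>ts j * real (Suc N)\<rceil> \<le> ts j * real (Suc N) + 1" by linarith
    then have "ss N j \<le> (ts j * real (Suc N) + 1) / real (Suc N)" unfolding ss_def by (intro divide_right_mono) auto
    then show ?thesis by (simp add: add_divide_distrib del: of_nat_Suc)
  qed
  have inv0: "(\<lambda>N. 1 / real (Suc N)) \<longlonglongrightarrow> 0"
    using LIMSEQ_inverse_real_of_nat by (simp add: divide_inverse)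
  have ss_lim: "(\<lambda>N. ss N j) \<longlonglongrightarrow> ts j" for j
  proof (rule tendsto_sandwich[OF _ _ tendsto_const])
    show "(\<lambda>N. ts j + 1 / real (Suc N)) \<longlonglongrightarrow> ts j"
      using tendsto_add[OF tendsto_const inv0, of "ts j"] by simp
  qed (use ss_ge ss_le in auto)
  have dpos: "0 < ts (Suc j) - ts j" if "j < p" for j using ts(3)[OF that] by simp
  have slopes: "\<forall>\<^sub>F N in sequentially. \<forall>j\<in>{..<p}. exp (- e) * (ss N (Suc j) - ss N j) < ts (Suc j) - ts j \<and>
      ts (Suc j) - ts j < exp e * (ss N (Suc j) - ss N j)"
  proof (rule eventually_ball_finite, simp, rule ballI)
    fix j assume j: "j \<in> {..<p}"
    have lim: "(\<lambda>N. c * (ss N (Suc j) - ss N j)) \<longlonglongrightarrow> c * (ts (Suc j) - ts j)" for c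
      by (intro tendsto_intros ss_lim)
    have "exp (- e) * (ts (Suc j) - ts j) < 1 * (ts (Suc j) - ts j)" "1 * (ts (Suc j) - ts j) < exp e * (ts (Suc j) - ts j)"
      using dpos j e by (intro mult_strict_right_mono; auto)+
    then show "\<forall>\<^sub>F N in sequentially. exp (- e) * (ss N (Suc j) - ss N j) < ts (Suc j) - ts j \<and>
        ts (Suc j) - ts j < exp e * (ss N (Suc j) - ss N j)"
      using order_tendstoD(2)[OF lim] order_tendstoD(1)[OF lim] by (intro eventually_conj) auto
  qed
  have "(\<lambda>N. real (Suc p) * (1 / real (Suc N))) \<longlonglongrightarrow> real (Suc p) * 0" by (intro tendsto_intros inv0)
  then have small: "\<forall>\<^sub>F N in sequentially. real (Suc p) * (1 / real (Suc N)) < e"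
    using e order_tendstoD(2) by fastforce
  have big: "\<forall>\<^sub>F N in sequentially. T \<le> real N"
    using filterlim_real_sequentially unfolding filterlim_at_top by blast
  show "\<forall>\<^sub>F N in sequentially. dist (J1_dist levy_dist (Z N) y) 0 < e0"
    using slopes small big
  proof eventually_elim
    case (elim N)
    let ?N = "real (Suc N)"
    have Npos: "0 < ?N" by simp
    have ss0: "ss N 0 = 0" by (simp add: ss_def ts(1))
    have ss_less: "ss N j < ss N (Suc j)" if "j < p" for j
    proof -
      have "0 < exp e * (ss N (Suc j) - ss N j)" using elim(1) dpos[OF that] that by force
      then show ?thesis by (simp add: zero_less_mult_iff)
    qed
    obtain \<psi> where \<psi>: "\<psi> \<in> time_changes" "time_change_norm \<psi> \<le> e" "\<And>j. j \<le> p \<Longrightarrow> \<psi> (ss N j) = ts j"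
    proof (rule piecewise_linear_time_change[of "ss N" ts p e])
      show "exp (- e) * (ss N (Suc j) - ss N j) \<le> ts (Suc j) - ts j"
        "ts (Suc j) - ts j \<le> exp e * (ss N (Suc j) - ss N j)" if "j < p" for j
        using elim(1) that by (auto simp: less_imp_le)
    qed (use ss0 ts ss_less e in auto)
    have tau: "ts j \<le> real_of_int \<lfloor>w * ?N\<rfloor> / ?N \<and> real_of_int \<lfloor>w * ?N\<rfloor> / ?N < ts (Suc j)"
      if "ss N j \<le> w" "w < ss N (Suc j)" for j w
    proof -
      have "real_of_int \<lceil>ts j * ?N\<rceil> \<le> w * ?N"
        using that(1) by (simp add: ss_def pos_divide_le_eq del: of_nat_Suc)
      then have "\<lceil>ts j * ?N\<rceil> \<le> \<lfloor>w * ?N\<rfloor>" by linarith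
      then have a: "ts j * ?N \<le> real_of_int \<lfloor>w * ?N\<rfloor>" by linarith
      have "w * ?N < real_of_int \<lceil>ts (Suc j) * ?N\<rceil>"
        using that(2) by (simp add: ss_def pos_less_divide_eq del: of_nat_Suc)
      then have "\<lfloor>w * ?N\<rfloor> < \<lceil>ts (Suc j) * ?N\<rceil>" by linarith
      then have "\<lfloor>w * ?N\<rfloor> \<le> \<lceil>ts (Suc j) * ?N\<rceil> - 1" by simp
      then have "real_of_int \<lfloor>w * ?N\<rfloor> \<le> real_of_int \<lceil>ts (Suc j) * ?N\<rceil> - 1" by linarith
      also have "\<dots> < ts (Suc j) * ?N" by linarith
      finally have "real_of_int \<lfloor>w * ?N\<rfloor> < ts (Suc j) * ?N" .
      then show ?thesis using a Npos by (simp add: pos_le_divide_eq pos_divide_less_eq del: of_nat_Suc)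
    qed
    have find: "\<exists>j<p. a j \<le> w \<and> w < a (Suc j)" if "a 0 \<le> w" "w < a p" for a :: "nat \<Rightarrow> real" and w
    proof -
      define q where "q = (LEAST q. w < a q)"
      have q: "w < a q" unfolding q_def by (rule LeastI[of _ p]) (rule that(2))
      have qp: "q \<le> p" unfolding q_def by (rule Least_le) (rule that(2))
      have "q \<noteq> 0" using q that(1) by (metis not_le)
      then obtain j where j: "q = Suc j" by (cases q) auto
      have "\<not> w < a j" using not_less_Least[of j "\<lambda>q. w < a q"] j by (simp add: q_def)
      then show ?thesis using q qp j by (intro exI[of _ j]) auto
    qed
    \<comment> \<open>Levels u that have passed a partition point of y but at which the grid path
      may not yet have followed.\<close>
    define B where "B = (\<Union>j\<in>{..p}. {ts j..ss N j})"
    have Bm: "B \<in> sets borel" unfolding B_def by (intro sets.finite_UN) auto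
    have "emeasure lborel B \<le> (\<Sum>j\<in>{..p}. emeasure lborel {ts j..ss N j})"
      unfolding B_def by (intro emeasure_subadditive_finite) auto
    also have "\<dots> = (\<Sum>j\<in>{..p}. ennreal (ss N j - ts j))" using ss_ge by simp
    also have "\<dots> \<le> (\<Sum>j\<in>{..p}. ennreal (1 / ?N))"
      using ss_le by (intro sum_mono ennreal_leI) (simp add: algebra_simps)
    also have "\<dots> = ennreal (\<Sum>j\<in>{..p}. 1 / ?N)" by (rule sum_ennreal) simp
    also have "\<dots> = ennreal (real (Suc p) * (1 / ?N))" by (simp del: of_nat_Suc)
    finally have Be: "emeasure lborel B \<le> ennreal (real (Suc p) * (1 / ?N))" .
    then have Bf: "emeasure lborel B < \<infinity>" by (rule le_less_trans) simp
    have Bme: "measure lborel B \<le> e"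
    proof -
      have "measure lborel B \<le> real (Suc p) * (1 / ?N)"
        using Be Bf by (simp add: emeasure_eq_ennreal_measure del: of_nat_Suc)
      then show ?thesis using elim(2) by linarith
    qed
    have "(LBINT u:{0..}. exp (- u) * sup_gap \<psi> (Z N) y u) \<le> 2 * e + measure lborel B + exp (- T)"
    proof (rule J1_cost_bound[OF Z y \<psi>(1) Bm Bf])
      fix u t :: real assume u: "0 \<le> u" "u < T" "u \<notin> B" and t: "0 \<le> t"
      let ?w = "min t u"
      let ?tau = "real_of_int \<lfloor>?w * ?N\<rfloor> / ?N"
      have w: "0 \<le> ?w" "?w < ?N" using u t elim(3) by auto
      have \<psi>t: "0 \<le> \<psi> t" by (rule time_changesD(3)[OF \<psi>(1) t])
      \<comment> \<open>For \<open>t < u\<close> the interval is found from the grid times and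
        carried over by \<open>\<psi>\<close>. Otherwise it is found from u itself, and
        \<open>u \<notin> B\<close> excludes that u lies between a partition point and its grid
        time.\<close>
      have same: "\<exists>j<p. ts j \<le> ?tau \<and> ?tau < ts (Suc j) \<and> ts j \<le> min (\<psi> t) u \<and> min (\<psi> t) u < ts (Suc j)"
      proof (cases "t < u")
        case True
        have "t < ss N p" using True u ss_ge[of p N] ts(2) by simp
        then obtain j where j: "j < p" "ss N j \<le> t" "t < ss N (Suc j)" using find[of "ss N" t] ss0 t by auto
        have s0: "0 \<le> ss N j" using ts0[of j] ss_ge[of j N] j(1) by linarith
        have a: "ts j \<le> \<psi> t" using time_changesD(2)[OF \<psi>(1) s0 j(2)] \<psi>(3)[of j] j(1) by simp
        have b: "\<psi> t < ts (Suc j)" using time_changesD(1)[OF \<psi>(1) t j(3)] \<psi>(3)[of "Suc j"] j(1) by simp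
        have c: "ts j \<le> u" using True j(2) ss_ge[of j N] by linarith
        show ?thesis using tau[OF j(2,3)] True a b c j(1) by (intro exI[of _ j]) (auto simp: min_def)
      next
        case False
        obtain j where j: "j < p" "ts j \<le> u" "u < ts (Suc j)" using find[of ts u] ts(1,2) u by auto
        have "ss N j < u" using u(3) j by (force simp: B_def)
        then have su: "ss N j \<le> u" "u < ss N (Suc j)" using j(3) ss_ge[of "Suc j" N] by auto
        have s0: "0 \<le> ss N j" using ts0[of j] ss_ge[of j N] j(1) by linarith
        have a: "ts j \<le> \<psi> t" using time_changesD(2)[OF \<psi>(1) s0, of t] su False \<psi>(3)[of j] j(1) by simp
        show ?thesis using tau[OF su] False a j by (intro exI[of _ j]) (auto simp: min_def)
      qed
      then obtain j where j: "j < p" "ts j \<le> ?tau" "?tau < ts (Suc j)" "ts j \<le> min (\<psi> t) u" "min (\<psi> t) u < ts (Suc j)"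
        by blast
      have "levy_dist (y ?tau) (y (min (\<psi> t) u)) \<le> e" by (rule osc[OF j])
      moreover have "levy_dist (Z N ?w) (y ?tau) \<le> 1 / ?N" by (rule close[OF w])
      moreover have "1 / ?N \<le> real (Suc p) * (1 / ?N)" by (simp add: divide_right_mono)
      then have "1 / ?N \<le> e" using elim(2) by linarith
      moreover have "levy_dist (Z N ?w) (y (min (\<psi> t) u)) \<le> levy_dist (Z N ?w) (y ?tau) + levy_dist (y ?tau) (y (min (\<psi> t) u))"
        using w(1) j ts0[of j] u(1) \<psi>t by (intro levy_dist_triangle skorohod_cdfs[OF Z] skorohod_cdfs[OF y]) auto
      ultimately show "levy_dist (Z N ?w) (y (min (\<psi> t) u)) \<le> 2 * e" by linarith
    qed (use e in simp)
    then have "J1_cost \<psi> (Z N) y \<le> 4 * e" using Bme T(2) \<psi>(2) e unfolding J1_cost_def by simp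
    then have "J1_dist levy_dist (Z N) y \<le> 4 * e" using J1_dist_le[OF \<psi>(1), of "Z N" y] by linarith
    then show ?case using J1_dist_nonneg[of "Z N" y] e0 by (simp add: dist_real_def e_def)
  qed
qed

section \<open>Borel measurability of the empirical process\<close>

lemma measurable_into_borel_of:
  assumes "\<And>\<omega>. \<omega> \<in> space M \<Longrightarrow> Y \<omega> \<in> topspace T"
    and "\<And>U. openin T U \<Longrightarrow> Y -` U \<inter> space M \<in> sets M"
  shows "Y \<in> M \<rightarrow>\<^sub>M borel_of T"
  unfolding borel_of_def
proof (rule measurable_measure_of)
  show "{U. openin T U} \<subseteq> Pow (topspace T)" using openin_subset by blast
qed (use assms in auto)

text \<open>The hypothesis on \<open>Z\<close> covers arbitrary sets U, as for random elements with
  countably many values. Measurability of the limit then follows from the metric alone, without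
  describing the Borel sets of the path space by coordinates.\<close>

lemma J1_measurable_limit:
  assumes Y: "\<And>\<omega>. \<omega> \<in> space M \<Longrightarrow> Y \<omega> \<in> skorohod_space"
    and Z: "\<And>N \<omega>. \<omega> \<in> space M \<Longrightarrow> Z N \<omega> \<in> skorohod_space"
    and meas: "\<And>N U. Z N -` U \<inter> space M \<in> sets M"
    and lim: "\<And>\<omega>. \<omega> \<in> space M \<Longrightarrow> (\<lambda>N. J1_dist levy_dist (Z N \<omega>) (Y \<omega>)) \<longlonglongrightarrow> 0"
  shows "Y \<in> M \<rightarrow>\<^sub>M borel_of J1_topology"
proof (rule measurable_into_borel_of)
  fix \<omega> assume "\<omega> \<in> space M"
  then show "Y \<omega> \<in> topspace J1_topology" using Y by (simp add: J1_topology_def)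
next
  fix U assume U: "openin J1_topology U"
  then have US: "U \<subseteq> skorohod_space" and Uo: "\<And>x. x \<in> U \<Longrightarrow> \<exists>e>0. \<forall>y\<in>skorohod_space. J1_dist levy_dist x y < e \<longrightarrow> y \<in> U"
    unfolding J1_topology_def openin_metric_topology by blast+
  \<comment> \<open>Points of U at distance at least \<open>1 / Suc k\<close> from the complement. A
    limit lies in U iff for some k the approximations are eventually in \<open>V k\<close>.\<close>
  define V where "V k = {x \<in> skorohod_space. \<forall>y\<in>skorohod_space. J1_dist levy_dist x y < 1 / real (Suc k) \<longrightarrow> y \<in> U}" for k
  have "Y -` U \<inter> space M = (\<Union>k. \<Union>m. \<Inter>N\<in>{m..}. Z N -` V k \<inter> space M)"
  proof (intro set_eqI iffI)
    fix \<omega> assume \<omega>: "\<omega> \<in> Y -` U \<inter> space M"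
    then obtain e where e: "e > 0" "\<forall>y\<in>skorohod_space. J1_dist levy_dist (Y \<omega>) y < e \<longrightarrow> y \<in> U"
      using Uo[of "Y \<omega>"] by auto
    obtain k where k: "1 / real (Suc k) < e / 2" using e(1) reals_Archimedean[of "e / 2"] by (auto simp: inverse_eq_divide)
    have "\<forall>\<^sub>F N in sequentially. dist (J1_dist levy_dist (Z N \<omega>) (Y \<omega>)) 0 < e / 2"
      using lim[of \<omega>] \<omega> e(1) by (intro tendstoD) auto
    then obtain m where m: "\<forall>N\<ge>m. dist (J1_dist levy_dist (Z N \<omega>) (Y \<omega>)) 0 < e / 2"
      by (auto simp: eventually_sequentially)
    have "Z N \<omega> \<in> V k" if "N \<ge> m" for N
    proof -
      have d: "J1_dist levy_dist (Z N \<omega>) (Y \<omega>) < e / 2" using m that by (auto simp: dist_real_def)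
      have ZY: "Z N \<omega> \<in> skorohod_space" "Y \<omega> \<in> skorohod_space" using Z Y \<omega> by auto
      have "y \<in> U" if y: "y \<in> skorohod_space" "J1_dist levy_dist (Z N \<omega>) y < 1 / real (Suc k)" for y
      proof -
        have "J1_dist levy_dist (Y \<omega>) y \<le> J1_dist levy_dist (Y \<omega>) (Z N \<omega>) + J1_dist levy_dist (Z N \<omega>) y"
          by (rule J1_dist_triangle[OF ZY(2,1) y(1)])
        also have "\<dots> < e" using J1_dist_sym[OF ZY] d y(2) k by linarith
        finally show ?thesis using e(2) y(1) by blast
      qed
      then show ?thesis using ZY by (simp add: V_def)
    qed
    then show "\<omega> \<in> (\<Union>k. \<Union>m. \<Inter>N\<in>{m..}. Z N -` V k \<inter> space M)" using \<omega> by blast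
  next
    fix \<omega> assume "\<omega> \<in> (\<Union>k. \<Union>m. \<Inter>N\<in>{m..}. Z N -` V k \<inter> space M)"
    then obtain k m where km: "\<And>N. N \<ge> m \<Longrightarrow> Z N \<omega> \<in> V k \<and> \<omega> \<in> space M" by fastforce
    then have \<omega>: "\<omega> \<in> space M" by blast
    have "\<forall>\<^sub>F N in sequentially. dist (J1_dist levy_dist (Z N \<omega>) (Y \<omega>)) 0 < 1 / real (Suc k)"
      using lim[OF \<omega>] by (intro tendstoD) auto
    then obtain m' where m': "\<forall>N\<ge>m'. dist (J1_dist levy_dist (Z N \<omega>) (Y \<omega>)) 0 < 1 / real (Suc k)"
      by (auto simp: eventually_sequentially)
    have "J1_dist levy_dist (Z (max m m') \<omega>) (Y \<omega>) < 1 / real (Suc k)" using m'[rule_format, of "max m m'"] by (simp add: dist_real_def)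
    then have "Y \<omega> \<in> U" using km[of "max m m'"] Y[OF \<omega>] by (auto simp: V_def)
    then show "\<omega> \<in> Y -` U \<inter> space M" using \<omega> by simp
  qed
  also have "\<dots> \<in> sets M"
  proof (rule sets.countable_UN'', simp, rule sets.countable_UN'', simp)
    fix k m :: nat
    show "(\<Inter>N\<in>{m..}. Z N -` V k \<inter> space M) \<in> sets M"
      by (rule sets.countable_INT') (use meas in auto)
  qed
  finally show "Y -` U \<inter> space M \<in> sets M" .
qed

lemma measurable_map_countable:
  fixes g :: "'i \<Rightarrow> 'w \<Rightarrow> 'c :: countable"
  assumes "\<And>j. j \<in> set js \<Longrightarrow> g j \<in> M \<rightarrow>\<^sub>M count_space UNIV"
  shows "(\<lambda>\<omega>. map (\<lambda>j. g j \<omega>) js) \<in> M \<rightarrow>\<^sub>M count_space UNIV"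
  using assms
proof (induction js)
  case (Cons j js)
  have "(\<lambda>\<omega>. g j \<omega> # map (\<lambda>j. g j \<omega>) js) \<in> M \<rightarrow>\<^sub>M count_space UNIV"
  proof (rule measurable_compose_countable[where f="\<lambda>a \<omega>. a # map (\<lambda>j. g j \<omega>) js" and g="g j"])
    show "(\<lambda>\<omega>. a # map (\<lambda>j. g j \<omega>) js) \<in> M \<rightarrow>\<^sub>M count_space UNIV" for a
      by (rule measurable_compose[where g="\<lambda>l. a # l"]) (use Cons in auto)
  qed (use Cons in auto)
  then show ?case by simp
qed simp

text \<open>Positions are sampled on a time grid and rounded down to a space grid. The resulting
  path is a function of a finite list of integers, so every preimage is measurable; by
  \<open>J1_grid_approximation\<close> these paths converge to the empirical process.\<close>

lemma empirical_process_measurable: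
  assumes n: "0 < n" and X: "\<And>i \<omega>. i < n \<Longrightarrow> \<omega> \<in> space M \<Longrightarrow> (\<lambda>t\<in>{0..}. X i t \<omega>) \<in> cadlag_paths euclideanreal"
    and Xm: "\<And>i t. i < n \<Longrightarrow> 0 \<le> t \<Longrightarrow> X i t \<in> borel_measurable M"
  shows "empirical_process n X \<in> M \<rightarrow>\<^sub>M borel_of J1_topology"
proof -
  define g :: "nat \<Rightarrow> nat \<times> nat \<Rightarrow> _ \<Rightarrow> int" where
    "g N = (\<lambda>(k, i) \<omega>. \<lfloor>X i (real k / real (Suc N)) \<omega> * real (Suc N)\<rfloor>)" for N
  \<comment> \<open>Sampling times run through the multiples of \<open>1 / Suc N\<close> up to
    \<open>Suc N\<close>; the \<open>min\<close> in \<open>G\<close> keeps later times inside the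
    list.\<close>
  define js where "js N = List.product [0..<Suc (Suc N * Suc N)] [0..<n]" for N
  define G where "G N l k = empirical_cdf n (\<lambda>i. real_of_int (the (map_of (zip (js N) l) (min k (Suc N * Suc N), i))) / real (Suc N))" for N l k
  define H where "H N l = (\<lambda>t\<in>{0..}. G N l (nat \<lfloor>t * real (Suc N)\<rfloor>))" for N l
  define q where "q N \<omega> = map (\<lambda>j. g N j \<omega>) (js N)" for N \<omega>
  have gm: "g N j \<in> M \<rightarrow>\<^sub>M count_space UNIV" if "j \<in> set (js N)" for N j
  proof -
    obtain k i where j: "j = (k, i)" by (cases j)
    have "i < n" using that by (auto simp: js_def j)
    then have [measurable]: "X i (real k / real (Suc N)) \<in> borel_measurable M" by (intro Xm) auto
    show ?thesis unfolding g_def j prod.case by measurable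
  qed
  have qm: "q N \<in> M \<rightarrow>\<^sub>M count_space UNIV" for N
    unfolding q_def using gm by (intro measurable_map_countable)
  have GQ: "G N (q N \<omega>) k = empirical_cdf n (\<lambda>i. real_of_int \<lfloor>X i (real (min k (Suc N * Suc N)) / real (Suc N)) \<omega> * real (Suc N)\<rfloor> / real (Suc N))" for N \<omega> k
  proof -
    have "(min k (Suc N * Suc N), i) \<in> set (js N)" if "i < n" for i using that by (auto simp: js_def)
    then show ?thesis
      unfolding G_def q_def empirical_cdf_def map_of_zip_map
      by (intro ext arg_cong[where f=card] arg_cong2[where f="(/)"] arg_cong[where f=real]) (auto simp: g_def)
  qed
  show ?thesis
  proof (rule J1_measurable_limit[where Z="\<lambda>N \<omega>. H N (q N \<omega>)"])
    fix \<omega> assume \<omega>: "\<omega> \<in> space M"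
    show Ys: "empirical_process n X \<omega> \<in> skorohod_space" by (rule empirical_process_skorohod[of n X \<omega>, OF n X[OF _ \<omega>]])
    have Hs: "H N (q N \<omega>) \<in> skorohod_space" for N
      unfolding H_def by (rule grid_path_skorohod) (auto simp: G_def intro: empirical_cdf_in_cdfs[OF n])
    then show "H N (q N \<omega>) \<in> skorohod_space" for N .
    show "(\<lambda>N. J1_dist levy_dist (H N (q N \<omega>)) (empirical_process n X \<omega>)) \<longlonglongrightarrow> 0"
    proof (rule J1_grid_approximation[OF Ys Hs])
      fix N and t :: real assume t: "0 \<le> t" "t < real (Suc N)"
      define k where "k = nat \<lfloor>t * real (Suc N)\<rfloor>"
      have k: "real k = real_of_int \<lfloor>t * real (Suc N)\<rfloor>" using t by (simp add: k_def)
      have "t * real (Suc N) < real (Suc N) * real (Suc N)" using t by (intro mult_strict_right_mono) auto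
      then have "real k < real (Suc N * Suc N)" unfolding k of_nat_mult by linarith
      then have kN: "k < Suc N * Suc N" using of_nat_less_iff by blast
      have 1: "H N (q N \<omega>) t = empirical_cdf n (\<lambda>i. real_of_int \<lfloor>X i (real k / real (Suc N)) \<omega> * real (Suc N)\<rfloor> / real (Suc N))"
        using t kN by (simp add: H_def GQ k_def[symmetric] min_absorb1 less_imp_le del: mult_Suc mult_Suc_right of_nat_Suc)
      have 2: "empirical_process n X \<omega> (real_of_int \<lfloor>t * real (Suc N)\<rfloor> / real (Suc N)) = empirical_cdf n (\<lambda>i. X i (real k / real (Suc N)) \<omega>)"
        unfolding k[symmetric] by (simp add: empirical_process_def)
      show "levy_dist (H N (q N \<omega>) t) (empirical_process n X \<omega> (real_of_int \<lfloor>t * real (Suc N)\<rfloor> / real (Suc N))) \<le> 1 / real (Suc N)"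
        unfolding 1 2
      proof (rule levy_dist_empirical[OF n])
        fix i
        define a where "a = X i (real k / real (Suc N)) \<omega>"
        have "real_of_int \<lfloor>a * real (Suc N)\<rfloor> / real (Suc N) - a = (real_of_int \<lfloor>a * real (Suc N)\<rfloor> - a * real (Suc N)) / real (Suc N)"
          by (simp add: diff_divide_distrib del: of_nat_Suc)
        moreover have "\<bar>real_of_int \<lfloor>a * real (Suc N)\<rfloor> - a * real (Suc N)\<bar> \<le> 1" by linarith
        ultimately show "\<bar>real_of_int \<lfloor>X i (real k / real (Suc N)) \<omega> * real (Suc N)\<rfloor> / real (Suc N) - X i (real k / real (Suc N)) \<omega>\<bar> \<le> 1 / real (Suc N)"
          unfolding a_def[symmetric] by (simp add: abs_divide divide_right_mono del: of_nat_Suc)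
      qed
    qed
  next
    fix N and U :: "(real \<Rightarrow> real \<Rightarrow> real) set"
    have "(\<lambda>\<omega>. H N (q N \<omega>)) -` U \<inter> space M = q N -` (H N -` U) \<inter> space M" by auto
    also have "\<dots> \<in> sets M" by (rule measurable_sets[OF qm]) simp
    finally show "(\<lambda>\<omega>. H N (q N \<omega>)) -` U \<inter> space M \<in> sets M" .
  qed
qed

section \<open>Noise in a time cell\<close>

text \<open>One source may feed several variables, such as the increments of one clock.
  \<open>G\<close> factorizes over the sources and \<open>prd\<close> within each of them; grouping
  a product over J by sources combines the two.\<close>

lemma (in prob_space) indep_vars_grouped:
  fixes X :: "'i \<Rightarrow> 'a \<Rightarrow> real" and src :: "'i \<Rightarrow> 's"
  assumes G: "indep_sets F S" and src: "\<And>i. i \<in> I \<Longrightarrow> src i \<in> S"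
    and rv: "\<And>i. i \<in> I \<Longrightarrow> X i \<in> borel_measurable M"
    and mem: "\<And>s J B. J \<subseteq> I \<Longrightarrow> finite J \<Longrightarrow> J \<noteq> {} \<Longrightarrow> (\<And>i. i \<in> J \<Longrightarrow> src i = s) \<Longrightarrow>
      (\<And>i. i \<in> J \<Longrightarrow> B i \<in> sets borel) \<Longrightarrow> (\<Inter>i\<in>J. X i -` B i \<inter> space M) \<in> F s"
    and prd: "\<And>s J B. J \<subseteq> I \<Longrightarrow> finite J \<Longrightarrow> J \<noteq> {} \<Longrightarrow> (\<And>i. i \<in> J \<Longrightarrow> src i = s) \<Longrightarrow>
      (\<And>i. i \<in> J \<Longrightarrow> B i \<in> sets borel) \<Longrightarrow>
      prob (\<Inter>i\<in>J. X i -` B i \<inter> space M) = (\<Prod>i\<in>J. prob (X i -` B i \<inter> space M))"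
  shows "indep_vars (\<lambda>_. borel) X I"
  unfolding indep_vars_def2
proof (intro conjI ballI rv)
  show "indep_sets (\<lambda>i. {X i -` A \<inter> space M |A. A \<in> sets borel}) I"
  proof (rule indep_setsI)
    fix i assume "i \<in> I"
    then show "{X i -` A \<inter> space M |A. A \<in> sets borel} \<subseteq> events" using rv by (auto intro: measurable_sets)
  next
    fix A J assume J: "J \<noteq> {}" "J \<subseteq> I" "finite J" and A: "\<forall>j\<in>J. A j \<in> {X j -` A \<inter> space M |A. A \<in> sets borel}"
    then have "\<forall>j\<in>J. \<exists>B. A j = X j -` B \<inter> space M \<and> B \<in> sets borel" by blast
    then obtain B where B: "\<And>j. j \<in> J \<Longrightarrow> A j = X j -` B j \<inter> space M" "\<And>j. j \<in> J \<Longrightarrow> B j \<in> sets borel" by metis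
    define Js where "Js s = {j \<in> J. src j = s}" for s
    define E where "E s = (\<Inter>i\<in>Js s. X i -` B i \<inter> space M)" for s
    have Js: "Js s \<subseteq> I" "finite (Js s)" "\<And>i. i \<in> Js s \<Longrightarrow> src i = s" "\<And>i. i \<in> Js s \<Longrightarrow> B i \<in> sets borel" for s
      using J B by (auto simp: Js_def)
    have ne: "Js s \<noteq> {}" if "s \<in> src ` J" for s using that by (auto simp: Js_def)
    have E_eq: "E s = (\<Inter>i\<in>Js s. A i)" for s
      unfolding E_def by (rule INF_cong) (use B(1) in \<open>auto simp: Js_def\<close>)
    have "(\<Inter>j\<in>J. A j) = (\<Inter>s\<in>src ` J. E s)"
      unfolding E_eq Js_def by blast
    also have "prob \<dots> = (\<Prod>s\<in>src ` J. prob (E s))"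
    proof (rule indep_setsD[OF G])
      show "src ` J \<subseteq> S" using src J by auto
      show "\<forall>s\<in>src ` J. E s \<in> F s"
        unfolding E_def by (rule ballI, rule mem[OF Js(1,2) ne Js(3,4)])
    qed (use J in auto)
    also have "\<dots> = (\<Prod>s\<in>src ` J. \<Prod>j\<in>Js s. prob (A j))"
    proof (rule prod.cong[OF refl])
      fix s assume "s \<in> src ` J"
      then have "prob (E s) = (\<Prod>i\<in>Js s. prob (X i -` B i \<inter> space M))"
        unfolding E_def by (rule prd[OF Js(1,2) ne Js(3,4)])
      also have "\<dots> = (\<Prod>j\<in>Js s. prob (A j))" using B(1) by (intro prod.cong) (auto simp: Js_def)
      finally show "prob (E s) = (\<Prod>j\<in>Js s. prob (A j))" .
    qed
    also have "\<dots> = (\<Prod>j\<in>J. prob (A j))"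
      unfolding Js_def using J by (intro prod.group) auto
    finally show "prob (\<Inter> (A ` J)) = (\<Prod>j\<in>J. prob (A j))" .
  qed
qed

text \<open>The independent real variables obtained from the sources: each clock is cut into its
  increments over the cells j, while the marks are kept one by one.\<close>

datatype noise_index = JInc nat nat | SInc nat nat | JMark nat nat | SMark nat nat

fun index_source :: "noise_index \<Rightarrow> source" where
  "index_source (JInc i j) = Jump_clock i"
| "index_source (SInc i j) = Sync_clock i"
| "index_source (JMark i l) = Jump_size i l"
| "index_source (SMark i l) = Target i l"

abbreviation index_owner :: "noise_index \<Rightarrow> nat" where
  "index_owner a \<equiv> owner (index_source a)"

lemma index_source_cases:
  "index_source a = Jump_clock i \<Longrightarrow> \<exists>j. a = JInc i j"
  "index_source a = Sync_clock i \<Longrightarrow> \<exists>j. a = SInc i j"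
  "index_source a = Jump_size i l \<Longrightarrow> a = JMark i l"
  "index_source a = Target i l \<Longrightarrow> a = SMark i l"
  by (cases a; simp)+

text \<open>For one clock, the two facts that \<open>indep_vars_grouped\<close> asks for: cell
  increments generate events of that clock, and they are independent of each other.\<close>

lemma (in prob_space) clock_group:
  fixes N :: "real \<Rightarrow> 'a \<Rightarrow> nat"
  assumes N: "poisson_process M r N" and d: "0 \<le> d" and Q: "finite Q" "Q \<noteq> {}"
    and B: "\<And>j. j \<in> Q \<Longrightarrow> B j \<in> sets (borel :: real measure)"
  defines "inc \<equiv> \<lambda>j \<omega>. real (N (d * real (Suc j)) \<omega> - N (d * real j) \<omega>)"
  shows "(\<Inter>j\<in>Q. inc j -` B j \<inter> space M) \<in> sigma_sets (space M) {{\<omega> \<in> space M. N t \<omega> = m} |t m. 0 \<le> t}"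
    and "prob (\<Inter>j\<in>Q. inc j -` B j \<inter> space M) = (\<Prod>j\<in>Q. prob (inc j -` B j \<inter> space M))"
proof -
  define g where "g = {{\<omega> \<in> space M. N t \<omega> = m} |t m. 0 \<le> t}"
  have gP: "g \<subseteq> Pow (space M)" by (auto simp: g_def)
  define S where "S = sigma (space M) g"
  have sp: "space S = space M" and st: "sets S = sigma_sets (space M) g"
    using gP by (auto simp: S_def)
  have Nm: "N t \<in> S \<rightarrow>\<^sub>M count_space UNIV" if "0 \<le> t" for t
    unfolding measurable_count_space_eq2_countable
  proof (intro conjI ballI)
    fix m
    have "N t -` {m} \<inter> space S = {\<omega> \<in> space M. N t \<omega> = m}" by (auto simp: sp)
    also have "\<dots> \<in> sets S" unfolding st using that by (intro sigma_sets.Basic) (auto simp: g_def)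
    finally show "N t -` {m} \<inter> space S \<in> sets S" .
  qed auto
  have im: "inc j \<in> borel_measurable S" for j
  proof -
    have t: "0 \<le> d * real (Suc j)" "0 \<le> d * real j" using d by auto
    note [measurable] = Nm[OF t(1)] Nm[OF t(2)]
    show ?thesis unfolding inc_def by measurable
  qed
  show "(\<Inter>j\<in>Q. inc j -` B j \<inter> space M) \<in> sigma_sets (space M) g"
  proof -
    have "(\<Inter>j\<in>Q. inc j -` B j \<inter> space S) \<in> sets S"
      using Q B im by (intro sets.finite_INT) (auto intro: measurable_sets)
    then show ?thesis unfolding st by (simp only: sp)
  qed
  define \<tau> where "\<tau> k = d * real k" for k :: nat
  have "0 \<le> \<tau> 0 \<and> incseq \<tau>" using d by (auto simp: \<tau>_def incseq_def mult_left_mono)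
  then have "indep_vars (\<lambda>_. count_space UNIV) (\<lambda>k \<omega>. N (\<tau> (Suc k)) \<omega> - N (\<tau> k) \<omega>) UNIV"
    using N unfolding poisson_process_def by blast
  then have "indep_vars (\<lambda>_. borel) (\<lambda>k \<omega>. real (N (\<tau> (Suc k)) \<omega> - N (\<tau> k) \<omega>)) UNIV"
    by (rule indep_vars_compose2) simp
  then have "indep_vars (\<lambda>_. borel) inc UNIV" by (simp add: inc_def \<tau>_def)
  then show "prob (\<Inter>j\<in>Q. inc j -` B j \<inter> space M) = (\<Prod>j\<in>Q. prob (inc j -` B j \<inter> space M))"
    by (rule indep_varsD) (use Q B in auto)
qed

text \<open>With at least two particles the set of possible targets is nonempty, so the uniform law
  on it makes sense.\<close>

locale noise_grid = moving_boundary \<zeta> lam v A0 + P: prob_space P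
  for \<zeta> lam v A0 and P :: "'w measure" +
  fixes n :: nat and NJ NS :: "nat \<Rightarrow> real \<Rightarrow> 'w \<Rightarrow> nat" and \<xi> :: "nat \<Rightarrow> nat \<Rightarrow> 'w \<Rightarrow> real"
    and K :: "nat \<Rightarrow> nat \<Rightarrow> 'w \<Rightarrow> nat" and \<delta> :: real
  assumes n2: "2 \<le> n" and \<delta>: "0 < \<delta>" and noise: "driving_noise P lam \<zeta> n NJ NS \<xi> K"
begin

text \<open>All noise is encoded in reals, so that a single independence statement covers counts,
  jump sizes and targets. The value 0 for owners outside the system makes every coordinate
  measurable.\<close>

definition V :: "noise_index \<Rightarrow> 'w \<Rightarrow> real" where
  "V a \<omega> = (if index_owner a < n then
     (case a of
        JInc i j \<Rightarrow> real (NJ i (\<delta> * real (Suc j)) \<omega> - NJ i (\<delta> * real j) \<omega>)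
      | SInc i j \<Rightarrow> real (NS i (\<delta> * real (Suc j)) \<omega> - NS i (\<delta> * real j) \<omega>)
      | JMark i l \<Rightarrow> \<xi> i l \<omega>
      | SMark i l \<Rightarrow> real (K i l \<omega>)) else 0)"

definition idx :: "noise_index set" where "idx = {a. index_owner a < n}"

lemma noiseD:
  assumes "i < n"
  shows "poisson_process P lam (NJ i)" "poisson_process P 1 (NS i)"
    "\<xi> i l \<in> borel_measurable P" "distr P borel (\<xi> i l) = \<zeta>"
    "K i l \<in> P \<rightarrow>\<^sub>M count_space UNIV"
    "distr P (count_space UNIV) (K i l) = measure_pmf (pmf_of_set ({..<n} - {i}))"
  using noise assms unfolding driving_noise_def by auto

lemma noise_indep: "P.indep_sets (source_events P NJ NS \<xi> K) {s. owner s < n}"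
  using noise unfolding driving_noise_def by blast

lemma clock_measurable: "poisson_process P r N \<Longrightarrow> 0 \<le> t \<Longrightarrow> N t \<in> P \<rightarrow>\<^sub>M count_space UNIV"
  by (auto simp: poisson_process_def)

lemma V_measurable [measurable]: "V a \<in> borel_measurable P"
proof (cases "index_owner a < n")
  case True
  have inc: "(\<lambda>\<omega>. real (N (\<delta> * real (Suc j)) \<omega> - N (\<delta> * real j) \<omega>)) \<in> borel_measurable P"
    if N: "poisson_process P r N" for N r j
  proof -
    have t: "0 \<le> \<delta> * real (Suc j)" "0 \<le> \<delta> * real j" using \<delta> by auto
    note [measurable] = clock_measurable[OF N t(1)] clock_measurable[OF N t(2)]
    show ?thesis by measurable
  qed
  show ?thesis
  proof (cases a)
    case (JInc i j)
    then show ?thesis using inc[OF noiseD(1)[of i], of j] True by (simp add: V_def[abs_def])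
  next
    case (SInc i j)
    then show ?thesis using inc[OF noiseD(2)[of i], of j] True by (simp add: V_def[abs_def])
  next
    case (JMark i l)
    then show ?thesis using noiseD(3)[of i l] True by (simp add: V_def[abs_def])
  next
    case (SMark i l)
    then have [measurable]: "K i l \<in> P \<rightarrow>\<^sub>M count_space UNIV" using noiseD(5)[of i l] True by simp
    have "(\<lambda>\<omega>. real (K i l \<omega>)) \<in> borel_measurable P" by measurable
    then show ?thesis using SMark True by (simp add: V_def[abs_def])
  qed
next
  case False
  then show ?thesis by (simp add: V_def[abs_def])
qed

lemma V_indep: "P.indep_vars (\<lambda>_. borel) V idx"
proof (rule P.indep_vars_grouped[OF noise_indep, where src=index_source])
  show "index_source a \<in> {s. owner s < n}" if "a \<in> idx" for a using that by (simp add: idx_def)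
  have main: "(\<Inter>a\<in>J. V a -` B a \<inter> space P) \<in> source_events P NJ NS \<xi> K s \<and>
      P.prob (\<Inter>a\<in>J. V a -` B a \<inter> space P) = (\<Prod>a\<in>J. P.prob (V a -` B a \<inter> space P))"
    if J: "J \<subseteq> idx" "finite J" "J \<noteq> {}" and s: "\<And>a. a \<in> J \<Longrightarrow> index_source a = s"
      and B: "\<And>a. a \<in> J \<Longrightarrow> B a \<in> sets borel" for s J B
  proof -
    have own: "owner s < n" using J s by (auto simp: idx_def)
    show ?thesis
    proof (cases s)
      case (Jump_clock i)
      define Q where "Q = {j. JInc i j \<in> J}"
      have JQ: "J = JInc i ` Q" using s index_source_cases(1) Jump_clock unfolding Q_def by blast
      have Q: "finite Q" "Q \<noteq> {}" using J JQ by (auto simp: finite_image_iff inj_on_def)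
      have i: "i < n" using own Jump_clock by simp
      have V: "V (JInc i j) = (\<lambda>\<omega>. real (NJ i (\<delta> * real (Suc j)) \<omega> - NJ i (\<delta> * real j) \<omega>))" for j
        using i by (simp add: V_def[abs_def])
      have BQ: "B (JInc i j) \<in> sets borel" if "j \<in> Q" for j using B that by (simp add: Q_def)
      have inj: "inj_on (JInc i) Q" by (simp add: inj_on_def)
      show ?thesis
        unfolding JQ image_image prod.reindex[OF inj] comp_def V Jump_clock source_events.simps
        using P.clock_group[OF noiseD(1)[OF i] less_imp_le[OF \<delta>] Q, of "\<lambda>j. B (JInc i j)", OF BQ] by blast
    next
      case (Sync_clock i)
      define Q where "Q = {j. SInc i j \<in> J}"
      have JQ: "J = SInc i ` Q" using s index_source_cases(2) Sync_clock unfolding Q_def by blast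
      have Q: "finite Q" "Q \<noteq> {}" using J JQ by (auto simp: finite_image_iff inj_on_def)
      have i: "i < n" using own Sync_clock by simp
      have V: "V (SInc i j) = (\<lambda>\<omega>. real (NS i (\<delta> * real (Suc j)) \<omega> - NS i (\<delta> * real j) \<omega>))" for j
        using i by (simp add: V_def[abs_def])
      have BQ: "B (SInc i j) \<in> sets borel" if "j \<in> Q" for j using B that by (simp add: Q_def)
      have inj: "inj_on (SInc i) Q" by (simp add: inj_on_def)
      show ?thesis
        unfolding JQ image_image prod.reindex[OF inj] comp_def V Sync_clock source_events.simps
        using P.clock_group[OF noiseD(2)[OF i] less_imp_le[OF \<delta>] Q, of "\<lambda>j. B (SInc i j)", OF BQ] by blast
    next
      case (Jump_size i l)
      have "J = {JMark i l}" using s index_source_cases(3) Jump_size J(3) by blast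
      moreover have "V (JMark i l) = \<xi> i l" using own Jump_size by (simp add: V_def[abs_def])
      ultimately show ?thesis using B Jump_size by auto
    next
      case (Target i l)
      have J1: "J = {SMark i l}" using s index_source_cases(4) Target J(3) by blast
      have "V (SMark i l) -` B (SMark i l) \<inter> space P = K i l -` (real -` B (SMark i l)) \<inter> space P"
        using own Target by (auto simp: V_def)
      then show ?thesis using J1 Target by auto
    qed
  qed
  show "(\<Inter>a\<in>J. V a -` B a \<inter> space P) \<in> source_events P NJ NS \<xi> K s"
    if "J \<subseteq> idx" "finite J" "J \<noteq> {}" "\<And>a. a \<in> J \<Longrightarrow> index_source a = s" "\<And>a. a \<in> J \<Longrightarrow> B a \<in> sets borel" for s J B
    using main[OF that] by simp
  show "P.prob (\<Inter>a\<in>J. V a -` B a \<inter> space P) = (\<Prod>a\<in>J. P.prob (V a -` B a \<inter> space P))"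
    if "J \<subseteq> idx" "finite J" "J \<noteq> {}" "\<And>a. a \<in> J \<Longrightarrow> index_source a = s" "\<And>a. a \<in> J \<Longrightarrow> B a \<in> sets borel" for s J B
    using main[OF that] by simp
qed simp

lemma increment_law:
  assumes N: "poisson_process P r N"
  shows "P.prob {\<omega> \<in> space P. N (\<delta> * real (Suc j)) \<omega> - N (\<delta> * real j) \<omega> = k} = exp (- (r * \<delta>)) * (r * \<delta>) ^ k / fact k"
proof -
  have law: "\<forall>s t k. 0 \<le> s \<and> s \<le> t \<longrightarrow>
        P.prob {\<omega> \<in> space P. N t \<omega> - N s \<omega> = k} = exp (- (r * (t - s))) * (r * (t - s)) ^ k / fact k"
    using N unfolding poisson_process_def by blast
  have "0 \<le> \<delta> * real j \<and> \<delta> * real j \<le> \<delta> * real (Suc j)" using \<delta> by auto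
  from law[THEN spec, THEN spec, THEN spec, THEN mp, OF this, of k]
  show ?thesis by (simp only: right_diff_distrib[symmetric] of_nat_Suc add_diff_cancel mult_1_right)
qed

lemma V_laws:
  assumes i: "i < n"
  shows "P.prob (V (JInc i j) -` {real k} \<inter> space P) = exp (- (lam * \<delta>)) * (lam * \<delta>) ^ k / fact k"
    "P.prob (V (SInc i j) -` {real k} \<inter> space P) = exp (- \<delta>) * \<delta> ^ k / fact k"
    "B \<in> sets borel \<Longrightarrow> P.prob (V (JMark i l) -` B \<inter> space P) = measure \<zeta> B"
    "P.prob (V (SMark i l) -` {real j} \<inter> space P) = (if j < n \<and> j \<noteq> i then 1 / real (n - 1) else 0)"
    "\<omega> \<in> space P \<Longrightarrow> V (JInc i j) \<omega> \<in> \<nat>" "\<omega> \<in> space P \<Longrightarrow> V (SInc i j) \<omega> \<in> \<nat>" "\<omega> \<in> space P \<Longrightarrow> V (SMark i l) \<omega> \<in> \<nat>"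
proof -
  have "V (JInc i j) -` {real k} \<inter> space P = {\<omega> \<in> space P. NJ i (\<delta> * real (Suc j)) \<omega> - NJ i (\<delta> * real j) \<omega> = k}"
    using i by (auto simp: V_def)
  then show "P.prob (V (JInc i j) -` {real k} \<inter> space P) = exp (- (lam * \<delta>)) * (lam * \<delta>) ^ k / fact k"
    using increment_law[OF noiseD(1)[OF i], of j k] by (simp only:)
  have "V (SInc i j) -` {real k} \<inter> space P = {\<omega> \<in> space P. NS i (\<delta> * real (Suc j)) \<omega> - NS i (\<delta> * real j) \<omega> = k}"
    using i by (auto simp: V_def)
  then show "P.prob (V (SInc i j) -` {real k} \<inter> space P) = exp (- \<delta>) * \<delta> ^ k / fact k"
    using increment_law[OF noiseD(2)[OF i], of j k] by (simp only: mult_1)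
  show "P.prob (V (JMark i l) -` B \<inter> space P) = measure \<zeta> B" if "B \<in> sets borel"
  proof -
    have "measure \<zeta> B = measure (distr P borel (\<xi> i l)) B" using noiseD(4)[OF i, of l] by simp
    also have "\<dots> = P.prob (\<xi> i l -` B \<inter> space P)" using that noiseD(3)[OF i] by (rule measure_distr[rotated])
    finally show ?thesis using i by (simp add: V_def[abs_def])
  qed
  have "(if i = 0 then 1 else 0) \<in> {..<n} - {i}" using n2 by auto
  then have ne: "{..<n} - {i} \<noteq> {}" by blast
  have "V (SMark i l) -` {real j} \<inter> space P = K i l -` {j} \<inter> space P" using i by (auto simp: V_def)
  also have "P.prob \<dots> = measure (distr P (count_space UNIV) (K i l)) {j}"
    using noiseD(5)[OF i] by (subst measure_distr) auto
  also have "\<dots> = pmf (pmf_of_set ({..<n} - {i})) j" unfolding noiseD(6)[OF i] by (simp add: measure_pmf_single)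
  also have "\<dots> = (if j < n \<and> j \<noteq> i then 1 / real (n - 1) else 0)"
  proof -
    have "card ({..<n} - {i}) = n - 1" using i by simp
    moreover have "pmf (pmf_of_set ({..<n} - {i})) j = indicator ({..<n} - {i}) j / real (card ({..<n} - {i}))"
      by (rule pmf_of_set[OF ne]) simp
    ultimately show ?thesis by (auto simp: indicator_def)
  qed
  finally show "P.prob (V (SMark i l) -` {real j} \<inter> space P) = (if j < n \<and> j \<noteq> i then 1 / real (n - 1) else 0)" .
qed (use i in \<open>auto simp: V_def\<close>)

end

section \<open>One step of the discretized system\<close>

text \<open>Covariances vanish and variances are at most 1, so the mean has second moment at most
  \<open>1 / n\<close>; nonnegativity of the variance of its modulus bounds the first moment by the
  root. The laws may differ, since each variable is centred separately.\<close>

lemma (in prob_space) weak_law_L1: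
  fixes Z :: "nat \<Rightarrow> 'a \<Rightarrow> real"
  assumes ind: "indep_vars (\<lambda>_. borel) Z {..<n}" and n: "0 < n"
    and Z01: "\<And>i \<omega>. i < n \<Longrightarrow> \<omega> \<in> space M \<Longrightarrow> 0 \<le> Z i \<omega> \<and> Z i \<omega> \<le> 1"
  shows "expectation (\<lambda>\<omega>. \<bar>(\<Sum>i<n. Z i \<omega> - expectation (Z i)) / real n\<bar>) \<le> 1 / sqrt (real n)"
proof -
  define W where "W i \<omega> = Z i \<omega> - expectation (Z i)" for i \<omega>
  have Zm [measurable]: "i < n \<Longrightarrow> Z i \<in> borel_measurable M" for i using ind by (auto simp: indep_vars_def)
  have Zi: "integrable M (Z i)" if "i < n" for i
    by (rule integrable_const_bound[where B=1]) (use Z01[OF that] Zm[OF that] in auto)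
  have EZ: "0 \<le> expectation (Z i)" "expectation (Z i) \<le> 1" if "i < n" for i
  proof -
    show "0 \<le> expectation (Z i)" using Z01[OF that] by (intro integral_nonneg_AE AE_I2) auto
    have "expectation (Z i) \<le> expectation (\<lambda>_. 1)" using Z01[OF that] by (intro integral_mono Zi that) auto
    then show "expectation (Z i) \<le> 1" by (simp add: prob_space)
  qed
  have Wb: "\<bar>W i \<omega>\<bar> \<le> 1" if "i < n" "\<omega> \<in> space M" for i \<omega>
    using Z01[OF that] EZ[OF that(1)] by (auto simp: W_def)
  have Wm [measurable]: "i < n \<Longrightarrow> W i \<in> borel_measurable M" for i unfolding W_def by measurable
  have Wi: "integrable M (W i)" if "i < n" for i
    by (rule integrable_const_bound[where B=1]) (use Wb[OF that] Wm[OF that] in auto)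
  have W0: "expectation (W i) = 0" if "i < n" for i
    unfolding W_def using Zi[OF that] by (simp add: prob_space)
  have Wind: "indep_vars (\<lambda>_. borel) W {..<n}"
    unfolding W_def[abs_def] by (rule indep_vars_compose2[OF ind, where Y="\<lambda>i z. z - expectation (Z i)"]) simp
  have Wprod: "\<bar>W i \<omega> * W j \<omega>\<bar> \<le> 1" if "i < n" "j < n" "\<omega> \<in> space M" for i j \<omega>
    using mult_mono[OF Wb[OF that(1,3)] Wb[OF that(2,3)]] by (simp add: abs_mult)
  have ip: "integrable M (\<lambda>\<omega>. W i \<omega> * W j \<omega>)" if ij: "i < n" "j < n" for i j
    by (rule integrable_const_bound[where B=1]) (use Wprod[OF ij] Wm[OF ij(1)] Wm[OF ij(2)] in auto)
  have WW: "expectation (\<lambda>\<omega>. W i \<omega> * W j \<omega>) \<le> (if i = j then 1 else 0)" if ij: "i < n" "j < n" for i j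
  proof (cases "i = j")
    case True
    have "expectation (\<lambda>\<omega>. W i \<omega> * W j \<omega>) \<le> expectation (\<lambda>_. 1)"
      using Wprod[OF ij] by (intro integral_mono ip[OF ij]) (auto simp: abs_le_iff)
    then show ?thesis using True by (simp add: prob_space)
  next
    case False
    have "expectation (\<lambda>\<omega>. \<Prod>k\<in>{i, j}. W k \<omega>) = (\<Prod>k\<in>{i, j}. expectation (W k))"
      by (rule indep_vars_lebesgue_integral) (use ij Wi in \<open>auto intro: indep_vars_subset[OF Wind]\<close>)
    then show ?thesis using False W0[OF ij(1)] by simp
  qed
  let ?S = "\<lambda>\<omega>. (\<Sum>i<n. W i \<omega>) / real n"
  have Sm: "?S \<in> borel_measurable M" by measurable
  have Sb: "\<bar>?S \<omega>\<bar> \<le> 1" if "\<omega> \<in> space M" for \<omega>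
  proof -
    have "\<bar>\<Sum>i<n. W i \<omega>\<bar> \<le> (\<Sum>i<n. \<bar>W i \<omega>\<bar>)" by (rule sum_abs)
    also have "\<dots> \<le> (\<Sum>i<n. 1)" using Wb that by (intro sum_mono) auto
    finally show ?thesis using n by (simp add: abs_divide pos_divide_le_eq)
  qed
  have Si: "integrable M (\<lambda>\<omega>. \<bar>?S \<omega>\<bar>)"
    by (rule integrable_const_bound[where B=1]) (use Sb Sm in auto)
  have S2i: "integrable M (\<lambda>\<omega>. (\<bar>?S \<omega>\<bar>)\<^sup>2)"
    by (rule integrable_const_bound[where B=1]) (use Sb Sm in \<open>auto simp: power_le_one abs_square_le_1\<close>)
  have "expectation (\<lambda>\<omega>. (\<bar>?S \<omega>\<bar>)\<^sup>2) = expectation (\<lambda>\<omega>. (\<Sum>i<n. \<Sum>j<n. W i \<omega> * W j \<omega>) / (real n)\<^sup>2)"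
    by (simp add: power_divide power2_eq_square sum_product)
  also have "\<dots> = (\<Sum>i<n. \<Sum>j<n. expectation (\<lambda>\<omega>. W i \<omega> * W j \<omega>)) / (real n)\<^sup>2"
  proof -
    have "expectation (\<lambda>\<omega>. \<Sum>i<n. \<Sum>j<n. W i \<omega> * W j \<omega>) = (\<Sum>i<n. expectation (\<lambda>\<omega>. \<Sum>j<n. W i \<omega> * W j \<omega>))"
      by (rule Bochner_Integration.integral_sum) (auto intro!: Bochner_Integration.integrable_sum ip)
    also have "\<dots> = (\<Sum>i<n. \<Sum>j<n. expectation (\<lambda>\<omega>. W i \<omega> * W j \<omega>))"
      by (intro sum.cong refl Bochner_Integration.integral_sum) (auto intro: ip)
    finally show ?thesis by simp
  qed
  also have "\<dots> \<le> (\<Sum>i<n. \<Sum>j<n. if i = j then 1 else 0) / (real n)\<^sup>2"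
    using WW by (intro divide_right_mono sum_mono) auto
  also have "\<dots> = 1 / real n" using n by (simp add: power2_eq_square)
  finally have S2: "expectation (\<lambda>\<omega>. (\<bar>?S \<omega>\<bar>)\<^sup>2) \<le> 1 / real n" .
  let ?m = "expectation (\<lambda>\<omega>. \<bar>?S \<omega>\<bar>)"
  have "0 \<le> expectation (\<lambda>\<omega>. (\<bar>?S \<omega>\<bar> - ?m)\<^sup>2)" by (intro integral_nonneg_AE) auto
  also have "\<dots> = expectation (\<lambda>\<omega>. (\<bar>?S \<omega>\<bar>)\<^sup>2) - ?m\<^sup>2"
    by (rule variance_eq[OF Si S2i])
  finally have "?m\<^sup>2 \<le> 1 / real n" using S2 by linarith
  then have "?m \<le> sqrt (1 / real n)" by (rule real_le_rsqrt)
  then show ?thesis by (simp add: W_def real_sqrt_divide)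
qed

text \<open>The empirical distribution function for extended positions: a particle at minus infinity
  is always counted, one at plus infinity never.\<close>

definition frac_le :: "nat \<Rightarrow> (nat \<Rightarrow> ereal) \<Rightarrow> real \<Rightarrow> real" where
  "frac_le n x y = (\<Sum>i<n. if x i \<le> ereal y then 1 else 0) / real n"

lemma frac_le_bounds: "0 \<le> frac_le n x y" "frac_le n x y \<le> 1"
proof -
  show "0 \<le> frac_le n x y" unfolding frac_le_def by (intro divide_nonneg_nonneg sum_nonneg) auto
  have "(\<Sum>i<n. if x i \<le> ereal y then 1 else 0 :: real) \<le> (\<Sum>i<n. 1)" by (intro sum_mono) auto
  then show "frac_le n x y \<le> 1" by (cases "n = 0") (auto simp: frac_le_def pos_divide_le_eq)
qed

lemma frac_le_mono: "y \<le> z \<Longrightarrow> frac_le n x y \<le> frac_le n x z"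
  unfolding frac_le_def
  by (intro divide_right_mono sum_mono) (auto intro: order_trans[of _ "ereal y"])

lemma frac_le_antimono: "(\<And>i. i < n \<Longrightarrow> x i \<le> x' i) \<Longrightarrow> frac_le n x' y \<le> frac_le n x y"
  unfolding frac_le_def
  by (intro divide_right_mono sum_mono) (auto intro: order_trans)

lemma frac_le_ereal: "frac_le n (\<lambda>i. ereal (x i)) = empirical_cdf n x"
proof
  fix y
  have "(\<Sum>i<n. if x i \<le> y then 1 else 0) = real (card {i \<in> {..<n}. x i \<le> y})"
    by (simp add: sum.If_cases Int_def)
  then show "frac_le n (\<lambda>i. ereal (x i)) y = empirical_cdf n x y" by (simp add: frac_le_def empirical_cdf_def)
qed

lemma regular_frac_le_measurable: "frac_le n x \<in> borel_measurable borel"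
  by (rule borel_measurable_mono) (simp add: monoI frac_le_mono)

context noise_grid
begin

text \<open>A vector \<open>r\<close> holds the noise of one time cell: \<open>r (i, 0)\<close> and \<open>r (i, 1)\<close> count the points of
  the two clocks of particle \<open>i\<close>, \<open>r (i, 2)\<close> and \<open>r (i, 3)\<close> are the marks that would be used next.
  Cells where this does not determine the motion are bad; there the particle is sent to \<open>w\<close>, one of
  the two infinities, so as to preserve a one-sided bound.\<close>

definition active :: "(nat \<times> nat \<Rightarrow> real) \<Rightarrow> nat \<Rightarrow> bool" where
  "active r i \<longleftrightarrow> r (i, 0) \<noteq> 0 \<or> r (i, 1) \<noteq> 0"

text \<open>A target without clock points stays put during the whole cell, so it is irrelevant when
  in the cell the synchronization happens.\<close>

definition target_ok :: "(nat \<times> nat \<Rightarrow> real) \<Rightarrow> nat \<Rightarrow> bool" where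
  "target_ok r i \<longleftrightarrow> (\<exists>j<n. j \<noteq> i \<and> r (i, 3) = real j \<and> \<not> active r j)"

definition bad :: "(nat \<times> nat \<Rightarrow> real) \<Rightarrow> nat \<Rightarrow> bool" where
  "bad r i \<longleftrightarrow> \<not> (\<not> active r i \<or> (r (i, 0) = 1 \<and> r (i, 1) = 0) \<or> (r (i, 0) = 0 \<and> r (i, 1) = 1 \<and> target_ok r i))"

text \<open>The move is defined in bad cells too, where it need not describe the particle. In this
  way it reads the noise of particle i only, which makes the moves of different particles
  independent. The integer part turns the real-valued target mark back into an index.\<close>

definition ideal :: "real \<Rightarrow> (nat \<Rightarrow> ereal) \<Rightarrow> (nat \<times> nat \<Rightarrow> real) \<Rightarrow> nat \<Rightarrow> ereal" where
  "ideal A x r i = (if r (i, 0) = 1 \<and> r (i, 1) = 0 then max (x i) (ereal A) + ereal (r (i, 2))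
     else if r (i, 0) = 0 \<and> r (i, 1) = 1 then max (x i) (x (nat \<lfloor>r (i, 3)\<rfloor>)) else x i)"

definition step :: "ereal \<Rightarrow> real \<Rightarrow> (nat \<Rightarrow> ereal) \<Rightarrow> (nat \<times> nat \<Rightarrow> real) \<Rightarrow> nat \<Rightarrow> ereal" where
  "step w A x r i = (if i < n then (if bad r i then w else ideal A x r i) else x i)"

definition euler :: "real \<Rightarrow> (real \<Rightarrow> real) \<Rightarrow> real \<Rightarrow> real" where
  "euler A F y = F y + \<delta> * model_rhs A F y"

lemma frac_le_step:
  "\<bar>frac_le n (step w A x r) y - frac_le n (ideal A x r) y\<bar> \<le> (\<Sum>i<n. if bad r i then 1 else 0) / real n"
proof -
  have "\<bar>frac_le n (step w A x r) y - frac_le n (ideal A x r) y\<bar> =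
    \<bar>\<Sum>i<n. (if step w A x r i \<le> ereal y then 1 else 0) - (if ideal A x r i \<le> ereal y then 1 else 0)\<bar> / real n"
    by (simp add: frac_le_def diff_divide_distrib[symmetric] sum_subtractf)
  also have "\<dots> \<le> (\<Sum>i<n. if bad r i then 1 else 0) / real n"
    by (intro divide_right_mono order_trans[OF sum_abs] sum_mono) (auto simp: step_def)
  finally show ?thesis .
qed

definition sel :: "nat \<Rightarrow> (nat \<Rightarrow> nat) \<Rightarrow> (nat \<Rightarrow> nat) \<Rightarrow> nat \<times> nat \<Rightarrow> noise_index" where
  "sel k c c' = (\<lambda>(i, q). if q = 0 then JInc i k else if q = 1 then SInc i k else if q = 2 then JMark i (c i) else SMark i (c' i))"

lemma sel_simps [simp]:
  "sel k c c' (i, 0) = JInc i k" "sel k c c' (i, Suc 0) = SInc i k"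
  "sel k c c' (i, 2) = JMark i (c i)" "sel k c c' (i, 3) = SMark i (c' i)"
  by (simp_all add: sel_def)

abbreviation cell :: "nat \<Rightarrow> (nat \<Rightarrow> nat) \<Rightarrow> (nat \<Rightarrow> nat) \<Rightarrow> 'w \<Rightarrow> nat \<times> nat \<Rightarrow> real" where
  "cell k c c' \<omega> \<equiv> \<lambda>p. V (sel k c c' p) \<omega>"

definition hit :: "nat \<Rightarrow> (nat \<Rightarrow> nat) \<Rightarrow> (nat \<Rightarrow> nat) \<Rightarrow> real \<Rightarrow> (nat \<Rightarrow> ereal) \<Rightarrow> real \<Rightarrow> nat \<Rightarrow> 'w \<Rightarrow> real" where
  "hit k c c' A x y i \<omega> = (if ideal A x (cell k c c' \<omega>) i \<le> ereal y then 1 else 0)"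

section \<open>Probabilities and means in one cell, for fixed mark indices\<close>

context
  fixes k :: nat and c c' :: "nat \<Rightarrow> nat"
begin

lemma prob_inter2:
  assumes "a \<in> idx" "b \<in> idx" "a \<noteq> b" "B1 \<in> sets borel" "B2 \<in> sets borel"
  shows "P.prob (V a -` B1 \<inter> V b -` B2 \<inter> space P) = P.prob (V a -` B1 \<inter> space P) * P.prob (V b -` B2 \<inter> space P)"
proof -
  have "P.prob (\<Inter>e\<in>{a, b}. V e -` (if e = a then B1 else B2) \<inter> space P) =
    (\<Prod>e\<in>{a, b}. P.prob (V e -` (if e = a then B1 else B2) \<inter> space P))"
    by (rule P.indep_varsD[OF V_indep]) (use assms in auto)
  moreover have "(\<Inter>e\<in>{a, b}. V e -` (if e = a then B1 else B2) \<inter> space P) = V a -` B1 \<inter> V b -` B2 \<inter> space P"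
    using assms by auto
  ultimately show ?thesis using assms by simp
qed

lemma prob_inter3:
  assumes "a \<in> idx" "b \<in> idx" "d \<in> idx" "a \<noteq> b" "a \<noteq> d" "b \<noteq> d" "B1 \<in> sets borel" "B2 \<in> sets borel" "B3 \<in> sets borel"
  shows "P.prob (V a -` B1 \<inter> V b -` B2 \<inter> V d -` B3 \<inter> space P) =
    P.prob (V a -` B1 \<inter> space P) * P.prob (V b -` B2 \<inter> space P) * P.prob (V d -` B3 \<inter> space P)"
proof -
  let ?B = "\<lambda>e. if e = a then B1 else if e = b then B2 else B3"
  have "P.prob (\<Inter>e\<in>{a, b, d}. V e -` ?B e \<inter> space P) = (\<Prod>e\<in>{a, b, d}. P.prob (V e -` ?B e \<inter> space P))"
    by (rule P.indep_varsD[OF V_indep]) (use assms in auto)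
  moreover have "(\<Inter>e\<in>{a, b, d}. V e -` ?B e \<inter> space P) = V a -` B1 \<inter> V b -` B2 \<inter> V d -` B3 \<inter> space P"
    using assms by auto
  ultimately show ?thesis using assms by simp
qed

lemma idx_simps [simp]:
  "JInc i j \<in> idx \<longleftrightarrow> i < n" "SInc i j \<in> idx \<longleftrightarrow> i < n" "JMark i j \<in> idx \<longleftrightarrow> i < n" "SMark i j \<in> idx \<longleftrightarrow> i < n"
  by (auto simp: idx_def)

lemma V_sets [measurable]: "B \<in> sets borel \<Longrightarrow> V a -` B \<inter> space P \<in> sets P"
  by (rule measurable_sets[OF V_measurable])

lemma exp_ge_1_minus: "1 - x \<le> exp (- x)" for x :: real
  using exp_ge_add_one_self[of "- x"] by simp

lemma prob_active_le:
  assumes i: "i < n"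
  shows "P.prob (V (JInc i k) -` (- {0}) \<inter> space P) \<le> lam * \<delta>"
    "P.prob (V (SInc i k) -` (- {0}) \<inter> space P) \<le> \<delta>"
    "P.prob (V (JInc i k) -` (- {0, 1}) \<inter> space P) \<le> (lam * \<delta>)\<^sup>2"
    "P.prob (V (SInc i k) -` (- {0, 1}) \<inter> space P) \<le> \<delta>\<^sup>2"
proof -
  have gen: "P.prob (V a -` (- {0}) \<inter> space P) \<le> x \<and> P.prob (V a -` (- {0, 1}) \<inter> space P) \<le> x\<^sup>2"
    if x: "0 \<le> x" and 0: "P.prob (V a -` {real 0} \<inter> space P) = exp (- x) * x ^ 0 / fact 0"
      and 1: "P.prob (V a -` {real 1} \<inter> space P) = exp (- x) * x ^ 1 / fact 1" for a x
  proof -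
    have "V a -` (- {0}) \<inter> space P = space P - (V a -` {0} \<inter> space P)" by auto
    then have e0: "P.prob (V a -` (- {0}) \<inter> space P) = 1 - exp (- x)"
      using 0 by (simp add: P.prob_compl)
    have "V a -` (- {0, 1}) \<inter> space P = space P - ((V a -` {0} \<inter> space P) \<union> (V a -` {1} \<inter> space P))" by auto
    then have "P.prob (V a -` (- {0, 1}) \<inter> space P) = 1 - P.prob ((V a -` {0} \<inter> space P) \<union> (V a -` {1} \<inter> space P))"
      by (simp add: P.prob_compl)
    also have "P.prob ((V a -` {0} \<inter> space P) \<union> (V a -` {1} \<inter> space P)) = exp (- x) + exp (- x) * x"
      using 0 1 by (subst P.finite_measure_Union) auto
    \<comment> \<open>By \<open>exp (- x) \<ge> 1 - x\<close>, two or more points have probability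
      at most \<open>1 - (1 - x) * (1 + x)\<close>.\<close>
    also have "1 - (exp (- x) + exp (- x) * x) \<le> x\<^sup>2"
    proof -
      have "(1 - x) * (1 + x) \<le> exp (- x) * (1 + x)" using x exp_ge_1_minus[of x] by (intro mult_right_mono) auto
      then show ?thesis by (simp add: algebra_simps power2_eq_square)
    qed
    finally show ?thesis using e0 exp_ge_1_minus[of x] by simp
  qed
  show "P.prob (V (JInc i k) -` (- {0}) \<inter> space P) \<le> lam * \<delta>"
    "P.prob (V (JInc i k) -` (- {0, 1}) \<inter> space P) \<le> (lam * \<delta>)\<^sup>2"
    using gen[OF _ V_laws(1)[OF i] V_laws(1)[OF i]] lam \<delta> by auto
  show "P.prob (V (SInc i k) -` (- {0}) \<inter> space P) \<le> \<delta>"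
    "P.prob (V (SInc i k) -` (- {0, 1}) \<inter> space P) \<le> \<delta>\<^sup>2"
    using gen[OF _ V_laws(2)[OF i] V_laws(2)[OF i]] \<delta> by auto
qed

lemma target_AE:
  assumes i: "i < n" shows "AE \<omega> in P. \<exists>j<n. j \<noteq> i \<and> V (SMark i l) \<omega> = real j"
proof -
  let ?T = "{..<n} - {i}"
  have "P.prob (\<Union>j\<in>?T. V (SMark i l) -` {real j} \<inter> space P) = (\<Sum>j\<in>?T. P.prob (V (SMark i l) -` {real j} \<inter> space P))"
    by (rule P.finite_measure_finite_Union) (auto simp: disjoint_family_on_def)
  also have "\<dots> = (\<Sum>j\<in>?T. 1 / real (n - 1))" by (intro sum.cong refl) (simp add: V_laws(4)[OF i])
  also have "\<dots> = 1" using n2 i by simp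
  finally have "P.prob (\<Union>j\<in>?T. V (SMark i l) -` {real j} \<inter> space P) = 1" .
  then have "AE \<omega> in P. \<omega> \<in> (\<Union>j\<in>?T. V (SMark i l) -` {real j} \<inter> space P)"
    by (intro P.AE_prob_1) 
  then show ?thesis by eventually_elim auto
qed

lemma ideal_measurable:
  assumes X: "\<And>j. X j \<in> borel_measurable M" and R: "\<And>q. q < 4 \<Longrightarrow> R (i, q) \<in> borel_measurable M"
  shows "(\<lambda>\<omega>. ideal A (\<lambda>j. X j \<omega>) (\<lambda>q. R q \<omega>) i) \<in> borel_measurable M"
proof -
  have [measurable]: "R (i, 0) \<in> borel_measurable M" "R (i, 1) \<in> borel_measurable M"
    "R (i, 2) \<in> borel_measurable M" "R (i, 3) \<in> borel_measurable M" "X i \<in> borel_measurable M"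
    using R X by auto
  have [measurable]: "(\<lambda>\<omega>. X (nat \<lfloor>R (i, 3) \<omega>\<rfloor>) \<omega>) \<in> borel_measurable M"
    by (rule measurable_compose_countable[where f="\<lambda>j \<omega>. X j \<omega>" and g="\<lambda>\<omega>. nat \<lfloor>R (i, 3) \<omega>\<rfloor>"])
      (use X in measurable)
  show ?thesis unfolding ideal_def by measurable
qed

lemma bad_measurable:
  assumes i: "i < n" and R: "\<And>j q. j < n \<Longrightarrow> q < 4 \<Longrightarrow> R (j, q) \<in> borel_measurable M"
  shows "Measurable.pred M (\<lambda>\<omega>. bad (\<lambda>q. R q \<omega>) i)"
proof -
  have [measurable]: "R (i, 0) \<in> borel_measurable M" "R (i, 1) \<in> borel_measurable M" "R (i, 3) \<in> borel_measurable M"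
    using R i by auto
  have tgt: "target_ok (\<lambda>q. R q \<omega>) i \<longleftrightarrow> (\<exists>j\<in>{..<n} - {i}. R (i, 3) \<omega> = real j \<and> R (j, 0) \<omega> = 0 \<and> R (j, 1) \<omega> = 0)" for \<omega>
    by (auto simp: target_ok_def active_def)
  have [measurable]: "Measurable.pred M (\<lambda>\<omega>. R (i, 3) \<omega> = real j \<and> R (j, 0) \<omega> = 0 \<and> R (j, 1) \<omega> = 0)" if "j \<in> {..<n} - {i}" for j
  proof -
    have [measurable]: "R (j, 0) \<in> borel_measurable M" "R (j, 1) \<in> borel_measurable M" using R that by auto
    show ?thesis by measurable
  qed
  have [measurable]: "Measurable.pred M (\<lambda>\<omega>. target_ok (\<lambda>q. R q \<omega>) i)"
    unfolding tgt by measurable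
  show ?thesis unfolding bad_def active_def by measurable
qed

lemma r_measurable [measurable]: "(\<lambda>\<omega>. cell k c c' \<omega> q) \<in> borel_measurable P"
  by simp

text \<open>A union bound: two jump points, two synchronization points, one point of each clock, or
  a synchronization whose target has a jump point or a synchronization point. Every case needs two
  independent events of probability of order \<open>\<delta>\<close>; for the last two cases one
  sums over the uniformly drawn target.\<close>

lemma prob_bad:
  assumes i: "i < n"
  shows "P.prob {\<omega> \<in> space P. bad (cell k c c' \<omega>) i} \<le> 2 * rate\<^sup>2 * \<delta>\<^sup>2"
proof -
  let ?a = "\<lambda>i. V (JInc i k)" and ?b = "\<lambda>i. V (SInc i k)" and ?t = "V (SMark i (c' i))"
  let ?T = "{..<n} - {i}"
  let ?U1 = "?a i -` (- {0, 1}) \<inter> space P" and ?U2 = "?b i -` (- {0, 1}) \<inter> space P"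
    and ?U3 = "?a i -` (- {0}) \<inter> ?b i -` (- {0}) \<inter> space P"
    and ?U4 = "\<lambda>j. ?b i -` (- {0}) \<inter> ?t -` {real j} \<inter> ?a j -` (- {0}) \<inter> space P"
    and ?U5 = "\<lambda>j. ?b i -` (- {0}) \<inter> ?t -` {real j} \<inter> ?b j -` (- {0}) \<inter> space P"
  have ms: "?U1 \<in> sets P" "?U2 \<in> sets P" "?U3 \<in> sets P" "?U4 j \<in> sets P" "?U5 j \<in> sets P" for j
    by measurable
  have "P.prob {\<omega> \<in> space P. bad (cell k c c' \<omega>) i} \<le> P.prob (?U1 \<union> ?U2 \<union> ?U3 \<union> (\<Union>j\<in>?T. ?U4 j) \<union> (\<Union>j\<in>?T. ?U5 j))"
  proof (rule P.finite_measure_mono_AE)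
    show "AE \<omega> in P. \<omega> \<in> {\<omega> \<in> space P. bad (cell k c c' \<omega>) i} \<longrightarrow> \<omega> \<in> ?U1 \<union> ?U2 \<union> ?U3 \<union> (\<Union>j\<in>?T. ?U4 j) \<union> (\<Union>j\<in>?T. ?U5 j)"
      using target_AE[OF i, of "c' i"] AE_space
    proof eventually_elim
      case (elim \<omega>)
      then obtain j where j: "j < n" "j \<noteq> i" "?t \<omega> = real j" by blast
      show ?case
      proof
        assume "\<omega> \<in> {\<omega> \<in> space P. bad (cell k c c' \<omega>) i}"
        then have b: "bad (cell k c c' \<omega>) i" by simp
        show "\<omega> \<in> ?U1 \<union> ?U2 \<union> ?U3 \<union> (\<Union>j\<in>?T. ?U4 j) \<union> (\<Union>j\<in>?T. ?U5 j)"
        proof (rule ccontr)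
          assume n: "\<not> ?thesis"
          have 1: "?a i \<omega> \<in> {0, 1}" "?b i \<omega> \<in> {0, 1}" "?a i \<omega> = 0 \<or> ?b i \<omega> = 0" using n elim(2) by auto
          have 2: "?b i \<omega> \<noteq> 0 \<Longrightarrow> ?a j \<omega> = 0 \<and> ?b j \<omega> = 0" using n elim(2) j by auto
          have "target_ok (cell k c c' \<omega>) i" if "?b i \<omega> \<noteq> 0"
            unfolding target_ok_def active_def using j 2[OF that] by (intro exI[of _ j]) simp
          then have "\<not> bad (cell k c c' \<omega>) i" using 1 unfolding bad_def active_def by auto
          then show False using b by simp
        qed
      qed
    qed
  qed (use ms in auto)
  also have "\<dots> \<le> P.prob ?U1 + P.prob ?U2 + P.prob ?U3 + P.prob (\<Union>j\<in>?T. ?U4 j) + P.prob (\<Union>j\<in>?T. ?U5 j)"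
  proof -
    have X: "(\<Union>j\<in>?T. ?U4 j) \<in> sets P" "(\<Union>j\<in>?T. ?U5 j) \<in> sets P" using ms by auto
    have "P.prob (?U1 \<union> ?U2) \<le> P.prob ?U1 + P.prob ?U2" by (rule measure_Un_le) (rule ms)+
    moreover have "P.prob (?U1 \<union> ?U2 \<union> ?U3) \<le> P.prob (?U1 \<union> ?U2) + P.prob ?U3"
      by (rule measure_Un_le) (intro sets.Un ms)+
    moreover have "P.prob (?U1 \<union> ?U2 \<union> ?U3 \<union> (\<Union>j\<in>?T. ?U4 j)) \<le> P.prob (?U1 \<union> ?U2 \<union> ?U3) + P.prob (\<Union>j\<in>?T. ?U4 j)"
      by (rule measure_Un_le) (intro sets.Un ms X)+
    moreover have "P.prob (?U1 \<union> ?U2 \<union> ?U3 \<union> (\<Union>j\<in>?T. ?U4 j) \<union> (\<Union>j\<in>?T. ?U5 j)) \<le>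
        P.prob (?U1 \<union> ?U2 \<union> ?U3 \<union> (\<Union>j\<in>?T. ?U4 j)) + P.prob (\<Union>j\<in>?T. ?U5 j)"
      by (rule measure_Un_le) (intro sets.Un ms X)+
    ultimately show ?thesis by linarith
  qed
  also have "\<dots> \<le> (lam * \<delta>)\<^sup>2 + \<delta>\<^sup>2 + (lam * \<delta>) * \<delta> + \<delta> * (lam * \<delta>) + \<delta> * \<delta>"
  proof (intro add_mono)
    show "P.prob ?U1 \<le> (lam * \<delta>)\<^sup>2" "P.prob ?U2 \<le> \<delta>\<^sup>2" by (rule prob_active_le[OF i])+
    have "P.prob ?U3 = P.prob (?a i -` (- {0}) \<inter> space P) * P.prob (?b i -` (- {0}) \<inter> space P)"
      by (rule prob_inter2) (use i in auto)
    then show "P.prob ?U3 \<le> (lam * \<delta>) * \<delta>"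
      using prob_active_le(1,2)[OF i] lam \<delta> by (simp only:) (intro mult_mono, auto)
    have T: "(\<Sum>j\<in>?T. \<delta> * (1 / real (n - 1)) * s) = \<delta> * s" for s using n2 i by simp
    have t: "P.prob (?t -` {real j} \<inter> space P) = 1 / real (n - 1)" if "j \<in> ?T" for j using V_laws(4)[OF i] that by simp
    have "P.prob (\<Union>j\<in>?T. ?U4 j) \<le> (\<Sum>j\<in>?T. P.prob (?U4 j))"
      by (rule P.finite_measure_subadditive_finite) (use ms in auto)
    also have "\<dots> \<le> (\<Sum>j\<in>?T. \<delta> * (1 / real (n - 1)) * (lam * \<delta>))"
    proof (rule sum_mono)
      fix j assume j: "j \<in> ?T"
      have "P.prob (?U4 j) = P.prob (?b i -` (- {0}) \<inter> space P) * P.prob (?t -` {real j} \<inter> space P) * P.prob (?a j -` (- {0}) \<inter> space P)"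
        by (rule prob_inter3) (use i j in auto)
      also have "\<dots> \<le> \<delta> * (1 / real (n - 1)) * (lam * \<delta>)"
        unfolding t[OF j] using prob_active_le(2)[OF i] prob_active_le(1)[of j] j \<delta> by (intro mult_mono) auto
      finally show "P.prob (?U4 j) \<le> \<delta> * (1 / real (n - 1)) * (lam * \<delta>)" .
    qed
    finally show "P.prob (\<Union>j\<in>?T. ?U4 j) \<le> \<delta> * (lam * \<delta>)" unfolding T .
    have "P.prob (\<Union>j\<in>?T. ?U5 j) \<le> (\<Sum>j\<in>?T. P.prob (?U5 j))"
      by (rule P.finite_measure_subadditive_finite) (use ms in auto)
    also have "\<dots> \<le> (\<Sum>j\<in>?T. \<delta> * (1 / real (n - 1)) * \<delta>)"
    proof (rule sum_mono)
      fix j assume j: "j \<in> ?T"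
      have "P.prob (?U5 j) = P.prob (?b i -` (- {0}) \<inter> space P) * P.prob (?t -` {real j} \<inter> space P) * P.prob (?b j -` (- {0}) \<inter> space P)"
        by (rule prob_inter3) (use i j in auto)
      also have "\<dots> \<le> \<delta> * (1 / real (n - 1)) * \<delta>"
        unfolding t[OF j] using prob_active_le(2)[OF i] prob_active_le(2)[of j] j \<delta> by (intro mult_mono) auto
      finally show "P.prob (?U5 j) \<le> \<delta> * (1 / real (n - 1)) * \<delta>" .
    qed
    finally show "P.prob (\<Union>j\<in>?T. ?U5 j) \<le> \<delta> * \<delta>" unfolding T .
  qed
  \<comment> \<open>The five bounds add up to \<open>lam\<^sup>2 + 2 * lam + 2\<close> times
    \<open>\<delta>\<^sup>2\<close>.\<close>
  also have "\<dots> \<le> 2 * rate\<^sup>2 * \<delta>\<^sup>2"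
  proof -
    have "(lam * \<delta>)\<^sup>2 + \<delta>\<^sup>2 + (lam * \<delta>) * \<delta> + \<delta> * (lam * \<delta>) + \<delta> * \<delta> = (lam\<^sup>2 + 2 * lam + 2) * \<delta>\<^sup>2"
      by (simp add: power2_eq_square algebra_simps)
    also have "\<dots> \<le> (2 * rate\<^sup>2) * \<delta>\<^sup>2"
      using lam by (intro mult_right_mono) (auto simp: rate_def power2_eq_square algebra_simps)
    finally show ?thesis by simp
  qed
  finally show ?thesis .
qed

text \<open>The noise indices of different particles form disjoint blocks, and the ideal move of a
  particle is a function of its block.\<close>

lemma hit_indep: "P.indep_vars (\<lambda>_. borel) (hit k c c' A x y) {..<n}"
proof -
  define L where "L i = {JInc i k, SInc i k, JMark i (c i), SMark i (c' i)}" for i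
  have sl: "sel k c c' (i, q) \<in> L i" for i q by (simp add: sel_def L_def)
  have "P.indep_vars (\<lambda>i. PiM (L i) (\<lambda>_. borel)) (\<lambda>i \<omega>. restrict (\<lambda>e. V e \<omega>) (L i)) {..<n}"
    by (rule P.indep_vars_restrict[OF V_indep]) (auto simp: L_def disjoint_family_on_def)
  then have "P.indep_vars (\<lambda>_. borel) (\<lambda>i \<omega>. (\<lambda>p. if ideal A x (\<lambda>q. p (sel k c c' q)) i \<le> ereal y then 1 else 0 :: real)
      (restrict (\<lambda>e. V e \<omega>) (L i))) {..<n}"
  proof (rule P.indep_vars_compose2)
    fix i
    have "(\<lambda>p. ideal A (\<lambda>j. x j) (\<lambda>q. p (sel k c c' q)) i) \<in> borel_measurable (PiM (L i) (\<lambda>_. borel))"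
      by (rule ideal_measurable[where X="\<lambda>j _. x j" and R="\<lambda>q p. p (sel k c c' q)"])
        (auto intro: measurable_component_singleton sl)
    then show "(\<lambda>p. if ideal A x (\<lambda>q. p (sel k c c' q)) i \<le> ereal y then 1 else 0 :: real) \<in> borel_measurable (PiM (L i) (\<lambda>_. borel))"
      by measurable
  qed
  also have "(\<lambda>i \<omega>. (\<lambda>p. if ideal A x (\<lambda>q. p (sel k c c' q)) i \<le> ereal y then 1 else 0 :: real)
      (restrict (\<lambda>e. V e \<omega>) (L i))) = hit k c c' A x y"
    by (intro ext) (simp add: hit_def ideal_def L_def)
  finally show ?thesis .
qed

text \<open>\<open>p10\<close> is the probability of a single jump point and no synchronization
  point, \<open>p01\<close> that of the converse. In all other cases \<open>ideal\<close> leaves the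
  particle where it is, which gives the last term.\<close>

lemma hit_mean:
  fixes A y :: real and x :: "nat \<Rightarrow> ereal"
  assumes i: "i < n"
  defines "B \<equiv> {z. max (x i) (ereal A) + ereal z \<le> ereal y}"
  defines "one \<equiv> \<lambda>j. if x j \<le> ereal y then 1 else 0 :: real"
  defines "p10 \<equiv> exp (- (lam * \<delta>)) * (lam * \<delta>) * exp (- \<delta>)" and "p01 \<equiv> exp (- (lam * \<delta>)) * (exp (- \<delta>) * \<delta>)"
  shows "P.expectation (hit k c c' A x y i) = p10 * measure \<zeta> B + p01 * (one i * (\<Sum>j\<in>{..<n} - {i}. one j) / real (n - 1))
     + (1 - p10 - p01) * one i"
proof -
  let ?a = "V (JInc i k)" and ?b = "V (SInc i k)" and ?e = "V (JMark i (c i))" and ?t = "V (SMark i (c' i))"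
  let ?T = "{..<n} - {i}"
  have Bm: "B \<in> sets borel" unfolding B_def by measurable
  let ?U1 = "?a -` {1} \<inter> ?b -` {0} \<inter> ?e -` B \<inter> space P"
  let ?U2 = "\<lambda>j. ?a -` {0} \<inter> ?b -` {1} \<inter> ?t -` {real j} \<inter> space P"
  let ?W1 = "?a -` {1} \<inter> ?b -` {0} \<inter> space P" and ?W2 = "?a -` {0} \<inter> ?b -` {1} \<inter> space P"
  have ms: "?U1 \<in> sets P" "?U2 j \<in> sets P" "?W1 \<in> sets P" "?W2 \<in> sets P" for j
    using Bm by measurable
  have la: "P.prob (?a -` {0} \<inter> space P) = exp (- (lam * \<delta>))" "P.prob (?a -` {1} \<inter> space P) = exp (- (lam * \<delta>)) * (lam * \<delta>)"
    "P.prob (?b -` {0} \<inter> space P) = exp (- \<delta>)" "P.prob (?b -` {1} \<inter> space P) = exp (- \<delta>) * \<delta>"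
    using V_laws(1)[OF i, of k 0] V_laws(1)[OF i, of k 1] V_laws(2)[OF i, of k 0] V_laws(2)[OF i, of k 1] by simp_all
  have U1: "P.prob ?U1 = p10 * measure \<zeta> B"
    using prob_inter3[of "JInc i k" "SInc i k" "JMark i (c i)" "{1}" "{0}" B] Bm i la V_laws(3)[OF i Bm]
    by (simp add: p10_def mult_ac)
  have U2: "P.prob (?U2 j) = p01 / real (n - 1)" if "j \<in> ?T" for j
    using prob_inter3[of "JInc i k" "SInc i k" "SMark i (c' i)" "{0}" "{1}" "{real j}"] i la V_laws(4)[OF i] that
    by (simp add: p01_def mult_ac)
  have W1: "P.prob ?W1 = p10"
    using prob_inter2[of "JInc i k" "SInc i k" "{1}" "{0}"] i la by (simp add: p10_def mult_ac)
  have W2: "P.prob ?W2 = p01"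
    using prob_inter2[of "JInc i k" "SInc i k" "{0}" "{1}"] i la by (simp add: p01_def mult_ac)
  have ind: "integrable P (indicat_real S)" "P.expectation (indicat_real S) = P.prob S" if "S \<in> sets P" for S
    using that by (auto simp: P.emeasure_eq_measure)
  let ?rhs = "\<lambda>\<omega>. indicat_real ?U1 \<omega> + (\<Sum>j\<in>?T. one i * one j * indicat_real (?U2 j) \<omega>) + one i * (1 - indicat_real ?W1 \<omega> - indicat_real ?W2 \<omega>)"
  have hm: "hit k c c' A x y i \<in> borel_measurable P"
    using hit_indep[of A x y] i by (auto simp: P.indep_vars_def)
  have rhsm: "?rhs \<in> borel_measurable P" 
    by (intro borel_measurable_add borel_measurable_sum borel_measurable_times borel_measurable_diff
        borel_measurable_const borel_measurable_indicator ms)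
  have "AE \<omega> in P. hit k c c' A x y i \<omega> = ?rhs \<omega>"
    using target_AE[OF i, of "c' i"] AE_space
  proof eventually_elim
    case (elim \<omega>)
    then obtain j where j: "j < n" "j \<noteq> i" "?t \<omega> = real j" by blast
    consider "?a \<omega> = 1" "?b \<omega> = 0" | "?a \<omega> = 0" "?b \<omega> = 1" | "\<not> (?a \<omega> = 1 \<and> ?b \<omega> = 0)" "\<not> (?a \<omega> = 0 \<and> ?b \<omega> = 1)" by blast
    then show ?case
    proof cases
      case 1
      then show ?thesis using elim(2) by (auto simp: hit_def ideal_def B_def indicator_def)
    next
      case 2
      have "(\<Sum>j'\<in>?T. one i * one j' * indicat_real (?U2 j') \<omega>) = (\<Sum>j'\<in>?T. if j' = j then one i * one j' else 0)"
        by (intro sum.cong refl) (use 2 j elim(2) in \<open>auto simp: indicator_def\<close>)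
      also have "\<dots> = one i * one j" using j by simp
      finally have s: "(\<Sum>j'\<in>?T. one i * one j' * indicat_real (?U2 j') \<omega>) = one i * one j" .
      have "indicat_real ?U1 \<omega> = 0" "indicat_real ?W1 \<omega> = 0" "indicat_real ?W2 \<omega> = 1" using 2 elim(2) by auto
      then have "?rhs \<omega> = one i * one j" using s by simp
      moreover have "hit k c c' A x y i \<omega> = one i * one j" using 2 j by (auto simp: hit_def ideal_def one_def)
      ultimately show ?thesis by simp
    next
      case 3
      have "(\<Sum>j'\<in>?T. one i * one j' * indicat_real (?U2 j') \<omega>) = (\<Sum>j'\<in>?T. 0)"
        by (intro sum.cong refl) (use 3 in auto)
      moreover have "indicat_real ?U1 \<omega> = 0" "indicat_real ?W1 \<omega> = 0" "indicat_real ?W2 \<omega> = 0" using 3 by auto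
      ultimately have "?rhs \<omega> = one i" by simp
      moreover have "hit k c c' A x y i \<omega> = one i" using 3 by (auto simp: hit_def ideal_def one_def)
      ultimately show ?thesis by simp
    qed
  qed
  then have "P.expectation (hit k c c' A x y i) = P.expectation ?rhs" using hm rhsm by (intro integral_cong_AE) auto
  also have "\<dots> = P.prob ?U1 + (\<Sum>j\<in>?T. one i * one j * P.prob (?U2 j)) + one i * (1 - P.prob ?W1 - P.prob ?W2)"
  proof -
    have tj: "integrable P (\<lambda>\<omega>. one i * one j * indicat_real (?U2 j) \<omega>)"
      "P.expectation (\<lambda>\<omega>. one i * one j * indicat_real (?U2 j) \<omega>) = one i * one j * P.prob (?U2 j)" for j
      using ind[OF ms(2)[of j]] by (simp_all only: integrable_mult_right integral_mult_right_zero)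
    have s: "integrable P (\<lambda>\<omega>. \<Sum>j\<in>?T. one i * one j * indicat_real (?U2 j) \<omega>)"
      "P.expectation (\<lambda>\<omega>. \<Sum>j\<in>?T. one i * one j * indicat_real (?U2 j) \<omega>) = (\<Sum>j\<in>?T. one i * one j * P.prob (?U2 j))"
      by (rule Bochner_Integration.integrable_sum, rule tj(1), subst Bochner_Integration.integral_sum, rule tj(1),
          intro sum.cong refl tj(2))
    have t: "integrable P (\<lambda>\<omega>. one i * (1 - indicat_real ?W1 \<omega> - indicat_real ?W2 \<omega>))"
      "P.expectation (\<lambda>\<omega>. one i * (1 - indicat_real ?W1 \<omega> - indicat_real ?W2 \<omega>)) = one i * (1 - P.prob ?W1 - P.prob ?W2)"
      using ind[OF ms(3)] ind[OF ms(4)] by (auto simp: P.prob_space)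
    show ?thesis using s t ind[OF ms(1)] by simp
  qed
  also have "(\<Sum>j\<in>?T. one i * one j * P.prob (?U2 j)) = (\<Sum>j\<in>?T. p01 * (one i * one j / real (n - 1)))"
    by (intro sum.cong refl) (simp add: U2)
  also have "\<dots> = p01 * (one i * (\<Sum>j\<in>?T. one j) / real (n - 1))"
    by (simp add: sum_distrib_left sum_divide_distrib)
  finally show ?thesis unfolding U1 W1 W2 by (simp add: algebra_simps)
qed

text \<open>The first term is the fluctuation of the mean over n particles. Of the
  \<open>3 * rate\<^sup>2 * \<delta>\<^sup>2\<close>, two parts come from bad particles and one from
  replacing Poisson probabilities by their linear terms. The last term arises because a particle
  never chooses itself.\<close>

definition step_error :: real where
  "step_error = 1 / sqrt (real n) + 3 * rate\<^sup>2 * \<delta>\<^sup>2 + \<delta> / real (n - 1)"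

lemma jump_frac_le:
  "(\<Sum>i<n. measure \<zeta> {z. max (x i) (ereal A) + ereal z \<le> ereal y}) / real n = jump A (frac_le n x) y"
proof -
  let ?B = "\<lambda>i. {z. max (x i) (ereal A) + ereal z \<le> ereal y}"
  have B: "max (x i) (ereal A) + ereal z \<le> ereal y \<longleftrightarrow> A \<le> y - z \<and> x i \<le> ereal (y - z)" for i z
    by (cases "x i") (auto simp: max_def)
  have Bm: "?B i \<in> sets \<zeta>" for i by measurable
  have s: "shifted A (frac_le n x) y z = (\<Sum>i<n. indicat_real (?B i) z) / real n" for z
  proof -
    have "indicat_real (?B i) z = (if A \<le> y - z \<and> x i \<le> ereal (y - z) then 1 else 0)" for i
      by (simp add: indicator_def B)
    then show ?thesis by (simp add: shifted_def frac_le_def)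
  qed
  have "jump A (frac_le n x) y = (\<Sum>i<n. \<integral>z. indicat_real (?B i) z \<partial>\<zeta>) / real n"
    unfolding jump_def s using Bm by (simp add: Bochner_Integration.integral_sum zeta.emeasure_eq_measure)
  then show ?thesis using Bm by simp
qed

text \<open>Two deviations from the Euler step. The one-point probabilities are
  \<open>lam * \<delta>\<close> and \<open>\<delta>\<close> only up to a factor \<open>1 - q\<close>
  with \<open>q \<le> rate * \<delta>\<close>, and the target is drawn from the other
  \<open>n - 1\<close> particles.\<close>

lemma hit_mean_sum:
  "\<bar>(\<Sum>i<n. P.expectation (hit k c c' A x y i)) / real n - euler A (frac_le n x) y\<bar> \<le> rate\<^sup>2 * \<delta>\<^sup>2 + \<delta> / real (n - 1)"
proof -
  define one where "one j = (if x j \<le> ereal y then 1 else 0 :: real)" for j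
  define J where "J i = measure \<zeta> {z. max (x i) (ereal A) + ereal z \<le> ereal y}" for i
  define F where "F = frac_le n x y"
  define p10 where "p10 = exp (- (lam * \<delta>)) * (lam * \<delta>) * exp (- \<delta>)"
  define p01 where "p01 = exp (- (lam * \<delta>)) * (exp (- \<delta>) * \<delta>)"
  have n0: "0 < n" "0 < real (n - 1)" using n2 by auto
  have nF: "(\<Sum>j<n. one j) = real n * F" using n0 by (simp add: F_def frac_le_def one_def)
  have F01: "0 \<le> F" "F \<le> 1" using frac_le_bounds by (auto simp: F_def)
  have one: "one i = 0 \<or> one i = 1" for i by (simp add: one_def)
  have J01: "0 \<le> J i" "J i \<le> 1" for i by (auto simp: J_def)
  have p: "p10 = lam * \<delta> * exp (- (rate * \<delta>))" "p01 = \<delta> * exp (- (rate * \<delta>))"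
    by (simp_all add: p10_def p01_def rate_def algebra_simps exp_add[symmetric])
  have e1: "0 \<le> 1 - exp (- (rate * \<delta>))" "1 - exp (- (rate * \<delta>)) \<le> rate * \<delta>"
    using rate_pos \<delta> exp_ge_1_minus[of "rate * \<delta>"] by auto
  have trm: "\<bar>P.expectation (hit k c c' A x y i) - (one i + \<delta> * (lam * (J i - one i) - one i + one i * F))\<bar>
      \<le> rate\<^sup>2 * \<delta>\<^sup>2 + \<delta> / real (n - 1)" if i: "i < n" for i
  proof -
    define Fi where "Fi = (\<Sum>j\<in>{..<n} - {i}. one j) / real (n - 1)"
    have "(\<Sum>j<n. one j) = one i + (\<Sum>j\<in>{..<n} - {i}. one j)" using i by (intro sum.remove) auto
    then have Fi: "real (n - 1) * Fi = real n * F - one i" using n0 by (simp add: Fi_def nF)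
    have Fi01: "0 \<le> Fi" "Fi \<le> 1"
    proof -
      show "0 \<le> Fi" unfolding Fi_def by (intro divide_nonneg_nonneg sum_nonneg) (auto simp: one_def)
      have "(\<Sum>j\<in>{..<n} - {i}. one j) \<le> (\<Sum>j\<in>{..<n} - {i}. 1)" by (intro sum_mono) (auto simp: one_def)
      also have "\<dots> = real (n - 1)" using i by simp
      finally show "Fi \<le> 1" using n0 by (simp add: Fi_def pos_divide_le_eq)
    qed
    \<comment> \<open>If particle i is itself below y, then removing it from the sample changes the
      fraction from F to Fi with \<open>(n - 1) * (Fi - F) = F - 1\<close>.\<close>
    have d3: "\<bar>one i * (Fi - F)\<bar> \<le> 1 / real (n - 1)"
    proof (cases "one i = 0")
      case False
      then have o: "one i = 1" using one by blast
      have "real (n - 1) * (Fi - F) = F - 1" using Fi o n0 by (simp add: of_nat_diff algebra_simps)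
      then have "\<bar>real (n - 1) * (Fi - F)\<bar> = \<bar>F - 1\<bar>" by simp
      moreover have "\<bar>real (n - 1) * (Fi - F)\<bar> = real (n - 1) * \<bar>Fi - F\<bar>" by (simp add: abs_mult)
      moreover have "\<bar>F - 1\<bar> \<le> 1" using F01 by linarith
      ultimately have "real (n - 1) * \<bar>Fi - F\<bar> \<le> 1" by linarith
      then show ?thesis using o n0 by (simp add: pos_le_divide_eq mult.commute)
    qed simp
    have m: "P.expectation (hit k c c' A x y i) = p10 * J i + p01 * (one i * Fi) + (1 - p10 - p01) * one i"
      using hit_mean[OF i, of A x y] by (simp add: J_def one_def p10_def p01_def Fi_def)
    define q where "q = 1 - exp (- (rate * \<delta>))"
    have pq: "p10 = lam * \<delta> * (1 - q)" "p01 = \<delta> * (1 - q)" unfolding p q_def by auto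
    have "P.expectation (hit k c c' A x y i) - (one i + \<delta> * (lam * (J i - one i) - one i + one i * F))
       = q * (\<delta> * (lam * (one i - J i) + one i * (1 - Fi))) + \<delta> * (one i * (Fi - F))"
      unfolding m pq by (simp add: algebra_simps)
    also have "\<bar>\<dots>\<bar> \<le> \<bar>q * (\<delta> * (lam * (one i - J i) + one i * (1 - Fi)))\<bar> + \<bar>\<delta> * (one i * (Fi - F))\<bar>"
      by (rule abs_triangle_ineq)
    also have "\<dots> \<le> (rate * \<delta>) * (\<delta> * rate) + \<delta> * (1 / real (n - 1))"
    proof (rule add_mono)
      have a: "\<bar>lam * (one i - J i) + one i * (1 - Fi)\<bar> \<le> rate"
      proof -
        have "\<bar>one i - J i\<bar> \<le> 1" "\<bar>one i * (1 - Fi)\<bar> \<le> 1" using one[of i] J01[of i] Fi01 by auto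
        moreover from this have "lam * \<bar>one i - J i\<bar> \<le> lam * 1" using lam by (intro mult_left_mono)
        moreover have "\<bar>lam * (one i - J i)\<bar> = lam * \<bar>one i - J i\<bar>" using lam by (simp add: abs_mult)
        ultimately show ?thesis by (simp add: rate_def)
      qed
      have "\<bar>q * (\<delta> * (lam * (one i - J i) + one i * (1 - Fi)))\<bar> = q * (\<delta> * \<bar>lam * (one i - J i) + one i * (1 - Fi)\<bar>)"
        using e1 \<delta> by (simp add: abs_mult q_def)
      also have "\<dots> \<le> (rate * \<delta>) * (\<delta> * rate)"
        using e1 \<delta> a rate_pos by (intro mult_mono mult_nonneg_nonneg) (auto simp: q_def)
      finally show "\<bar>q * (\<delta> * (lam * (one i - J i) + one i * (1 - Fi)))\<bar> \<le> (rate * \<delta>) * (\<delta> * rate)" .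
      show "\<bar>\<delta> * (one i * (Fi - F))\<bar> \<le> \<delta> * (1 / real (n - 1))"
        using mult_left_mono[OF d3, of \<delta>] \<delta> by (simp add: abs_mult)
    qed
    finally show ?thesis by (simp add: power2_eq_square mult_ac)
  qed
  have "euler A (frac_le n x) y = (\<Sum>i<n. one i + \<delta> * (lam * (J i - one i) - one i + one i * F)) / real n"
  proof -
    have j: "(\<Sum>i<n. J i) = real n * jump A (frac_le n x) y"
      using jump_frac_le[of x A y] n0 by (simp add: J_def field_simps)
    have "(\<Sum>i<n. one i + \<delta> * (lam * (J i - one i) - one i + one i * F)) =
      (\<Sum>i<n. one i) + \<delta> * (lam * ((\<Sum>i<n. J i) - (\<Sum>i<n. one i)) - (\<Sum>i<n. one i) + (\<Sum>i<n. one i) * F)"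
      by (simp add: sum.distrib sum_distrib_left sum_distrib_right sum_subtractf algebra_simps)
    also have "\<dots> = real n * (F + \<delta> * (lam * (jump A (frac_le n x) y - F) - F + F * F))"
      unfolding nF j by (simp add: algebra_simps)
    finally have eq: "(\<Sum>i<n. one i + \<delta> * (lam * (J i - one i) - one i + one i * F)) =
      real n * (F + \<delta> * (lam * (jump A (frac_le n x) y - F) - F + F * F))" .
    have "euler A (frac_le n x) y = F + \<delta> * (lam * (jump A (frac_le n x) y - F) - F + F * F)"
      by (simp add: euler_def model_rhs_def gain_def rate_def F_def power2_eq_square algebra_simps)
    then show ?thesis unfolding eq using n0 by simp
  qed
  then have "\<bar>(\<Sum>i<n. P.expectation (hit k c c' A x y i)) / real n - euler A (frac_le n x) y\<bar> =
    \<bar>\<Sum>i<n. P.expectation (hit k c c' A x y i) - (one i + \<delta> * (lam * (J i - one i) - one i + one i * F))\<bar> / real n"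
    by (simp add: diff_divide_distrib[symmetric] sum_subtractf)
  also have "\<dots> \<le> (\<Sum>i<n. rate\<^sup>2 * \<delta>\<^sup>2 + \<delta> / real (n - 1)) / real n"
    using trm by (intro divide_right_mono order_trans[OF sum_abs] sum_mono) auto
  also have "\<dots> = rate\<^sup>2 * \<delta>\<^sup>2 + \<delta> / real (n - 1)" using n0 by simp
  finally show ?thesis .
qed

text \<open>The distance to the Euler step is split at the ideal configuration and at its mean: bad
  particles, fluctuation, bias.\<close>

lemma one_step:
  "P.expectation (\<lambda>\<omega>. \<bar>frac_le n (step w A x (cell k c c' \<omega>)) y - euler A (frac_le n x) y\<bar>) \<le> step_error"
proof -
  have n0: "0 < n" using n2 by auto
  let ?bad = "\<lambda>\<omega>. (\<Sum>i<n. indicat_real {\<omega> \<in> space P. bad (cell k c c' \<omega>) i} \<omega>) / real n"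
  let ?fl = "\<lambda>\<omega>. \<bar>(\<Sum>i<n. hit k c c' A x y i \<omega> - P.expectation (hit k c c' A x y i)) / real n\<bar>"
  let ?C = "rate\<^sup>2 * \<delta>\<^sup>2 + \<delta> / real (n - 1)"
  have bm: "{\<omega> \<in> space P. bad (cell k c c' \<omega>) i} \<in> sets P" if "i < n" for i
    using bad_measurable[OF that, where R="\<lambda>q \<omega>. cell k c c' \<omega> q" and M=P] by (simp add: pred_def)
  have hm: "hit k c c' A x y i \<in> borel_measurable P" if "i < n" for i
    using hit_indep[of A x y] that by (auto simp: P.indep_vars_def)
  have h01: "0 \<le> hit k c c' A x y i \<omega> \<and> hit k c c' A x y i \<omega> \<le> 1" for i \<omega> by (simp add: hit_def)
  have ib: "integrable P (indicat_real {\<omega> \<in> space P. bad (cell k c c' \<omega>) i})" if "i < n" for i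
    using bm[OF that] by (simp add: P.emeasure_eq_measure)
  have "integrable P (\<lambda>\<omega>. \<Sum>i<n. indicat_real {\<omega> \<in> space P. bad (cell k c c' \<omega>) i} \<omega>)"
    by (rule Bochner_Integration.integrable_sum) (use ib in auto)
  then have bi: "integrable P ?bad" by (rule integrable_divide_zero)
  have hi: "integrable P (hit k c c' A x y i)" if "i < n" for i
    by (rule P.integrable_const_bound[where B=1]) (use h01 hm[OF that] in auto)
  have "integrable P (\<lambda>\<omega>. \<Sum>i<n. hit k c c' A x y i \<omega> - P.expectation (hit k c c' A x y i))"
    by (rule Bochner_Integration.integrable_sum) (use hi in auto)
  then have fli: "integrable P ?fl" by (intro integrable_abs integrable_divide_zero)
  have pt: "\<bar>frac_le n (step w A x (cell k c c' \<omega>)) y - euler A (frac_le n x) y\<bar> \<le> ?bad \<omega> + ?fl \<omega> + ?C" if "\<omega> \<in> space P" for \<omega>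
  proof -
    have 1: "\<bar>frac_le n (step w A x (cell k c c' \<omega>)) y - frac_le n (ideal A x (cell k c c' \<omega>)) y\<bar> \<le> ?bad \<omega>"
      using frac_le_step[of w A x "cell k c c' \<omega>" y] that by (simp add: indicator_def of_bool_def)
    have "frac_le n (ideal A x (cell k c c' \<omega>)) y = (\<Sum>i<n. hit k c c' A x y i \<omega>) / real n"
      by (simp add: frac_le_def hit_def)
    then have "\<bar>frac_le n (ideal A x (cell k c c' \<omega>)) y - (\<Sum>i<n. P.expectation (hit k c c' A x y i)) / real n\<bar> = ?fl \<omega>"
      by (simp add: diff_divide_distrib[symmetric] sum_subtractf)
    moreover have "\<bar>a - d\<bar> \<le> p + q + s"
      if "\<bar>a - b\<bar> \<le> p" "\<bar>b - c\<bar> = q" "\<bar>c - d\<bar> \<le> s" for a b c d p q s :: real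
      using that by linarith
    ultimately show ?thesis using 1 hit_mean_sum[of A x y] by blast
  qed
  have "P.expectation (\<lambda>\<omega>. \<bar>frac_le n (step w A x (cell k c c' \<omega>)) y - euler A (frac_le n x) y\<bar>) \<le> P.expectation (\<lambda>\<omega>. ?bad \<omega> + ?fl \<omega> + ?C)"
  proof (rule integral_mono_AE')
    show "integrable P (\<lambda>\<omega>. ?bad \<omega> + ?fl \<omega> + ?C)" using bi fli by auto
    show "AE \<omega> in P. 0 \<le> ?bad \<omega> + ?fl \<omega> + ?C"
      by (rule AE_I2, rule order_trans[OF abs_ge_zero pt])
    show "AE \<omega> in P. \<bar>frac_le n (step w A x (cell k c c' \<omega>)) y - euler A (frac_le n x) y\<bar> \<le> ?bad \<omega> + ?fl \<omega> + ?C"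
      by (rule AE_I2, rule pt)
  qed
  also have "\<dots> = P.expectation ?bad + P.expectation ?fl + ?C" using bi fli by (simp add: P.prob_space)
  also have "P.expectation ?bad = (\<Sum>i<n. P.prob {\<omega> \<in> space P. bad (cell k c c' \<omega>) i}) / real n"
    using ib bm by (simp add: Bochner_Integration.integral_sum)
  also have "\<dots> \<le> (\<Sum>i<n. 2 * rate\<^sup>2 * \<delta>\<^sup>2) / real n"
    by (intro divide_right_mono sum_mono prob_bad) auto
  also have "\<dots> = 2 * rate\<^sup>2 * \<delta>\<^sup>2" using n0 by simp
  also have "P.expectation ?fl \<le> 1 / sqrt (real n)"
    by (rule P.weak_law_L1[OF hit_indep n0]) (use h01 in auto)
  finally show ?thesis by (simp add: step_error_def algebra_simps)
qed

end

end

section \<open>The chains with random mark indices, and the independence of past and future\<close>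

context noise_grid
begin

text \<open>The number of points before cell k, recovered from the noise vector itself, so that a
  chain is a function of \<open>\<nu>\<close> alone.\<close>

definition cJ :: "(noise_index \<Rightarrow> real) \<Rightarrow> nat \<Rightarrow> nat \<Rightarrow> nat" where
  "cJ \<nu> k i = nat \<lfloor>\<Sum>j<k. \<nu> (JInc i j)\<rfloor>"

definition cS :: "(noise_index \<Rightarrow> real) \<Rightarrow> nat \<Rightarrow> nat \<Rightarrow> nat" where
  "cS \<nu> k i = nat \<lfloor>\<Sum>j<k. \<nu> (SInc i j)\<rfloor>"

definition cellv :: "(noise_index \<Rightarrow> real) \<Rightarrow> nat \<Rightarrow> nat \<times> nat \<Rightarrow> real" where
  "cellv \<nu> k p = \<nu> (sel k (cJ \<nu> k) (cS \<nu> k) p)"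

text \<open>\<open>As k\<close> is the boundary level used throughout cell k. The lower chain takes
  the level at the start of the cell and \<open>w\<close> minus infinity, the upper one the level at
  the end and plus infinity.\<close>

primrec chain :: "ereal \<Rightarrow> (nat \<Rightarrow> real) \<Rightarrow> (nat \<Rightarrow> ereal) \<Rightarrow> (noise_index \<Rightarrow> real) \<Rightarrow> nat \<Rightarrow> nat \<Rightarrow> ereal" where
  "chain w As x0 \<nu> 0 = x0"
| "chain w As x0 \<nu> (Suc k) = step w (As k) (chain w As x0 \<nu> k) (cellv \<nu> k)"

definition counts :: "(noise_index \<Rightarrow> real) \<Rightarrow> nat \<Rightarrow> (nat \<times> nat) list" where
  "counts \<nu> k = map (\<lambda>i. (cJ \<nu> k i, cS \<nu> k i)) [0..<n]"

text \<open>For counts c reached at the start of cell k: all variables that the first k steps can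
  have read. The set is deterministic once c is fixed.\<close>

definition past :: "nat \<Rightarrow> (nat \<times> nat) list \<Rightarrow> noise_index set" where
  "past k c = {a \<in> idx. case a of JInc i j \<Rightarrow> j < k | SInc i j \<Rightarrow> j < k
     | JMark i l \<Rightarrow> l < fst (c ! i) | SMark i l \<Rightarrow> l < snd (c ! i)}"

definition sel_c :: "nat \<Rightarrow> (nat \<times> nat) list \<Rightarrow> nat \<times> nat \<Rightarrow> noise_index" where
  "sel_c k c = sel k (\<lambda>i. fst (c ! i)) (\<lambda>i. snd (c ! i))"

text \<open>The variables that step k reads when the counts are c. Its marks have the first index
  not in \<open>past\<close>, so the two sets are disjoint.\<close>

definition future :: "nat \<Rightarrow> (nat \<times> nat) list \<Rightarrow> noise_index set" where
  "future k c = sel_c k c ` ({..<n} \<times> UNIV)"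

text \<open>A mark is read only if its clock shows exactly one point in the cell; unread marks may
  be changed freely.\<close>

lemma step_cong:
  assumes "\<And>j. j < n \<Longrightarrow> r (j, 0) = r' (j, 0)" "\<And>j. j < n \<Longrightarrow> r (j, 1) = r' (j, 1)"
    and "i < n \<Longrightarrow> r (i, 0) = 1 \<Longrightarrow> r (i, 2) = r' (i, 2)" and "i < n \<Longrightarrow> r (i, 1) = 1 \<Longrightarrow> r (i, 3) = r' (i, 3)"
  shows "step w A x r i = step w A x r' i"
proof (cases "i < n")
  case True
  have t: "target_ok r i \<longleftrightarrow> target_ok r' i" if "r (i, 1) = 1"
    using assms(1,2) assms(4)[OF True that] by (auto simp: target_ok_def active_def)
  have "bad r i \<longleftrightarrow> bad r' i"
    using t assms(1,2)[OF True] by (auto simp: bad_def active_def)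
  moreover have "ideal A x r i = ideal A x r' i"
    using assms(1,2)[OF True] assms(3,4)[OF True] by (simp add: ideal_def)
  ultimately show ?thesis by (simp add: step_def)
qed (simp add: step_def)

lemma V_nat:
  assumes "\<omega> \<in> space P" shows "V (JInc i j) \<omega> \<in> \<nat>" "V (SInc i j) \<omega> \<in> \<nat>"
  using V_laws(5,6)[OF _ assms, of i j] by (cases "i < n"; simp add: V_def)+

lemma cnt_mono:
  assumes "\<And>j. f j \<in> \<nat>" "(m :: nat) \<le> k"
  shows "nat \<lfloor>\<Sum>j<m. f j\<rfloor> \<le> nat \<lfloor>\<Sum>j<k. f j :: real\<rfloor>"
proof -
  have "0 \<le> f j" for j using assms(1)[of j] by (auto elim: Nats_cases)
  then have "(\<Sum>j<m. f j) \<le> (\<Sum>j<k. f j)" using assms(2) by (intro sum_mono2) auto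
  then show ?thesis by (intro nat_mono floor_mono)
qed

lemma cnt_Suc:
  assumes "\<And>j. f j \<in> \<nat>" "f m = 1"
  shows "nat \<lfloor>\<Sum>j<m. f j\<rfloor> < nat \<lfloor>\<Sum>j<Suc m. f j :: real\<rfloor>"
proof -
  have "(\<Sum>j<m. f j) \<in> \<nat>" using assms(1) by (induction m) auto
  then obtain a where a: "(\<Sum>j<m. f j) = real a" by (auto elim: Nats_cases)
  show ?thesis by (simp add: a assms(2))
qed

lemma counts_restrict:
  "i < n \<Longrightarrow> m \<le> k \<Longrightarrow> cJ (restrict \<nu> (past k c)) m i = cJ \<nu> m i"
  "i < n \<Longrightarrow> m \<le> k \<Longrightarrow> cS (restrict \<nu> (past k c)) m i = cS \<nu> m i"
  "counts (restrict \<nu> (past k c)) k = counts \<nu> k"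
proof -
  show 1: "i < n \<Longrightarrow> m \<le> k \<Longrightarrow> cJ (restrict \<nu> (past k c)) m i = cJ \<nu> m i" for i m
    unfolding cJ_def by (intro arg_cong[where f=nat] arg_cong[where f=floor] sum.cong) (auto simp: past_def idx_def)
  show 2: "i < n \<Longrightarrow> m \<le> k \<Longrightarrow> cS (restrict \<nu> (past k c)) m i = cS \<nu> m i" for i m
    unfolding cS_def by (intro arg_cong[where f=nat] arg_cong[where f=floor] sum.cong) (auto simp: past_def idx_def)
  show "counts (restrict \<nu> (past k c)) k = counts \<nu> k"
    unfolding counts_def using 1 2 by (intro map_cong) auto
qed

text \<open>The chain is adapted: a mark read in an earlier cell belongs to a point in that cell, so
  its index lies below the count at time k. Integer-valued increments make the counts
  nondecreasing.\<close>

lemma chain_restrict: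
  assumes N: "\<And>i j. \<nu> (JInc i j) \<in> \<nat>" "\<And>i j. \<nu> (SInc i j) \<in> \<nat>" and c: "counts \<nu> k = c" and "m \<le> k"
  shows "chain w As x0 (restrict \<nu> (past k c)) m = chain w As x0 \<nu> m"
  using \<open>m \<le> k\<close>
proof (induction m)
  case (Suc m)
  let ?\<nu> = "restrict \<nu> (past k c)"
  have ck: "fst (c ! i) = cJ \<nu> k i" "snd (c ! i) = cS \<nu> k i" if "i < n" for i
    using c that by (auto simp: counts_def)
  have "step w (As m) (chain w As x0 \<nu> m) (cellv ?\<nu> m) i = step w (As m) (chain w As x0 \<nu> m) (cellv \<nu> m) i" for i
  proof (rule step_cong)
    have mk: "m < k" "m \<le> k" using Suc.prems by auto
    show "cellv ?\<nu> m (j, 0) = cellv \<nu> m (j, 0)" "cellv ?\<nu> m (j, 1) = cellv \<nu> m (j, 1)" if "j < n" for j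
      using that mk by (auto simp: cellv_def past_def idx_def)
    show "cellv ?\<nu> m (i, 2) = cellv \<nu> m (i, 2)" if i: "i < n" and 1: "cellv ?\<nu> m (i, 0) = 1"
    proof -
      have "\<nu> (JInc i m) = 1" using 1 i mk by (auto simp: cellv_def past_def idx_def)
      then have "cJ \<nu> m i < cJ \<nu> (Suc m) i" unfolding cJ_def by (intro cnt_Suc N)
      also have "\<dots> \<le> cJ \<nu> k i" unfolding cJ_def using mk by (intro cnt_mono N) auto
      finally show ?thesis using i mk ck(1)[OF i] counts_restrict(1)[OF i mk(2)]
        by (simp add: cellv_def past_def idx_def)
    qed
    show "cellv ?\<nu> m (i, 3) = cellv \<nu> m (i, 3)" if i: "i < n" and 1: "cellv ?\<nu> m (i, 1) = 1"
    proof -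
      have "\<nu> (SInc i m) = 1" using 1 i mk by (auto simp: cellv_def past_def idx_def)
      then have "cS \<nu> m i < cS \<nu> (Suc m) i" unfolding cS_def by (intro cnt_Suc N)
      also have "\<dots> \<le> cS \<nu> k i" unfolding cS_def using mk by (intro cnt_mono N) auto
      finally show ?thesis using i mk ck(2)[OF i] counts_restrict(2)[OF i mk(2)]
        by (simp add: cellv_def past_def idx_def)
    qed
  qed
  note st = this
  have ih: "chain w As x0 ?\<nu> m = chain w As x0 \<nu> m"
    by (rule Suc.IH) (use Suc.prems in simp)
  show ?case unfolding chain.simps ih by (rule ext) (rule st)
qed simp

context
  fixes M :: "'m measure" and \<nu> :: "'m \<Rightarrow> noise_index \<Rightarrow> real"
  assumes \<nu>: "\<And>a. (\<lambda>\<omega>. \<nu> \<omega> a) \<in> borel_measurable M"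
begin

lemma cJ_measurable [measurable]: "(\<lambda>\<omega>. cJ (\<nu> \<omega>) k i) \<in> M \<rightarrow>\<^sub>M count_space UNIV"
  and cS_measurable [measurable]: "(\<lambda>\<omega>. cS (\<nu> \<omega>) k i) \<in> M \<rightarrow>\<^sub>M count_space UNIV"
  unfolding cJ_def cS_def using \<nu> by measurable

lemma cellv_measurable: "(\<lambda>\<omega>. cellv (\<nu> \<omega>) k (i, q)) \<in> borel_measurable M"
proof -
  consider "q = 0" | "q = 1" | "q = 2" | "q \<noteq> 0" "q \<noteq> 1" "q \<noteq> 2" by blast
  then show ?thesis
  proof cases
    case 3
    have "(\<lambda>\<omega>. \<nu> \<omega> (JMark i (cJ (\<nu> \<omega>) k i))) \<in> borel_measurable M"
      by (rule measurable_compose_countable[where f="\<lambda>l \<omega>. \<nu> \<omega> (JMark i l)" and g="\<lambda>\<omega>. cJ (\<nu> \<omega>) k i"])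
        (use \<nu> cJ_measurable in auto)
    then show ?thesis using 3 by (simp add: cellv_def sel_def)
  next
    case 4
    have "(\<lambda>\<omega>. \<nu> \<omega> (SMark i (cS (\<nu> \<omega>) k i))) \<in> borel_measurable M"
      by (rule measurable_compose_countable[where f="\<lambda>l \<omega>. \<nu> \<omega> (SMark i l)" and g="\<lambda>\<omega>. cS (\<nu> \<omega>) k i"])
        (use \<nu> cS_measurable in auto)
    then show ?thesis using 4 by (simp add: cellv_def sel_def)
  qed (use \<nu> in \<open>simp_all add: cellv_def sel_def\<close>)
qed

lemma step_measurable:
  assumes X: "\<And>j. X j \<in> borel_measurable M" and R: "\<And>q. R q \<in> borel_measurable M"
  shows "(\<lambda>\<omega>. step w A (\<lambda>j. X j \<omega>) (\<lambda>q. R q \<omega>) i) \<in> borel_measurable M"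
proof (cases "i < n")
  case True
  have [measurable]: "Measurable.pred M (\<lambda>\<omega>. bad (\<lambda>q. R q \<omega>) i)" by (rule bad_measurable[OF True R])
  have [measurable]: "(\<lambda>\<omega>. ideal A (\<lambda>j. X j \<omega>) (\<lambda>q. R q \<omega>) i) \<in> borel_measurable M" by (rule ideal_measurable[OF X R])
  show ?thesis using True by (simp add: step_def)
qed (use X in \<open>simp add: step_def\<close>)

lemma chain_measurable: "(\<lambda>\<omega>. chain w As x0 (\<nu> \<omega>) k i) \<in> borel_measurable M"
proof (induction k arbitrary: i)
  case (Suc k)
  have R: "(\<lambda>\<omega>. cellv (\<nu> \<omega>) k q) \<in> borel_measurable M" for q using cellv_measurable by (cases q) simp
  show ?case
    using step_measurable[where X="\<lambda>j \<omega>. chain w As x0 (\<nu> \<omega>) k j" and R="\<lambda>q \<omega>. cellv (\<nu> \<omega>) k q", OF Suc R]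
    by simp
qed simp

end

lemma frac_le_measurable:
  assumes X: "\<And>j. X j \<in> borel_measurable M" and y: "y \<in> borel_measurable M"
  shows "(\<lambda>\<omega>. frac_le n (\<lambda>j. X j \<omega>) (y \<omega>)) \<in> borel_measurable M"
  unfolding frac_le_def using X y by measurable

lemma euler_measurable:
  assumes X: "\<And>j. X j \<in> borel_measurable M"
  shows "(\<lambda>\<omega>. euler A (frac_le n (\<lambda>j. X j \<omega>)) y) \<in> borel_measurable M"
proof -
  have [measurable]: "(\<lambda>p. frac_le n (\<lambda>j. X j (fst p)) (y - snd p)) \<in> borel_measurable (M \<Otimes>\<^sub>M \<zeta>)"
    by (rule frac_le_measurable[where X="\<lambda>j p. X j (fst p)"]) (use X in measurable)
  have "(\<lambda>p. shifted A (frac_le n (\<lambda>j. X j (fst p))) y (snd p)) \<in> borel_measurable (M \<Otimes>\<^sub>M \<zeta>)"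
    unfolding shifted_def by measurable
  then have [measurable]: "(\<lambda>\<omega>. jump A (frac_le n (\<lambda>j. X j \<omega>)) y) \<in> borel_measurable M"
    unfolding jump_def by (intro zeta.borel_measurable_lebesgue_integral) (simp add: case_prod_unfold)
  have [measurable]: "(\<lambda>\<omega>. frac_le n (\<lambda>j. X j \<omega>) y) \<in> borel_measurable M"
    by (rule frac_le_measurable[OF X]) simp
  show ?thesis unfolding euler_def model_rhs_def gain_def by measurable
qed

definition Vc :: "'w \<Rightarrow> noise_index \<Rightarrow> real" where "Vc \<omega> = (\<lambda>a. V a \<omega>)"

lemma Vc_measurable: "(\<lambda>\<omega>. Vc \<omega> a) \<in> borel_measurable P" by (simp add: Vc_def)

definition defect :: "ereal \<Rightarrow> real \<Rightarrow> real \<Rightarrow> (nat \<Rightarrow> ereal) \<Rightarrow> (nat \<times> nat \<Rightarrow> real) \<Rightarrow> real" where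
  "defect w A y x r = \<bar>frac_le n (step w A x r) y - euler A (frac_le n x) y\<bar>"

lemma defect_measurable:
  assumes X: "\<And>j. X j \<in> borel_measurable M" and R: "\<And>q. R q \<in> borel_measurable M"
  shows "(\<lambda>\<omega>. defect w A y (\<lambda>j. X j \<omega>) (\<lambda>q. R q \<omega>)) \<in> borel_measurable M"
proof -
  have "(\<lambda>\<omega>. frac_le n (\<lambda>i. step w A (\<lambda>j. X j \<omega>) (\<lambda>q. R q \<omega>) i) y) \<in> borel_measurable M"
    by (rule frac_le_measurable[where X="\<lambda>i \<omega>. step w A (\<lambda>j. X j \<omega>) (\<lambda>q. R q \<omega>) i"])
      (use step_measurable[where \<nu>="\<lambda>_ _. 0", OF _ X R] in auto)
  then show ?thesis using euler_measurable[OF X] unfolding defect_def by measurable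
qed

lemma defect_nn:
  "(\<integral>\<^sup>+\<omega>. ennreal (defect w A y x (cell k c c' \<omega>)) \<partial>P) \<le> ennreal step_error"
proof -
  have m: "(\<lambda>\<omega>. defect w A y x (cell k c c' \<omega>)) \<in> borel_measurable P"
    by (rule defect_measurable[where X="\<lambda>j _. x j" and R="\<lambda>q \<omega>. cell k c c' \<omega> q"]) auto
  define C where "C = 1 + \<bar>euler A (frac_le n x) y\<bar>"
  have b: "defect w A y x r \<le> C" for r
    unfolding defect_def C_def using frac_le_bounds[of n "step w A x r" y] by linarith
  have "integrable P (\<lambda>\<omega>. defect w A y x (cell k c c' \<omega>))"
  proof (rule P.integrable_const_bound[where B=C])
    show "AE \<omega> in P. norm (defect w A y x (cell k c c' \<omega>)) \<le> C"
      using b by (intro AE_I2) (simp add: defect_def)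
  qed (rule m)
  then have "(\<integral>\<^sup>+\<omega>. ennreal (defect w A y x (cell k c c' \<omega>)) \<partial>P) = ennreal (P.expectation (\<lambda>\<omega>. defect w A y x (cell k c c' \<omega>)))"
    by (intro nn_integral_eq_integral) (auto simp: defect_def)
  also have "\<dots> \<le> ennreal step_error" using one_step by (intro ennreal_leI) (simp add: defect_def)
  finally show ?thesis .
qed

lemma past_future: "past k c \<inter> future k c = {}" "past k c \<subseteq> idx" "future k c \<subseteq> idx"
  by (auto simp: past_def future_def sel_c_def sel_def idx_def split: if_splits)

text \<open>A coordinate outside A is constantly \<open>undefined\<close>. This allows chains, which
  mention all coordinates, to be evaluated on restricted noise vectors.\<close>

lemma component_measurable: "(\<lambda>p. p a) \<in> borel_measurable (PiM A (\<lambda>_. borel :: real measure))"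
proof (cases "a \<in> A")
  case False
  have "(\<lambda>p. p a) \<in> borel_measurable (PiM A (\<lambda>_. borel :: real measure)) \<longleftrightarrow>
    (\<lambda>p. undefined :: real) \<in> borel_measurable (PiM A (\<lambda>_. borel :: real measure))"
    by (rule measurable_cong) (use False in \<open>auto simp: space_PiM PiE_def extensional_def\<close>)
  then show ?thesis by simp
qed simp

definition chain_defect :: "ereal \<Rightarrow> (nat \<Rightarrow> real) \<Rightarrow> (nat \<Rightarrow> ereal) \<Rightarrow> real \<Rightarrow> nat \<Rightarrow> 'w \<Rightarrow> real" where
  "chain_defect w As x0 y k \<omega> = defect w (As k) y (chain w As x0 (Vc \<omega>) k) (cellv (Vc \<omega>) k)"

text \<open>On the event that the counts equal c, the chain is a function of the \<open>past\<close>
  variables and the cell a function of the \<open>future\<close> ones. These are independent, so by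
  Fubini the bound for a deterministic configuration and fixed mark indices applies under the
  integral.\<close>

lemma defect_counts:
  "(\<integral>\<^sup>+\<omega>. ennreal (chain_defect w As x0 y k \<omega>) * indicator {counts (Vc \<omega>) k} c \<partial>P)
   \<le> ennreal step_error * (\<integral>\<^sup>+\<omega>. indicator {counts (Vc \<omega>) k} c \<partial>P)"
proof -
  let ?cell = "cell k (\<lambda>i. fst (c ! i)) (\<lambda>i. snd (c ! i))"
  let ?A = "past k c" and ?B = "future k c"
  let ?MA = "PiM ?A (\<lambda>_. borel :: real measure)" and ?MB = "PiM ?B (\<lambda>_. borel :: real measure)"
  define pv where "pv \<omega> = restrict (\<lambda>a. V a \<omega>) ?A" for \<omega>
  define fv where "fv \<omega> = restrict (\<lambda>a. V a \<omega>) ?B" for \<omega>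
  have ind: "P.indep_var ?MA pv ?MB fv"
    unfolding pv_def[abs_def] fv_def[abs_def] by (rule P.indep_var_restrict[OF V_indep past_future])
  have pvm: "pv \<in> P \<rightarrow>\<^sub>M ?MA" and fvm: "fv \<in> P \<rightarrow>\<^sub>M ?MB"
    and dist: "distr P ?MA pv \<Otimes>\<^sub>M distr P ?MB fv = distr P (?MA \<Otimes>\<^sub>M ?MB) (\<lambda>\<omega>. (pv \<omega>, fv \<omega>))"
    using ind unfolding P.indep_var_distribution_eq by auto
  define \<Phi> where "\<Phi> = (\<lambda>(p, f). ennreal (defect w (As k) y (chain w As x0 p k) (\<lambda>q. f (sel_c k c q))) * indicator {counts p k} c)"
  have cm: "(\<lambda>p. counts p k) \<in> ?MA \<rightarrow>\<^sub>M count_space UNIV"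
    unfolding counts_def
  proof -
    have "(\<lambda>p. (cJ p k i, cS p k i)) \<in> ?MA \<rightarrow>\<^sub>M count_space UNIV" for i
    proof (rule measurable_compose_countable[where f="\<lambda>a p. (a, cS p k i)" and g="\<lambda>p. cJ p k i"])
      show "(\<lambda>p. (a, cS p k i)) \<in> ?MA \<rightarrow>\<^sub>M count_space UNIV" for a
        by (rule measurable_compose[OF cS_measurable[OF component_measurable], of "\<lambda>b. (a, b)"]) simp
    qed (rule cJ_measurable[OF component_measurable])
    then show "(\<lambda>p. map (\<lambda>i. (cJ p k i, cS p k i)) [0..<n]) \<in> ?MA \<rightarrow>\<^sub>M count_space UNIV"
      by (intro measurable_map_countable[where g="\<lambda>i p. (cJ p k i, cS p k i)"])
  qed
  have im: "(\<lambda>p. indicator {counts p k} c :: ennreal) \<in> borel_measurable ?MA"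
    by (rule measurable_compose[OF cm, of "\<lambda>l. indicator {l} c"]) simp
  have \<Phi>m: "\<Phi> \<in> borel_measurable (?MA \<Otimes>\<^sub>M ?MB)"
  proof -
    have "(\<lambda>q. defect w (As k) y (\<lambda>j. chain w As x0 (fst q) k j) (\<lambda>s. snd q (sel_c k c s))) \<in> borel_measurable (?MA \<Otimes>\<^sub>M ?MB)"
    proof (rule defect_measurable[where X="\<lambda>j q. chain w As x0 (fst q) k j" and R="\<lambda>s q. snd q (sel_c k c s)"])
      show "(\<lambda>q. chain w As x0 (fst q) k j) \<in> borel_measurable (?MA \<Otimes>\<^sub>M ?MB)" for j
        by (rule measurable_compose[OF measurable_fst chain_measurable[OF component_measurable]])
      show "(\<lambda>q. snd q (sel_c k c s)) \<in> borel_measurable (?MA \<Otimes>\<^sub>M ?MB)" for s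
        by (rule measurable_compose[OF measurable_snd component_measurable])
    qed
    then show ?thesis
      unfolding \<Phi>_def case_prod_unfold using measurable_compose[OF measurable_fst im]
      by (intro borel_measurable_times_ennreal measurable_compose[OF _ measurable_ennreal]) auto
  qed
  \<comment> \<open>On the event \<open>counts = c\<close> the true chain and cell agree with those
    built from the restricted vectors. Off this event both sides vanish, as the counts themselves
    can be read off the past.\<close>
  have eq: "ennreal (chain_defect w As x0 y k \<omega>) * indicator {counts (Vc \<omega>) k} c = \<Phi> (pv \<omega>, fv \<omega>)"
    if \<omega>: "\<omega> \<in> space P" for \<omega>
  proof -
    have pvr: "pv \<omega> = restrict (Vc \<omega>) ?A" by (simp add: pv_def Vc_def)
    have cc: "counts (pv \<omega>) k = counts (Vc \<omega>) k" unfolding pvr by (rule counts_restrict)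
    show ?thesis
    proof (cases "counts (Vc \<omega>) k = c")
      case True
      have ch: "chain w As x0 (pv \<omega>) k = chain w As x0 (Vc \<omega>) k"
        unfolding pvr by (rule chain_restrict) (use V_nat[OF \<omega>] True in \<open>auto simp: Vc_def\<close>)
      have ck: "fst (c ! i) = cJ (Vc \<omega>) k i" "snd (c ! i) = cS (Vc \<omega>) k i" if "i < n" for i
        using True that by (auto simp: counts_def)
      have cl: "fv \<omega> (sel_c k c (i, q)) = cellv (Vc \<omega>) k (i, q)" if "i < n" for i q
      proof -
        have "sel_c k c (i, q) \<in> ?B" using that by (auto simp: future_def)
        moreover have "sel_c k c (i, q) = sel k (cJ (Vc \<omega>) k) (cS (Vc \<omega>) k) (i, q)"
          using ck[OF that] by (simp add: sel_c_def sel_def)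
        ultimately show ?thesis by (simp add: fv_def cellv_def Vc_def)
      qed
      have "step w (As k) (chain w As x0 (Vc \<omega>) k) (\<lambda>q. fv \<omega> (sel_c k c q)) = step w (As k) (chain w As x0 (Vc \<omega>) k) (cellv (Vc \<omega>) k)"
        by (rule ext, rule step_cong) (use cl in auto)
      then show ?thesis using True cc ch by (simp add: \<Phi>_def defect_def chain_defect_def)
    next
      case False
      then show ?thesis using cc by (simp add: \<Phi>_def)
    qed
  qed
  interpret FV: prob_space "distr P ?MB fv" using fvm by (rule P.prob_space_distr)
  have "(\<integral>\<^sup>+\<omega>. ennreal (chain_defect w As x0 y k \<omega>) * indicator {counts (Vc \<omega>) k} c \<partial>P)
      = (\<integral>\<^sup>+\<omega>. \<Phi> (pv \<omega>, fv \<omega>) \<partial>P)"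
    using eq by (rule nn_integral_cong)
  also have "\<dots> = (\<integral>\<^sup>+q. \<Phi> q \<partial>(distr P ?MA pv \<Otimes>\<^sub>M distr P ?MB fv))"
    unfolding dist using pvm fvm \<Phi>m by (subst nn_integral_distr) auto
  also have "\<dots> = (\<integral>\<^sup>+p. (\<integral>\<^sup>+f. \<Phi> (p, f) \<partial>distr P ?MB fv) \<partial>distr P ?MA pv)"
    by (rule FV.nn_integral_fst[symmetric]) (use \<Phi>m in \<open>simp cong: measurable_cong_sets\<close>)
  also have "\<dots> \<le> (\<integral>\<^sup>+p. ennreal step_error * indicator {counts p k} c \<partial>distr P ?MA pv)"
  proof (rule nn_integral_mono)
    fix p assume "p \<in> space (distr P ?MA pv)"
    then have p: "p \<in> space ?MA" by simp
    have fm: "(\<lambda>f. \<Phi> (p, f)) \<in> borel_measurable ?MB" by (rule measurable_compose[OF measurable_Pair1'[OF p] \<Phi>m])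
    have "(\<integral>\<^sup>+f. \<Phi> (p, f) \<partial>distr P ?MB fv) = (\<integral>\<^sup>+\<omega>. \<Phi> (p, fv \<omega>) \<partial>P)"
      by (rule nn_integral_distr[OF fvm]) (use fm in simp)
    also have "\<dots> = (\<integral>\<^sup>+\<omega>. ennreal (defect w (As k) y (chain w As x0 p k) (?cell \<omega>)) * indicator {counts p k} c \<partial>P)"
    proof (rule nn_integral_cong)
      fix \<omega>
      have cl: "fv \<omega> (sel_c k c (i, q)) = ?cell \<omega> (i, q)" if "i < n" for i q
      proof -
        have "sel_c k c (i, q) \<in> ?B" using that by (auto simp: future_def)
        then show ?thesis by (simp add: fv_def sel_c_def)
      qed
      have "step w (As k) (chain w As x0 p k) (\<lambda>q. fv \<omega> (sel_c k c q)) = step w (As k) (chain w As x0 p k) (?cell \<omega>)"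
        by (rule ext, rule step_cong) (use cl in auto)
      then show "\<Phi> (p, fv \<omega>) = ennreal (defect w (As k) y (chain w As x0 p k) (?cell \<omega>)) * indicator {counts p k} c"
        by (simp add: \<Phi>_def defect_def)
    qed
    also have "\<dots> = (\<integral>\<^sup>+\<omega>. ennreal (defect w (As k) y (chain w As x0 p k) (?cell \<omega>)) \<partial>P) * indicator {counts p k} c"
    proof (rule nn_integral_multc)
      have "(\<lambda>\<omega>. defect w (As k) y (\<lambda>j. chain w As x0 p k j) (\<lambda>q. ?cell \<omega> q)) \<in> borel_measurable P"
        by (rule defect_measurable[where X="\<lambda>j _. chain w As x0 p k j" and R="\<lambda>q \<omega>. ?cell \<omega> q"]) auto
      then show "(\<lambda>\<omega>. ennreal (defect w (As k) y (chain w As x0 p k) (?cell \<omega>))) \<in> borel_measurable P"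
        by simp
    qed
    also have "\<dots> \<le> ennreal step_error * indicator {counts p k} c"
      by (intro mult_right_mono defect_nn) auto
    finally show "(\<integral>\<^sup>+f. \<Phi> (p, f) \<partial>distr P ?MB fv) \<le> ennreal step_error * indicator {counts p k} c" .
  qed
  also have "\<dots> = ennreal step_error * (\<integral>\<^sup>+p. indicator {counts p k} c \<partial>distr P ?MA pv)"
    by (rule nn_integral_cmult) (use im in simp)
  also have "(\<integral>\<^sup>+p. indicator {counts p k} c \<partial>distr P ?MA pv) = (\<integral>\<^sup>+\<omega>. indicator {counts (pv \<omega>) k} c \<partial>P)"
    by (rule nn_integral_distr[OF pvm]) (use im in simp)
  also have "\<dots> = (\<integral>\<^sup>+\<omega>. indicator {counts (Vc \<omega>) k} c \<partial>P)"
    by (intro nn_integral_cong) (simp add: pv_def Vc_def[symmetric] counts_restrict(3))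
  finally show ?thesis .
qed

end

section \<open>Accumulation of the one-step errors\<close>

context noise_grid
begin

lemma counts_indicator_measurable:
  "(\<lambda>\<omega>. indicator {counts (Vc \<omega>) k} c :: ennreal) \<in> borel_measurable P"
proof -
  have "(\<lambda>\<omega>. (cJ (Vc \<omega>) k i, cS (Vc \<omega>) k i)) \<in> P \<rightarrow>\<^sub>M count_space UNIV" for i
  proof (rule measurable_compose_countable[where f="\<lambda>a \<omega>. (a, cS (Vc \<omega>) k i)" and g="\<lambda>\<omega>. cJ (Vc \<omega>) k i"])
    show "(\<lambda>\<omega>. (a, cS (Vc \<omega>) k i)) \<in> P \<rightarrow>\<^sub>M count_space UNIV" for a
      by (rule measurable_compose[OF cS_measurable[OF Vc_measurable], of "\<lambda>b. (a, b)"]) simp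
  qed (rule cJ_measurable[OF Vc_measurable])
  then have "(\<lambda>\<omega>. counts (Vc \<omega>) k) \<in> P \<rightarrow>\<^sub>M count_space UNIV"
    unfolding counts_def by (intro measurable_map_countable[where g="\<lambda>i \<omega>. (cJ (Vc \<omega>) k i, cS (Vc \<omega>) k i)"])
  then show ?thesis by (rule measurable_compose[where g="\<lambda>l. indicator {l} c"]) simp
qed

lemma chain_defect_measurable:
  "(\<lambda>\<omega>. chain_defect w As x0 y k \<omega>) \<in> borel_measurable P"
proof -
  have "(\<lambda>\<omega>. cellv (Vc \<omega>) k q) \<in> borel_measurable P" for q
    using cellv_measurable[OF Vc_measurable] by (cases q) simp
  then show ?thesis unfolding chain_defect_def
    by (intro defect_measurable[where X="\<lambda>j \<omega>. chain w As x0 (Vc \<omega>) k j" and R="\<lambda>q \<omega>. cellv (Vc \<omega>) k q"]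
        chain_measurable[OF Vc_measurable])
qed

text \<open>Summation of \<open>defect_counts\<close> over the possible counts, which are lists of
  pairs of naturals and hence countably many.\<close>

lemma chain_defect_nn:
  "(\<integral>\<^sup>+\<omega>. ennreal (chain_defect w As x0 y k \<omega>) \<partial>P) \<le> ennreal step_error"
proof -
  let ?D = "\<lambda>\<omega>. ennreal (chain_defect w As x0 y k \<omega>)"
  have sing: "(\<integral>\<^sup>+c. a * indicator {d} c \<partial>count_space UNIV) = a" for a :: ennreal and d :: "(nat \<times> nat) list"
    by (simp add: nn_integral_indicator_singleton)
  have ind: "indicator {c} d = (indicator {d} c :: ennreal)" for c d :: "(nat \<times> nat) list" by (auto simp: indicator_def)
  have "(\<integral>\<^sup>+\<omega>. ?D \<omega> \<partial>P) = (\<integral>\<^sup>+\<omega>. (\<integral>\<^sup>+c. ?D \<omega> * indicator {counts (Vc \<omega>) k} c \<partial>count_space UNIV) \<partial>P)"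
    unfolding sing ..
  also have "\<dots> = (\<integral>\<^sup>+c. (\<integral>\<^sup>+\<omega>. ?D \<omega> * indicator {counts (Vc \<omega>) k} c \<partial>P) \<partial>count_space UNIV)"
    by (rule nn_integral_count_space_nn_integral)
      (use chain_defect_measurable counts_indicator_measurable in \<open>auto intro!: borel_measurable_times_ennreal\<close>)
  also have "\<dots> \<le> (\<integral>\<^sup>+c. ennreal step_error * (\<integral>\<^sup>+\<omega>. indicator {counts (Vc \<omega>) k} c \<partial>P) \<partial>count_space UNIV)"
    by (rule nn_integral_mono) (rule defect_counts)
  also have "\<dots> = ennreal step_error * (\<integral>\<^sup>+c. (\<integral>\<^sup>+\<omega>. indicator {counts (Vc \<omega>) k} c \<partial>P) \<partial>count_space UNIV)"
    by (rule nn_integral_cmult) simp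
  also have "(\<integral>\<^sup>+c. (\<integral>\<^sup>+\<omega>. indicator {counts (Vc \<omega>) k} c \<partial>P) \<partial>count_space UNIV) =
      (\<integral>\<^sup>+\<omega>. (\<integral>\<^sup>+c. indicator {counts (Vc \<omega>) k} c \<partial>count_space UNIV) \<partial>P)"
    by (rule nn_integral_count_space_nn_integral[symmetric]) (use counts_indicator_measurable in auto)
  also have "\<dots> = (\<integral>\<^sup>+\<omega>. 1 \<partial>P)" using sing[of 1] by simp
  finally show ?thesis by (simp add: P.emeasure_space_1)
qed

lemma step_error_nonneg: "0 \<le> step_error"
  using \<delta> by (simp add: step_error_def)

definition err :: "ereal \<Rightarrow> (nat \<Rightarrow> real) \<Rightarrow> (nat \<Rightarrow> ereal) \<Rightarrow> (real \<Rightarrow> real \<Rightarrow> real) \<Rightarrow> nat \<Rightarrow> real \<Rightarrow> real" where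
  "err w As x0 g k y = P.expectation (\<lambda>\<omega>. \<bar>frac_le n (chain w As x0 (Vc \<omega>) k) y - g (\<delta> * real k) y\<bar>)"

lemma chain_frac_measurable [measurable]: "(\<lambda>\<omega>. frac_le n (chain w As x0 (Vc \<omega>) k) y) \<in> borel_measurable P"
  by (rule frac_le_measurable[where X="\<lambda>j \<omega>. chain w As x0 (Vc \<omega>) k j", OF chain_measurable[OF Vc_measurable]]) simp

lemma bounded_integrable:
  assumes "f \<in> borel_measurable P" "\<And>\<omega>. \<bar>f \<omega>\<bar> \<le> (B :: real)" shows "integrable P f"
  by (rule P.integrable_const_bound[where B=B]) (use assms in auto)

lemma euler_step_cdf:
  assumes g: "mild g" and A: "bdry (\<delta> * real k) \<le> A" "A \<le> bdry (\<delta> * real (Suc k))"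
  shows "\<bar>euler A (g (\<delta> * real k)) y - g (\<delta> * real (Suc k)) y\<bar> \<le>
    2 * rate\<^sup>2 * \<delta>\<^sup>2 + \<delta> * lam * measure \<zeta> {z. bdry (\<delta> * real k) \<le> y - z \<and> y - z < bdry (\<delta> * real (Suc k))}"
proof -
  let ?s = "\<delta> * real k" and ?t = "\<delta> * real (Suc k)"
  let ?B = "{z. bdry ?s \<le> y - z \<and> y - z < bdry ?t}"
  define G where "G = g ?s"
  have s: "0 \<le> ?s" "?s \<le> ?t" "?t - ?s = \<delta>" using \<delta> by (auto simp: algebra_simps)
  have Gr: "regular G" unfolding G_def by (rule cdfs_regular[OF mildD(1)[OF g s(1)]])
  have Bm: "?B \<in> sets borel" by measurable
  have close: "\<bar>model_rhs (bdry u) (g u) y - model_rhs A G y\<bar> \<le> lam * measure \<zeta> ?B + 2 * rate\<^sup>2 * \<delta>"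
    if u: "?s \<le> u" "u \<le> ?t" for u
  proof -
    have u0: "0 \<le> u" by (rule order_trans[OF s(1) u(1)])
    have gr: "regular (g u)" by (rule cdfs_regular[OF mildD(1)[OF g u0]])
    have d: "\<bar>g u x - G x\<bar> \<le> rate * \<delta>" for x
    proof -
      have "\<bar>g u x - g ?s x\<bar> \<le> rate * \<bar>u - ?s\<bar>" by (rule mild_diff_le[OF g s(1) u0])
      also have "\<dots> \<le> rate * \<delta>" using u s rate_pos by (intro mult_left_mono) auto
      finally show ?thesis by (simp add: G_def)
    qed
    have bu: "bdry ?s \<le> bdry u" "bdry u \<le> bdry ?t" using u v by (auto simp: bdry_def)
    have sh: "\<bar>shifted (bdry u) (g u) y z - shifted A G y z\<bar> \<le> rate * \<delta> + indicator ?B z" for z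
    proof (cases "z \<in> ?B")
      case True
      then have "indicat_real ?B z = 1" by (rule indicator_simps(1))
      moreover have "0 \<le> rate * \<delta>" using rate_pos \<delta> by simp
      ultimately show ?thesis using shifted_bounds[OF gr, of "bdry u" y z] shifted_bounds[OF Gr, of A y z] by linarith
    next
      case False
      then have "y - z < bdry ?s \<or> bdry ?t \<le> y - z" by auto
      then show ?thesis using d[of "y - z"] bu A rate_pos \<delta> False by (auto simp: shifted_def)
    qed
    have iB: "integrable \<zeta> (\<lambda>z. rate * \<delta> + indicat_real ?B z)" using Bm by (auto simp: zeta.emeasure_eq_measure)
    have isD: "integrable \<zeta> (\<lambda>z. shifted (bdry u) (g u) y z - shifted A G y z)" using integrable_shifted[OF gr] integrable_shifted[OF Gr] by simp
    have "\<bar>jump (bdry u) (g u) y - jump A G y\<bar> = \<bar>\<integral>z. shifted (bdry u) (g u) y z - shifted A G y z \<partial>\<zeta>\<bar>"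
      unfolding jump_def using integrable_shifted[OF gr] integrable_shifted[OF Gr] by simp
    also have "\<dots> \<le> (\<integral>z. \<bar>shifted (bdry u) (g u) y z - shifted A G y z\<bar> \<partial>\<zeta>)"
      using integral_norm_bound[of \<zeta> "\<lambda>z. shifted (bdry u) (g u) y z - shifted A G y z"] by simp
    also have "\<dots> \<le> (\<integral>z. rate * \<delta> + indicat_real ?B z \<partial>\<zeta>)"
      by (intro integral_mono integrable_abs isD iB sh)
    also have "\<dots> = rate * \<delta> + measure \<zeta> ?B" using Bm zeta.prob_space by (simp add: zeta.emeasure_eq_measure)
    finally have j: "\<bar>jump (bdry u) (g u) y - jump A G y\<bar> \<le> rate * \<delta> + measure \<zeta> ?B" .
    have q: "\<bar>((g u y)\<^sup>2 - rate * g u y) - ((G y)\<^sup>2 - rate * G y)\<bar> \<le> (rate * \<delta>) * (rate + 1)"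
    proof -
      have "((g u y)\<^sup>2 - rate * g u y) - ((G y)\<^sup>2 - rate * G y) = (g u y - G y) * (g u y + G y - rate)"
        by (simp add: power2_eq_square algebra_simps)
      moreover have "\<bar>g u y + G y - rate\<bar> \<le> rate + 1"
        using regularD(2,3)[OF gr, of y] regularD(2,3)[OF Gr, of y] lam unfolding rate_def by linarith
      ultimately show ?thesis using d[of y] rate_pos \<delta> by (simp only: abs_mult) (intro mult_mono, auto)
    qed
    have "model_rhs (bdry u) (g u) y - model_rhs A G y = lam * (jump (bdry u) (g u) y - jump A G y)
        + (((g u y)\<^sup>2 - rate * g u y) - ((G y)\<^sup>2 - rate * G y))"
      by (simp add: model_rhs_def gain_def algebra_simps)
    moreover have "\<bar>lam * (jump (bdry u) (g u) y - jump A G y)\<bar> \<le> lam * (rate * \<delta> + measure \<zeta> ?B)"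
      using mult_left_mono[OF j lam] lam by (simp add: abs_mult)
    ultimately have "\<bar>model_rhs (bdry u) (g u) y - model_rhs A G y\<bar> \<le> lam * (rate * \<delta> + measure \<zeta> ?B) + (rate * \<delta>) * (rate + 1)"
      using q by linarith
    \<comment> \<open>The smooth part is \<open>rate * \<delta>\<close> times
      \<open>lam + rate + 1\<close>, which is \<open>2 * rate\<close>.\<close>
    also have "\<dots> = lam * measure \<zeta> ?B + 2 * rate\<^sup>2 * \<delta>" by (simp add: rate_def power2_eq_square algebra_simps)
    finally show ?thesis .
  qed
  have a: "((\<lambda>u. model_rhs (bdry u) (g u) y) has_integral (g ?t y - g 0 y)) {0..?t}"
    using mild_integral_equation[OF g, of ?t y] s by (simp add: model_rhs_def)
  have b: "((\<lambda>u. model_rhs (bdry u) (g u) y) has_integral (G y - g 0 y)) {0..?s}"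
    using mild_integral_equation[OF g s(1), of y] by (simp add: model_rhs_def G_def)
  have "(\<lambda>u. model_rhs (bdry u) (g u) y) integrable_on {?s..?t}"
    using integrable_on_subinterval[OF has_integral_integrable[OF a], of ?s ?t] s by auto
  then obtain i where i: "((\<lambda>u. model_rhs (bdry u) (g u) y) has_integral i) {?s..?t}" by blast
  from has_integral_combine[OF s(1,2) b i] a have "G y - g 0 y + i = g ?t y - g 0 y" by (rule has_integral_unique)
  then have "i = g ?t y - G y" by simp
  with i have i': "((\<lambda>u. model_rhs (bdry u) (g u) y) has_integral (g ?t y - G y)) {?s..?t}" by simp
  let ?e = "lam * measure \<zeta> ?B + 2 * rate\<^sup>2 * \<delta>"
  have c: "((\<lambda>u. model_rhs A G y + d) has_integral (\<delta> * (model_rhs A G y + d))) {?s..?t}" for d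
    using has_integral_const_real[of "model_rhs A G y + d" ?s ?t] s by simp
  have "g ?t y - G y \<le> \<delta> * (model_rhs A G y + ?e)"
  proof (rule has_integral_le[OF i' c])
    fix u assume "u \<in> {?s..?t}"
    then have "\<bar>model_rhs (bdry u) (g u) y - model_rhs A G y\<bar> \<le> ?e" by (intro close) (simp_all only: atLeastAtMost_iff)
    then show "model_rhs (bdry u) (g u) y \<le> model_rhs A G y + ?e" by linarith
  qed
  moreover have "\<delta> * (model_rhs A G y + (- ?e)) \<le> g ?t y - G y"
  proof (rule has_integral_le[OF c i'])
    fix u assume "u \<in> {?s..?t}"
    then have "\<bar>model_rhs (bdry u) (g u) y - model_rhs A G y\<bar> \<le> ?e" by (intro close) (simp_all only: atLeastAtMost_iff)
    then show "model_rhs A G y + (- ?e) \<le> model_rhs (bdry u) (g u) y" by linarith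
  qed
  ultimately have "\<bar>euler A G y - g ?t y\<bar> \<le> \<delta> * ?e"
    unfolding euler_def by (simp add: algebra_simps abs_le_iff)
  also have "\<dots> = 2 * rate\<^sup>2 * \<delta>\<^sup>2 + \<delta> * lam * measure \<zeta> ?B" by (simp add: power2_eq_square algebra_simps)
  finally show ?thesis by (simp add: G_def)
qed

text \<open>The jump term reads the error at \<open>y - z\<close>, so a bound B uniform in y is
  needed for the increment. The error at y itself is kept apart, so that the crossing masses for
  this y can be summed over the cells.\<close>

lemma chain_error_step:
  assumes g: "mild g" and A: "bdry (\<delta> * real k) \<le> As k" "As k \<le> bdry (\<delta> * real (Suc k))"
    and B: "\<And>y. err w As x0 g k y \<le> B"
  shows "err w As x0 g (Suc k) y \<le> err w As x0 g k y + \<delta> * (2 * rate) * B + step_error + 2 * rate\<^sup>2 * \<delta>\<^sup>2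
    + \<delta> * lam * measure \<zeta> {z. bdry (\<delta> * real k) \<le> y - z \<and> y - z < bdry (\<delta> * real (Suc k))}"
proof -
  let ?s = "\<delta> * real k"
  define F where "F \<omega> = frac_le n (chain w As x0 (Vc \<omega>) k)" for \<omega>
  define G where "G = g ?s"
  let ?A = "As k"
  have s0: "0 \<le> ?s" using \<delta> by simp
  have Gr: "regular G" unfolding G_def by (rule cdfs_regular[OF mildD(1)[OF g s0]])
  have F01: "0 \<le> F \<omega> y" "F \<omega> y \<le> 1" for \<omega> y using frac_le_bounds by (auto simp: F_def)
  have FG: "\<bar>F \<omega> y - G y\<bar> \<le> 1" for \<omega> y using F01[of \<omega> y] regularD(2,3)[OF Gr, of y] by linarith
  have Fm [measurable]: "(\<lambda>\<omega>. F \<omega> y) \<in> borel_measurable P" for y unfolding F_def by measurable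
  have Gm [measurable]: "G \<in> borel_measurable borel" by (rule regular_measurable[OF Gr])
  have Fm2 [measurable]: "(\<lambda>p. F (fst p) (y - snd p)) \<in> borel_measurable (P \<Otimes>\<^sub>M \<zeta>)" for y
    unfolding F_def
    by (rule frac_le_measurable[where X="\<lambda>j p. chain w As x0 (Vc (fst p)) k j"])
      (auto intro: measurable_compose[OF measurable_fst chain_measurable[OF Vc_measurable]])
  have Fy [measurable]: "F \<omega> \<in> borel_measurable borel" for \<omega> unfolding F_def by (rule regular_frac_le_measurable)
  have errk: "err w As x0 g k y = P.expectation (\<lambda>\<omega>. \<bar>F \<omega> y - G y\<bar>)" for y by (simp add: err_def F_def G_def)
  interpret PZ: pair_prob_space P \<zeta> ..
  define jd where "jd \<omega> = (\<integral>z. \<bar>F \<omega> (y - z) - G (y - z)\<bar> \<partial>\<zeta>)" for \<omega>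
  have jm: "case_prod (\<lambda>\<omega> z. \<bar>F \<omega> (y - z) - G (y - z)\<bar>) \<in> borel_measurable (P \<Otimes>\<^sub>M \<zeta>)"
    unfolding case_prod_unfold by measurable
  have jb: "\<bar>\<bar>F \<omega> (y - z) - G (y - z)\<bar>\<bar> \<le> 1" for \<omega> z using FG by simp
  have jdm [measurable]: "jd \<in> borel_measurable P"
    unfolding jd_def by (rule zeta.borel_measurable_lebesgue_integral[OF jm])
  have jd01: "0 \<le> jd \<omega>" "jd \<omega> \<le> 1" for \<omega>
  proof -
    show "0 \<le> jd \<omega>" unfolding jd_def by (intro integral_nonneg_AE) simp
    have "jd \<omega> \<le> (\<integral>z. 1 \<partial>\<zeta>)" unfolding jd_def
      by (rule integral_mono_AE') (use FG in \<open>auto simp: zeta.emeasure_eq_measure\<close>)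
    then show "jd \<omega> \<le> 1" using zeta.prob_space by simp
  qed
  \<comment> \<open>By Fubini the expected error in the jump term is an average over z of the errors
    at \<open>y - z\<close>.\<close>
  have Ejd: "P.expectation jd \<le> B"
  proof -
    have "P.expectation jd = integral\<^sup>L (P \<Otimes>\<^sub>M \<zeta>) (case_prod (\<lambda>\<omega> z. \<bar>F \<omega> (y - z) - G (y - z)\<bar>))"
      unfolding jd_def by (rule PZ.iterated_integral_bounded(2)[OF jm jb])
    also have "\<dots> = (\<integral>z. P.expectation (\<lambda>\<omega>. \<bar>F \<omega> (y - z) - G (y - z)\<bar>) \<partial>\<zeta>)"
      using PZ.integral_snd[OF PZ.iterated_integral_bounded(1)[OF jm jb]] by simp
    also have "\<dots> \<le> (\<integral>z. B \<partial>\<zeta>)"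
    proof (rule integral_mono_AE')
      have "0 \<le> err w As x0 g k 0" unfolding err_def by (intro integral_nonneg_AE) simp
      then show "AE z in \<zeta>. 0 \<le> B" using B[of 0] by simp
    qed (use B in \<open>auto simp: errk[symmetric]\<close>)
    finally show ?thesis using zeta.prob_space by simp
  qed
  have pt: "\<bar>frac_le n (chain w As x0 (Vc \<omega>) (Suc k)) y - g (\<delta> * real (Suc k)) y\<bar> \<le>
     chain_defect w As x0 y k \<omega>
     + (\<bar>F \<omega> y - G y\<bar> + \<delta> * (lam * jd \<omega> + (rate + 1) * \<bar>F \<omega> y - G y\<bar>))
     + \<bar>euler ?A G y - g (\<delta> * real (Suc k)) y\<bar>" for \<omega>
  proof -
    have "\<bar>euler ?A (F \<omega>) y - euler ?A G y\<bar> \<le> \<bar>F \<omega> y - G y\<bar> + \<delta> * (lam * jd \<omega> + (rate + 1) * \<bar>F \<omega> y - G y\<bar>)"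
    proof -
      have iF: "integrable \<zeta> (shifted ?A (F \<omega>) y)"
        by (rule zeta.integrable_const_bound[where B=1]) (use F01 in \<open>auto simp: shifted_def\<close>)
      have iG: "integrable \<zeta> (shifted ?A G y)" by (rule integrable_shifted[OF Gr])
      have "\<bar>jump ?A (F \<omega>) y - jump ?A G y\<bar> = \<bar>\<integral>z. shifted ?A (F \<omega>) y z - shifted ?A G y z \<partial>\<zeta>\<bar>"
        unfolding jump_def using iF iG by simp
      also have "\<dots> \<le> (\<integral>z. \<bar>shifted ?A (F \<omega>) y z - shifted ?A G y z\<bar> \<partial>\<zeta>)"
        using integral_norm_bound[of \<zeta> "\<lambda>z. shifted ?A (F \<omega>) y z - shifted ?A G y z"] by simp
      also have "\<dots> \<le> jd \<omega>"
        unfolding jd_def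
      proof (rule integral_mono)
        show "integrable \<zeta> (\<lambda>z. \<bar>F \<omega> (y - z) - G (y - z)\<bar>)"
          by (rule zeta.integrable_const_bound[where B=1]) (use FG in auto)
        show "\<bar>shifted ?A (F \<omega>) y z - shifted ?A G y z\<bar> \<le> \<bar>F \<omega> (y - z) - G (y - z)\<bar>" for z by (simp add: shifted_def)
      qed (use iF iG in simp)
      finally have j: "lam * \<bar>jump ?A (F \<omega>) y - jump ?A G y\<bar> \<le> lam * jd \<omega>" using lam by (rule mult_left_mono)
      have m: "model_rhs ?A (F \<omega>) y - model_rhs ?A G y = lam * (jump ?A (F \<omega>) y - jump ?A G y) + (F \<omega> y - G y) * (F \<omega> y + G y - rate)"
        by (simp add: model_rhs_def gain_def power2_eq_square algebra_simps)
      have "\<bar>F \<omega> y + G y - rate\<bar> \<le> rate + 1"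
        using F01[of \<omega> y] regularD(2,3)[OF Gr, of y] lam unfolding rate_def by linarith
      then have "\<bar>(F \<omega> y - G y) * (F \<omega> y + G y - rate)\<bar> \<le> \<bar>F \<omega> y - G y\<bar> * (rate + 1)"
        unfolding abs_mult by (intro mult_left_mono) auto
      moreover have "\<bar>lam * (jump ?A (F \<omega>) y - jump ?A G y)\<bar> = lam * \<bar>jump ?A (F \<omega>) y - jump ?A G y\<bar>" using lam by (simp add: abs_mult)
      ultimately have "\<bar>model_rhs ?A (F \<omega>) y - model_rhs ?A G y\<bar> \<le> lam * jd \<omega> + (rate + 1) * \<bar>F \<omega> y - G y\<bar>"
        unfolding m using j by (simp add: mult.commute)
      then have "\<delta> * \<bar>model_rhs ?A (F \<omega>) y - model_rhs ?A G y\<bar> \<le> \<delta> * (lam * jd \<omega> + (rate + 1) * \<bar>F \<omega> y - G y\<bar>)"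
        using \<delta> by (intro mult_left_mono) auto
      moreover have "euler ?A (F \<omega>) y - euler ?A G y = (F \<omega> y - G y) + \<delta> * (model_rhs ?A (F \<omega>) y - model_rhs ?A G y)"
        by (simp add: euler_def algebra_simps)
      moreover have "\<bar>\<delta> * (model_rhs ?A (F \<omega>) y - model_rhs ?A G y)\<bar> = \<delta> * \<bar>model_rhs ?A (F \<omega>) y - model_rhs ?A G y\<bar>"
        using \<delta> by (simp add: abs_mult)
      ultimately show ?thesis by linarith
    qed
    then show ?thesis unfolding chain_defect_def defect_def F_def[symmetric] chain.simps by linarith
  qed
  let ?D = "\<lambda>\<omega>. chain_defect w As x0 y k \<omega>"
  have Dnn: "0 \<le> ?D \<omega>" for \<omega> by (simp add: chain_defect_def defect_def)
  have Di: "integrable P ?D"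
    by (rule integrableI_nonneg[OF chain_defect_measurable])
      (use Dnn chain_defect_nn[of w As x0 y k] in \<open>auto intro: le_less_trans\<close>)
  have ED: "P.expectation ?D \<le> step_error"
  proof -
    have "ennreal (P.expectation ?D) = (\<integral>\<^sup>+\<omega>. ennreal (?D \<omega>) \<partial>P)"
      by (rule nn_integral_eq_integral[symmetric, OF Di]) (use Dnn in simp)
    also have "\<dots> \<le> ennreal step_error" by (rule chain_defect_nn)
    finally show ?thesis using step_error_nonneg by simp
  qed
  have Fi: "integrable P (\<lambda>\<omega>. \<bar>F \<omega> y - G y\<bar>)" by (rule bounded_integrable[where B=1]) (use FG in auto)
  have ji: "integrable P jd" by (rule bounded_integrable[where B=1]) (use jd01 in auto)
  let ?c = "\<bar>euler ?A G y - g (\<delta> * real (Suc k)) y\<bar>"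
  have "err w As x0 g (Suc k) y \<le> P.expectation (\<lambda>\<omega>. ?D \<omega> + (\<bar>F \<omega> y - G y\<bar> + \<delta> * (lam * jd \<omega> + (rate + 1) * \<bar>F \<omega> y - G y\<bar>)) + ?c)"
    unfolding err_def
  proof (rule integral_mono_AE')
    show "integrable P (\<lambda>\<omega>. ?D \<omega> + (\<bar>F \<omega> y - G y\<bar> + \<delta> * (lam * jd \<omega> + (rate + 1) * \<bar>F \<omega> y - G y\<bar>)) + ?c)"
      using Di Fi ji by simp
    show "AE \<omega> in P. 0 \<le> ?D \<omega> + (\<bar>F \<omega> y - G y\<bar> + \<delta> * (lam * jd \<omega> + (rate + 1) * \<bar>F \<omega> y - G y\<bar>)) + ?c"
      by (rule AE_I2, rule order_trans[OF abs_ge_zero pt])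
    show "AE \<omega> in P. \<bar>frac_le n (chain w As x0 (Vc \<omega>) (Suc k)) y - g (\<delta> * real (Suc k)) y\<bar>
        \<le> ?D \<omega> + (\<bar>F \<omega> y - G y\<bar> + \<delta> * (lam * jd \<omega> + (rate + 1) * \<bar>F \<omega> y - G y\<bar>)) + ?c"
      by (rule AE_I2, rule pt)
  qed
  also have "\<dots> = P.expectation ?D + (err w As x0 g k y + \<delta> * (lam * P.expectation jd + (rate + 1) * err w As x0 g k y)) + ?c"
    using Di Fi ji by (simp add: errk P.prob_space)
  also have "\<dots> \<le> step_error + (err w As x0 g k y + \<delta> * (lam * B + (rate + 1) * B)) + ?c"
    using ED Ejd B[of y] lam rate_pos \<delta> by (intro add_mono mult_left_mono) auto
  also have "?c \<le> 2 * rate\<^sup>2 * \<delta>\<^sup>2 + \<delta> * lam * measure \<zeta> {z. bdry (\<delta> * real k) \<le> y - z \<and> y - z < bdry (\<delta> * real (Suc k))}"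
    unfolding G_def by (rule euler_step_cdf[OF g A])
  finally show ?thesis by (simp add: rate_def algebra_simps)
qed

text \<open>Discrete Gronwall with two bounds carried in one induction: a sum depending on y, which
  retains the crossing masses, and the uniform bound obtained from it because these masses add up to
  at most 1. Using only the uniform bound would pay the full mass in every cell.\<close>

lemma chain_error:
  assumes g: "mild g" and A: "\<And>k. bdry (\<delta> * real k) \<le> As k" "\<And>k. As k \<le> bdry (\<delta> * real (Suc k))"
    and init: "g 0 = frac_le n x0" and "k \<le> L"
  shows "err w As x0 g k y \<le> (real L * (step_error + 2 * rate\<^sup>2 * \<delta>\<^sup>2) + lam * \<delta>) * (1 + \<delta> * (2 * rate)) ^ k"
proof -
  define a where "a = step_error + 2 * rate\<^sup>2 * \<delta>\<^sup>2"
  define b where "b = real L * a + lam * \<delta>"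
  define C where "C = \<delta> * (2 * rate)"
  define p where "p j y = measure \<zeta> {z. bdry (\<delta> * real j) \<le> y - z \<and> y - z < bdry (\<delta> * real (Suc j))}" for j y
  have a0: "0 \<le> a" using step_error_nonneg by (simp add: a_def)
  have C0: "0 \<le> C" using \<delta> rate_pos by (simp add: C_def)
  \<comment> \<open>The boundary sweeps the half-open strips of successive cells one after the
    other, so these are disjoint sets of jump sizes.\<close>
  have psum: "(\<Sum>j<k. p j y) \<le> 1" for k y
  proof -
    let ?S = "\<lambda>j. {z. bdry (\<delta> * real j) \<le> y - z \<and> y - z < bdry (\<delta> * real (Suc j))}"
    have bm: "bdry (\<delta> * real i) \<le> bdry (\<delta> * real j)" if "i \<le> j" for i j :: nat
      using that v \<delta> by (simp add: bdry_def)
    have dj: "disjoint_family_on ?S {..<k}"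
      unfolding disjoint_family_on_def
    proof (intro ballI impI)
      fix i j :: nat assume "i \<noteq> j"
      then have "Suc i \<le> j \<or> Suc j \<le> i" by auto
      then show "?S i \<inter> ?S j = {}" using bm[of "Suc i" j] bm[of "Suc j" i] by auto
    qed
    have m: "?S j \<in> sets \<zeta>" for j by measurable
    have "(\<Sum>j<k. p j y) = measure \<zeta> (\<Union>j<k. ?S j)"
      unfolding p_def using dj m by (intro zeta.finite_measure_finite_Union[symmetric]) auto
    also have "\<dots> \<le> 1" by simp
    finally show ?thesis .
  qed
  \<comment> \<open>The geometric sum with weight \<open>C * b\<close> produces
    \<open>b * ((1 + C) ^ k - 1)\<close>; the missing b pays for the accumulated step errors and
    crossing masses.\<close>
  have "err w As x0 g k y \<le> b * (1 + C) ^ k \<and> err w As x0 g k y \<le> (\<Sum>j<k. C * (b * (1 + C) ^ j) + a + \<delta> * lam * p j y)"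
    if "k \<le> L" for k y
    using that
  proof (induction k arbitrary: y)
    case 0
    have "0 \<le> b" using a0 lam \<delta> by (simp add: b_def)
    then show ?case by (simp add: err_def init)
  next
    case (Suc k)
    have IH: "err w As x0 g k y \<le> b * (1 + C) ^ k" "err w As x0 g k y \<le> (\<Sum>j<k. C * (b * (1 + C) ^ j) + a + \<delta> * lam * p j y)" for y
      using Suc.IH[of y] Suc.prems by auto
    have "err w As x0 g (Suc k) y \<le> err w As x0 g k y + \<delta> * (2 * rate) * (b * (1 + C) ^ k) + step_error + 2 * rate\<^sup>2 * \<delta>\<^sup>2 + \<delta> * lam * p k y"
      unfolding p_def by (rule chain_error_step[where As=As, OF g A IH(1)])
    also have "\<dots> \<le> (\<Sum>j<Suc k. C * (b * (1 + C) ^ j) + a + \<delta> * lam * p j y)"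
      using IH(2)[of y] by (simp add: a_def C_def)
    finally have 1: "err w As x0 g (Suc k) y \<le> (\<Sum>j<Suc k. C * (b * (1 + C) ^ j) + a + \<delta> * lam * p j y)" .
    also have "\<dots> = C * b * (\<Sum>j<Suc k. (1 + C) ^ j) + real (Suc k) * a + \<delta> * lam * (\<Sum>j<Suc k. p j y)"
      by (simp add: sum.distrib sum_distrib_left mult_ac algebra_simps)
    also have "C * b * (\<Sum>j<Suc k. (1 + C) ^ j) = b * ((1 + C) ^ Suc k - 1)"
      using power_diff_1_eq[of "1 + C" "Suc k"] by (simp add: mult_ac)
    also have "real (Suc k) * a \<le> real L * a" using Suc.prems a0 by (intro mult_right_mono) auto
    also have "\<delta> * lam * (\<Sum>j<Suc k. p j y) \<le> \<delta> * lam * 1" using psum[of y "Suc k"] lam \<delta> by (intro mult_left_mono) auto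
    finally have "err w As x0 g (Suc k) y \<le> b * (1 + C) ^ Suc k" by (simp add: b_def algebra_simps)
    then show ?case using 1 by simp
  qed
  then show ?thesis using \<open>k \<le> L\<close> by (auto simp: a_def b_def C_def)
qed

end

section \<open>Comparison of the particle system with the chains\<close>

text \<open>The point is the infimum of the times at which the final value is attained. Right
  continuity gives the value there, and an increment of one leaves only the initial value
  before.\<close>

lemma clock_single_point:
  fixes N :: "real \<Rightarrow> nat"
  assumes mono: "mono_on {0..} N" and rc: "\<And>t. 0 \<le> t \<Longrightarrow> \<forall>\<^sub>F u in at_right t. N u = N t"
    and s: "0 \<le> s" "s \<le> t" and one: "N t = Suc (N s)"
  obtains \<tau> where "s < \<tau>" "\<tau> \<le> t" "point_at N (N s) \<tau>" "\<And>u. s \<le> u \<Longrightarrow> u < \<tau> \<Longrightarrow> N u = N s"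
    "\<And>u. \<tau> \<le> u \<Longrightarrow> u \<le> t \<Longrightarrow> N u = N t"
proof -
  define S where "S = {u. s \<le> u \<and> u \<le> t \<and> N u = N t}"
  define \<tau> where "\<tau> = Inf S"
  have tS: "t \<in> S" using s by (simp add: S_def)
  have bdd: "bdd_below S" by (rule bdd_belowI[of _ s]) (simp add: S_def)
  have m: "N u \<le> N w" if "s \<le> u" "u \<le> w" for u w using mono that s(1) by (auto simp: mono_on_def)
  have \<tau>1: "s \<le> \<tau>" unfolding \<tau>_def by (rule cInf_greatest) (use tS in \<open>auto simp: S_def\<close>)
  have \<tau>2: "\<tau> \<le> t" unfolding \<tau>_def by (rule cInf_lower[OF tS bdd])
  have after: "N u = N t" if u: "\<tau> < u" "u \<le> t" for u
  proof -
    obtain u' where u': "u' \<in> S" "u' < u" using cInf_lessD[of S u] tS u(1) by (auto simp: \<tau>_def)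
    then have "N t \<le> N u" using m[of u' u] by (auto simp: S_def)
    moreover have "N u \<le> N t" using m[of u t] u \<tau>1 by simp
    ultimately show ?thesis by simp
  qed
  have at: "N \<tau> = N t"
  proof (cases "\<tau> = t")
    case False
    obtain b where b: "\<tau> < b" "\<And>u. \<tau> < u \<Longrightarrow> u < b \<Longrightarrow> N u = N \<tau>"
      using rc[of \<tau>] \<tau>1 s(1) unfolding eventually_at_right_field by auto
    obtain u where "\<tau> < u" "u < min b t" using dense[of \<tau> "min b t"] b(1) \<tau>2 False by auto
    then show ?thesis using b(2)[of u] after[of u] by simp
  qed simp
  have st: "s < \<tau>" using \<tau>1 at one by (cases "s = \<tau>") auto
  have before: "N u = N s" if u: "s \<le> u" "u < \<tau>" for u
  proof -
    have "u \<notin> S" using cInf_lower[of u S] bdd u(2) by (auto simp: \<tau>_def)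
    then have "N u \<noteq> N t" using u \<tau>2 by (simp add: S_def)
    moreover have "N s \<le> N u" "N u \<le> N t" using m[of s u] m[of u t] u \<tau>2 by auto
    ultimately show ?thesis using one by simp
  qed
  have "point_at N (N s) \<tau>"
    unfolding point_at_def eventually_at_left_field
  proof (intro conjI exI[of _ s] allI impI)
    show "0 < \<tau>" using st s(1) by simp
    show "N \<tau> = Suc (N s)" using at one by simp
    show "s < \<tau>" by (rule st)
    show "N u = N s" if "s < u" "u < \<tau>" for u using before[of u] that by simp
  qed
  moreover have "N u = N t" if "\<tau> \<le> u" "u \<le> t" for u using after[of u] at that by (cases "u = \<tau>") auto
  ultimately show ?thesis using that[of \<tau>] st \<tau>2 before by blast
qed

context noise_grid
begin

definition driven_path :: "(nat \<Rightarrow> real \<Rightarrow> 'w \<Rightarrow> real) \<Rightarrow> 'w \<Rightarrow> bool" where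
  "driven_path X \<omega> \<longleftrightarrow> (\<forall>i<n.
     (\<forall>s t. 0 \<le> s \<and> s \<le> t \<and> NJ i s \<omega> = NJ i t \<omega> \<and> NS i s \<omega> = NS i t \<omega> \<longrightarrow> X i t \<omega> = X i s \<omega>) \<and>
     (\<forall>t k. point_at (\<lambda>s. NJ i s \<omega>) k t \<longrightarrow>
        (\<forall>\<^sub>F s in at_left t. X i t \<omega> = max (X i s \<omega>) (A0 + v * t) + \<xi> i k \<omega>)) \<and>
     (\<forall>t k. point_at (\<lambda>s. NS i s \<omega>) k t \<longrightarrow>
        (\<forall>\<^sub>F s in at_left t. X i t \<omega> = max (X i s \<omega>) (X (K i k \<omega>) s \<omega>))))"

lemma clock_path:
  assumes N: "poisson_process P r N" and \<omega>: "\<omega> \<in> space P"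
  shows "N 0 \<omega> = 0" "mono_on {0..} (\<lambda>t. N t \<omega>)" "0 \<le> t \<Longrightarrow> \<forall>\<^sub>F s in at_right t. N s \<omega> = N t \<omega>"
    "0 \<le> s \<Longrightarrow> s \<le> t \<Longrightarrow> N s \<omega> \<le> N t \<omega>"
proof -
  show m: "mono_on {0..} (\<lambda>t. N t \<omega>)" using N \<omega> unfolding poisson_process_def by blast
  show "N 0 \<omega> = 0" "0 \<le> t \<Longrightarrow> \<forall>\<^sub>F s in at_right t. N s \<omega> = N t \<omega>" using N \<omega> unfolding poisson_process_def by blast+
  show "N s \<omega> \<le> N t \<omega>" if "0 \<le> s" "s \<le> t" using m that by (auto simp: mono_on_def)
qed

lemma path_stays:
  assumes d: "driven_path X \<omega>" and \<omega>: "\<omega> \<in> space P" and j: "j < n" and s: "0 \<le> s" "s \<le> u" "u \<le> t"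
    and eq: "NJ j t \<omega> - NJ j s \<omega> = 0" "NS j t \<omega> - NS j s \<omega> = 0"
  shows "X j u \<omega> = X j s \<omega>"
proof -
  have "NJ j s \<omega> \<le> NJ j u \<omega>" "NJ j u \<omega> \<le> NJ j t \<omega>" "NS j s \<omega> \<le> NS j u \<omega>" "NS j u \<omega> \<le> NS j t \<omega>"
    using clock_path(4)[OF noiseD(1)[OF j] \<omega>] clock_path(4)[OF noiseD(2)[OF j] \<omega>] s by auto
  then have "NJ j s \<omega> = NJ j u \<omega>" "NS j s \<omega> = NS j u \<omega>" using eq by auto
  then show ?thesis using d j s unfolding driven_path_def by blast
qed

text \<open>In a cell that is not bad, the true motion is the ideal one with the boundary taken at a
  time u of the cell: the jump time if there is a jump. In the other cases the level does not enter
  and u is merely some time of the cell.\<close>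

lemma ideal_path:
  assumes d: "driven_path X \<omega>" and \<omega>: "\<omega> \<in> space P" and s: "0 \<le> s" "s \<le> t" and i: "i < n" and nb: "\<not> bad r i"
    and r0: "\<And>j. j < n \<Longrightarrow> r (j, 0) = real (NJ j t \<omega> - NJ j s \<omega>)" and r1: "\<And>j. j < n \<Longrightarrow> r (j, 1) = real (NS j t \<omega> - NS j s \<omega>)"
    and r2: "r (i, 2) = \<xi> i (NJ i s \<omega>) \<omega>" and r3: "r (i, 3) = real (K i (NS i s \<omega>) \<omega>)"
  shows "\<exists>u. s \<le> u \<and> u \<le> t \<and> ideal (bdry u) (\<lambda>j. ereal (X j s \<omega>)) r i = ereal (X i t \<omega>)"
proof -
  have const: "X i b \<omega> = X i a \<omega>" if "0 \<le> a" "a \<le> b" "NJ i a \<omega> = NJ i b \<omega>" "NS i a \<omega> = NS i b \<omega>" for a b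
    using d i that unfolding driven_path_def by blast
  have stay: "X j u \<omega> = X j s \<omega>" if "j < n" "\<not> active r j" "s \<le> u" "u \<le> t" for j u
    using path_stays[OF d \<omega> that(1) s(1) that(3,4)] that(2) r0[OF that(1)] r1[OF that(1)] by (simp add: active_def)
  note J = clock_path[OF noiseD(1)[OF i] \<omega>] and S = clock_path[OF noiseD(2)[OF i] \<omega>]
  have sq: "N u \<omega> = N s \<omega>" if "N t \<omega> - N s \<omega> = 0" "s \<le> u" "u \<le> t" "poisson_process P q N" for N :: "real \<Rightarrow> 'w \<Rightarrow> nat" and u q
    using clock_path(4)[OF that(4) \<omega>, of s u] clock_path(4)[OF that(4) \<omega>, of u t] that(1-3) s by auto
  \<comment> \<open>An equation holding eventually to the left of the point is used at one time
    inside the cell; as locations are constant between points, it then refers to the configuration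
    at s.\<close>
  have pick: "\<exists>u. Q u \<and> s < u \<and> u < \<tau>" if "\<forall>\<^sub>F u in at_left \<tau>. Q u" "s < \<tau>" for Q \<tau>
  proof -
    have "\<forall>\<^sub>F u in at_left \<tau>. s < u \<and> u < \<tau>" using that(2) unfolding eventually_at_left_field by blast
    with that(1) show ?thesis by (rule eventually_happens'[OF trivial_limit_at_left_real eventually_conj])
  qed
  consider (idle) "\<not> active r i" | (jump) "r (i, 0) = 1" "r (i, 1) = 0"
    | (sync) "r (i, 0) = 0" "r (i, 1) = 1" "target_ok r i" using nb by (auto simp: bad_def)
  then show ?thesis
  proof cases
    case idle
    then have "ideal (bdry s) (\<lambda>j. ereal (X j s \<omega>)) r i = ereal (X i t \<omega>)"
      using stay[OF i idle s(2)] by (simp add: ideal_def active_def)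
    then show ?thesis using s by (intro exI[of _ s]) simp
  next
    case jump
    have "NJ i t \<omega> = Suc (NJ i s \<omega>)" using jump(1) r0[OF i] by simp
    then obtain \<tau> where \<tau>: "s < \<tau>" "\<tau> \<le> t" "point_at (\<lambda>u. NJ i u \<omega>) (NJ i s \<omega>) \<tau>"
      "\<And>u. s \<le> u \<Longrightarrow> u < \<tau> \<Longrightarrow> NJ i u \<omega> = NJ i s \<omega>" "\<And>u. \<tau> \<le> u \<Longrightarrow> u \<le> t \<Longrightarrow> NJ i u \<omega> = NJ i t \<omega>"
      using clock_single_point[OF J(2,3) s] by blast
    have S0: "NS i u \<omega> = NS i s \<omega>" if "s \<le> u" "u \<le> t" for u
      using sq[OF _ that noiseD(2)[OF i]] jump(2) r1[OF i] by simp
    have "\<forall>\<^sub>F u in at_left \<tau>. X i \<tau> \<omega> = max (X i u \<omega>) (A0 + v * \<tau>) + \<xi> i (NJ i s \<omega>) \<omega>"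
      using d i \<tau>(3) unfolding driven_path_def by blast
    from pick[OF this \<tau>(1)]
    obtain u where u: "X i \<tau> \<omega> = max (X i u \<omega>) (A0 + v * \<tau>) + \<xi> i (NJ i s \<omega>) \<omega>" "s < u" "u < \<tau>" by blast
    have "X i u \<omega> = X i s \<omega>" by (rule const) (use u s \<tau>(2) \<tau>(4)[of u] S0[of u] in auto)
    moreover have "X i t \<omega> = X i \<tau> \<omega>"
      by (rule const) (use \<tau>(1,2) \<tau>(5)[of \<tau>] s S0[of \<tau>] S0[of t] in auto)
    ultimately have e1: "X i t \<omega> = max (X i s \<omega>) (bdry \<tau>) + r (i, 2)" using u(1) r2 by (simp only: bdry_def)
    have e2: "ideal (bdry \<tau>) (\<lambda>j. ereal (X j s \<omega>)) r i = max (ereal (X i s \<omega>)) (ereal (bdry \<tau>)) + ereal (r (i, 2))"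
      unfolding ideal_def using jump by (simp only: simp_thms if_True)
    have e3: "max (ereal a) (ereal b) + ereal c = ereal (max a b + c)" for a b c
      unfolding ereal_max[symmetric] by (rule plus_ereal.simps(1))
    have "ideal (bdry \<tau>) (\<lambda>j. ereal (X j s \<omega>)) r i = ereal (X i t \<omega>)"
      unfolding e2 e3 e1 ..
    then show ?thesis using \<tau>(1,2) by (intro exI[of _ \<tau>]) simp
  next
    case sync
    obtain j where j: "j < n" "r (i, 3) = real j" "\<not> active r j" using sync(3) by (auto simp: target_ok_def)
    have Kj: "K i (NS i s \<omega>) \<omega> = j" using j(2) r3 by simp
    have "NS i t \<omega> = Suc (NS i s \<omega>)" using sync(2) r1[OF i] by simp
    then obtain \<tau> where \<tau>: "s < \<tau>" "\<tau> \<le> t" "point_at (\<lambda>u. NS i u \<omega>) (NS i s \<omega>) \<tau>"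
      "\<And>u. s \<le> u \<Longrightarrow> u < \<tau> \<Longrightarrow> NS i u \<omega> = NS i s \<omega>" "\<And>u. \<tau> \<le> u \<Longrightarrow> u \<le> t \<Longrightarrow> NS i u \<omega> = NS i t \<omega>"
      using clock_single_point[OF S(2,3) s] by blast
    have J0: "NJ i u \<omega> = NJ i s \<omega>" if "s \<le> u" "u \<le> t" for u
      using sq[OF _ that noiseD(1)[OF i]] sync(1) r0[OF i] by simp
    have "\<forall>\<^sub>F u in at_left \<tau>. X i \<tau> \<omega> = max (X i u \<omega>) (X (K i (NS i s \<omega>) \<omega>) u \<omega>)"
      using d i \<tau>(3) unfolding driven_path_def by blast
    from pick[OF this \<tau>(1)]
    obtain u where u: "X i \<tau> \<omega> = max (X i u \<omega>) (X (K i (NS i s \<omega>) \<omega>) u \<omega>)" "s < u" "u < \<tau>" by blast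
    have "X i u \<omega> = X i s \<omega>" by (rule const) (use u s \<tau>(2) \<tau>(4)[of u] J0[of u] in auto)
    \<comment> \<open>The target has no clock point in the cell, so its location just before the
      synchronization is the one at s.\<close>
    moreover have "X j u \<omega> = X j s \<omega>" by (rule stay[OF j(1,3)]) (use u(2,3) \<tau>(2) in auto)
    moreover have "X i t \<omega> = X i \<tau> \<omega>"
      by (rule const) (use \<tau>(1,2) \<tau>(5)[of \<tau>] s J0[of \<tau>] J0[of t] in auto)
    ultimately have e1: "X i t \<omega> = max (X i s \<omega>) (X j s \<omega>)" using u(1) Kj by (simp only:)
    have "ideal (bdry \<tau>) (\<lambda>j. ereal (X j s \<omega>)) r i = max (ereal (X i s \<omega>)) (ereal (X j s \<omega>))"
      unfolding ideal_def using sync(1,2) j(2) by simp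
    then have "ideal (bdry \<tau>) (\<lambda>j. ereal (X j s \<omega>)) r i = ereal (X i t \<omega>)"
      unfolding e1 ereal_max .
    then show ?thesis using \<tau>(1,2) by (intro exI[of _ \<tau>]) simp
  qed
qed

text \<open>Every rule is monotone in configuration and boundary. Not being bad guarantees that a
  synchronization target is one of the particles for which the order is assumed.\<close>

lemma ideal_mono:
  assumes x: "\<And>j. j < n \<Longrightarrow> x j \<le> x' j" and A: "A \<le> A'" and i: "i < n" and nb: "\<not> bad r i"
  shows "ideal A x r i \<le> ideal A' x' r i"
proof (cases "r (i, 0) = 0 \<and> r (i, 1) = 1")
  case True
  then obtain j where j: "j < n" "r (i, 3) = real j" using nb by (auto simp: bad_def active_def target_ok_def)
  then have "ideal B y r i = max (y i) (y j)" for B y using True by (simp add: ideal_def)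
  then show ?thesis using max.mono[OF x[OF i] x[OF j(1)]] by (simp only:)
next
  case False
  have "max (x i) (ereal A) + ereal (r (i, 2)) \<le> max (x' i) (ereal A') + ereal (r (i, 2))"
    using x[OF i] A by (intro add_mono max.mono) auto
  then show ?thesis using False x[OF i] by (auto simp: ideal_def)
qed

lemma cell_counts:
  assumes \<omega>: "\<omega> \<in> space P" and i: "i < n"
  shows "cJ (Vc \<omega>) k i = NJ i (\<delta> * real k) \<omega>" "cS (Vc \<omega>) k i = NS i (\<delta> * real k) \<omega>"
proof -
  have tel: "(\<Sum>j<k. real (N (\<delta> * real (Suc j)) \<omega> - N (\<delta> * real j) \<omega>)) = real (N (\<delta> * real k) \<omega>)"
    if N: "poisson_process P q N" for q and N :: "real \<Rightarrow> 'w \<Rightarrow> nat" and k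
  proof (induction k)
    case (Suc k)
    have "N (\<delta> * real k) \<omega> \<le> N (\<delta> * real (Suc k)) \<omega>" by (rule clock_path(4)[OF N \<omega>]) (use \<delta> in auto)
    then show ?case using Suc by simp
  qed (use clock_path(1)[OF N \<omega>] in simp)
  show "cJ (Vc \<omega>) k i = NJ i (\<delta> * real k) \<omega>"
    using tel[OF noiseD(1)[OF i], of k] i by (simp add: cJ_def Vc_def V_def)
  show "cS (Vc \<omega>) k i = NS i (\<delta> * real k) \<omega>"
    using tel[OF noiseD(2)[OF i], of k] i by (simp add: cS_def Vc_def V_def)
qed

lemma cellv_values:
  assumes \<omega>: "\<omega> \<in> space P" and i: "i < n"
  shows "cellv (Vc \<omega>) k (i, 0) = real (NJ i (\<delta> * real (Suc k)) \<omega> - NJ i (\<delta> * real k) \<omega>)"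
    "cellv (Vc \<omega>) k (i, 1) = real (NS i (\<delta> * real (Suc k)) \<omega> - NS i (\<delta> * real k) \<omega>)"
    "cellv (Vc \<omega>) k (i, 2) = \<xi> i (NJ i (\<delta> * real k) \<omega>) \<omega>"
    "cellv (Vc \<omega>) k (i, 3) = real (K i (NS i (\<delta> * real k) \<omega>) \<omega>)"
  using i cell_counts[OF \<omega> i, of k] by (simp_all add: cellv_def Vc_def V_def)

text \<open>By induction on the cells: the boundary at the actual jump time lies between its values
  at the ends of the cell, and a bad particle sits at an infinity, where the bound is trivial and
  remains compatible with \<open>ideal_mono\<close> in later cells.\<close>

lemma chain_sandwich:
  assumes d: "driven_path X \<omega>" and \<omega>: "\<omega> \<in> space P" and x0: "\<And>i. i < n \<Longrightarrow> X i 0 \<omega> = x0 i" and i: "i < n"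
  shows "chain (-\<infinity>) (\<lambda>k. bdry (\<delta> * real k)) (\<lambda>i. ereal (x0 i)) (Vc \<omega>) k i \<le> ereal (X i (\<delta> * real k) \<omega>) \<and>
    ereal (X i (\<delta> * real k) \<omega>) \<le> chain \<infinity> (\<lambda>k. bdry (\<delta> * real (Suc k))) (\<lambda>i. ereal (x0 i)) (Vc \<omega>) k i"
  using i
proof (induction k arbitrary: i)
  case (Suc k)
  let ?l = "chain (-\<infinity>) (\<lambda>k. bdry (\<delta> * real k)) (\<lambda>i. ereal (x0 i)) (Vc \<omega>) k"
  let ?u = "chain \<infinity> (\<lambda>k. bdry (\<delta> * real (Suc k))) (\<lambda>i. ereal (x0 i)) (Vc \<omega>) k"
  let ?r = "cellv (Vc \<omega>) k" and ?s = "\<delta> * real k" and ?t = "\<delta> * real (Suc k)"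
  let ?x = "\<lambda>j. ereal (X j ?s \<omega>)"
  show ?case
  proof (cases "bad ?r i")
    case False
    have s: "0 \<le> ?s" "?s \<le> ?t" using \<delta> by auto
    obtain w where w: "?s \<le> w" "w \<le> ?t" "ideal (bdry w) ?x ?r i = ereal (X i ?t \<omega>)"
      using ideal_path[OF d \<omega> s Suc.prems False cellv_values(1,2)[OF \<omega>] cellv_values(3,4)[OF \<omega> Suc.prems]] by blast
    have b: "bdry ?s \<le> bdry w" "bdry w \<le> bdry ?t" using w v by (auto simp: bdry_def)
    have "ideal (bdry ?s) ?l ?r i \<le> ideal (bdry w) ?x ?r i"
      by (rule ideal_mono[OF _ b(1) Suc.prems False]) (use Suc.IH in blast)
    moreover have "ideal (bdry w) ?x ?r i \<le> ideal (bdry ?t) ?u ?r i"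
      by (rule ideal_mono[OF _ b(2) Suc.prems False]) (use Suc.IH in blast)
    ultimately show ?thesis using w(3) Suc.prems False by (simp add: step_def)
  qed (use Suc.prems in \<open>simp add: step_def\<close>)
qed (use x0 in simp)

lemma driven_path_AE: "driven_motion P A0 v n NJ NS \<xi> K X \<Longrightarrow> AE \<omega> in P. driven_path X \<omega>"
  unfolding driven_motion_def driven_path_def .

text \<open>A quantity between two others deviates from a third by no more than the sum of their
  deviations, hence twice the bound for a chain.\<close>

lemma empirical_error:
  assumes dm: "driven_motion P A0 v n NJ NS \<xi> K X" and x0: "\<And>i \<omega>. i < n \<Longrightarrow> \<omega> \<in> space P \<Longrightarrow> X i 0 \<omega> = x0 i"
    and g: "mild g" and g0: "g 0 = empirical_cdf n x0" and k: "k \<le> L"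
  shows "P.expectation (\<lambda>\<omega>. \<bar>empirical_cdf n (\<lambda>i. X i (\<delta> * real k) \<omega>) y - g (\<delta> * real k) y\<bar>) \<le>
    2 * ((real L * (step_error + 2 * rate\<^sup>2 * \<delta>\<^sup>2) + lam * \<delta>) * (1 + \<delta> * (2 * rate)) ^ k)"
proof -
  let ?x = "\<lambda>i. ereal (x0 i)" and ?G = "g (\<delta> * real k) y"
  let ?Al = "\<lambda>k. bdry (\<delta> * real k)" and ?Au = "\<lambda>k. bdry (\<delta> * real (Suc k))"
  let ?l = "\<lambda>\<omega>. frac_le n (chain (-\<infinity>) ?Al ?x (Vc \<omega>) k) y" and ?u = "\<lambda>\<omega>. frac_le n (chain \<infinity> ?Au ?x (Vc \<omega>) k) y"
  have G01: "0 \<le> ?G" "?G \<le> 1"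
  proof -
    have "g (\<delta> * real k) \<in> cdfs" by (rule mildD(1)[OF g]) (use \<delta> in simp)
    then show "0 \<le> ?G" "?G \<le> 1" by (simp_all add: cdfs_nonneg cdfs_le_1)
  qed
  have int: "integrable P (\<lambda>\<omega>. \<bar>?l \<omega> - ?G\<bar>)" "integrable P (\<lambda>\<omega>. \<bar>?u \<omega> - ?G\<bar>)"
  proof -
    have "\<bar>frac_le n x y - ?G\<bar> \<le> 1" for x using frac_le_bounds[of n x y] G01 by linarith
    then show "integrable P (\<lambda>\<omega>. \<bar>?l \<omega> - ?G\<bar>)" "integrable P (\<lambda>\<omega>. \<bar>?u \<omega> - ?G\<bar>)"
      by (auto intro!: bounded_integrable[where B=1])
  qed
  have bm: "?Al k \<le> ?Au k" for k using v \<delta> by (auto simp: bdry_def)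
  have g0': "g 0 = frac_le n ?x" using g0 by (simp add: frac_le_ereal)
  have "P.expectation (\<lambda>\<omega>. \<bar>empirical_cdf n (\<lambda>i. X i (\<delta> * real k) \<omega>) y - ?G\<bar>) \<le> P.expectation (\<lambda>\<omega>. \<bar>?l \<omega> - ?G\<bar> + \<bar>?u \<omega> - ?G\<bar>)"
  proof (rule integral_mono_AE')
    show "AE \<omega> in P. \<bar>empirical_cdf n (\<lambda>i. X i (\<delta> * real k) \<omega>) y - ?G\<bar> \<le> \<bar>?l \<omega> - ?G\<bar> + \<bar>?u \<omega> - ?G\<bar>"
      using driven_path_AE[OF dm] AE_space
    proof eventually_elim
      case (elim \<omega>)
      have "?u \<omega> \<le> frac_le n (\<lambda>i. ereal (X i (\<delta> * real k) \<omega>)) y" "frac_le n (\<lambda>i. ereal (X i (\<delta> * real k) \<omega>)) y \<le> ?l \<omega>"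
        using chain_sandwich[OF elim x0[OF _ elim(2)]] by (auto intro: frac_le_antimono)
      then show ?case unfolding frac_le_ereal by linarith
    qed
  qed (use int in auto)
  also have "\<dots> = err (-\<infinity>) ?Al ?x g k y + err \<infinity> ?Au ?x g k y" using int by (simp add: err_def)
  finally show ?thesis
    using chain_error[where w="-\<infinity>" and As="?Al" and g=g and y=y, OF g order_refl bm g0' k]
      chain_error[where w="\<infinity>" and As="?Au" and g=g and y=y, OF g bm order_refl g0' k] by linarith
qed

section \<open>The fraction of particles with a clock point in a cell\<close>

definition activity :: "nat \<Rightarrow> 'w \<Rightarrow> real" where
  "activity k \<omega> = (\<Sum>i<n. if V (JInc i k) \<omega> \<noteq> 0 \<or> V (SInc i k) \<omega> \<noteq> 0 then 1 else 0) / real n"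

lemma activity_measurable [measurable]: "activity k \<in> borel_measurable P"
  unfolding activity_def by measurable

lemma activity_bounds: "0 \<le> activity k \<omega>" "activity k \<omega> \<le> 1"
proof -
  show "0 \<le> activity k \<omega>" unfolding activity_def by (intro divide_nonneg_nonneg sum_nonneg) auto
  have "(\<Sum>i<n. if V (JInc i k) \<omega> \<noteq> 0 \<or> V (SInc i k) \<omega> \<noteq> 0 then 1 else 0 :: real) \<le> (\<Sum>i<n. 1)" by (intro sum_mono) auto
  then show "activity k \<omega> \<le> 1" using n2 by (auto simp: activity_def pos_divide_le_eq)
qed

lemma activity_increment:
  assumes d: "driven_path X \<omega>" and \<omega>: "\<omega> \<in> space P" and t: "\<delta> * real k \<le> t" "t \<le> \<delta> * real (Suc k)"
  shows "\<bar>empirical_cdf n (\<lambda>i. X i t \<omega>) x - empirical_cdf n (\<lambda>i. X i (\<delta> * real k) \<omega>) x\<bar> \<le> activity k \<omega>"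
proof -
  let ?one = "\<lambda>t i. if ereal (X i t \<omega>) \<le> ereal x then 1 else 0 :: real"
  have s: "0 \<le> \<delta> * real k" using \<delta> by simp
  have "\<bar>empirical_cdf n (\<lambda>i. X i t \<omega>) x - empirical_cdf n (\<lambda>i. X i (\<delta> * real k) \<omega>) x\<bar>
      = \<bar>\<Sum>i<n. ?one t i - ?one (\<delta> * real k) i\<bar> / real n"
    unfolding frac_le_ereal[symmetric] by (simp only: frac_le_def diff_divide_distrib[symmetric] sum_subtractf abs_divide abs_of_nat)
  also have "\<dots> \<le> activity k \<omega>"
    unfolding activity_def
  proof (intro divide_right_mono order_trans[OF sum_abs] sum_mono)
    fix i assume "i \<in> {..<n}"
    then have i: "i < n" by simp
    show "\<bar>?one t i - ?one (\<delta> * real k) i\<bar> \<le> (if V (JInc i k) \<omega> \<noteq> 0 \<or> V (SInc i k) \<omega> \<noteq> 0 then 1 else 0)"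
    proof (cases "V (JInc i k) \<omega> = 0 \<and> V (SInc i k) \<omega> = 0")
      case True
      then have "X i t \<omega> = X i (\<delta> * real k) \<omega>"
        using i by (intro path_stays[OF d \<omega> i s t]) (simp_all add: V_def)
      then show ?thesis by simp
    qed auto
  qed simp
  finally show ?thesis .
qed

text \<open>The mean fraction is at most \<open>rate * \<delta>\<close>, so the excess over this
  value is dominated by the centred fluctuation. The bound has order \<open>1 / sqrt n\<close> for a
  fixed cell length.\<close>

lemma activity_excess: "P.expectation (\<lambda>\<omega>. max 0 (activity k \<omega> - rate * \<delta>)) \<le> 1 / sqrt (real n)"
proof -
  define Z where "Z i \<omega> = (if V (JInc i k) \<omega> \<noteq> 0 \<or> V (SInc i k) \<omega> \<noteq> 0 then 1 else 0 :: real)" for i \<omega>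
  have Zm [measurable]: "Z i \<in> borel_measurable P" for i unfolding Z_def by measurable
  have n0: "0 < n" using n2 by simp
  define L where "L i = {JInc i k, SInc i k}" for i
  have "P.indep_vars (\<lambda>i. PiM (L i) (\<lambda>_. borel)) (\<lambda>i \<omega>. restrict (\<lambda>e. V e \<omega>) (L i)) {..<n}"
    by (rule P.indep_vars_restrict[OF V_indep]) (auto simp: L_def disjoint_family_on_def)
  then have "P.indep_vars (\<lambda>_. borel) (\<lambda>i \<omega>. (\<lambda>p. if p (JInc i k) \<noteq> 0 \<or> p (SInc i k) \<noteq> 0 then 1 else 0 :: real) (restrict (\<lambda>e. V e \<omega>) (L i))) {..<n}"
  proof (rule P.indep_vars_compose2)
    fix i
    have "Measurable.pred (PiM (L i) (\<lambda>_. borel :: real measure)) (\<lambda>p. p a = 0)" for a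
      by (rule measurable_compose[OF component_measurable, of "\<lambda>r. r = 0"]) measurable
    then show "(\<lambda>p. if p (JInc i k) \<noteq> 0 \<or> p (SInc i k) \<noteq> 0 then 1 else 0 :: real) \<in> borel_measurable (PiM (L i) (\<lambda>_. borel :: real measure))"
      by (intro measurable_If measurable_const predE pred_intros_logic) auto
  qed
  then have ind: "P.indep_vars (\<lambda>_. borel) Z {..<n}" by (simp add: Z_def[abs_def] L_def)
  have EZ: "P.expectation (Z i) \<le> rate * \<delta>" if i: "i < n" for i
  proof -
    have "Z i = indicat_real (V (JInc i k) -` (- {0}) \<union> V (SInc i k) -` (- {0}))" by (auto simp: Z_def)
    then have "P.expectation (Z i) = P.prob ((V (JInc i k) -` (- {0}) \<union> V (SInc i k) -` (- {0})) \<inter> space P)" by simp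
    also have "\<dots> \<le> P.prob (V (JInc i k) -` (- {0}) \<inter> space P) + P.prob (V (SInc i k) -` (- {0}) \<inter> space P)"
      unfolding Int_Un_distrib2 by (rule measure_subadditive) (auto simp: P.emeasure_eq_measure)
    also have "\<dots> \<le> rate * \<delta>" using prob_active_le(1,2)[OF i, of k] by (simp add: rate_def algebra_simps)
    finally show ?thesis .
  qed
  let ?S = "\<lambda>\<omega>. \<bar>(\<Sum>i<n. Z i \<omega> - P.expectation (Z i)) / real n\<bar>"
  have "P.expectation (\<lambda>\<omega>. max 0 (activity k \<omega> - rate * \<delta>)) \<le> P.expectation ?S"
  proof (rule integral_mono_AE')
    have b: "\<bar>P.expectation (Z i)\<bar> \<le> 1" for i
    proof -
      have "\<bar>P.expectation (Z i)\<bar> \<le> P.expectation (\<lambda>\<omega>. \<bar>Z i \<omega>\<bar>)" using integral_norm_bound[of P "Z i"] by simp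
      also have "\<dots> \<le> P.expectation (\<lambda>\<omega>. 1)" by (rule integral_mono_AE') (auto simp: Z_def)
      finally show ?thesis by (simp add: P.prob_space)
    qed
    have "integrable P (Z i)" for i by (rule bounded_integrable[where B=1]) (auto simp: Z_def)
    then show "integrable P ?S" by auto
    have "max 0 (activity k \<omega> - rate * \<delta>) \<le> ?S \<omega>" for \<omega>
    proof -
      have "(\<Sum>i<n. P.expectation (Z i)) \<le> (\<Sum>i<n. rate * \<delta>)" using EZ by (intro sum_mono) auto
      then have "(\<Sum>i<n. P.expectation (Z i)) / real n \<le> rate * \<delta>" using n0 by (simp add: pos_divide_le_eq mult.commute)
      then have "activity k \<omega> - rate * \<delta> \<le> (\<Sum>i<n. Z i \<omega> - P.expectation (Z i)) / real n"
        unfolding activity_def Z_def[symmetric] by (simp add: sum_subtractf diff_divide_distrib)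
      then show ?thesis by linarith
    qed
    then show "AE \<omega> in P. max 0 (activity k \<omega> - rate * \<delta>) \<le> ?S \<omega>" by simp
  qed simp
  also have "\<dots> \<le> 1 / sqrt (real n)"
    by (rule P.weak_law_L1[OF ind n0]) (auto simp: Z_def)
  finally show ?thesis .
qed

end

section \<open>Convergence to the mean-field limit\<close>

lemma inverse_sqrt_tendsto: "(\<lambda>n. 1 / sqrt (real n)) \<longlonglongrightarrow> 0"
  by (intro tendsto_divide_0[OF tendsto_const] filterlim_at_top_imp_at_infinity
      filterlim_compose[OF sqrt_at_top] filterlim_real_sequentially)

text \<open>Between grid points monotonicity replaces the comparison, at the price of a shift by
  \<open>2 * h\<close>; beyond the grid one of the two functions is within b of its limit. The
  points \<open>c j\<close> may be placed anywhere in their meshes, and the disjunctions allow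
  either function to supply the tail bound.\<close>

lemma grid_shift:
  fixes F G :: "real \<Rightarrow> real" and c :: "int \<Rightarrow> real" and m :: int
  assumes F: "mono F" "\<And>x. F x \<le> 1" and G: "mono G" "\<And>x. 0 \<le> G x" and h: "0 < h" and a: "0 \<le> a" and b: "0 \<le> b"
    and e: "0 \<le> e" and m: "0 \<le> m"
    and c: "\<And>j. -m \<le> j \<Longrightarrow> j \<le> m \<Longrightarrow> h * of_int j \<le> c j \<and> c j \<le> h * of_int j + h"
    and le: "\<And>j. -m \<le> j \<Longrightarrow> j \<le> m \<Longrightarrow> F (c j) \<le> G (c j + e) + a"
    and right: "1 - b \<le> F (h * of_int m) \<or> 1 - b \<le> G (h * of_int m)"
    and left: "F (- h * of_int m) \<le> b \<or> G (- h * of_int m + h + e) \<le> b"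
  shows "F x \<le> G (x + 2 * h + e) + a + b"
proof -
  define j where "j = \<lceil>x / h\<rceil>"
  have Fm: "F u \<le> F w" if "u \<le> w" for u w using F(1) that by (rule monoD)
  have Gm: "G u \<le> G w" if "u \<le> w" for u w using G(1) that by (rule monoD)
  have "x / h \<le> of_int j" "of_int j < x / h + 1" unfolding j_def by linarith+
  then have j: "x \<le> h * of_int j" "h * of_int j < x + h"
    using h by (simp_all add: pos_divide_le_eq mult.commute field_simps)
  have "j < -m \<or> (-m \<le> j \<and> j \<le> m) \<or> m < j" by linarith
  then show ?thesis
  proof (elim disjE)
    assume J: "-m \<le> j \<and> j \<le> m"
    have "F x \<le> F (c j)" by (rule Fm) (use j c[of j] J in linarith)
    also have "\<dots> \<le> G (c j + e) + a" using le J by blast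
    also have "G (c j + e) \<le> G (x + 2 * h + e)" by (rule Gm) (use j c[of j] J in linarith)
    finally show ?thesis using b by linarith
  next
    assume "m < j"
    then have "of_int m \<le> (of_int j :: real) - 1" by linarith
    then have "h * of_int m \<le> h * (of_int j - 1)" using h by (intro mult_left_mono) auto
    then have x: "h * of_int m \<le> x" using j(2) by (simp add: algebra_simps)
    from right show ?thesis
    proof
      assume *: "1 - b \<le> F (h * of_int m)"
      have "F (h * of_int m) \<le> F (c m)" by (rule Fm) (use c[of m] m in auto)
      moreover have "F (c m) \<le> G (c m + e) + a" using le m by simp
      moreover have "G (c m + e) \<le> G (x + 2 * h + e)" by (rule Gm) (use c[of m] m x h in auto)
      ultimately show ?thesis using * F(2)[of x] by linarith
    next
      assume *: "1 - b \<le> G (h * of_int m)"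
      have "G (h * of_int m) \<le> G (x + 2 * h + e)" by (rule Gm) (use x h e in linarith)
      then show ?thesis using * F(2)[of x] a by linarith
    qed
  next
    assume "j < -m"
    then have "(of_int j :: real) \<le> - of_int m" by linarith
    then have "h * of_int j \<le> h * (- of_int m)" using h by (intro mult_left_mono) auto
    then have x: "x \<le> - h * of_int m" using j(1) by simp
    from left show ?thesis
    proof
      assume "F (- h * of_int m) \<le> b"
      then show ?thesis using Fm[OF x] G(2)[of "x + 2 * h + e"] a by linarith
    next
      assume *: "G (- h * of_int m + h + e) \<le> b"
      have cm: "- h * of_int m \<le> c (-m)" "c (-m) \<le> - h * of_int m + h" using c[of "-m"] m by auto
      have "F x \<le> F (c (-m))" by (rule Fm) (use x cm in linarith)
      moreover have "F (c (-m)) \<le> G (c (-m) + e) + a" using le m by simp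
      moreover have "G (c (-m) + e) \<le> G (- h * of_int m + h + e)" by (rule Gm) (use cm in linarith)
      ultimately show ?thesis using * G(2)[of "x + 2 * h + e"] by linarith
    qed
  qed
qed

lemma grid_tails:
  assumes F: "F \<in> cdfs" and G: "G \<in> cdfs" and h: "0 < h" and b: "0 < b"
  obtains m :: int where "0 \<le> m" "F (- h * of_int m + d) \<le> b" "1 - b \<le> G (h * of_int m - d)"
proof -
  obtain N where N: "\<And>x. x \<le> N \<Longrightarrow> F x < b"
    using order_tendstoD(2)[OF cdfsD(3)[OF F] b] unfolding eventually_at_bot_linorder by blast
  obtain M where M: "\<And>x. M \<le> x \<Longrightarrow> 1 - b < G x"
    using order_tendstoD(1)[OF cdfsD(4)[OF G], of "1 - b"] b unfolding eventually_at_top_linorder by auto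
  obtain m :: nat where m: "max (d - N) (M + d) < real m * h" using ex_less_of_nat_mult[OF h] by blast
  have "F (- h * of_int (int m) + d) \<le> b" using m by (intro less_imp_le N) (simp add: mult.commute)
  moreover have "1 - b \<le> G (h * of_int (int m) - d)" using m by (intro less_imp_le M) (simp add: mult.commute)
  ultimately show ?thesis using that[of "int m"] by simp
qed

text \<open>Weak convergence gives convergence at finitely many continuity points, and
  \<open>grid_shift\<close> extends it to all x simultaneously.\<close>

lemma weak_conv_shift:
  assumes f: "f \<in> cdfs" and fn: "\<forall>\<^sub>F n in sequentially. fn n \<in> cdfs" and conv: "weak_conv fn f" and e: "0 < e"
  shows "\<forall>\<^sub>F n in sequentially. \<forall>x. fn n x \<le> f (x + e) + e \<and> f x \<le> fn n (x + e) + e"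
proof -
  define h where "h = e / 2"
  have h: "0 < h" using e by (simp add: h_def)
  obtain m :: int where m: "0 \<le> m" "f (- h * of_int m + h) \<le> h" "1 - h \<le> f (h * of_int m - h)"
    using grid_tails[OF f f h h, of h] by blast
  \<comment> \<open>A monotone function has only countably many discontinuities, so each mesh
    contains a continuity point.\<close>
  have "\<exists>c. h * of_int j < c \<and> c < h * of_int j + h \<and> isCont f c" for j
  proof -
    have "countable {a. \<not> isCont f a}" by (rule mono_ctble_discont[OF cdfsD(1)[OF f]])
    moreover have "uncountable {h * of_int j<..<h * of_int j + h}" using h by (simp add: uncountable_open_interval)
    ultimately have "\<not> {h * of_int j<..<h * of_int j + h} \<subseteq> {a. \<not> isCont f a}" using countable_subset by blast
    then show ?thesis by auto
  qed
  then obtain c where c: "\<And>j. h * of_int j < c j" "\<And>j. c j < h * of_int j + h" "\<And>j. isCont f (c j)" by metis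
  have "\<forall>\<^sub>F n in sequentially. \<bar>fn n (c j) - f (c j)\<bar> < h" for j
  proof -
    have "(\<lambda>n. fn n (c j)) \<longlonglongrightarrow> f (c j)" using conv c(3)[of j] by (simp add: weak_conv_def)
    from tendstoD[OF this h] show ?thesis by (simp add: dist_real_def)
  qed
  then have "\<forall>\<^sub>F n in sequentially. \<forall>j\<in>{-m..m}. \<bar>fn n (c j) - f (c j)\<bar> < h"
    by (intro eventually_ball_finite) auto
  then show ?thesis
    using fn
  proof eventually_elim
    case (elim n)
    have le: "\<bar>fn n (c j) - f (c j)\<bar> \<le> h" if "-m \<le> j" "j \<le> m" for j using elim(1) that by force
    note f' = cdfsD(1)[OF f] cdfs_le_1[OF f] cdfs_nonneg[OF f] and fn' = cdfsD(1)[OF elim(2)] cdfs_le_1[OF elim(2)] cdfs_nonneg[OF elim(2)]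
    have t1: "1 - h \<le> f (h * of_int m)" using m(3) monoD[OF f'(1), of "h * of_int m - h" "h * of_int m"] h by simp
    have t2: "f (- h * of_int m) \<le> h" using m(2) monoD[OF f'(1), of "- h * of_int m" "- h * of_int m + h"] h by simp
    have "fn n x \<le> f (x + 2 * h + 0) + h + h" for x
    proof (rule grid_shift[OF fn'(1,2) f'(1,3) h, where c=c and m=m])
      show "fn n (c j) \<le> f (c j + 0) + h" if "-m \<le> j" "j \<le> m" for j using le[OF that] by simp
    qed (use t1 m h c in \<open>auto simp: less_imp_le\<close>)
    moreover have "f x \<le> fn n (x + 2 * h + 0) + h + h" for x
    proof (rule grid_shift[OF f'(1,2) fn'(1,3) h, where c=c and m=m])
      show "f (c j) \<le> fn n (c j + 0) + h" if "-m \<le> j" "j \<le> m" for j using le[OF that] by simp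
    qed (use t1 t2 m h c in \<open>auto simp: less_imp_le\<close>)
    ultimately show ?case by (simp add: h_def add.commute)
  qed
qed

context moving_boundary
begin

text \<open>The comparison runs through E at time s, g on the grid, f at time s by the shift
  estimate, and f at time t by the Lipschitz bound. The total shift \<open>3 * h\<close> is
  \<open>2 * h\<close> from the grid and h from the initial states.\<close>

lemma levy_close_of_grid:
  fixes E :: "real \<Rightarrow> real \<Rightarrow> real" and m :: int
  assumes pos: "AE z in \<zeta>. z > 0" and f: "mild f" and g: "mild g" and h: "0 < h" and m: "0 \<le> m"
    and init: "\<And>x. g 0 x \<le> f 0 (x + h) + h" "\<And>x. f 0 x \<le> g 0 (x + h) + h"
    and tails: "f 0 (- h * of_int m + 2 * h) \<le> h" "1 - h \<le> f T (h * of_int m - 2 * h)"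
    and s: "0 \<le> s" "s \<le> t" "t \<le> T" and Es: "E s \<in> cdfs" and \<beta>: "rate * (t - s) \<le> \<beta>"
    and grid: "\<And>j. -m \<le> j \<Longrightarrow> j \<le> m \<Longrightarrow> \<bar>E s (h * of_int j) - g s (h * of_int j)\<bar> \<le> \<gamma>"
    and inc: "\<And>x. \<bar>E t x - E s x\<bar> \<le> \<beta>"
  shows "E t x \<le> f t (x + 3 * h) + (2 * \<beta> + \<gamma> + h * exp T + h) \<and> f t x \<le> E t (x + 3 * h) + (2 * \<beta> + \<gamma> + h * exp T + h)"
proof -
  have fs: "f s \<in> cdfs" by (rule mildD(1)[OF f s(1)])
  have anti: "f w x \<le> f u x" if "0 \<le> u" "u \<le> w" for u w x by (rule mild_antimono[OF f pos that])
  have \<gamma>0: "0 \<le> \<gamma>" using grid[of 0] m by simp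
  have T0: "0 \<le> T" using s by simp
  have fT: "f T \<in> cdfs" by (rule mildD(1)[OF f T0])
  have hexp: "h * exp s \<le> h * exp T" using h s by simp
  have cmp: "g s x \<le> f s (x + h) + h * exp T" "f s x \<le> g s (x + h) + h * exp T" for x
    using mild_shift_comparison[OF g f less_imp_le[OF h] less_imp_le[OF h] init(1) s(1), of x]
      mild_shift_comparison[OF f g less_imp_le[OF h] less_imp_le[OF h] init(2) s(1), of x] hexp by linarith+
  \<comment> \<open>As f decreases in time, the right tail is worst at T and the left tail at 0, so
    one grid serves all times.\<close>
  have right: "1 - h \<le> f s (h * of_int m - h)"
    using tails(2) cdfs_mono[OF fT, of "h * of_int m - 2 * h" "h * of_int m - h"] anti[of s T "h * of_int m - h"] s h by simp
  have left: "f s (- h * of_int m + 2 * h) \<le> h" using tails(1) anti[of 0 s "- h * of_int m + 2 * h"] s by simp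
  note f' = cdfsD(1)[OF fs] cdfs_le_1[OF fs] cdfs_nonneg[OF fs] and E' = cdfsD(1)[OF Es] cdfs_le_1[OF Es] cdfs_nonneg[OF Es]
  have a0: "0 \<le> \<gamma> + h * exp T" using \<gamma>0 h by simp
  have up: "E s x \<le> f s (x + 2 * h + h) + (\<gamma> + h * exp T) + h" for x
  proof (rule grid_shift[OF E'(1,2) f'(1,3) h a0 less_imp_le[OF h] less_imp_le[OF h] m, where c="\<lambda>j. h * of_int j"])
    show "E s (h * of_int j) \<le> f s (h * of_int j + h) + (\<gamma> + h * exp T)" if "-m \<le> j" "j \<le> m" for j
      using grid[OF that] cmp(1)[of "h * of_int j"] by linarith
    have "f s (h * of_int m - h) \<le> f s (h * of_int m)" by (rule cdfs_mono[OF fs]) (use h in simp)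
    then show "1 - h \<le> E s (h * of_int m) \<or> 1 - h \<le> f s (h * of_int m)" using right by linarith
    have "- h * of_int m + h + h = - h * of_int m + 2 * h" by simp
    then show "E s (- h * of_int m) \<le> h \<or> f s (- h * of_int m + h + h) \<le> h" using left by simp
  qed (use h in simp)
  \<comment> \<open>E is controlled only at the grid points themselves, so here the shift by h is
    put into f; the result is evaluated at \<open>x + h\<close> afterwards.\<close>
  have lo: "f s (x - h) \<le> E s (x + 2 * h + 0) + (\<gamma> + h * exp T) + h" for x
  proof (rule grid_shift[OF _ _ E'(1,3) h a0 less_imp_le[OF h] order_refl m, where c="\<lambda>j. h * of_int j" and F="\<lambda>x. f s (x - h)"])
    show "f s (h * of_int j - h) \<le> E s (h * of_int j + 0) + (\<gamma> + h * exp T)" if "-m \<le> j" "j \<le> m" for j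
      using grid[OF that] cmp(2)[of "h * of_int j - h"] by simp
    show "1 - h \<le> f s (h * of_int m - h) \<or> 1 - h \<le> E s (h * of_int m)" using right by simp
    have "f s (- h * of_int m - h) \<le> f s (- h * of_int m + 2 * h)" by (rule cdfs_mono[OF fs]) (use h in simp)
    then show "f s (- h * of_int m - h) \<le> h \<or> E s (- h * of_int m + h + 0) \<le> h" using left by linarith
    show "mono (\<lambda>x. f s (x - h))" by (rule monoI) (rule cdfs_mono[OF fs], simp)
  qed (use h f'(2) in simp_all)
  have "\<bar>f t w - f s w\<bar> \<le> \<beta>" for w
    using mild_diff_le[OF f s(1), of t w] s \<beta> by simp
  moreover have "x + 2 * h + h = x + 3 * h" "x + h - h = x" "x + h + 2 * h + 0 = x + 3 * h" by simp_all
  ultimately show ?thesis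
    using up[of x] lo[of "x + h"] inc[of x] inc[of "x + 3 * h"] anti[OF s(1,2), of x] \<gamma>0
    by (smt (verit))
qed

end

lemma particle_system_noise_grid:
  assumes mb: "moving_boundary \<zeta> lam v" and sys: "particle_system P lam \<zeta> A0 v n F0 X" and n: "2 \<le> n" and \<delta>: "0 < \<delta>"
  obtains x0 NJ NS \<xi> K where "noise_grid \<zeta> lam v P n NJ NS \<xi> K \<delta>" "driven_motion P A0 v n NJ NS \<xi> K X"
    "empirical_cdf n x0 = F0" "\<And>i \<omega>. i < n \<Longrightarrow> \<omega> \<in> space P \<Longrightarrow> X i 0 \<omega> = x0 i"
proof -
  obtain x0 NJ NS \<xi> K where *: "empirical_cdf n x0 = F0" "\<forall>i<n. \<forall>\<omega>\<in>space P. X i 0 \<omega> = x0 i"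
    "driving_noise P lam \<zeta> n NJ NS \<xi> K" "driven_motion P A0 v n NJ NS \<xi> K X" and "prob_space P"
    using sys unfolding particle_system_def by blast
  then have "noise_grid \<zeta> lam v P n NJ NS \<xi> K \<delta>"
    using mb n \<delta> by (intro noise_grid.intro noise_grid_axioms.intro)
  then show ?thesis using that * by blast
qed

context moving_boundary
begin

text \<open>Each interval of length \<open>\<Delta>\<close> is refined into \<open>q'\<close> cells.
  First \<open>q'\<close> is chosen so large that the discretization error is below
  \<open>\<eta> / 2\<close>, then n so large that the fluctuations summed over the
  \<open>q' * k\<close> cells are. The estimate is uniform in y and in the initial state.\<close>

lemma empirical_cdf_limit:
  fixes \<Delta> \<eta> :: real
  assumes pos: "AE z in \<zeta>. z > 0" and \<Delta>: "0 < \<Delta>" and \<eta>: "0 < \<eta>"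
  shows "\<forall>\<^sub>F n in sequentially. \<forall>(P :: 'w measure) F0 X y. particle_system P lam \<zeta> A0 v n F0 X \<longrightarrow>
    (\<integral>\<omega>. \<bar>empirical_cdf n (\<lambda>i. X i (\<Delta> * real k) \<omega>) y - sol F0 (\<Delta> * real k) y\<bar> \<partial>P) \<le> \<eta>"
proof -
  define C where "C = exp (2 * rate * \<Delta> * real k)"
  \<comment> \<open>With \<open>\<delta> = \<Delta> / q'\<close> and \<open>q' * k\<close> cells,
    the terms of order \<open>\<delta>\<^sup>2\<close> have total coefficient
    \<open>3 + 2 = 5\<close> times \<open>rate\<^sup>2\<close>; they and the crossing term
    \<open>lam * \<delta>\<close> add up to \<open>D / q'\<close>.\<close>
  define D where "D = 5 * rate\<^sup>2 * real k * \<Delta>\<^sup>2 + lam * \<Delta>"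
  have C0: "0 < C" by (simp add: C_def)
  have D0: "0 \<le> D" using \<Delta> lam by (simp add: D_def)
  obtain q :: nat where q: "4 * C * D / \<eta> < real q" using reals_Archimedean2 by blast
  define q' where "q' = Suc q"
  have q': "0 < q'" "4 * C * D < \<eta> * real q'" using q \<eta> by (auto simp: q'_def field_simps)
  have "(\<lambda>n. 2 * C * (real (q' * k) * (1 / sqrt (real n)) + real k * \<Delta> / real (n - 1))) \<longlonglongrightarrow>
      2 * C * (real (q' * k) * 0 + 0)"
  proof (intro tendsto_intros)
    show "(\<lambda>n. 1 / sqrt (real n)) \<longlonglongrightarrow> 0"
      by (rule inverse_sqrt_tendsto)
    show "(\<lambda>n. real k * \<Delta> / real (n - 1)) \<longlonglongrightarrow> 0"
      by (intro tendsto_divide_0[OF tendsto_const] filterlim_at_top_imp_at_infinity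
          filterlim_compose[OF filterlim_real_sequentially] filterlim_minus_const_nat_at_top)
  qed
  then have "\<forall>\<^sub>F n in sequentially. 2 * C * (real (q' * k) * (1 / sqrt (real n)) + real k * \<Delta> / real (n - 1)) < \<eta> / 2"
    using \<eta> by (intro order_tendstoD(2)) auto
  then show ?thesis
    using eventually_ge_at_top[of 2]
  proof eventually_elim
    case (elim n)
    show ?case
    proof (intro allI impI)
      fix P :: "'w measure" and F0 X y
      assume sys: "particle_system P lam \<zeta> A0 v n F0 X"
      let ?I = "\<integral>\<omega>. \<bar>empirical_cdf n (\<lambda>i. X i (\<Delta> * real k) \<omega>) y - sol F0 (\<Delta> * real k) y\<bar> \<partial>P"
      let ?\<delta> = "\<Delta> / real q'"
      have \<delta>0: "0 < ?\<delta>" using \<Delta> q' by simp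
      obtain x0 NJ NS \<xi> K where G: "noise_grid \<zeta> lam v P n NJ NS \<xi> K ?\<delta>" and dm: "driven_motion P A0 v n NJ NS \<xi> K X"
        and x0: "empirical_cdf n x0 = F0" "\<And>i \<omega>. i < n \<Longrightarrow> \<omega> \<in> space P \<Longrightarrow> X i 0 \<omega> = x0 i"
        by (rule particle_system_noise_grid[OF moving_boundary_axioms sys elim(2) \<delta>0]) (rule that)
      interpret noise_grid \<zeta> lam v A0 P n NJ NS \<xi> K ?\<delta> by (rule G)
      have F0: "F0 \<in> cdfs" using empirical_cdf_in_cdfs[of n x0] elim(2) x0(1) by simp
      have s0: "sol F0 0 = empirical_cdf n x0" using sol_zero[OF cdfs_regular[OF F0]] x0(1) by simp
      have t: "?\<delta> * real (q' * k) = \<Delta> * real k" using q' by simp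
      have "?I \<le>
          2 * ((real (q' * k) * (step_error + 2 * rate\<^sup>2 * ?\<delta>\<^sup>2) + lam * ?\<delta>) * (1 + ?\<delta> * (2 * rate)) ^ (q' * k))"
        using empirical_error[OF dm x0(2) sol_mild[OF F0 pos] s0 order_refl, of "q' * k" y] unfolding t .
      also have "\<dots> \<le> 2 * ((real (q' * k) * (step_error + 2 * rate\<^sup>2 * ?\<delta>\<^sup>2) + lam * ?\<delta>) * C)"
      proof (intro mult_left_mono)
        have "(1 + ?\<delta> * (2 * rate)) ^ (q' * k) \<le> exp (?\<delta> * (2 * rate)) ^ (q' * k)"
        proof (intro power_mono exp_ge_add_one_self)
          have "0 \<le> ?\<delta> * (2 * rate)" using \<delta>0 rate_pos by (intro mult_nonneg_nonneg) auto
          then show "0 \<le> 1 + ?\<delta> * (2 * rate)" by linarith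
        qed
        also have "\<dots> = exp (?\<delta> * real (q' * k) * (2 * rate))" unfolding exp_of_nat_mult[symmetric] by (simp add: mult_ac)
        also have "\<dots> = C" unfolding t C_def by (simp add: mult_ac)
        finally show "(1 + ?\<delta> * (2 * rate)) ^ (q' * k) \<le> C" .
        have "0 \<le> lam * ?\<delta>" "0 \<le> step_error + 2 * rate\<^sup>2 * ?\<delta>\<^sup>2" using step_error_nonneg by (auto intro: mult_nonneg_nonneg[OF lam less_imp_le[OF \<delta>0]] simp del: times_divide_eq_right)
        then show "0 \<le> real (q' * k) * (step_error + 2 * rate\<^sup>2 * ?\<delta>\<^sup>2) + lam * ?\<delta>"
          by (intro add_nonneg_nonneg[OF mult_nonneg_nonneg[OF of_nat_0_le_iff]])
      qed simp
      also have "real (q' * k) * (step_error + 2 * rate\<^sup>2 * ?\<delta>\<^sup>2) + lam * ?\<delta> =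
          real (q' * k) * (1 / sqrt (real n)) + real k * \<Delta> / real (n - 1) + D / real q'"
        using q' by (simp add: step_error_def D_def field_simps power2_eq_square)
      finally have "?I \<le>
          2 * C * (real (q' * k) * (1 / sqrt (real n)) + real k * \<Delta> / real (n - 1)) + 2 * C * D / real q'"
        by (simp add: algebra_simps)
      moreover have "2 * C * D / real q' \<le> \<eta> / 2" using q' by (simp add: field_simps)
      ultimately show "?I \<le> \<eta>"
        using elim(1) by linarith
    qed
  qed
qed

text \<open>Between grid times the distribution function changes at most by the fraction of active
  particles, uniformly in x; \<open>W\<close> is the excess of this fraction over its mean
  bound.\<close>

lemma empirical_cdf_increments:
  assumes sys: "particle_system P lam \<zeta> A0 v n F0 X" and n: "2 \<le> n" and \<Delta>: "0 < \<Delta>"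
  shows "\<exists>W. (\<forall>k. integrable P (W k) \<and> (\<forall>\<omega>. 0 \<le> W k \<omega>) \<and> (\<integral>\<omega>. W k \<omega> \<partial>P) \<le> 1 / sqrt (real n)) \<and>
    (AE \<omega> in P. \<forall>k t x. \<Delta> * real k \<le> t \<longrightarrow> t \<le> \<Delta> * real (Suc k) \<longrightarrow>
      \<bar>empirical_cdf n (\<lambda>i. X i t \<omega>) x - empirical_cdf n (\<lambda>i. X i (\<Delta> * real k) \<omega>) x\<bar> \<le> rate * \<Delta> + W k \<omega>)"
proof -
  obtain x0 NJ NS \<xi> K where G: "noise_grid \<zeta> lam v P n NJ NS \<xi> K \<Delta>" and dm: "driven_motion P A0 v n NJ NS \<xi> K X"
    and "empirical_cdf n x0 = F0" "\<And>i \<omega>. i < n \<Longrightarrow> \<omega> \<in> space P \<Longrightarrow> X i 0 \<omega> = x0 i"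
    by (rule particle_system_noise_grid[OF moving_boundary_axioms sys n \<Delta>]) (rule that)
  interpret noise_grid \<zeta> lam v A0 P n NJ NS \<xi> K \<Delta> by (rule G)
  let ?W = "\<lambda>k \<omega>. max 0 (activity k \<omega> - rate * \<Delta>)"
  have "0 \<le> rate * \<Delta>" using rate_pos \<Delta> by simp
  then have "\<bar>?W k \<omega>\<bar> \<le> 1" for k \<omega> using activity_bounds[of k \<omega>] by linarith
  then have "integrable P (?W k)" for k by (intro bounded_integrable[where B=1]) auto
  moreover have "AE \<omega> in P. \<forall>k t x. \<Delta> * real k \<le> t \<longrightarrow> t \<le> \<Delta> * real (Suc k) \<longrightarrow>
      \<bar>empirical_cdf n (\<lambda>i. X i t \<omega>) x - empirical_cdf n (\<lambda>i. X i (\<Delta> * real k) \<omega>) x\<bar> \<le> rate * \<Delta> + ?W k \<omega>"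
    using driven_path_AE[OF dm] AE_space
  proof eventually_elim
    case (elim \<omega>)
    show ?case
    proof (intro allI impI)
      fix k t x assume "\<Delta> * real k \<le> t" "t \<le> \<Delta> * real (Suc k)"
      from activity_increment[OF elim this, of x]
      show "\<bar>empirical_cdf n (\<lambda>i. X i t \<omega>) x - empirical_cdf n (\<lambda>i. X i (\<Delta> * real k) \<omega>) x\<bar> \<le> rate * \<Delta> + ?W k \<omega>"
        by linarith
    qed
  qed
  ultimately show ?thesis using activity_excess by (intro exI[of _ ?W]) auto
qed

text \<open>Uniform closeness on \<open>[0, T)\<close> is reduced to the smallness of one random
  variable R, a finite sum of errors with vanishing mean. Working with R avoids the measurability of
  a supremum over all times.\<close>

lemma uniform_levy_bound:
  fixes P :: "nat \<Rightarrow> 'w measure"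
  assumes pos: "AE z in \<zeta>. z > 0" and f0: "f0 \<in> cdfs" and fn0: "\<And>n. 2 \<le> n \<Longrightarrow> fn0 n \<in> empirical_cdfs n"
    and conv: "weak_conv fn0 f0" and sys: "\<And>n. 2 \<le> n \<Longrightarrow> particle_system (P n) lam \<zeta> A0 v n (fn0 n) (X n)"
    and T: "0 < T" and \<epsilon>: "0 < \<epsilon>"
  shows "\<exists>\<gamma>>0. \<exists>R :: nat \<Rightarrow> 'w \<Rightarrow> real. (\<forall>\<^sub>F n in sequentially. integrable (P n) (R n) \<and> (\<forall>\<omega>. 0 \<le> R n \<omega>) \<and>
      (AE \<omega> in P n. R n \<omega> \<le> \<gamma> \<longrightarrow>
        (\<forall>t. 0 \<le> t \<and> t < T \<longrightarrow> levy_dist (sol f0 t) (empirical_cdf n (\<lambda>i. X n i t \<omega>)) \<le> \<epsilon>))) \<and>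
    (\<lambda>n. \<integral>\<omega>. R n \<omega> \<partial>P n) \<longlonglongrightarrow> 0"
proof -
  \<comment> \<open>In the final estimate the errors at time and space grid contribute
    \<open>5 * \<gamma> = \<epsilon> / 2\<close> and the initial states
    \<open>h * exp T + h = \<epsilon> / 4\<close>. \<open>\<Delta>\<close> is such that the
    mean-field limit moves by at most \<open>\<gamma>\<close> in one interval.\<close>
  define \<gamma> where "\<gamma> = \<epsilon> / 10"
  define p where "p = exp T + 1"
  define h where "h = \<epsilon> / (4 * p)"
  define \<Delta> where "\<Delta> = \<gamma> / rate"
  define M where "M = nat \<lceil>T / \<Delta>\<rceil>"
  have e0: "2 < p" using T exp_gt_one[of T] by (simp add: p_def)
  have \<gamma>: "0 < \<gamma>" and \<Delta>: "0 < \<Delta>" and r\<Delta>: "rate * \<Delta> = \<gamma>"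
    using \<epsilon> rate_pos by (auto simp: \<gamma>_def \<Delta>_def)
  have h: "0 < h" using \<epsilon> e0 by (simp add: h_def)
  have hp: "h * p = \<epsilon> / 4" using e0 by (simp add: h_def)
  then have hc: "h * exp T + h = \<epsilon> / 4" by (simp add: p_def algebra_simps)
  have "2 * h \<le> p * h" using e0 h by (intro mult_right_mono) auto
  then have h3: "3 * h \<le> \<epsilon>" using hp \<epsilon> by (simp add: mult.commute)
  have fm: "mild (sol f0)" by (rule sol_mild[OF f0 pos])
  obtain m :: int where m: "0 \<le> m" "f0 (- h * of_int m + 2 * h) \<le> h" "1 - h \<le> sol f0 T (h * of_int m - 2 * h)"
    by (rule grid_tails[OF f0 mildD(1)[OF fm less_imp_le[OF T]] h h])
  define Q where "Q n W \<longleftrightarrow> (\<forall>k. integrable (P n) (W k) \<and> (\<forall>\<omega>. 0 \<le> W k \<omega>) \<and> (\<integral>\<omega>. W k \<omega> \<partial>P n) \<le> 1 / sqrt (real n)) \<and>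
    (AE \<omega> in P n. \<forall>k t x. \<Delta> * real k \<le> t \<longrightarrow> t \<le> \<Delta> * real (Suc k) \<longrightarrow>
      \<bar>empirical_cdf n (\<lambda>i. X n i t \<omega>) x - empirical_cdf n (\<lambda>i. X n i (\<Delta> * real k) \<omega>) x\<bar> \<le> rate * \<Delta> + W k \<omega>)" for n and W :: "nat \<Rightarrow> 'w \<Rightarrow> real"
  have "\<exists>W. 2 \<le> n \<longrightarrow> Q n W" for n
    using empirical_cdf_increments[OF sys _ \<Delta>, of n] unfolding Q_def by blast
  then have "\<forall>n. \<exists>W. 2 \<le> n \<longrightarrow> Q n W" by blast
  from choice[OF this] obtain W where "\<And>n. 2 \<le> n \<Longrightarrow> Q n (W n)" by blast
  then have Wi: "integrable (P n) (W n k)" and W0: "0 \<le> W n k \<omega>" and WE: "(\<integral>\<omega>. W n k \<omega> \<partial>P n) \<le> 1 / sqrt (real n)"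
    and WA: "AE \<omega> in P n. \<forall>k t x. \<Delta> * real k \<le> t \<longrightarrow> t \<le> \<Delta> * real (Suc k) \<longrightarrow>
      \<bar>empirical_cdf n (\<lambda>i. X n i t \<omega>) x - empirical_cdf n (\<lambda>i. X n i (\<Delta> * real k) \<omega>) x\<bar> \<le> rate * \<Delta> + W n k \<omega>"
    if "2 \<le> n" for n k \<omega> using that unfolding Q_def by blast+
  have fnc: "fn0 n \<in> cdfs" if "2 \<le> n" for n
    using fn0[OF that] empirical_cdf_in_cdfs[of n] that by (auto simp: empirical_cdfs_def)
  define D where "D n k j \<omega> = \<bar>empirical_cdf n (\<lambda>i. X n i (\<Delta> * real k) \<omega>) (h * of_int j) - sol (fn0 n) (\<Delta> * real k) (h * of_int j)\<bar>"
    for n k and j :: int and \<omega>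
  have D0: "0 \<le> D n k j \<omega>" for n k j \<omega> by (simp add: D_def)
  have Di: "integrable (P n) (D n k j)" if n: "2 \<le> n" for n k j
  proof -
    interpret prob_space "P n" using sys[OF n] by (simp add: particle_system_def)
    have t: "0 \<le> \<Delta> * real k" using \<Delta> by simp
    have "(\<lambda>\<omega>. empirical_cdf n (\<lambda>i. X n i (\<Delta> * real k) \<omega>) y) \<in> borel_measurable (P n)" for y
      unfolding frac_le_ereal[symmetric] frac_le_def
    proof (intro borel_measurable_divide borel_measurable_sum measurable_const)
      fix i assume "i \<in> {..<n}"
      then have [measurable]: "X n i (\<Delta> * real k) \<in> borel_measurable (P n)"
        using sys[OF n] t by (simp add: particle_system_def)
      show "(\<lambda>\<omega>. if ereal (X n i (\<Delta> * real k) \<omega>) \<le> ereal y then 1 else 0) \<in> borel_measurable (P n)" by measurable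
    qed simp
    then have Dm: "D n k j \<in> borel_measurable (P n)" unfolding D_def by measurable
    have "norm (D n k j \<omega>) \<le> 1" for \<omega>
      using frac_le_bounds[of n "\<lambda>i. ereal (X n i (\<Delta> * real k) \<omega>)" "h * of_int j"]
        cdfs_nonneg[OF mildD(1)[OF sol_mild[OF fnc[OF n] pos] t], of "h * of_int j"]
        cdfs_le_1[OF mildD(1)[OF sol_mild[OF fnc[OF n] pos] t], of "h * of_int j"]
      unfolding D_def frac_le_ereal by simp
    then show ?thesis using Dm by (intro integrable_const_bound[where B=1]) auto
  qed
  \<comment> \<open>All errors at the M grid times and the \<open>2 * m + 1\<close> grid points,
    plus the excess activities. The terms are nonnegative, so each of them is bounded by R.\<close>
  define R where "R n \<omega> = (\<Sum>k<M. \<Sum>j\<in>{-m..m}. D n k j \<omega>) + (\<Sum>k<M. W n k \<omega>)" for n \<omega>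
  have ev2: "\<forall>\<^sub>F n in sequentially. 2 \<le> n" by (rule eventually_ge_at_top)
  have "(\<lambda>n. \<integral>\<omega>. D n k j \<omega> \<partial>P n) \<longlonglongrightarrow> 0" for k j
  proof (rule tendstoI)
    fix e :: real assume "0 < e"
    then have e: "0 < e / 2" by simp
    show "\<forall>\<^sub>F n in sequentially. dist (\<integral>\<omega>. D n k j \<omega> \<partial>P n) 0 < e"
      using empirical_cdf_limit[where 'w='w and k=k, OF pos \<Delta> e] ev2
    proof eventually_elim
      case (elim n)
      have "(\<integral>\<omega>. D n k j \<omega> \<partial>P n) \<le> e / 2" unfolding D_def using elim(1) sys[OF elim(2)] by blast
      moreover have "0 \<le> (\<integral>\<omega>. D n k j \<omega> \<partial>P n)" by (intro integral_nonneg_AE AE_I2 D0)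
      ultimately show ?case using e by simp
    qed
  qed
  moreover have "(\<lambda>n. \<integral>\<omega>. W n k \<omega> \<partial>P n) \<longlonglongrightarrow> 0" for k
  proof (rule tendsto_sandwich[where f="\<lambda>_. 0" and h="\<lambda>n. 1 / sqrt (real n)"])
    show "\<forall>\<^sub>F n in sequentially. 0 \<le> (\<integral>\<omega>. W n k \<omega> \<partial>P n)"
      using ev2 by eventually_elim (intro integral_nonneg_AE AE_I2 W0)
    show "\<forall>\<^sub>F n in sequentially. (\<integral>\<omega>. W n k \<omega> \<partial>P n) \<le> 1 / sqrt (real n)" using ev2 by eventually_elim (rule WE)
    show "(\<lambda>n. 1 / sqrt (real n)) \<longlonglongrightarrow> 0"
      by (rule inverse_sqrt_tendsto)
  qed simp
  ultimately have lim: "(\<lambda>n. (\<Sum>k<M. \<Sum>j\<in>{-m..m}. \<integral>\<omega>. D n k j \<omega> \<partial>P n) + (\<Sum>k<M. \<integral>\<omega>. W n k \<omega> \<partial>P n)) \<longlonglongrightarrow> 0"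
    by (intro tendsto_add_zero tendsto_null_sum)
  have "\<forall>\<^sub>F n in sequentially. (\<Sum>k<M. \<Sum>j\<in>{-m..m}. \<integral>\<omega>. D n k j \<omega> \<partial>P n) + (\<Sum>k<M. \<integral>\<omega>. W n k \<omega> \<partial>P n) = (\<integral>\<omega>. R n \<omega> \<partial>P n)"
    using ev2
  proof eventually_elim
    case (elim n)
    show ?case unfolding R_def using Di[OF elim] Wi[OF elim] by simp
  qed
  then have RE: "(\<lambda>n. \<integral>\<omega>. R n \<omega> \<partial>P n) \<longlonglongrightarrow> 0" using lim by (rule Lim_transform_eventually[rotated])
  have "\<forall>\<^sub>F n in sequentially. fn0 n \<in> cdfs" using ev2 by eventually_elim (rule fnc)
  from weak_conv_shift[OF f0 this conv h] ev2
  have main: "\<forall>\<^sub>F n in sequentially. integrable (P n) (R n) \<and> (\<forall>\<omega>. 0 \<le> R n \<omega>) \<and>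
      (AE \<omega> in P n. R n \<omega> \<le> \<gamma> \<longrightarrow>
        (\<forall>t. 0 \<le> t \<and> t < T \<longrightarrow> levy_dist (sol f0 t) (empirical_cdf n (\<lambda>i. X n i t \<omega>)) \<le> \<epsilon>))"
  proof eventually_elim
    case (elim n)
    note n = elim(2)
    have R1: "integrable (P n) (R n)" unfolding R_def using Di[OF n] Wi[OF n] by simp
    have S0: "0 \<le> (\<Sum>j\<in>{-m..m}. D n k j \<omega>)" for k \<omega> by (intro sum_nonneg D0)
    have SS0: "0 \<le> (\<Sum>k<M. \<Sum>j\<in>{-m..m}. D n k j \<omega>)" "0 \<le> (\<Sum>k<M. W n k \<omega>)" for \<omega>
      by (intro sum_nonneg S0 W0[OF n])+
    then have R2: "0 \<le> R n \<omega>" for \<omega> unfolding R_def by (intro add_nonneg_nonneg)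
    have Dle: "D n k j \<omega> \<le> R n \<omega>" if "k < M" "-m \<le> j" "j \<le> m" for k j \<omega>
    proof -
      have "D n k j \<omega> \<le> (\<Sum>j\<in>{-m..m}. D n k j \<omega>)"
        by (rule member_le_sum) (use that D0 in auto)
      also have "\<dots> \<le> (\<Sum>k<M. \<Sum>j\<in>{-m..m}. D n k j \<omega>)"
        by (rule member_le_sum[where f="\<lambda>k. \<Sum>j\<in>{-m..m}. D n k j \<omega>"]) (use that S0 in auto)
      finally show ?thesis using SS0(2)[of \<omega>] unfolding R_def by linarith
    qed
    have Wle: "W n k \<omega> \<le> R n \<omega>" if "k < M" for k \<omega>
    proof -
      have "W n k \<omega> \<le> (\<Sum>k<M. W n k \<omega>)"
        by (rule member_le_sum[where f="\<lambda>k. W n k \<omega>"]) (use that W0[OF n] in auto)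
      then show ?thesis using SS0(1)[of \<omega>] unfolding R_def by linarith
    qed
    have gm: "mild (sol (fn0 n))" by (rule sol_mild[OF fnc[OF n] pos])
    have z: "sol f0 0 = f0" "sol (fn0 n) 0 = fn0 n" by (rule sol_zero[OF cdfs_regular], fact f0 fnc[OF n])+
    have "AE \<omega> in P n. R n \<omega> \<le> \<gamma> \<longrightarrow>
        (\<forall>t. 0 \<le> t \<and> t < T \<longrightarrow> levy_dist (sol f0 t) (empirical_cdf n (\<lambda>i. X n i t \<omega>)) \<le> \<epsilon>)"
      using WA[OF n]
    proof eventually_elim
      case inc: (elim \<omega>)
      show ?case
      proof (intro impI allI)
        fix t assume R: "R n \<omega> \<le> \<gamma>" and t: "0 \<le> t \<and> t < T"
        define E where "E u = empirical_cdf n (\<lambda>i. X n i u \<omega>)" for u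
        define k where "k = nat \<lfloor>t / \<Delta>\<rfloor>"
        have k': "real k = of_int \<lfloor>t / \<Delta>\<rfloor>" using t \<Delta> by (simp add: k_def)
        have "t / \<Delta> < T / \<Delta>" using t \<Delta> by (simp add: divide_strict_right_mono)
        then have "\<lfloor>t / \<Delta>\<rfloor> < \<lceil>T / \<Delta>\<rceil>" by linarith
        moreover have "0 \<le> \<lfloor>t / \<Delta>\<rfloor>" using t \<Delta> by simp
        moreover have "0 < \<lceil>T / \<Delta>\<rceil>" using T \<Delta> by simp
        ultimately have kM: "k < M" unfolding k_def M_def by linarith
        have "real k \<le> t / \<Delta>" "t / \<Delta> \<le> real (Suc k)" unfolding of_nat_Suc k' by linarith+
        then have s: "\<Delta> * real k \<le> t" "t \<le> \<Delta> * real (Suc k)" using \<Delta> by (simp_all add: field_simps)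
        have s0: "0 \<le> \<Delta> * real k" using \<Delta> by simp
        have Ec: "E u \<in> cdfs" for u unfolding E_def by (rule empirical_cdf_in_cdfs) (use n in simp)
        have ft: "sol f0 t \<in> cdfs" by (rule mildD(1)[OF fm]) (use t in simp)
        have cl: "E t x \<le> sol f0 t (x + 3 * h) + (2 * (2 * \<gamma>) + \<gamma> + h * exp T + h) \<and>
            sol f0 t x \<le> E t (x + 3 * h) + (2 * (2 * \<gamma>) + \<gamma> + h * exp T + h)" for x
        proof (rule levy_close_of_grid[OF pos fm gm h m(1), where s="\<Delta> * real k" and E=E and T=T])
          show "sol (fn0 n) 0 x \<le> sol f0 0 (x + h) + h" "sol f0 0 x \<le> sol (fn0 n) 0 (x + h) + h" for x
            using elim(1) unfolding z by blast+
          show "sol f0 0 (- h * of_int m + 2 * h) \<le> h" "1 - h \<le> sol f0 T (h * of_int m - 2 * h)" using m(2,3) by (simp_all only: z)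
          show "0 \<le> \<Delta> * real k" "\<Delta> * real k \<le> t" "t \<le> T" "E (\<Delta> * real k) \<in> cdfs" using s s0 t Ec by auto
          have "rate * (t - \<Delta> * real k) \<le> rate * \<Delta>" using s rate_pos by (intro mult_left_mono) (auto simp: algebra_simps)
          then show "rate * (t - \<Delta> * real k) \<le> 2 * \<gamma>" using r\<Delta> \<gamma> by linarith
          show "\<bar>E (\<Delta> * real k) (h * of_int j) - sol (fn0 n) (\<Delta> * real k) (h * of_int j)\<bar> \<le> \<gamma>" if "-m \<le> j" "j \<le> m" for j
            using Dle[OF kM that, of \<omega>] R unfolding D_def E_def by linarith
          show "\<bar>E t x - E (\<Delta> * real k) x\<bar> \<le> 2 * \<gamma>" for x
          proof -
            have "\<bar>E t x - E (\<Delta> * real k) x\<bar> \<le> rate * \<Delta> + W n k \<omega>" unfolding E_def using inc s by blast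
            then show ?thesis using Wle[OF kM, of \<omega>] R r\<Delta> by linarith
          qed
        qed
        have c: "2 * (2 * \<gamma>) + \<gamma> + h * exp T + h \<le> \<epsilon>" using hc \<epsilon> by (simp add: \<gamma>_def)
        have "levy_within (sol f0 t) (E t) \<epsilon>"
          unfolding levy_within_def
        proof (intro allI conjI)
          fix x
          have "sol f0 t (x - \<epsilon>) \<le> sol f0 t (x - 3 * h)" by (rule cdfs_mono[OF ft]) (use h3 in simp)
          then show "sol f0 t (x - \<epsilon>) - \<epsilon> \<le> E t x" using cl[of "x - 3 * h"] c by simp
          have "sol f0 t (x + 3 * h) \<le> sol f0 t (x + \<epsilon>)" by (rule cdfs_mono[OF ft]) (use h3 in simp)
          then show "E t x \<le> sol f0 t (x + \<epsilon>) + \<epsilon>" using cl[of x] c by linarith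
        qed
        then show "levy_dist (sol f0 t) (empirical_cdf n (\<lambda>i. X n i t \<omega>)) \<le> \<epsilon>"
          unfolding E_def by (rule levy_dist_le[OF \<epsilon>])
      qed
    qed
    then show ?case using R1 R2 by blast
  qed
  show ?thesis by (rule exI[of _ \<gamma>], intro conjI exI[of _ R] \<gamma> main RE)
qed

end

section \<open>Convergence in law and the final statement\<close>

lemma space_borel_of [simp]: "space (borel_of T) = topspace T"
  unfolding borel_of_def by (rule space_measure_of) (use openin_subset in blast)

lemma continuous_map_borel_of:
  assumes "continuous_map T euclideanreal F" shows "F \<in> borel_measurable (borel_of T)"
proof (rule borel_measurableI)
  fix S :: "real set" assume "open S"
  then have "openin T {x \<in> topspace T. F x \<in> S}" by (intro openin_continuous_map_preimage[OF assms]) simp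
  moreover have "sets (borel_of T) = sigma_sets (topspace T) {U. openin T U}"
    unfolding borel_of_def by (rule sets_measure_of) (use openin_subset in blast)
  moreover have "F -` S \<inter> space (borel_of T) = {x \<in> topspace T. F x \<in> S}" by auto
  ultimately show "F -` S \<inter> space (borel_of T) \<in> sets (borel_of T)" by auto
qed

context moving_boundary
begin

lemma mild_levy_dist:
  assumes "mild f" "0 \<le> s" "0 \<le> t" shows "levy_dist (f s) (f t) \<le> rate * \<bar>t - s\<bar>"
  using mild_diff_le[OF assms] by (intro levy_dist_le_sup[OF mildD(1)[OF assms(1,2)]]) (simp add: abs_minus_commute)

lemma mild_skorohod:
  assumes f: "mild f" shows "restrict f {0..} \<in> skorohod_space"
proof -
  have lim: "limitin weak_topology (restrict f {0..}) (f t) F"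
    if t: "0 \<le> t" and F: "\<forall>\<^sub>F s in F. 0 \<le> s" "((\<lambda>s. s) \<longlongrightarrow> t) F" for t F
  proof -
    have "((\<lambda>s. rate * \<bar>s - t\<bar>) \<longlongrightarrow> 0) F" using F(2) by (auto intro!: tendsto_eq_intros)
    moreover have "\<forall>\<^sub>F s in F. norm (levy_dist (f t) (restrict f {0..} s)) \<le> rate * \<bar>s - t\<bar>"
      using F(1)
    proof eventually_elim
      case (elim s)
      then show ?case using mild_levy_dist[OF f t elim] levy_dist_nonneg[OF mildD(1)[OF f t] mildD(1)[OF f elim]] by simp
    qed
    ultimately have "((\<lambda>s. levy_dist (f t) (restrict f {0..} s)) \<longlongrightarrow> 0) F" by (rule Lim_null_comparison[rotated])
    moreover have "\<forall>\<^sub>F s in F. restrict f {0..} s \<in> cdfs" using F(1) by eventually_elim (simp add: mildD(1)[OF f])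
    ultimately show ?thesis using mildD(1)[OF f t] by (simp add: limitin_weak_topology_ev)
  qed
  have "restrict f {0..} \<in> {0..} \<rightarrow>\<^sub>E topspace weak_topology" using mildD(1)[OF f] by auto
  moreover have "limitin weak_topology (restrict f {0..}) (restrict f {0..} t) (at_right t)" if "0 \<le> t" for t
  proof -
    have "\<forall>\<^sub>F s in at_right t. 0 \<le> s" using eventually_at_right_less[of t] by eventually_elim (use that in simp)
    from lim[OF that this tendsto_ident_at] show ?thesis using that by simp
  qed
  moreover have "\<exists>l. limitin weak_topology (restrict f {0..}) l (at_left t)" if "0 < t" for t
  proof -
    have "\<forall>\<^sub>F s in at_left t. 0 \<le> s" using eventually_at_left_real[OF that] by eventually_elim simp
    from lim[OF less_imp_le[OF that] this tendsto_ident_at] show ?thesis by blast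
  qed
  ultimately show ?thesis by (simp add: skorohod_space_def cadlag_paths_def)
qed

lemma mild_continuous_map:
  assumes f: "mild f" shows "continuous_map (top_of_set {0..}) weak_topology f"
  unfolding continuous_map_def
proof (intro conjI allI impI)
  show "f \<in> topspace (top_of_set {0..}) \<rightarrow> topspace weak_topology" using mildD(1)[OF f] by auto
  fix U assume U: "openin weak_topology U"
  show "openin (top_of_set {0..}) {t \<in> topspace (top_of_set {0..}). f t \<in> U}"
    unfolding openin_euclidean_subtopology_iff
  proof (intro conjI ballI)
    fix t assume "t \<in> {t \<in> topspace (top_of_set {0..}). f t \<in> U}"
    then have t: "0 \<le> t" "f t \<in> U" by auto
    obtain e where e: "0 < e" "\<And>y. y \<in> cdfs \<Longrightarrow> levy_dist (f t) y < e \<Longrightarrow> y \<in> U"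
      using U t(2) unfolding weak_topology_def openin_metric_topology by blast
    have "f s \<in> U" if s: "0 \<le> s" "dist s t < e / rate" for s
    proof (rule e(2))
      show "f s \<in> cdfs" by (rule mildD(1)[OF f s(1)])
      have "levy_dist (f t) (f s) \<le> rate * \<bar>s - t\<bar>" by (rule mild_levy_dist[OF f t(1) s(1)])
      also have "\<dots> < e" using s(2) rate_pos by (simp add: dist_real_def pos_less_divide_eq mult.commute)
      finally show "levy_dist (f t) (f s) < e" .
    qed
    then show "\<exists>e>0. \<forall>s\<in>{0..}. dist s t < e \<longrightarrow> s \<in> {t \<in> topspace (top_of_set {0..}). f t \<in> U}"
      using e(1) rate_pos by (intro exI[of _ "e / rate"]) auto
  qed auto
qed

text \<open>The limit is deterministic, so it is enough that F composed with the process converges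
  to \<open>F f\<close> in mean. Near f continuity of F is used, elsewhere its boundedness together
  with a Markov bound for R.\<close>

lemma empirical_process_converges:
  fixes P :: "nat \<Rightarrow> 'w measure"
  assumes pos: "AE z in \<zeta>. z > 0" and f0: "f0 \<in> cdfs" and fn0: "\<And>n. 2 \<le> n \<Longrightarrow> fn0 n \<in> empirical_cdfs n"
    and conv: "weak_conv fn0 f0" and sys: "\<And>n. 2 \<le> n \<Longrightarrow> particle_system (P n) lam \<zeta> A0 v n (fn0 n) (X n)"
  shows "converges_in_distribution J1_topology P (\<lambda>n. empirical_process n (X n))
    (return (borel_of J1_topology) (restrict (sol f0) {0..}))"
proof -
  let ?E = "\<lambda>n. empirical_process n (X n)"
  define f where "f = restrict (sol f0) {0..}"
  have fS: "f \<in> skorohod_space" unfolding f_def by (rule mild_skorohod[OF sol_mild[OF f0 pos]])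
  have top: "topspace J1_topology = skorohod_space" by (simp add: J1_topology_def)
  have Em: "?E n \<in> P n \<rightarrow>\<^sub>M borel_of J1_topology" if n: "2 \<le> n" for n
    by (rule empirical_process_measurable) (use sys[OF n] n in \<open>auto simp: particle_system_def\<close>)
  have ES: "?E n \<omega> \<in> skorohod_space" if "2 \<le> n" "\<omega> \<in> space (P n)" for n \<omega>
    using measurable_space[OF Em[OF that(1)] that(2)] by (simp add: top)
  have ev2: "\<forall>\<^sub>F n in sequentially. 2 \<le> n" by (rule eventually_ge_at_top)
  have "(\<lambda>n. \<integral>x. F x \<partial>distr (P n) (borel_of J1_topology) (?E n)) \<longlonglongrightarrow> (\<integral>x. F x \<partial>return (borel_of J1_topology) f)"
    if F: "continuous_map J1_topology euclideanreal F" and bF: "bounded (F ` topspace J1_topology)" for F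
  proof (rule tendstoI)
    fix e :: real assume e: "0 < e"
    have Fm: "F \<in> borel_measurable (borel_of J1_topology)" by (rule continuous_map_borel_of[OF F])
    obtain B where B: "0 < B" "\<And>y. y \<in> skorohod_space \<Longrightarrow> \<bar>F y\<bar> \<le> B"
      using bF unfolding bounded_pos top by auto
    have "openin J1_topology {y \<in> topspace J1_topology. F y \<in> ball (F f) (e / 2)}"
      by (rule openin_continuous_map_preimage[OF F]) simp
    moreover have "f \<in> {y \<in> topspace J1_topology. F y \<in> ball (F f) (e / 2)}" using fS e by (simp add: top)
    ultimately obtain d where d: "0 < d"
      "\<And>y. y \<in> skorohod_space \<Longrightarrow> J1_dist levy_dist f y < d \<Longrightarrow> \<bar>F y - F f\<bar> < e / 2"
      unfolding J1_topology_def openin_metric_topology by (auto simp: dist_real_def abs_minus_commute)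
    \<comment> \<open>Chosen so that the tail of the distance is below \<open>d / 2\<close>;
      together with the uniform bound \<open>d / 3\<close> this stays below d.\<close>
    define T where "T = 1 + \<bar>ln (d / 2)\<bar>"
    have T: "0 < T" by (simp add: T_def add_pos_nonneg)
    have "exp (- T) < exp (ln (d / 2))" unfolding T_def by simp
    then have expT: "exp (- T) < d / 2" using d(1) by simp
    have d3: "0 < d / 3" using d(1) by simp
    have "\<exists>\<gamma>>0. \<exists>R :: nat \<Rightarrow> 'w \<Rightarrow> real. (\<forall>\<^sub>F n in sequentially. integrable (P n) (R n) \<and> (\<forall>\<omega>. 0 \<le> R n \<omega>) \<and>
      (AE \<omega> in P n. R n \<omega> \<le> \<gamma> \<longrightarrow>
        (\<forall>t. 0 \<le> t \<and> t < T \<longrightarrow> levy_dist (sol f0 t) (empirical_cdf n (\<lambda>i. X n i t \<omega>)) \<le> d / 3))) \<and>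
      (\<lambda>n. \<integral>\<omega>. R n \<omega> \<partial>P n) \<longlonglongrightarrow> 0"
      by (rule uniform_levy_bound[OF pos f0 fn0 conv sys T d3])
    then obtain \<gamma> and R :: "nat \<Rightarrow> 'w \<Rightarrow> real" where \<gamma>: "0 < \<gamma>" and R: "\<forall>\<^sub>F n in sequentially. integrable (P n) (R n) \<and> (\<forall>\<omega>. 0 \<le> R n \<omega>) \<and>
      (AE \<omega> in P n. R n \<omega> \<le> \<gamma> \<longrightarrow>
        (\<forall>t. 0 \<le> t \<and> t < T \<longrightarrow> levy_dist (sol f0 t) (empirical_cdf n (\<lambda>i. X n i t \<omega>)) \<le> d / 3))"
      and RE: "(\<lambda>n. \<integral>\<omega>. R n \<omega> \<partial>P n) \<longlonglongrightarrow> 0"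
      by blast
    have "\<forall>\<^sub>F n in sequentially. (\<integral>\<omega>. R n \<omega> \<partial>P n) < e / 2 / (2 * B / \<gamma>)"
      by (rule order_tendstoD(2)[OF RE]) (use e B \<gamma> in simp)
    then show "\<forall>\<^sub>F n in sequentially. dist (\<integral>x. F x \<partial>distr (P n) (borel_of J1_topology) (?E n)) (\<integral>x. F x \<partial>return (borel_of J1_topology) f) < e"
      using R ev2
    proof eventually_elim
      case (elim n)
      note n = elim(3)
      interpret prob_space "P n" using sys[OF n] by (simp add: particle_system_def)
      have Ri: "integrable (P n) (R n)" and R0: "0 \<le> R n \<omega>" for \<omega> using elim(2) by auto
      have FE: "integrable (P n) (\<lambda>\<omega>. F (?E n \<omega>))"
        by (rule integrable_const_bound[where B=B]) (use B(2) ES[OF n] measurable_compose[OF Em[OF n] Fm] in \<open>auto intro: AE_I2\<close>)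
      \<comment> \<open>Markov's inequality in pointwise form: where R exceeds
        \<open>\<gamma>\<close>, the crude bound \<open>2 * B\<close> is paid for by
        \<open>R / \<gamma> > 1\<close>.\<close>
      have AEb: "AE \<omega> in P n. \<bar>F (?E n \<omega>) - F f\<bar> \<le> e / 2 + 2 * B / \<gamma> * R n \<omega>"
        using conjunct2[OF conjunct2[OF elim(2)]] AE_space
      proof eventually_elim
        case L: (elim \<omega>)
        have S: "?E n \<omega> \<in> skorohod_space" by (rule ES[OF n L(2)])
        have r: "0 \<le> 2 * B / \<gamma> * R n \<omega>" using B(1) \<gamma> R0 by simp
        show ?case
        proof (cases "R n \<omega> \<le> \<gamma>")
          case True
          have "J1_dist levy_dist f (?E n \<omega>) \<le> d / 3 + exp (- T)"
          proof (rule J1_dist_uniform[OF fS S less_imp_le[OF d3]])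
            fix t :: real assume "0 \<le> t" "t < T"
            then show "levy_dist (f t) (?E n \<omega> t) \<le> d / 3" using L(1) True by (simp add: f_def empirical_process_def)
          qed
          then have "J1_dist levy_dist f (?E n \<omega>) < d" using expT d(1) by linarith
          then show ?thesis using d(2)[OF S] r by force
        next
          case False
          then have "2 * B / \<gamma> * \<gamma> \<le> 2 * B / \<gamma> * R n \<omega>" using B(1) \<gamma> by (intro mult_left_mono) auto
          then have "2 * B \<le> 2 * B / \<gamma> * R n \<omega>" using \<gamma> by simp
          then show ?thesis using B(2)[OF S] B(2)[OF fS] e by linarith
        qed
      qed
      have "\<bar>expectation (\<lambda>\<omega>. F (?E n \<omega>)) - F f\<bar> = \<bar>expectation (\<lambda>\<omega>. F (?E n \<omega>) - F f)\<bar>"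
        using FE by (simp add: prob_space)
      also have "\<dots> \<le> expectation (\<lambda>\<omega>. \<bar>F (?E n \<omega>) - F f\<bar>)"
        using integral_norm_bound[of "P n" "\<lambda>\<omega>. F (?E n \<omega>) - F f"] by simp
      also have "\<dots> \<le> expectation (\<lambda>\<omega>. e / 2 + 2 * B / \<gamma> * R n \<omega>)"
        by (rule integral_mono_AE) (use FE Ri AEb in auto)
      also have "\<dots> = e / 2 + 2 * B / \<gamma> * expectation (R n)" using Ri by (simp add: prob_space)
      also have "\<dots> < e"
      proof -
        have "0 < 2 * B / \<gamma>" using B(1) \<gamma> by simp
        then have "2 * B / \<gamma> * expectation (R n) < e / 2" using elim(1) by (simp only: pos_less_divide_eq mult.commute)
        then show ?thesis by linarith
      qed
      finally have "\<bar>expectation (\<lambda>\<omega>. F (?E n \<omega>)) - F f\<bar> < e" .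
      moreover have "(\<integral>x. F x \<partial>return (borel_of J1_topology) f) = F f" by (rule integral_return[OF _ Fm]) (simp add: top fS)
      ultimately show ?case unfolding integral_distr[OF Em[OF n] Fm] dist_real_def by simp
    qed
  qed
  moreover have "\<forall>\<^sub>F n in sequentially. ?E n \<in> P n \<rightarrow>\<^sub>M borel_of J1_topology" using ev2 by eventually_elim (rule Em)
  ultimately show ?thesis unfolding converges_in_distribution_def converges_in_law_def f_def by blast
qed

end

text \<open>The witness is the Picard limit restricted to nonnegative times. Uniqueness goes through
  the mean-field model property: every candidate is a mild solution with the same initial
  state.\<close>

theorem theorem5:
  fixes lam v A0 :: real
    and \<zeta> :: "real measure"
    and J f0 :: "real \<Rightarrow> real"
  assumes "lam \<ge> 0"
    and "v > 0"
    and "real_distribution \<zeta>"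
    and "AE z in \<zeta>. z > 0"
    and "integrable \<zeta> (\<lambda>z. z)"
    and "(\<integral>z. z \<partial>\<zeta>) = 1"
    and "J = cdf \<zeta>"
    and "f0 \<in> cdfs"
  shows "\<exists>!f. f \<in> skorohod_space \<and> f 0 = f0 \<and>
    (\<forall>(P :: nat \<Rightarrow> 'w measure) (fn0 :: nat \<Rightarrow> real \<Rightarrow> real) X.
       (\<forall>n\<ge>2. fn0 n \<in> empirical_cdfs n) \<longrightarrow>
       weak_conv fn0 f0 \<longrightarrow>
       (\<forall>n\<ge>2. particle_system (P n) lam \<zeta> A0 v n (fn0 n) (X n)) \<longrightarrow>
       converges_in_distribution J1_topology P (\<lambda>n. empirical_process n (X n))
         (return (borel_of J1_topology) f)) \<and>
    continuous_map (top_of_set {0..}) weak_topology f \<and>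
    (\<forall>h\<in>test_functions. \<forall>t\<ge>0.
       set_integrable lborel {0..t} (\<lambda>s. L_op lam \<zeta> (A0 + v * s) (f s) h) \<and>
       cdf_integral (f t) h - cdf_integral (f 0) h
         - (LBINT s:{0..t}. L_op lam \<zeta> (A0 + v * s) (f s) h) = 0) \<and>
    mean_field_model lam J A0 v f \<and>
    (\<forall>g. mean_field_model lam J A0 v g \<and> g 0 = f0 \<longrightarrow> (\<forall>t\<ge>0. g t = f t))"
proof -
  note pos = assms(4) and f0 = assms(8)
  interpret moving_boundary \<zeta> lam v A0
    using assms(1-3) by (intro moving_boundary.intro moving_boundary_axioms.intro)
  define f where "f = restrict (sol f0) {0..}"
  have sm: "mild (sol f0)" by (rule sol_mild[OF f0 pos])
  have feq: "f t = sol f0 t" if "0 \<le> t" for t using that by (simp add: f_def)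
  have f00: "f 0 = f0" using feq[of 0] sol_zero[OF cdfs_regular[OF f0]] by simp
  have fS: "f \<in> skorohod_space" unfolding f_def by (rule mild_skorohod[OF sm])
  have fm: "mild f"
    unfolding mild_def
  proof (intro conjI allI impI)
    fix x
    show "rate-lipschitz_on {0..} (\<lambda>t. f t x)"
      using mildD(2)[OF sm, of x] by (rule lipschitz_on_transform) (simp add: feq)
    fix t :: real assume t: "0 \<le> t"
    show "((\<lambda>s. exp (rate * s) * gain (bdry s) (f s) x) has_integral (exp (rate * t) * f t x - f 0 x)) {0..t}"
      unfolding feq[OF t] feq[OF order_refl] by (rule has_integral_eq[OF _ mildD(3)[OF sm t]]) (simp add: feq)
  qed (use mildD(1)[OF sm] feq in simp)
  have uniq: "g t = f t" if "mean_field_model lam J A0 v g" "g 0 = f0" "0 \<le> t" for g t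
    by (rule mild_unique[OF mean_field_model_mild[OF that(1)[unfolded assms(7)] pos] fm _ that(3)]) (simp add: that(2) f00)
  have weak: "set_integrable lborel {0..t} (\<lambda>s. L_op lam \<zeta> (A0 + v * s) (f s) h) \<and>
      cdf_integral (f t) h - cdf_integral (f 0) h - (LBINT s:{0..t}. L_op lam \<zeta> (A0 + v * s) (f s) h) = 0"
    if h: "h \<in> test_functions" and t: "0 \<le> t" for h t
  proof
    have "set_integrable lborel {0..t} (\<lambda>s. L_op lam \<zeta> (A0 + v * s) (f s) h) \<longleftrightarrow>
        set_integrable lborel {0..t} (\<lambda>s. L_op lam \<zeta> (bdry s) (sol f0 s) h)"
      by (rule set_integrable_cong) (auto simp: bdry_def feq)
    then show "set_integrable lborel {0..t} (\<lambda>s. L_op lam \<zeta> (A0 + v * s) (f s) h)"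
      using sol_weak_equation(1)[OF f0 pos t h] by simp
    have "(LBINT s:{0..t}. L_op lam \<zeta> (A0 + v * s) (f s) h) = (LBINT s:{0..t}. L_op lam \<zeta> (bdry s) (sol f0 s) h)"
      by (rule set_lebesgue_integral_cong) (auto simp: bdry_def feq)
    then show "cdf_integral (f t) h - cdf_integral (f 0) h - (LBINT s:{0..t}. L_op lam \<zeta> (A0 + v * s) (f s) h) = 0"
      using sol_weak_equation(2)[OF f0 pos t h] by (simp add: feq[OF t] f00)
  qed
  have mfm: "mean_field_model lam J A0 v f" unfolding assms(7) by (rule mild_mean_field_model[OF fm pos])
  have cm: "continuous_map (top_of_set {0..}) weak_topology f" by (rule mild_continuous_map[OF fm])
  have cd: "converges_in_distribution J1_topology P (\<lambda>n. empirical_process n (X n)) (return (borel_of J1_topology) f)"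
    if "\<forall>n\<ge>2. fn0 n \<in> empirical_cdfs n" "weak_conv fn0 f0"
      "\<forall>n\<ge>2. particle_system (P n) lam \<zeta> A0 v n (fn0 n) (X n)" for P :: "nat \<Rightarrow> 'w measure" and fn0 X
    unfolding f_def by (rule empirical_process_converges[OF pos f0 _ that(2)]) (use that in auto)
  \<comment> \<open>Equality as functions on all reals: at negative times both paths are
    \<open>undefined\<close>, because elements of the Skorohod space are extensional.\<close>
  have ext: "g = f" if g: "g \<in> skorohod_space" "g 0 = f0" "mean_field_model lam J A0 v g" for g
  proof
    fix t
    show "g t = f t"
    proof (cases "0 \<le> t")
      case False
      have "g \<in> extensional {0..}" using g(1) by (auto simp: skorohod_space_def cadlag_paths_def PiE_def)
      then show ?thesis using False by (simp add: f_def extensional_def)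
    qed (rule uniq[OF g(3,2)])
  qed
  let "\<exists>!f. ?P f" = ?thesis
  show ?thesis
  proof (rule ex1I)
    show "?P f" by (intro conjI allI impI ballI fS f00 cm mfm weak[THEN conjunct1] weak[THEN conjunct2]) (erule cd uniq conjE | assumption | (elim conjE, rule uniq))+
  qed (elim conjE, rule ext)
qed

end
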